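(* Let $\phi,\psi$ be Dirichlet characters modulo $16$ and let $a_{\phi,\psi,\mathfrak{n}}$ be as defined in the context. For every $\epsilon>0$ there is a constant $C_\epsilon>0$ depending only on $\epsilon$ such that for every $X\ge2$, $$\left|\sum_{\mathrm{N}(\mathfrak{n})\le X} a_{\phi,\psi,\mathfrak{n}}\Lambda(\mathfrak{n})\right|\le C_\epsilon X^{\frac{149}{150}+\epsilon},$$ the sum being over nonzero ideals $\mathfrak{n}$ of $\mathbb{Z}[\sqrt2]$.
   Context: An element $u+v\sqrt2\in\mathbb{Z}[\sqrt2]$ is totally positive if $u>0$ and $u^2-2v^2>0$; every nonzero ideal $\mathfrak{n}$ of $\mathbb{Z}[\sqrt2]$ has a totally positive generator, and $\mathrm{N}(\mathfrak{n})=u^2-2v^2$ for any totally positive generator $u+v\sqrt2$. Let $\varepsilon=1+\sqrt2$. For totally positive $u+v\sqrt2$ define $[u+v\sqrt2]=\left(\frac{v}{u}\right)$ (Jacobi symbol) if $u$ is odd and $[u+v\sqrt2]=0$ if $u$ is even, and for Dirichlet characters $\phi,\psi$ modulo $16$ put $[u+v\sqrt2]_{\phi,\psi}=[u+v\sqrt2]\,\phi(-u^2+2v^2)\,\psi(u)$. For a nonzero ideal $\mathfrak{n}$ with a totally positive generator $w$, set $a_{\phi,\psi,\mathfrak{n}}=\sum_{k=0}^{3}[\varepsilon^{2k}w]_{\phi,\psi}$ (this does not depend on the choice of $w$). $\Lambda(\mathfrak{n})=\log \mathrm{N}(\mathfrak{p})$ if $\mathfrak{n}=\mathfrak{p}^k$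 for a prime ideal $\mathfrak{p}$ and $k\ge1$, and $\Lambda(\mathfrak{n})=0$ otherwise. *)

theory Defs
  imports
    Complex_Main
    "HOL-Number_Theory.Number_Theory"
    "HOL-Algebra.Ideal_Product"
    "HOL-Algebra.QuotRing"
    "HOL-Algebra.Algebraic_Closure_Type"
begin

text \<open>
  \<open>ZSqrt2 u v\<close> stands for \<open>u + v \<surd>2\<close>; the function \<open>real_of_zsqrt2\<close> below is the embedding
  into the real numbers.
\<close>

datatype zsqrt2 = ZSqrt2 (rat_part: int) (sqrt_part: int)

instantiation zsqrt2 :: comm_ring_1
begin

definition zero_zsqrt2 :: zsqrt2 where "0 = ZSqrt2 0 0"

definition one_zsqrt2 :: zsqrt2 where "1 = ZSqrt2 1 0"

definition plus_zsqrt2 :: "zsqrt2 \<Rightarrow> zsqrt2 \<Rightarrow> zsqrt2" where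
  "x + y = ZSqrt2 (rat_part x + rat_part y) (sqrt_part x + sqrt_part y)"

definition uminus_zsqrt2 :: "zsqrt2 \<Rightarrow> zsqrt2" where
  "- x = ZSqrt2 (- rat_part x) (- sqrt_part x)"

definition minus_zsqrt2 :: "zsqrt2 \<Rightarrow> zsqrt2 \<Rightarrow> zsqrt2" where
  "x - y = ZSqrt2 (rat_part x - rat_part y) (sqrt_part x - sqrt_part y)"

definition times_zsqrt2 :: "zsqrt2 \<Rightarrow> zsqrt2 \<Rightarrow> zsqrt2" where
  "x * y = ZSqrt2 (rat_part x * rat_part y + 2 * sqrt_part x * sqrt_part y)
                  (rat_part x * sqrt_part y + sqrt_part x * rat_part y)"

instance
  by standard
    (auto simp: zero_zsqrt2_def one_zsqrt2_def plus_zsqrt2_def uminus_zsqrt2_def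
       minus_zsqrt2_def times_zsqrt2_def zsqrt2.expand algebra_simps)

end

definition real_of_zsqrt2 :: "zsqrt2 \<Rightarrow> real" where
  "real_of_zsqrt2 x = of_int (rat_part x) + of_int (sqrt_part x) * sqrt 2"

lemma real_of_zsqrt2_hom:
  "real_of_zsqrt2 0 = 0" "real_of_zsqrt2 1 = 1"
  "real_of_zsqrt2 (x + y) = real_of_zsqrt2 x + real_of_zsqrt2 y"
  "real_of_zsqrt2 (x * y) = real_of_zsqrt2 x * real_of_zsqrt2 y"
  by (simp_all add: real_of_zsqrt2_def zero_zsqrt2_def one_zsqrt2_def plus_zsqrt2_def
        times_zsqrt2_def algebra_simps)

text \<open>The ring as a record, so that the ideal theory of \<open>HOL-Algebra\<close> applies to it.\<close>

abbreviation zsqrt2_ring :: "zsqrt2 ring" where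
  "zsqrt2_ring \<equiv> ring_of_type_algebra"

text \<open>The absolute norm, that is the index; it is finite for every nonzero ideal.\<close>

definition ideal_norm :: "zsqrt2 set \<Rightarrow> nat" where
  "ideal_norm I = card (carrier (zsqrt2_ring Quot I))"

definition totally_positive :: "zsqrt2 \<Rightarrow> bool" where
  "totally_positive w \<longleftrightarrow> rat_part w > 0 \<and> (rat_part w)\<^sup>2 - 2 * (sqrt_part w)\<^sup>2 > 0"

text \<open>The Jacobi symbol \<open>(a / n)\<close>, meant for odd \<open>n > 0\<close>; \<open>n = 1\<close> gives the empty product.\<close>

definition Jacobi :: "int \<Rightarrow> int \<Rightarrow> int" where
  "Jacobi a n = (\<Prod>p\<in>#prime_factorization n. Legendre a p)"

definition dirichlet_char :: "int \<Rightarrow> (int \<Rightarrow> complex) \<Rightarrow> bool" where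
  "dirichlet_char m \<chi> \<longleftrightarrow>
     (\<forall>a b. \<chi> (a * b) = \<chi> a * \<chi> b) \<and>
     (\<forall>a. \<chi> (a + m) = \<chi> a) \<and>
     (\<forall>a. \<chi> a \<noteq> 0 \<longleftrightarrow> coprime a m)"

definition spin :: "zsqrt2 \<Rightarrow> int" where
  "spin w = (if odd (rat_part w) then Jacobi (sqrt_part w) (rat_part w) else 0)"

definition twisted_spin :: "(int \<Rightarrow> complex) \<Rightarrow> (int \<Rightarrow> complex) \<Rightarrow> zsqrt2 \<Rightarrow> complex" where
  "twisted_spin \<phi> \<psi> w =
     of_int (spin w) * \<phi> (- (rat_part w)\<^sup>2 + 2 * (sqrt_part w)\<^sup>2) * \<psi> (rat_part w)"

definition fund_unit :: zsqrt2 where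
  "fund_unit = ZSqrt2 1 1"

text \<open>
  The sum below is independent of the totally positive generator \<open>w\<close>, and every nonzero ideal
  has one, so the choice operator is harmless on nonzero ideals.
\<close>

definition ideal_coeff :: "(int \<Rightarrow> complex) \<Rightarrow> (int \<Rightarrow> complex) \<Rightarrow> zsqrt2 set \<Rightarrow> complex" where
  "ideal_coeff \<phi> \<psi> I =
     (let w = (SOME w. totally_positive w \<and> I = PIdl\<^bsub>zsqrt2_ring\<^esub> w)
      in \<Sum>k\<le>3. twisted_spin \<phi> \<psi> (fund_unit ^ (2 * k) * w))"

text \<open>
  The base \<open>p\<close> of a nonzero prime power \<open>I = p\<^sup>k\<close> is unique, by unique factorization; the power
  is formed with the product of ideals.
\<close>

definition is_prime_base :: "zsqrt2 set \<Rightarrow> zsqrt2 set \<Rightarrow> bool" where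
  "is_prime_base p I \<longleftrightarrow>
     primeideal p zsqrt2_ring \<and> (\<exists>k::nat. k \<ge> 1 \<and> I = p [^]\<^bsub>ideals_set zsqrt2_ring\<^esub> k)"

definition ideal_mangoldt :: "zsqrt2 set \<Rightarrow> real" where
  "ideal_mangoldt I =
     (if \<exists>p. is_prime_base p I then ln (real (ideal_norm (SOME p. is_prime_base p I))) else 0)"

text \<open>
  Only finitely many nonzero ideals have norm at most \<open>x\<close>, so that sums over this set
  are genuine finite sums.
\<close>

definition ideals_upto :: "real \<Rightarrow> zsqrt2 set set" where
  "ideals_upto x = {I. ideal I zsqrt2_ring \<and> I \<noteq> {0} \<and> real (ideal_norm I) \<le> x}"

end

theory Submission
  imports Defs "HOL-Analysis.Analysis"
begin

text \<open>
  Every ideal is a product of prime ideals, and fixing a totally positive generator of each prime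
  turns sums over ideals into sums over multisets of primes, on which Vaughan's identity is
  available without a unit ambiguity. Its type I sums reduce to sums of \<open>(v / u)\<close> over \<open>v\<close> along a
  residue class, bounded by the Polya--Vinogradov inequality. For the type II sums, quadratic
  reciprocity factors the spin: once residues modulo \<open>16\<close> are fixed, \<open>[w z]\<close> is
  \<open>[w] [z]\<close> up to a sign times a quadratic symbol \<open>\<chi>\<^sub>w(z)\<close> that is multiplicative in \<open>z\<close>.
  After Hoelder's inequality with exponent \<open>6\<close> the
  sum of \<open>\<chi>\<^sub>w(z) \<chi>\<^sub>w\<^sub>'(z)\<close> over a full box of \<open>z\<close> vanishes unless the product of the two norms is a
  square. This saves \<open>y\<^bsup>1/12\<^esup>\<close>, and \<open>y = x\<^bsup>3/25\<^esup>\<close> gives an exponent below \<open>149/150\<close>.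
\<close>

text \<open>The spin is neither a function of the ideal nor multiplicative, and both defects are
  finite. Multiplication by \<epsilon>^8 preserves the symbol and the rational part modulo 16, so a
  sum over four powers of \<epsilon>^2 depends on the ideal alone; and the signs produced by
  reciprocity depend on finitely many residues and parities of the two factors. The exponent six
  comes from the second moment. In a box of side Y, about M^2 pairs of symbols of period at most M^2
  cost M^4 Y, while the pairs whose norms multiply to a square cost M Y^2. The first cost is
  harmless once Y >= M^3. A product of six elements of norm at most N has coordinates of size N^3,
  so six is just enough when M <= N. The second moment saves M^(1/2), of which the sixth root leaves
  M^(1/12). The cut y balances the type I total y^2 x^(3/4) against the type II total x y^(-1/12):
  both are x^(99/100) at y = x^(3/25), and the gap up to 149/150 absorbs logarithms and small
  powers.\<close>

hide_const (open) Divisibility.prime Divisibility.irreducible Module.module.smult UnivPoly.monom UnivPoly.deg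

section \<open>Jacobi symbols\<close>

lemma Legendre_cong: "[a = b] (mod p) \<Longrightarrow> Legendre a p = Legendre b p"
  unfolding Legendre_def QuadRes_def Cong.cong_def by simp

lemma abs_Legendre_le: "\<bar>Legendre a p\<bar> \<le> 1"
  by (auto simp: Legendre_def)

text \<open>Euler's criterion gives the identity modulo p. Both sides lie between -1 and 1, so they
  differ by at most 2 < p and the congruence is an equality.\<close>

lemma Legendre_mult:
  assumes "prime (p::int)" "p > 2"
  shows "Legendre (a * b) p = Legendre a p * Legendre b p"
proof -
  define q where "q = nat p"
  have q: "prime q" "2 < q" "int q = p" using assms by (auto simp: q_def prime_ge_0_int)
  have e: "[Legendre c p = c ^ ((q - 1) div 2)] (mod p)" for c
    using euler_criterion[OF q(1,2), of c] q(3) by simp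
  have "[Legendre (a * b) p = Legendre a p * Legendre b p] (mod p)"
    using e[of "a * b"] cong_mult[OF e[of a] e[of b]]
    by (metis cong_sym cong_trans power_mult_distrib)
  hence d: "p dvd (Legendre (a * b) p - Legendre a p * Legendre b p)"
    by (simp add: cong_iff_dvd_diff)
  have "Legendre x p \<in> {-1, 0, 1}" for x by (auto simp: Legendre_def)
  from this[of a] this[of b] this[of "a * b"]
  have "\<bar>Legendre (a * b) p - Legendre a p * Legendre b p\<bar> \<le> 2" by auto
  with d assms(2) show ?thesis
    using zdvd_imp_le[of p "\<bar>Legendre (a * b) p - Legendre a p * Legendre b p\<bar>"] by fastforce
qed

lemma Legendre_eq_0_iff: "Legendre a p = 0 \<longleftrightarrow> p dvd a"
  by (auto simp: Legendre_def cong_0_iff)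

lemma Jacobi_1_right [simp]: "Jacobi a 1 = 1"
  by (simp add: Jacobi_def)

lemma Jacobi_mult_right:
  "m \<noteq> 0 \<Longrightarrow> n \<noteq> 0 \<Longrightarrow> Jacobi a (m * n) = Jacobi a m * Jacobi a n"
  by (simp add: Jacobi_def prime_factorization_mult)

lemma Jacobi_prime: "prime p \<Longrightarrow> Jacobi a p = Legendre a p"
  by (simp add: Jacobi_def prime_factorization_prime)

lemma Jacobi_cong:
  assumes "[a = b] (mod n)" shows "Jacobi a n = Jacobi b n"
proof -
  have "Legendre a p = Legendre b p" if "p \<in># prime_factorization n" for p
    by (rule Legendre_cong) (meson assms cong_dvd_modulus in_prime_factors_iff that)
  thus ?thesis unfolding Jacobi_def by (metis image_mset_cong)
qed

lemma odd_prime_factor_gt_2: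
  assumes "odd (n::int)" "p \<in># prime_factorization n"
  shows "prime p" "p > 2" "odd p"
proof -
  show p: "prime p" using assms by auto
  have "p dvd n" using assms by auto
  thus "odd p" using assms(1) dvd_trans by blast
  hence "p \<noteq> 2" by auto
  thus "p > 2" using prime_ge_2_int[OF p] by auto
qed

lemma Jacobi_mult_left:
  assumes "odd n" shows "Jacobi (a * b) n = Jacobi a n * Jacobi b n"
proof -
  have "Legendre (a * b) p = Legendre a p * Legendre b p" if "p \<in># prime_factorization n" for p
    using odd_prime_factor_gt_2[OF assms that] by (intro Legendre_mult)
  hence "(\<Prod>p\<in>#prime_factorization n. Legendre (a * b) p) =
    (\<Prod>p\<in>#prime_factorization n. Legendre a p * Legendre b p)"
    by (metis (no_types, lifting) image_mset_cong)
  thus ?thesis by (simp add: Jacobi_def prod_mset.distrib)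
qed

lemma abs_Jacobi_le: "\<bar>Jacobi a n\<bar> \<le> 1"
proof -
  have "\<bar>\<Prod>p\<in>#A. Legendre a p\<bar> \<le> 1" for A
  proof (induction A)
    case (add x A)
    have "\<bar>Legendre a x\<bar> * \<bar>\<Prod>p\<in>#A. Legendre a p\<bar> \<le> 1 * 1"
      by (intro mult_mono add abs_Legendre_le) auto
    thus ?case by (simp add: abs_mult)
  qed auto
  thus ?thesis by (simp add: Jacobi_def)
qed

lemma Jacobi_eq_0_iff:
  assumes "n \<noteq> 0" shows "Jacobi a n = 0 \<longleftrightarrow> \<not> coprime a n"
proof
  assume "Jacobi a n = 0"
  then obtain p where p: "p \<in># prime_factorization n" "Legendre a p = 0"
    by (auto simp: Jacobi_def prod_mset_zero_iff)
  hence "p dvd a" "p dvd n" "prime p" by (auto simp: Legendre_eq_0_iff)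
  thus "\<not> coprime a n" by (meson not_coprimeI not_prime_unit)
next
  assume nc: "\<not> coprime a n"
  have "\<not> is_unit (gcd a n)" using nc by (simp add: coprime_iff_gcd_eq_1)
  then obtain p where p: "prime p" "p dvd gcd a n"
    using assms by (metis gcd_eq_0_iff prime_divisor_exists)
  hence "Legendre a p = 0" "p \<in># prime_factorization n"
    using assms by (auto simp: Legendre_eq_0_iff in_prime_factors_iff)
  thus "Jacobi a n = 0" by (auto simp: Jacobi_def prod_mset_zero_iff)
qed

lemma Jacobi_cases:
  assumes "coprime a n" "n \<noteq> 0" shows "Jacobi a n = 1 \<or> Jacobi a n = -1"
  using Jacobi_eq_0_iff[of n a] assms abs_Jacobi_le[of a n] by auto

lemma Jacobi_square:
  assumes "coprime a n" "n \<noteq> 0" shows "Jacobi a n * Jacobi a n = 1"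
  using Jacobi_cases[OF assms] by auto

lemma Jacobi_power2_left:
  assumes "odd n" "coprime a n" shows "Jacobi (a\<^sup>2) n = 1"
  using Jacobi_square[OF assms(2)] Jacobi_mult_left[OF assms(1)] assms(1)
  by (metis even_zero power2_eq_square)

lemma Jacobi_1_left [simp]: "odd n \<Longrightarrow> Jacobi 1 n = 1"
  using Jacobi_power2_left[of n 1] by simp

lemma Jacobi_power_left:
  assumes "odd n" shows "Jacobi (a ^ k) n = Jacobi a n ^ k"
  by (induction k) (simp_all add: assms Jacobi_mult_left)

section \<open>Quadratic reciprocity and its supplements for Jacobi symbols\<close>

text \<open>The sign of quadratic reciprocity, written with residues modulo 4 instead of a power of
  -1, so that periodicity and multiplicativity on odd arguments are immediate.\<close>

definition rsign :: "int \<Rightarrow> int \<Rightarrow> int" where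
  "rsign m n = (if m mod 4 = 3 \<and> n mod 4 = 3 then -1 else 1)"

text \<open>For odd positive \<open>n\<close> this is \<open>Jacobi (-1) n\<close>, and
  \<open>tsign n\<close> is \<open>Jacobi 2 n\<close>.\<close>

definition msign :: "int \<Rightarrow> int" where
  "msign n = (if n mod 4 = 3 then -1 else 1)"

definition tsign :: "int \<Rightarrow> int" where
  "tsign n = (if n mod 8 = 3 \<or> n mod 8 = 5 then -1 else 1)"

lemma rsign_sq: "rsign m n * rsign m n = 1" by (simp add: rsign_def)
lemma msign_sq: "msign m * msign m = 1" by (simp add: msign_def)
lemma tsign_sq: "tsign m * tsign m = 1" by (simp add: tsign_def)
lemma rsign_commute: "rsign m n = rsign n m" by (auto simp: rsign_def)
lemma rsign_self: "rsign m m = msign m" by (auto simp: rsign_def msign_def)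

lemma odd_mod_4: "odd (m::int) \<Longrightarrow> m mod 4 = 1 \<or> m mod 4 = 3" by presburger

lemma odd_mult_mod_4:
  assumes "odd (m::int)" "odd n"
  shows "(m * n) mod 4 = 3 \<longleftrightarrow> (m mod 4 = 3) \<noteq> (n mod 4 = 3)"
proof -
  have "(m * n) mod 4 = ((m mod 4) * (n mod 4)) mod 4" by (simp add: mod_mult_eq)
  thus ?thesis using odd_mod_4[OF assms(1)] odd_mod_4[OF assms(2)] by auto
qed

lemma rsign_mult_left:
  assumes "odd m" "odd n" shows "rsign (m * n) k = rsign m k * rsign n k"
  using odd_mult_mod_4[OF assms] by (auto simp: rsign_def)

lemma rsign_mult_right:
  assumes "odd m" "odd n" shows "rsign k (m * n) = rsign k m * rsign k n"
  using rsign_mult_left[OF assms] by (simp add: rsign_commute)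

lemma msign_mult:
  assumes "odd m" "odd n" shows "msign (m * n) = msign m * msign n"
  using odd_mult_mod_4[OF assms] by (auto simp: msign_def)

text \<open>Peeling off one odd prime at a time carries statements from Legendre symbols to Jacobi
  symbols.\<close>

lemma odd_pos_int_induct [consumes 2, case_names one mult]:
  fixes n :: int
  assumes "odd n" "n > 0" "P 1"
    and "\<And>p n. prime p \<Longrightarrow> p > 2 \<Longrightarrow> odd p \<Longrightarrow> odd n \<Longrightarrow> n > 0 \<Longrightarrow> P n \<Longrightarrow> P (p * n)"
  shows "P n"
proof -
  have "n \<noteq> 0" using assms by auto
  thus ?thesis using assms(1,2)
  proof (induction n rule: prime_divisors_induct)
    case zero thus ?case by simp
  next
    case (unit x)
    hence "x = 1" by (simp add: zdvd1_eq)
    thus ?case using assms(3) by simp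
  next
    case (factor p x)
    have "p > 0" using factor.hyps prime_gt_0_int by blast
    moreover have "p \<noteq> 2" using factor by auto
    ultimately show ?case using factor assms(4)[of p x] prime_ge_2_int[of p]
      by (auto simp: zero_less_mult_iff)
  qed
qed

text \<open>The classical law evaluates the product of both symbols for distinct primes; the symbols
  are then nonzero and square to one, which moves one of them across. For p = q both sides
  vanish.\<close>

lemma Legendre_reciprocity:
  assumes "prime (p::int)" "p > 2" "prime (q::int)" "q > 2"
  shows "Legendre p q = rsign p q * Legendre q p"
proof (cases "p = q")
  case True
  thus ?thesis by (auto simp: Legendre_eq_0_iff Legendre_def cong_0_iff)
next
  case False
  have o: "odd p" "odd q" using assms prime_odd_int by auto
  have pn: "prime (nat p)" "prime (nat q)" using assms by auto
  have qr: "Legendre p q * Legendre q p = (-1) ^ nat ((p - 1) div 2 * ((q - 1) div 2))"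
    using Quadratic_Reciprocity_int[OF pn(1) assms(2) pn(2) assms(4) False] .
  have ev: "even ((p - 1) div 2) \<longleftrightarrow> p mod 4 \<noteq> 3" "even ((q - 1) div 2) \<longleftrightarrow> q mod 4 \<noteq> 3"
    using o by presburger+
  have "0 \<le> (p - 1) div 2 * ((q - 1) div 2)" using assms by auto
  hence ev2: "even (nat ((p - 1) div 2 * ((q - 1) div 2))) \<longleftrightarrow>
      even ((p - 1) div 2) \<or> even ((q - 1) div 2)"
    by (simp add: even_nat_iff)
  have "(-1::int) ^ nat ((p - 1) div 2 * ((q - 1) div 2)) = rsign p q"
    using ev2 ev by (auto simp: rsign_def minus_one_power_iff)
  with qr have 1: "Legendre p q * Legendre q p = rsign p q" by simp
  hence "Legendre q p \<noteq> 0" by (auto simp: rsign_def split: if_splits)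
  hence "Legendre q p * Legendre q p = 1" by (auto simp: Legendre_def)
  thus ?thesis using 1 by (metis mult.assoc mult.right_neutral)
qed

text \<open>The induction runs over the prime factors of \<open>n\<close> while \<open>m\<close> is
  prime, then over those of \<open>m\<close>. With a common factor both sides are zero, so the law
  holds for all odd positive arguments.\<close>

lemma Jacobi_reciprocity:
  assumes "odd m" "m > 0" "odd n" "n > 0"
  shows "Jacobi m n = rsign m n * Jacobi n m"
proof -
  have aux: "Jacobi p n = rsign p n * Legendre n p"
    if "prime p" "p > 2" "odd p" "odd n" "n > 0" for p n :: int
    using that(4,5)
  proof (induction n rule: odd_pos_int_induct)
    case one
    have "Legendre 1 p = 1" using that Jacobi_prime[of p 1] by simp
    thus ?case by (simp add: rsign_def)
  next
    case (mult q n)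
    have "Jacobi p (q * n) = Legendre p q * Jacobi p n"
      using mult by (subst Jacobi_mult_right) (auto simp: Jacobi_prime)
    also have "\<dots> = (rsign p q * rsign p n) * (Legendre q p * Legendre n p)"
      using mult that by (simp add: Legendre_reciprocity[of p q])
    also have "\<dots> = rsign p (q * n) * Legendre (q * n) p"
      using mult that by (simp add: rsign_mult_right Legendre_mult)
    finally show ?case .
  qed
  show ?thesis using assms(1,2)
  proof (induction m rule: odd_pos_int_induct)
    case one
    thus ?case using assms by (simp add: rsign_def)
  next
    case (mult p m)
    have "Jacobi (p * m) n = Jacobi p n * Jacobi m n" using assms by (simp add: Jacobi_mult_left)
    also have "\<dots> = (rsign p n * rsign m n) * (Legendre n p * Jacobi n m)"
      using aux[of p n] mult assms by simp
    also have "\<dots> = rsign (p * m) n * Jacobi n (p * m)"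
      using mult by (simp add: rsign_mult_left Jacobi_mult_right Jacobi_prime)
    finally show ?case .
  qed
qed

lemma Jacobi_minus_1:
  assumes "odd n" "n > 0" shows "Jacobi (-1) n = msign n"
  using assms
proof (induction n rule: odd_pos_int_induct)
  case (mult p n)
  have p: "prime (nat p)" "2 < nat p" using mult by auto
  have ec: "[Legendre (-1) p = (-1) ^ ((nat p - 1) div 2)] (mod p)"
    using euler_criterion[OF p, of "-1"] mult by simp
  have "int ((nat p - 1) div 2) = (p - 1) div 2" using mult(2) by (simp add: zdiv_int of_nat_diff)
  hence "even ((nat p - 1) div 2) \<longleftrightarrow> even ((p - 1) div 2)" by (metis even_of_nat)
  moreover have "even ((p - 1) div 2) \<longleftrightarrow> p mod 4 \<noteq> 3" using mult(3) by presburger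
  ultimately have "even ((nat p - 1) div 2) \<longleftrightarrow> p mod 4 \<noteq> 3" by simp
  hence "(-1::int) ^ ((nat p - 1) div 2) = msign p"
    by (auto simp: msign_def minus_one_power_iff)
  with ec have "p dvd Legendre (-1) p - msign p" by (simp add: cong_iff_dvd_diff)
  moreover have "\<bar>Legendre (-1) p - msign p\<bar> \<le> 2" by (auto simp: Legendre_def msign_def)
  ultimately have "Legendre (-1) p = msign p"
    using mult(2) zdvd_imp_le[of p "\<bar>Legendre (-1) p - msign p\<bar>"] by fastforce
  thus ?case using mult by (simp add: Jacobi_mult_right Jacobi_prime msign_mult)
qed (auto simp: msign_def)

text \<open>Induction from m to m + 2. Modulo m + 2 the number 2 is -m, so the symbol splits into
  (-1 / m + 2) and (m / m + 2). Reciprocity turns the latter into (m + 2 / m) = (2 / m), without a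
  sign because one of m and m + 2 is 1 modulo 4.\<close>

lemma Jacobi_2:
  assumes "odd n" "n > 0" shows "Jacobi 2 n = tsign n"
proof -
  have "Jacobi 2 (2 * int k + 1) = tsign (2 * int k + 1)" for k
  proof (induction k)
    case 0 thus ?case by (simp add: tsign_def)
  next
    case (Suc k)
    define m where "m = 2 * int k + 1"
    have m: "odd m" "m > 0" by (auto simp: m_def)
    have s: "2 * int (Suc k) + 1 = m + 2" by (simp add: m_def)
    have 1: "Jacobi 2 (m + 2) = Jacobi (-1) (m + 2) * Jacobi m (m + 2)"
    proof -
      have "[2 = (-1) * m] (mod (m + 2))" by (simp add: cong_iff_dvd_diff add.commute)
      from Jacobi_cong[OF this] show ?thesis using m Jacobi_mult_left[of "m + 2" "-1" m] by simp
    qed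
    have 2: "Jacobi m (m + 2) = rsign m (m + 2) * Jacobi (m + 2) m"
      using m by (intro Jacobi_reciprocity) auto
    have 3: "rsign m (m + 2) = 1" using m unfolding rsign_def by presburger
    have 4: "Jacobi (m + 2) m = Jacobi 2 m" by (rule Jacobi_cong) (simp add: cong_iff_dvd_diff)
    have "Jacobi 2 (m + 2) = msign (m + 2) * tsign m"
      using 1 2 3 4 Suc m Jacobi_minus_1[of "m + 2"] by (simp add: m_def)
    also have "\<dots> = tsign (m + 2)"
    proof -
      obtain q r where q: "m = 8 * q + r" "0 \<le> r" "r < 8"
        by (metis mult_div_mod_eq pos_mod_bound pos_mod_sign zero_less_numeral)
      have "odd r" using m(1) q(1) by simp
      hence "r = 1 \<or> r = 3 \<or> r = 5 \<or> r = 7" using q(2,3) by presburger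
      moreover have "(8 * q + c) mod 4 = c mod 4" "(8 * q + c) mod 8 = c mod 8" for c
        by (simp_all add: mod_simps) presburger
      ultimately show ?thesis unfolding msign_def tsign_def q(1) add.assoc
        by (elim disjE) simp_all
    qed
    finally show ?case by (simp only: s)
  qed
  from this[of "nat ((n - 1) div 2)"] assms show ?thesis by (auto elim!: oddE)
qed

text \<open>Prescribing a sign at one prime: the source of all vanishing character sums below.\<close>

lemma exists_Jacobi_minus_1:
  fixes p m :: int
  assumes "prime p" "odd p" "odd m" "coprime p m" "odd e" "m \<noteq> 0"
  shows "\<exists>g. [g = 1] (mod m) \<and> coprime g (p ^ e * m) \<and> Jacobi g (p ^ e * m) = -1"
proof -
  have p2: "p > 2" using assms(1,2) prime_ge_2_int[OF assms(1)] by (cases "p = 2") auto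
  have pn: "prime (nat p)" "2 < nat p" using assms p2 by auto
  \<comment> \<open>A nonresidue exists by counting: otherwise the squares of 1, ..., (p - 1) / 2
    would have to cover all p - 1 nonzero classes.\<close>
  have "\<exists>r. Legendre r p = -1"
  proof (rule ccontr)
    assume nex: "\<not> ?thesis"
    hence L: "Legendre r p = 1" if "\<not> p dvd r" for r
      using that Legendre_eq_0_iff[of r p] by (auto simp: Legendre_def split: if_splits)
    have ex: "\<exists>y\<in>{1..(p - 1) div 2}. [y\<^sup>2 = r] (mod p)" if "r \<in> {1..p - 1}" for r
    proof -
      have "\<not> p dvd r" using that zdvd_not_zless[of r p] by auto
      hence "QuadRes p r" using L[of r] by (auto simp: Legendre_def split: if_splits)
      then obtain y where y: "[y\<^sup>2 = r] (mod p)" by (auto simp: QuadRes_def)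
      define z where "z = y mod p"
      have z: "[z\<^sup>2 = r] (mod p)" "0 \<le> z" "z < p"
        using y p2 power_mod[of y p 2] by (auto simp: z_def Cong.cong_def)
      have z0: "z \<noteq> 0"
      proof
        assume "z = 0"
        hence "p dvd r" using z(1) by (simp add: Cong.cong_def mod_eq_0_iff_dvd) 
        thus False using \<open>\<not> p dvd r\<close> by simp
      qed
      show ?thesis
      proof (cases "z \<le> (p - 1) div 2")
        case True thus ?thesis using z z0 by (intro bexI[of _ z]) auto
      next
        case False
        have "[(p - z)\<^sup>2 = z\<^sup>2] (mod p)"
          by (simp add: cong_iff_dvd_diff power2_eq_square algebra_simps)
        hence "[(p - z)\<^sup>2 = r] (mod p)" using z(1) cong_trans by blast
        moreover have "p - z \<le> (p - 1) div 2" using False assms(2) by presburger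
        ultimately show ?thesis using z by (intro bexI[of _ "p - z"]) auto
      qed
    qed
    have "{1..p - 1} \<subseteq> (\<lambda>y. y\<^sup>2 mod p) ` {1..(p - 1) div 2}"
    proof
      fix r assume r: "r \<in> {1..p - 1}"
      from ex[OF r] obtain y where "y \<in> {1..(p - 1) div 2}" "[y\<^sup>2 = r] (mod p)" by blast
      thus "r \<in> (\<lambda>y. y\<^sup>2 mod p) ` {1..(p - 1) div 2}"
        using r by (intro image_eqI[of _ _ y]) (auto simp: Cong.cong_def)
    qed
    hence "card {1..p - 1} \<le> card {1..(p - 1) div 2}"
      by (meson card_image_le card_mono finite_atLeastAtMost_int finite_imageI le_trans)
    thus False using p2 by auto
  qed
  then obtain r where r: "Legendre r p = -1" by blast
  \<comment> \<open>The Chinese remainder theorem puts the nonresidue at \<open>p\<close> and 1 at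
    \<open>m\<close>; the odd exponent preserves the sign.\<close>
  obtain g where g: "[g = r] (mod p)" "[g = 1] (mod m)"
    using binary_chinese_remainder_int[OF assms(4), of r 1] by blast
  have Lg: "Legendre g p = -1" using Legendre_cong[OF g(1)] r by simp
  have "Jacobi g (p ^ k) = (-1) ^ k" for k
  proof (induction k)
    case (Suc k)
    have "p \<noteq> 0" using p2 by auto
    thus ?case using Suc assms(1) Lg by (simp add: Jacobi_mult_right Jacobi_prime)
  qed auto
  moreover have "Jacobi g m = 1" using Jacobi_cong[OF g(2)] assms by simp
  ultimately have J: "Jacobi g (p ^ e * m) = -1"
    using assms p2 by (simp add: Jacobi_mult_right)
  moreover have "coprime g (p ^ e * m)"
    using J Jacobi_eq_0_iff[of "p ^ e * m" g] assms p2 by auto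
  ultimately show ?thesis using g(2) by blast
qed

text \<open>Some prime occurs to an odd power in a positive nonsquare; the sign is prescribed there,
  and the rest of the modulus sees 1.\<close>

lemma nonsquare_exists_Jacobi_minus_1:
  fixes n :: int
  assumes "odd n" "n > 0" "\<nexists>k. n = k\<^sup>2"
  shows "\<exists>g. coprime g n \<and> Jacobi g n = -1"
proof -
  have "\<exists>p. prime p \<and> odd (multiplicity p n)"
  proof (rule ccontr)
    assume nex: "\<not> ?thesis"
    have "n = (\<Prod>p\<in>prime_factors n. p ^ multiplicity p n)"
      using assms prime_factorization_int by (intro prime_factorization_int) auto
    also have "\<dots> = (\<Prod>p\<in>prime_factors n. (p ^ (multiplicity p n div 2))\<^sup>2)"
    proof (intro prod.cong refl)
      fix p assume "p \<in> prime_factors n"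
      hence "even (multiplicity p n)" using nex by auto
      thus "p ^ multiplicity p n = (p ^ (multiplicity p n div 2))\<^sup>2"
        by (metis dvd_div_mult_self power_mult)
    qed
    also have "\<dots> = (\<Prod>p\<in>prime_factors n. p ^ (multiplicity p n div 2))\<^sup>2"
      by (simp add: prod_power_distrib)
    finally show False using assms(3) by blast
  qed
  then obtain p where p: "prime p" "odd (multiplicity p n)" by blast
  define e where "e = multiplicity p n"
  obtain m where m: "n = p ^ e * m" "\<not> p dvd m"
    using multiplicity_decompose'[of n p] assms p unfolding e_def
    by (metis less_irrefl not_prime_unit)
  have "e > 0" using p(2) by (auto simp: e_def intro: Nat.gr0I)
  hence "p dvd n" using m by (simp add: dvd_power)
  hence "odd p" using assms(1) dvd_trans by blast
  moreover have "odd m" "m \<noteq> 0" using assms m by auto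
  moreover have "coprime p m" using p m by (simp add: prime_imp_coprime)
  moreover have "odd e" using p(2) by (simp add: e_def)
  ultimately obtain g where "coprime g (p ^ e * m)" "Jacobi g (p ^ e * m) = -1"
    using exists_Jacobi_minus_1[of p m e] p(1) by blast
  thus ?thesis unfolding m(1)[symmetric] by blast
qed

section \<open>Arithmetic of the quadratic ring\<close>

lemma zsqrt2_sel [simp]:
  "rat_part (x + y) = rat_part x + rat_part y" "sqrt_part (x + y) = sqrt_part x + sqrt_part y"
  "rat_part (x - y) = rat_part x - rat_part y" "sqrt_part (x - y) = sqrt_part x - sqrt_part y"
  "rat_part (- x) = - rat_part x" "sqrt_part (- x) = - sqrt_part x"
  "rat_part (x * y) = rat_part x * rat_part y + 2 * sqrt_part x * sqrt_part y"
  "sqrt_part (x * y) = rat_part x * sqrt_part y + sqrt_part x * rat_part y"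
  "rat_part (0 :: zsqrt2) = 0" "sqrt_part (0 :: zsqrt2) = 0"
  "rat_part (1 :: zsqrt2) = 1" "sqrt_part (1 :: zsqrt2) = 0"
  by (simp_all add: plus_zsqrt2_def minus_zsqrt2_def uminus_zsqrt2_def times_zsqrt2_def
        zero_zsqrt2_def one_zsqrt2_def)

lemma zsqrt2_eq_iff: "x = y \<longleftrightarrow> rat_part x = rat_part y \<and> sqrt_part x = sqrt_part y"
  by (cases x; cases y) simp

definition nrm :: "zsqrt2 \<Rightarrow> int" where
  "nrm w = (rat_part w)\<^sup>2 - 2 * (sqrt_part w)\<^sup>2"

definition conj2 :: "zsqrt2 \<Rightarrow> zsqrt2" where
  "conj2 w = ZSqrt2 (rat_part w) (- sqrt_part w)"

lemma conj2_sel [simp]: "rat_part (conj2 w) = rat_part w" "sqrt_part (conj2 w) = - sqrt_part w"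
  by (simp_all add: conj2_def)

lemma nrm_mult: "nrm (x * y) = nrm x * nrm y"
  by (simp add: nrm_def power2_eq_square algebra_simps)

lemma nrm_simps [simp]: "nrm 0 = 0" "nrm 1 = 1" "nrm (conj2 w) = nrm w" "nrm (- w) = nrm w"
  by (simp_all add: nrm_def)

lemma nrm_power: "nrm (x ^ k) = nrm x ^ k"
  by (induction k) (simp_all add: nrm_mult)

lemma mult_conj2: "x * conj2 x = ZSqrt2 (nrm x) 0"
  by (simp add: zsqrt2_eq_iff nrm_def power2_eq_square)

text \<open>Irrationality of sqrt 2: in a^2 = 2 b^2 with b nonzero the two sides would have 2-adic
  valuations of opposite parity.\<close>

lemma nrm_eq_0_iff: "nrm w = 0 \<longleftrightarrow> w = 0"
proof
  assume "nrm w = 0"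
  hence e: "(rat_part w)\<^sup>2 = 2 * (sqrt_part w)\<^sup>2" by (simp add: nrm_def)
  have "sqrt_part w = 0"
  proof (rule ccontr)
    assume b: "sqrt_part w \<noteq> 0"
    hence a: "rat_part w \<noteq> 0" using e by auto
    have "multiplicity (2::int) ((rat_part w)\<^sup>2) = 2 * multiplicity 2 (rat_part w)"
      using a by (simp add: prime_elem_multiplicity_power_distrib)
    moreover have "multiplicity (2::int) (2 * (sqrt_part w)\<^sup>2) = 1 + 2 * multiplicity 2 (sqrt_part w)"
      using b by (simp add: prime_elem_multiplicity_power_distrib prime_elem_multiplicity_mult_distrib)
    ultimately have "2 * multiplicity 2 (rat_part w) = 1 + 2 * multiplicity 2 (sqrt_part w)"
      using e by metis
    thus False by presburger
  qed
  thus "w = 0" using e by (simp add: zsqrt2_eq_iff)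
qed simp

instance zsqrt2 :: idom
proof
  fix a b :: zsqrt2 assume "a \<noteq> 0" "b \<noteq> 0"
  thus "a * b \<noteq> 0" by (metis nrm_eq_0_iff nrm_mult mult_eq_0_iff)
qed

section \<open>Euclidean division\<close>

instantiation zsqrt2 :: modulo
begin

text \<open>The exact quotient \<open>x * conj2 y / nrm y\<close> with both rational coordinates
  rounded to the nearest integer. Real division by zero makes the quotient by 0 equal to 0.\<close>

definition divide_zsqrt2 :: "zsqrt2 \<Rightarrow> zsqrt2 \<Rightarrow> zsqrt2" where
  "x div y = ZSqrt2 (round (real_of_int (rat_part (x * conj2 y)) / real_of_int (nrm y)))
                    (round (real_of_int (sqrt_part (x * conj2 y)) / real_of_int (nrm y)))"

definition modulo_zsqrt2 :: "zsqrt2 \<Rightarrow> zsqrt2 \<Rightarrow> zsqrt2" where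
  "(x::zsqrt2) mod y = x - (x div y) * y"

instance ..

end

instance zsqrt2 :: idom_modulo
proof
  fix a b :: zsqrt2
  show "a div 0 = 0" by (simp add: divide_zsqrt2_def zsqrt2_eq_iff)
  show "a div b * b + a mod b = a" by (simp add: modulo_zsqrt2_def)
  assume "b \<noteq> 0"
  hence n: "nrm b \<noteq> 0" by (simp add: nrm_eq_0_iff)
  have e: "a * b * conj2 b = a * ZSqrt2 (nrm b) 0" by (simp add: mult.assoc mult_conj2)
  show "a * b div b = a" using n unfolding divide_zsqrt2_def e by (simp add: zsqrt2_eq_iff)
qed

text \<open>Rounding leaves \<open>(a mod b) * conj2 b\<close> with coordinates A, B of size at most
  |n| / 2, so |A^2 - 2 B^2| is at most n^2 / 2. The norm of the remainder is therefore at most half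
  of |n|.\<close>

lemma nrm_mod_less:
  assumes "b \<noteq> (0::zsqrt2)" shows "\<bar>nrm (a mod b)\<bar> < \<bar>nrm b\<bar>"
proof -
  define n where "n = nrm b"
  have n: "n \<noteq> 0" using assms by (simp add: n_def nrm_eq_0_iff)
  have round: "4 * (x - round (real_of_int x / real_of_int n) * n)\<^sup>2 \<le> n\<^sup>2" for x
  proof -
    define q where "q = round (real_of_int x / real_of_int n)"
    have "\<bar>real_of_int q - real_of_int x / real_of_int n\<bar> \<le> 1 / 2"
      unfolding q_def by (rule of_int_round_abs_le)
    hence "\<bar>real_of_int q - real_of_int x / real_of_int n\<bar> * \<bar>real_of_int n\<bar> \<le> 1 / 2 * \<bar>real_of_int n\<bar>"
      by (intro mult_right_mono) auto
    hence "\<bar>(real_of_int q - real_of_int x / real_of_int n) * real_of_int n\<bar> \<le> \<bar>real_of_int n\<bar> / 2"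
      by (simp add: abs_mult)
    also have "(real_of_int q - real_of_int x / real_of_int n) * real_of_int n
        = real_of_int (q * n - x)" using n by (simp add: field_simps)
    finally have "2 * \<bar>real_of_int (q * n - x)\<bar> \<le> \<bar>real_of_int n\<bar>" by argo
    hence "real_of_int (2 * \<bar>q * n - x\<bar>) \<le> real_of_int \<bar>n\<bar>" by simp
    hence "2 * \<bar>x - q * n\<bar> \<le> \<bar>n\<bar>" unfolding of_int_le_iff by (simp add: abs_minus_commute)
    hence "(2 * \<bar>x - q * n\<bar>)\<^sup>2 \<le> \<bar>n\<bar>\<^sup>2" by (intro power_mono) auto
    thus ?thesis by (simp add: power_mult_distrib q_def)
  qed
  define A where "A = rat_part ((a mod b) * conj2 b)"
  define B where "B = sqrt_part ((a mod b) * conj2 b)"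
  have e: "(a mod b) * conj2 b = a * conj2 b - (a div b) * ZSqrt2 n 0"
    by (simp add: modulo_zsqrt2_def left_diff_distrib mult.assoc mult_conj2 n_def)
  have "4 * A\<^sup>2 \<le> n\<^sup>2" "4 * B\<^sup>2 \<le> n\<^sup>2"
    using round[of "rat_part (a * conj2 b)"] round[of "sqrt_part (a * conj2 b)"]
    unfolding A_def B_def e by (simp_all add: divide_zsqrt2_def n_def)
  moreover have "nrm (a mod b) * n = A\<^sup>2 - 2 * B\<^sup>2"
    using nrm_mult[of "a mod b" "conj2 b"] by (simp add: nrm_def A_def B_def n_def)
  moreover have "0 \<le> A\<^sup>2" "0 \<le> B\<^sup>2" by simp_all
  ultimately have "2 * \<bar>nrm (a mod b) * n\<bar> \<le> n\<^sup>2" by linarith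
  also have "n\<^sup>2 < 2 * (\<bar>n\<bar> * \<bar>n\<bar>)" using n zero_less_power2[of n] unfolding power2_eq_square by simp
  finally have "\<bar>nrm (a mod b)\<bar> * \<bar>n\<bar> < \<bar>n\<bar> * \<bar>n\<bar>" by (simp add: abs_mult)
  thus ?thesis unfolding n_def by (rule mult_right_less_imp_less) simp
qed

lemma zsqrt2_is_unit_iff: "w dvd 1 \<longleftrightarrow> \<bar>nrm w\<bar> = 1"
proof
  assume "w dvd 1"
  then obtain v where "1 = w * v" by (auto simp: dvd_def)
  hence "nrm w * nrm v = 1" by (metis nrm_mult nrm_simps(2))
  thus "\<bar>nrm w\<bar> = 1" using zmult_eq_1_iff by auto
next
  assume a: "\<bar>nrm w\<bar> = 1"
  hence s: "nrm w * nrm w = 1" by (metis abs_mult_self_eq mult_1)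
  have "w * (conj2 w * ZSqrt2 (nrm w) 0) = ZSqrt2 (nrm w) 0 * ZSqrt2 (nrm w) 0"
    by (metis mult.assoc mult_conj2)
  also have "\<dots> = 1" using s by (simp add: zsqrt2_eq_iff)
  finally show "w dvd 1" by (metis dvd_triv_left)
qed

section \<open>A fundamental domain for the totally positive units\<close>

text \<open>The slope v / u of a totally positive u + v sqrt 2 lies strictly between -1 / sqrt 2 and
  1 / sqrt 2. Multiplication by \<epsilon>^2 = 3 + 2 sqrt 2 increases it and sends slope 0 to 2/3,
  so the slopes from 0 (included) to 2/3 (excluded) form a fundamental domain.\<close>

definition canonical :: "zsqrt2 \<Rightarrow> bool" where
  "canonical w \<longleftrightarrow> rat_part w > 0 \<and> 0 \<le> sqrt_part w \<and> 3 * sqrt_part w < 2 * rat_part w"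

abbreviation unit_sq :: zsqrt2 where "unit_sq \<equiv> ZSqrt2 3 2"
abbreviation unit_sq_inv :: zsqrt2 where "unit_sq_inv \<equiv> ZSqrt2 3 (-2)"

lemma unit_sq_mult_inv: "unit_sq * unit_sq_inv = 1" "unit_sq_inv * unit_sq = 1"
  by (simp_all add: zsqrt2_eq_iff)

lemma fund_unit_power2: "fund_unit ^ 2 = unit_sq"
  by (simp add: fund_unit_def power2_eq_square zsqrt2_eq_iff)

lemma totally_positive_nrm: "totally_positive w \<longleftrightarrow> rat_part w > 0 \<and> nrm w > 0"
  by (simp add: totally_positive_def nrm_def)

text \<open>A rational form of |v| < u / sqrt 2, which keeps the reduction argument linear.\<close>

lemma totally_positive_bound:
  assumes "totally_positive w" shows "4 * \<bar>sqrt_part w\<bar> < 3 * rat_part w"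
proof -
  have "0 \<le> (sqrt_part w)\<^sup>2" by simp
  hence "16 * (sqrt_part w)\<^sup>2 < 9 * (rat_part w)\<^sup>2"
    using assms unfolding totally_positive_def by linarith
  hence "(4 * \<bar>sqrt_part w\<bar>)\<^sup>2 < (3 * rat_part w)\<^sup>2" by (simp add: power_mult_distrib)
  thus ?thesis by (rule power2_less_imp_less) (use assms in \<open>auto simp: totally_positive_def\<close>)
qed

lemma totally_positive_mult:
  assumes "totally_positive w" "totally_positive z" shows "totally_positive (w * z)"
proof -
  have "\<bar>2 * sqrt_part w * sqrt_part z\<bar> * 8 = (4 * \<bar>sqrt_part w\<bar>) * (4 * \<bar>sqrt_part z\<bar>)"
    by (simp add: abs_mult)
  define x y where "x = 2 * (sqrt_part w)\<^sup>2" and "y = 2 * (sqrt_part z)\<^sup>2"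
  have "x < (rat_part w)\<^sup>2" "y < (rat_part z)\<^sup>2" "0 \<le> x" "0 \<le> y"
    using assms by (auto simp: x_def y_def totally_positive_def)
  hence "x * y < (rat_part w)\<^sup>2 * (rat_part z)\<^sup>2" by (intro mult_strict_mono') auto
  hence "\<bar>2 * sqrt_part w * sqrt_part z\<bar>\<^sup>2 < (rat_part w * rat_part z)\<^sup>2"
    by (simp add: x_def y_def power_mult_distrib)
  hence "\<bar>2 * sqrt_part w * sqrt_part z\<bar> < rat_part w * rat_part z"
    by (rule power2_less_imp_less) (use assms in \<open>auto simp: totally_positive_def\<close>)
  hence "rat_part (w * z) > 0" by simp
  moreover have "nrm (w * z) > 0" using assms by (simp add: nrm_mult totally_positive_nrm)
  ultimately show ?thesis by (simp add: totally_positive_nrm)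
qed

lemma totally_positive_simps [simp]:
  "totally_positive 1" "totally_positive unit_sq" "totally_positive unit_sq_inv"
  by (simp_all add: totally_positive_def)

lemma canonical_imp_totally_positive:
  assumes "canonical w" shows "totally_positive w"
proof -
  have "(3 * sqrt_part w)\<^sup>2 < (2 * rat_part w)\<^sup>2"
    using assms by (intro power_strict_mono) (auto simp: canonical_def)
  hence "9 * (sqrt_part w)\<^sup>2 < 4 * (rat_part w)\<^sup>2" by (simp add: power_mult_distrib)
  moreover have "8 * (sqrt_part w)\<^sup>2 \<le> 9 * (sqrt_part w)\<^sup>2" by simp
  ultimately have "(rat_part w)\<^sup>2 - 2 * (sqrt_part w)\<^sup>2 > 0" by linarith
  thus ?thesis using assms by (auto simp: canonical_def totally_positive_def)
qed

text \<open>With slope below 2/3 the norm is at least (1 - 8/9) u^2. Inside the domain the norm thus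
  controls both coordinates, which fails for general totally positive elements.\<close>

lemma canonical_bound:
  assumes "canonical w" shows "(rat_part w)\<^sup>2 \<le> 9 * nrm w"
proof -
  have "(3 * sqrt_part w)\<^sup>2 < (2 * rat_part w)\<^sup>2"
    using assms by (intro power_strict_mono) (auto simp: canonical_def)
  thus ?thesis unfolding power_mult_distrib nrm_def by simp
qed

lemma totally_positive_nonzero: "totally_positive w \<Longrightarrow> w \<noteq> 0"
  by (auto simp: totally_positive_def)

lemma canonical_nonzero: "canonical w \<Longrightarrow> w \<noteq> 0"
  by (auto simp: canonical_def)

text \<open>Reduction theory as an induction rule: outside the domain, multiplication by
  \<epsilon>^2 or its inverse either lowers the rational part or lands in the domain at
  once.\<close>

lemma totally_positive_induct [consumes 1, case_names canonical up down]:
  assumes "totally_positive w"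
    and "\<And>w. canonical w \<Longrightarrow> P w"
    and "\<And>w. totally_positive w \<Longrightarrow> P (unit_sq * w) \<Longrightarrow> P w"
    and "\<And>w. totally_positive w \<Longrightarrow> P (unit_sq_inv * w) \<Longrightarrow> P w"
  shows "P w"
  using assms(1)
proof (induction "nat (rat_part w)" arbitrary: w rule: less_induct)
  case less
  note tp = less.prems
  have a: "rat_part w > 0" using tp by (simp add: totally_positive_def)
  have b: "4 * \<bar>sqrt_part w\<bar> < 3 * rat_part w" by (rule totally_positive_bound[OF tp])
  show ?case
  proof (cases "sqrt_part w \<ge> 0")
    case True
    show ?thesis
    proof (cases "3 * sqrt_part w < 2 * rat_part w")
      case True
      thus ?thesis using \<open>sqrt_part w \<ge> 0\<close> a assms(2) by (auto simp: canonical_def)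
    next
      case False
      have "P (unit_sq_inv * w)"
        by (rule less.hyps) (use False a b tp in \<open>auto intro: totally_positive_mult\<close>)
      thus ?thesis using assms(4) tp by blast
    qed
  next
    case False
    \<comment> \<open>For slopes from -1/2 up to 0 the rational part need not drop, but a single
      multiplication by \<open>unit_sq\<close> reaches the domain.\<close>
    show ?thesis
    proof (cases "2 * \<bar>sqrt_part w\<bar> \<le> rat_part w")
      case True
      hence "canonical (unit_sq * w)" using False a by (auto simp: canonical_def)
      thus ?thesis using assms(2,3) tp by blast
    next
      case F2: False
      have "P (unit_sq * w)"
        by (rule less.hyps) (use False F2 a b tp in \<open>auto intro: totally_positive_mult\<close>)
      thus ?thesis using assms(3) tp by blast
    qed
  qed
qed

text \<open>The fundamental unit has norm -1 and corrects the sign of the norm; a factor -1 then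
  corrects the sign of the rational part.\<close>

lemma totally_positive_associate_exists:
  assumes "w \<noteq> 0" shows "\<exists>u. u dvd 1 \<and> totally_positive (u * w)"
proof -
  have "\<exists>u. u dvd 1 \<and> nrm (u * w) > 0"
  proof (cases "nrm w > 0")
    case False
    hence "nrm w < 0" using assms nrm_eq_0_iff[of w] by linarith
    moreover have "nrm fund_unit = -1" by (simp add: nrm_def fund_unit_def)
    ultimately show ?thesis
      by (intro exI[of _ fund_unit]) (simp add: zsqrt2_is_unit_iff nrm_mult)
  qed (auto intro: exI[of _ 1])
  then obtain u where u: "u dvd 1" "nrm (u * w) > 0" by blast
  have "rat_part (u * w) \<noteq> 0"
    using u(2) unfolding nrm_def[of "u * w"] by (metis diff_gt_0_iff_gt less_le_not_le mult_nonneg_nonneg zero_le_numeral zero_le_power2 zero_power2)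
  hence "rat_part (u * w) > 0 \<or> rat_part (- u * w) > 0" by auto
  thus ?thesis
  proof
    assume "rat_part (u * w) > 0"
    thus ?thesis using u unfolding totally_positive_nrm by blast
  next
    assume "rat_part (- u * w) > 0"
    moreover have "nrm (- u * w) > 0" using u(2) by (simp add: nrm_mult)
    ultimately show ?thesis using u(1) unfolding totally_positive_nrm by (metis minus_dvd_iff)
  qed
qed

lemma canonical_associate_exists:
  assumes "w \<noteq> 0" shows "\<exists>z. canonical z \<and> z dvd w \<and> w dvd z"
proof -
  obtain u where u: "u dvd 1" "totally_positive (u * w)"
    using totally_positive_associate_exists[OF assms] by blast
  have "\<exists>z. canonical z \<and> z dvd v \<and> v dvd z" if "totally_positive v" for v
    using that
  proof (induction v rule: totally_positive_induct)
    case (up v)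
    have "unit_sq dvd 1" using unit_sq_mult_inv(1) by (metis dvd_triv_left)
    thus ?case using up by (metis dvd_mult_unit_iff' mult_unit_dvd_iff')
  next
    case (down v)
    have "unit_sq_inv dvd 1" using unit_sq_mult_inv(2) by (metis dvd_triv_left)
    thus ?case using down by (metis dvd_mult_unit_iff' mult_unit_dvd_iff')
  qed auto
  from this[OF u(2)] show ?thesis using u(1) by (metis dvd_mult_unit_iff' mult_unit_dvd_iff')
qed

text \<open>Uniqueness in the fundamental domain. A unit p + q sqrt 2 of norm 1 with q > 0 has q >=
  2, as p^2 = 3 is impossible, and then 4/3 <= p/q <= 3/2. Such a unit moves every slope of the
  domain to 2/3 or beyond.\<close>

lemma canonical_unit_mult:
  assumes w: "canonical w" and z: "canonical (e * w)"
    and e: "rat_part e > 0" "nrm e = 1" "sqrt_part e \<ge> 0"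
  shows "e = 1"
proof -
  define p q a b where "p = rat_part e" and "q = sqrt_part e" and "a = rat_part w" and "b = sqrt_part w"
  have pq: "p\<^sup>2 = 2 * q\<^sup>2 + 1" using e(2) by (simp add: nrm_def p_def q_def)
  have p0: "p > 0" "q \<ge> 0" using e by (auto simp: p_def q_def)
  have ab: "a > 0" "b \<ge> 0" using w by (auto simp: canonical_def a_def b_def)
  have "q = 0"
  proof (rule ccontr)
    assume "q \<noteq> 0"
    hence q1: "q \<ge> 1" using p0 by auto
    have "q \<noteq> 1"
    proof
      assume "q = 1"
      hence "p\<^sup>2 = 3" using pq by simp
      moreover have "p\<^sup>2 \<ge> 2\<^sup>2 \<or> p \<le> 1" using power_mono[of 2 p 2] by (cases "p \<ge> 2") auto
      moreover have "p \<le> 1 \<Longrightarrow> p = 1" using p0 by auto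
      ultimately show False by auto
    qed
    hence q2: "q \<ge> 2" using q1 by auto
    have "2\<^sup>2 \<le> q\<^sup>2" using q2 by (intro power_mono) auto
    hence "(2 * p)\<^sup>2 \<le> (3 * q)\<^sup>2" unfolding power_mult_distrib pq by simp
    hence 1: "2 * p \<le> 3 * q" by (rule power2_le_imp_le) (use q2 in auto)
    have "(4 * q)\<^sup>2 \<le> (3 * p)\<^sup>2" unfolding power_mult_distrib pq using \<open>2\<^sup>2 \<le> q\<^sup>2\<close> by simp
    hence 2: "4 * q \<le> 3 * p" by (rule power2_le_imp_le) (use p0 in auto)
    have "3 * (p * b + q * a) < 2 * (p * a + 2 * q * b)"
      using z by (simp add: canonical_def p_def q_def a_def b_def)
    hence "(3 * p - 4 * q) * b < (2 * p - 3 * q) * a" by (simp add: algebra_simps)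
    moreover have "(3 * p - 4 * q) * b \<ge> 0" using 2 ab by simp
    moreover have "(2 * p - 3 * q) * a \<le> 0" using 1 ab by (simp add: mult_nonpos_nonneg)
    ultimately show False by linarith
  qed
  moreover from this pq p0 have "p = 1" by (simp add: power2_eq_1_iff)
  ultimately show ?thesis by (simp add: zsqrt2_eq_iff p_def q_def)
qed

text \<open>The quotient e = z / w has norm 1, and its rational part is positive because both slopes
  are below 2/3. Its inverse is its conjugate, so one of the two has a nonnegative second coordinate
  and \<open>canonical_unit_mult\<close> applies to it.\<close>

lemma canonical_associated_eq:
  assumes w: "canonical w" and z: "canonical z" and "w dvd z" "z dvd w"
  shows "w = z"
proof -
  obtain e where e: "z = e * w" using assms(3) by (auto simp: dvd_def mult.commute)
  obtain f where f: "w = f * z" using assms(4) by (auto simp: dvd_def mult.commute)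
  have w0: "w \<noteq> 0" using w by (rule canonical_nonzero)
  have "f * e * w = 1 * w" using e f by (simp add: mult.assoc)
  hence fe: "f * e = 1" using w0 mult_right_cancel by blast
  have np: "nrm w > 0" "nrm z > 0"
    using w z canonical_imp_totally_positive totally_positive_nrm by auto
  have "nrm e * nrm w > 0" using np e by (simp add: nrm_mult)
  hence "nrm e > 0" using np by (simp add: zero_less_mult_iff)
  moreover have "nrm f * nrm e = 1" using fe by (metis nrm_mult nrm_simps(2))
  ultimately have n1: "nrm e = 1" by (simp add: zmult_eq_1_iff)
  have fc: "f = conj2 e"
  proof -
    have "e * conj2 e = 1" using n1 by (simp add: mult_conj2 zsqrt2_eq_iff)
    hence "f * (e * conj2 e) = f" by simp
    moreover have "f * (e * conj2 e) = conj2 e" using fe by (metis mult.assoc mult_1)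
    ultimately show ?thesis by simp
  qed
  have "z * conj2 w = e * (w * conj2 w)" using e by (simp add: mult_ac)
  hence "rat_part z * rat_part w - 2 * sqrt_part z * sqrt_part w = rat_part e * nrm w"
    by (simp add: mult_conj2 zsqrt2_eq_iff)
  moreover have "2 * sqrt_part z * sqrt_part w < rat_part z * rat_part w"
  proof -
    have "3 * sqrt_part z \<le> 2 * rat_part z" "3 * sqrt_part w \<le> 2 * rat_part w"
        "0 \<le> sqrt_part w" "0 \<le> 2 * rat_part z"
      using w z unfolding canonical_def by linarith+
    hence "(3 * sqrt_part z) * (3 * sqrt_part w) \<le> (2 * rat_part z) * (2 * rat_part w)"
      by - (rule mult_mono, linarith+)
    hence "9 * (sqrt_part z * sqrt_part w) \<le> 4 * (rat_part z * rat_part w)" by simp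
    moreover have "rat_part z * rat_part w > 0" using w z by (simp add: canonical_def)
    moreover have "sqrt_part z * sqrt_part w \<ge> 0" using w z by (simp add: canonical_def)
    ultimately show ?thesis by linarith
  qed
  ultimately have "rat_part e * nrm w > 0" by linarith
  hence re: "rat_part e > 0" using np by (simp add: zero_less_mult_iff)
  show ?thesis
  proof (cases "sqrt_part e \<ge> 0")
    case True
    have "e = 1" using canonical_unit_mult[OF w _ re n1 True] z e by simp
    thus ?thesis using e by simp
  next
    case False
    have "f = 1" using canonical_unit_mult[OF z, of f] w f re n1 False fc by simp
    thus ?thesis using f by simp
  qed
qed

instantiation zsqrt2 :: normalization_euclidean_semiring
begin

definition euclidean_size_zsqrt2 :: "zsqrt2 \<Rightarrow> nat" where
  "euclidean_size w = nat \<bar>nrm w\<bar>"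

text \<open>The normal form of an element is its associate in the fundamental domain. The predicate
  \<open>prime\<close> then selects exactly one generator of each nonzero prime ideal, and this
  generator is totally positive.\<close>

definition normalize_zsqrt2 :: "zsqrt2 \<Rightarrow> zsqrt2" where
  "normalize w = (if w = 0 then 0 else THE z. canonical z \<and> z dvd w \<and> w dvd z)"

definition unit_factor_zsqrt2 :: "zsqrt2 \<Rightarrow> zsqrt2" where
  "unit_factor (w::zsqrt2) = w div normalize w"

lemma normalize_zsqrt2_eqI:
  assumes "w \<noteq> 0" "canonical z" "z dvd w" "w dvd z" shows "normalize w = z"
proof -
  have "(THE z. canonical z \<and> z dvd w \<and> w dvd z) = z"
    using assms by (intro the_equality) (auto intro!: canonical_associated_eq intro: dvd_trans)
  thus ?thesis using assms by (simp add: normalize_zsqrt2_def)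
qed

lemma normalize_zsqrt2_props:
  assumes "w \<noteq> (0::zsqrt2)"
  shows "canonical (normalize w)" "normalize w dvd w" "w dvd normalize w"
  using canonical_associate_exists[OF assms] normalize_zsqrt2_eqI[OF assms] by blast+

instance
proof
  show "euclidean_size (0::zsqrt2) = 0" by (simp add: euclidean_size_zsqrt2_def)
  show "normalize (0::zsqrt2) = 0" by (simp add: normalize_zsqrt2_def)
  show "unit_factor (0::zsqrt2) = 0" by (simp add: normalize_zsqrt2_def unit_factor_zsqrt2_def)
next
  fix a b :: zsqrt2 assume b: "b \<noteq> 0"
  show "euclidean_size (a mod b) < euclidean_size b"
    using nrm_mod_less[OF b, of a] by (simp add: euclidean_size_zsqrt2_def)
  have "\<bar>nrm b\<bar> \<ge> 1" using b nrm_eq_0_iff[of b] by linarith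
  hence "\<bar>nrm a\<bar> * 1 \<le> \<bar>nrm a\<bar> * \<bar>nrm b\<bar>" by (intro mult_left_mono) auto
  thus "euclidean_size a \<le> euclidean_size (a * b)"
    by (simp add: euclidean_size_zsqrt2_def nrm_mult abs_mult)
next
  fix a b :: zsqrt2
  show "unit_factor a * normalize a = a"
  proof (cases "a = 0")
    case False
    thus ?thesis using normalize_zsqrt2_props[OF False]
      by (simp add: unit_factor_zsqrt2_def)
  qed (simp add: normalize_zsqrt2_def unit_factor_zsqrt2_def)
  {
    assume a: "a \<noteq> 0"
    have "normalize a * unit_factor a = a"
      using normalize_zsqrt2_props[OF a] by (simp add: unit_factor_zsqrt2_def)
    hence "normalize a * unit_factor a dvd normalize a * 1"
      using normalize_zsqrt2_props[OF a] by simp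
    thus "unit_factor a dvd 1" using canonical_nonzero normalize_zsqrt2_props(1)[OF a] dvd_times_left_cancel_iff by blast
  }
  assume u: "a dvd 1"
  hence a: "a \<noteq> 0" by auto
  have "canonical 1" by (simp add: canonical_def)
  hence "normalize a = 1" using a u by (intro normalize_zsqrt2_eqI) auto
  thus "unit_factor a = a" by (simp add: unit_factor_zsqrt2_def)
  show "unit_factor (a * b) = a * unit_factor b"
  proof (cases "b = 0")
    case True
    thus ?thesis by (simp add: normalize_zsqrt2_def unit_factor_zsqrt2_def)
  next
    case False
    note n = normalize_zsqrt2_props[OF False]
    have "normalize (a * b) = normalize b"
      using a False u n by (intro normalize_zsqrt2_eqI) (auto simp: mult_unit_dvd_iff')
    thus ?thesis using n by (simp add: unit_factor_zsqrt2_def div_mult_swap)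
  qed
qed

end

lemma canonical_normalize: "w \<noteq> (0::zsqrt2) \<Longrightarrow> canonical (normalize w)"
  by (rule normalize_zsqrt2_props)

lemma normalize_canonical: "canonical w \<Longrightarrow> normalize w = w"
  using normalize_zsqrt2_eqI[of w w] canonical_nonzero[of w] by simp

lemma nrm_normalize: "\<bar>nrm (normalize w)\<bar> = \<bar>nrm (w::zsqrt2)\<bar>"
  using euclidean_size_normalize[of w] unfolding euclidean_size_zsqrt2_def by simp

text \<open>Reduction to the domain only multiplies by \<epsilon>^2 and its inverse, so a function
  blind to \<epsilon>^2 depends on the ideal alone.\<close>

lemma totally_positive_invariant:
  assumes "totally_positive w" and inv: "\<And>v. totally_positive v \<Longrightarrow> f (unit_sq * v) = f v"
  shows "f (normalize w) = f w"
  using assms(1)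
proof (induction w rule: totally_positive_induct)
  case (canonical w) thus ?case by (simp add: normalize_canonical)
next
  case (up w)
  have "unit_sq dvd 1" using unit_sq_mult_inv(1) by (metis dvd_triv_left)
  hence "normalize (unit_sq * w) = normalize w" by (simp add: normalize_mult_unit_left)
  thus ?case using up inv by simp
next
  case (down w)
  have "unit_sq_inv dvd 1" using unit_sq_mult_inv(2) by (metis dvd_triv_left)
  hence "normalize (unit_sq_inv * w) = normalize w" by (simp add: normalize_mult_unit_left)
  moreover have "f (unit_sq * (unit_sq_inv * w)) = f (unit_sq_inv * w)"
    using down by (intro inv totally_positive_mult) auto
  ultimately show ?case using down by (simp add: mult.assoc[symmetric] unit_sq_mult_inv)
qed

section \<open>Spin and reciprocity\<close>

lemma square_cancel: "(x::int) * x = 1 \<Longrightarrow> x * (x * y) = y"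
  by (simp add: mult.assoc[symmetric])

section \<open>The reciprocity formula for the spin of a product\<close>

text \<open>Here (a + b sqrt 2)(c + d sqrt 2) = u + v sqrt 2. The identity a v - d N = b u gives v =
  d N / a modulo u, so the symbol splits into (a / u), (d / u) and (N / u). Reciprocity flips these,
  and u = 2 b d modulo a, u = a c modulo d' leave symbols with moduli a, d' and N. The sign and the
  power of 2 in d are kept abstract as \<open>\<delta>\<close>.\<close>

lemma Jacobi_product_coprime:
  fixes a b c d d' \<delta> :: int
  defines "u \<equiv> a * c + 2 * b * d" and "v \<equiv> a * d + b * c" and "N \<equiv> a\<^sup>2 - 2 * b\<^sup>2"
  assumes pos: "a > 0" "odd a" "odd c" "u > 0" "N > 0" "d' > 0" "odd d'"
    and d: "d = \<delta> * d'" and \<delta>: "\<And>m. odd m \<Longrightarrow> coprime \<delta> m"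
    and cop: "coprime a b" "coprime c d"
  shows "Jacobi v u = Jacobi (2 * b) a * Jacobi c d' * Jacobi u N * (Jacobi \<delta> u * Jacobi \<delta> a) *
           (rsign a u * rsign d' u * rsign a d' * rsign N u)"
proof -
  \<comment> \<open>Inverting a modulo u fails exactly at the common factors of a and d'. These
    divide u as well, so \<open>g\<close> is split off from u and the two moduli are treated
    apart.\<close>
  define g where "g = gcd a d'"
  have "a \<noteq> 0" using pos by simp
  then obtain a1 d1 where ad: "a = g * a1" "d' = g * d1" "coprime a1 d1"
    using gcd_coprime_exists[of a d'] unfolding g_def by (metis gcd_eq_0_iff mult.commute)
  have g0: "g > 0" using \<open>a \<noteq> 0\<close> by (simp add: g_def)
  have odd: "odd g" "odd a1" "odd d1" using pos ad by auto
  have a1: "a1 > 0" using pos(1) ad(1) g0 by (simp add: zero_less_mult_iff)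
  have d1: "d1 > 0" using pos(6) ad(2) g0 by (simp add: zero_less_mult_iff)
  define u1 where "u1 = a1 * c + 2 * b * \<delta> * d1"
  have uu: "u = g * u1" unfolding u_def u1_def d ad(1,2) by (simp add: algebra_simps)
  have u1: "u1 > 0" using pos(4) uu g0 by (simp add: zero_less_mult_iff)
  have oddu1: "odd u1" using odd pos by (simp add: u1_def)
  have oddN: "odd N" using pos by (simp add: N_def)
  have ga: "coprime g b" "coprime a1 b" using cop(1) ad(1) by simp_all
  have gc: "coprime c g" "coprime c d1" using cop(2) unfolding d ad(2) by simp_all
  have c2: "coprime g 2" "coprime a1 2" using odd by simp_all
  have ca: "coprime a1 u1"
  proof -
    have "coprime a1 (2 * b * \<delta> * d1)"
      using c2 ga ad(3) \<delta>[OF odd(2)] by (simp add: coprime_commute)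
    thus ?thesis unfolding u1_def by (metis coprime_iff_gcd_eq_1 gcd_add_mult mult.commute add.commute)
  qed
  have "Jacobi u1 a1 = Jacobi (2 * b * \<delta> * d1) a1"
    by (rule Jacobi_cong) (simp add: u1_def cong_iff_dvd_diff)
  hence E4: "Jacobi a1 u1 = rsign a1 u1 * (Jacobi (2 * b) a1 * Jacobi \<delta> a1 * Jacobi d1 a1)"
    using Jacobi_reciprocity[of a1 u1] odd a1 u1 oddu1 by (simp add: Jacobi_mult_left)
  have "Jacobi u1 d1 = Jacobi (a1 * c) d1"
    by (rule Jacobi_cong) (simp add: u1_def cong_iff_dvd_diff)
  hence E5: "Jacobi d1 u1 = rsign d1 u1 * (Jacobi a1 d1 * Jacobi c d1)"
    using Jacobi_reciprocity[of d1 u1] odd d1 u1 oddu1 by (simp add: Jacobi_mult_left)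
  have E6: "Jacobi d1 a1 = rsign a1 d1 * Jacobi a1 d1"
    using Jacobi_reciprocity[of d1 a1] odd a1 d1 by (simp add: rsign_commute)
  have s1: "Jacobi a1 d1 * Jacobi a1 d1 = 1" using ad(3) d1 by (simp add: Jacobi_square)
  have s2: "Jacobi a1 u1 * Jacobi a1 u1 = 1" using ca u1 by (simp add: Jacobi_square)
  have E1: "Jacobi v u = Jacobi v g * Jacobi v u1" unfolding uu using g0 u1 by (simp add: Jacobi_mult_right)
  have "Jacobi v g = Jacobi (b * c) g"
    by (rule Jacobi_cong) (simp add: v_def ad(1) cong_iff_dvd_diff)
  hence E2: "Jacobi v g = Jacobi b g * Jacobi c g" using odd by (simp add: Jacobi_mult_left)
  \<comment> \<open>The identity a v - d N = b u after division by \<open>g\<close>; now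
    \<open>a1\<close> is invertible modulo \<open>u1\<close>.\<close>
  have "a1 * v - \<delta> * d1 * N = b * u1"
    unfolding v_def N_def u1_def d ad(1,2) by (simp add: power2_eq_square algebra_simps)
  hence "[a1 * v = \<delta> * d1 * N] (mod u1)" by (simp add: cong_iff_dvd_diff)
  hence "Jacobi (a1 * v) u1 = Jacobi (\<delta> * d1 * N) u1" by (rule Jacobi_cong)
  hence "Jacobi a1 u1 * Jacobi v u1 = Jacobi \<delta> u1 * Jacobi d1 u1 * Jacobi N u1"
    using oddu1 by (simp add: Jacobi_mult_left)
  hence "Jacobi a1 u1 * (Jacobi a1 u1 * Jacobi v u1) =
      Jacobi a1 u1 * (Jacobi \<delta> u1 * Jacobi d1 u1 * Jacobi N u1)" by simp
  hence E3: "Jacobi v u1 = Jacobi a1 u1 * (Jacobi \<delta> u1 * Jacobi d1 u1 * Jacobi N u1)"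
    using square_cancel[OF s2] by simp
  have E7: "Jacobi N u1 = rsign N u1 * Jacobi u1 N"
    using Jacobi_reciprocity[of N u1] oddN pos u1 oddu1 by simp
  \<comment> \<open>Modulo \<open>g\<close> the norm is -2 b^2, which evaluates the contribution of
    \<open>g\<close> to (u / N).\<close>
  have "Jacobi N g = Jacobi (-1 * 2 * b\<^sup>2) g"
    by (rule Jacobi_cong) (simp add: N_def ad(1) cong_iff_dvd_diff power_mult_distrib power2_eq_square)
  also have "\<dots> = msign g * Jacobi 2 g"
    using odd g0 ga Jacobi_power2_left[of g b] Jacobi_minus_1[of g] Jacobi_mult_left[of g "-1 * 2" "b\<^sup>2"]
      Jacobi_mult_left[of g "-1" 2] by (simp add: coprime_commute)
  finally have E8: "Jacobi g N = rsign g N * (msign g * Jacobi 2 g)"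
    using Jacobi_reciprocity[of g N] odd g0 oddN pos by simp
  have E9: "Jacobi u N = Jacobi g N * Jacobi u1 N" unfolding uu using oddN by (simp add: Jacobi_mult_left)
  have R1: "Jacobi (2 * b) a = Jacobi 2 g * Jacobi b g * Jacobi (2 * b) a1"
    unfolding ad(1) using g0 a1 odd by (simp add: Jacobi_mult_right Jacobi_mult_left)
  have R2: "Jacobi c d' = Jacobi c g * Jacobi c d1"
    unfolding ad(2) using g0 d1 by (simp add: Jacobi_mult_right)
  have R3: "Jacobi \<delta> u = Jacobi \<delta> g * Jacobi \<delta> u1" "Jacobi \<delta> a = Jacobi \<delta> g * Jacobi \<delta> a1"
    unfolding uu ad(1) using g0 u1 a1 by (simp_all add: Jacobi_mult_right)
  \<comment> \<open>Each sign is expanded over the factors of a, d' and u; the surplus signs and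
    symbols cancel in pairs because they square to 1.\<close>
  have P1: "rsign a u = msign g * rsign g u1 * (rsign g a1 * rsign a1 u1)"
    unfolding uu ad(1) using odd oddu1
    by (simp add: rsign_mult_left rsign_mult_right rsign_self rsign_commute[of a1 g] rsign_commute[of u1 g])
  have P2: "rsign d' u = msign g * rsign g u1 * (rsign g d1 * rsign d1 u1)"
    unfolding uu ad(2) using odd oddu1
    by (simp add: rsign_mult_left rsign_mult_right rsign_self rsign_commute[of d1 g] rsign_commute[of u1 g])
  have P3: "rsign a d' = msign g * rsign g d1 * (rsign g a1 * rsign a1 d1)"
    unfolding ad(1,2) using odd
    by (simp add: rsign_mult_left rsign_mult_right rsign_self rsign_commute[of a1 g] rsign_commute[of d1 g])
  have P4: "rsign N u = rsign g N * rsign N u1"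
    unfolding uu using odd oddu1 by (simp add: rsign_mult_right rsign_commute[of N g])
  have sq: "Jacobi 2 g * Jacobi 2 g = 1" "Jacobi \<delta> g * Jacobi \<delta> g = 1"
    using c2 g0 \<delta>[OF odd(1)] by (simp_all add: Jacobi_square coprime_commute)
  note sqs = sq s1 rsign_sq msign_sq
  show ?thesis
    unfolding E1 E2 E3 E4 E5 E6 E7 E9 E8 R1 R2 R3 P1 P2 P3 P4
    by (simp add: mult_ac sqs sqs[THEN square_cancel])
qed

lemma not_coprime_odd_obtain:
  assumes "\<not> coprime (a::int) b" "odd a"
  obtains h where "h dvd a" "h dvd b" "\<not> is_unit h" "odd h"
  using assms by (meson coprimeI dvd_trans)

text \<open>An odd common divisor of a and b, or of c and d, divides both u and v. Then both sides
  vanish, which leaves the coprime case.\<close>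

lemma Jacobi_product:
  fixes a b c d d' \<delta> :: int
  defines "u \<equiv> a * c + 2 * b * d" and "v \<equiv> a * d + b * c" and "N \<equiv> a\<^sup>2 - 2 * b\<^sup>2"
  assumes pos: "a > 0" "odd a" "odd c" "u > 0" "N > 0" "d' > 0" "odd d'"
    and d: "d = \<delta> * d'" and \<delta>: "\<And>m. odd m \<Longrightarrow> coprime \<delta> m"
  shows "Jacobi v u = Jacobi (2 * b) a * Jacobi c d' * Jacobi u N * (Jacobi \<delta> u * Jacobi \<delta> a) *
           (rsign a u * rsign d' u * rsign a d' * rsign N u)"
proof -
  consider "coprime a b" "coprime c d" | "\<not> coprime a b" | "\<not> coprime c d" by blast
  thus ?thesis
  proof cases
    case 1
    thus ?thesis unfolding u_def v_def N_def
      using pos d \<delta> by (intro Jacobi_product_coprime) (auto simp: u_def N_def)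
  next
    case 2
    then obtain h where h: "h dvd a" "h dvd b" "\<not> is_unit h" "odd h"
      using not_coprime_odd_obtain pos(2) by blast
    have "\<not> coprime v u" using h by (intro not_coprimeI[of h]) (auto simp: u_def v_def)
    moreover have "\<not> coprime (2 * b) a" using h by (intro not_coprimeI[of h]) auto
    ultimately have "Jacobi v u = 0" "Jacobi (2 * b) a = 0"
      using Jacobi_eq_0_iff[of u v] Jacobi_eq_0_iff[of a "2 * b"] pos by simp_all
    thus ?thesis by simp
  next
    case 3
    then obtain h where h: "h dvd c" "h dvd d" "\<not> is_unit h" "odd h"
      using not_coprime_odd_obtain pos(3) by blast
    have "\<not> coprime v u" using h by (intro not_coprimeI[of h]) (auto simp: u_def v_def)
    moreover have "h dvd d'"
      using h(2) \<delta>[OF h(4)] unfolding d by (simp add: coprime_commute coprime_dvd_mult_right_iff)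
    hence "\<not> coprime c d'" using h by (intro not_coprimeI[of h]) auto
    ultimately have "Jacobi v u = 0" "Jacobi c d' = 0"
      using Jacobi_eq_0_iff[of u v] Jacobi_eq_0_iff[of d' c] pos by simp_all
    thus ?thesis by simp
  qed
qed

text \<open>The odd part is positive, so it can serve as the modulus of a symbol; the sign and the
  power of 2 go into \<open>even_part\<close>.\<close>

definition odd_part :: "int \<Rightarrow> int" where
  "odd_part d = \<bar>d\<bar> div 2 ^ multiplicity 2 d"

definition even_part :: "int \<Rightarrow> int" where
  "even_part d = sgn d * 2 ^ multiplicity 2 d"

lemma odd_part_props:
  assumes "d \<noteq> 0"
  shows "odd (odd_part d)" "odd_part d > 0" "d = even_part d * odd_part d"
proof -
  have dv: "2 ^ multiplicity 2 d dvd \<bar>d\<bar>" by (simp add: multiplicity_dvd)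
  hence e: "\<bar>d\<bar> = 2 ^ multiplicity 2 d * odd_part d" by (simp add: odd_part_def)
  show "odd_part d > 0" using e assms by (metis zero_less_abs_iff zero_less_mult_pos zero_less_numeral zero_less_power)
  show "d = even_part d * odd_part d"
    using e unfolding even_part_def by (metis mult.assoc mult.commute mult_sgn_abs sgn_mult_abs)
  have "multiplicity 2 \<bar>d\<bar> = multiplicity 2 d" by (rule multiplicity_cong) auto
  hence "\<not> 2 dvd \<bar>d\<bar> div 2 ^ multiplicity 2 d"
    using multiplicity_decompose[of "\<bar>d\<bar>" 2] assms by simp
  thus "odd (odd_part d)" by (simp add: odd_part_def)
qed

lemma even_part_coprime:
  assumes "d \<noteq> 0" "odd m" shows "coprime (even_part d) m"
  using assms by (auto simp: even_part_def sgn_if)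

lemma Jacobi_even_part:
  assumes "d \<noteq> 0" "odd m" "m > 0"
  shows "Jacobi (even_part d) m =
    (if d < 0 then msign m else 1) * (if even (multiplicity 2 d) then 1 else tsign m)"
proof -
  have "tsign m ^ k = (if even k then 1 else tsign m)" for k
    by (induction k) (auto simp: tsign_sq)
  thus ?thesis
    using assms Jacobi_minus_1[of m] Jacobi_2[of m] Jacobi_mult_left[of m "-1" "2 ^ multiplicity 2 d"]
    by (auto simp: even_part_def sgn_if Jacobi_power_left)
qed

definition class_left :: "zsqrt2 \<Rightarrow> int \<times> int" where
  "class_left w = (rat_part w mod 16, sqrt_part w mod 16)"

text \<open>The finite data of the right factor that determine the reciprocity signs: residues
  modulo 16, the sign and the parity of the 2-adic valuation, which together determine the symbol of
  \<open>even_part\<close>, and the odd part modulo 4 for \<open>rsign\<close>.\<close>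

definition class_right :: "zsqrt2 \<Rightarrow> int \<times> int \<times> bool \<times> bool \<times> int" where
  "class_right z = (rat_part z mod 16, sqrt_part z mod 16, sqrt_part z < 0,
     even (multiplicity 2 (sqrt_part z)), odd_part (sqrt_part z) mod 4)"

text \<open>The sign factors of \<open>Jacobi_product\<close>, recomputed from class representatives
  and listed in the same order. They depend on the pair through finitely many classes only.\<close>

definition class_sign :: "int \<times> int \<Rightarrow> int \<times> int \<times> bool \<times> bool \<times> int \<Rightarrow> int" where
  "class_sign = (\<lambda>(a, b) (c, d, neg, ev, o'). let u = a * c + 2 * b * d in
     ((if neg then msign u else 1) * (if ev then 1 else tsign u) *
      ((if neg then msign a else 1) * (if ev then 1 else tsign a))) *
     (rsign a u * rsign o' u * rsign a o' * rsign (a\<^sup>2 - 2 * b\<^sup>2) u))"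

text \<open>When b is coprime to N = a^2 - 2 b^2, the number r = a / b is a square root of 2 modulo
  N, and b (a d + b c) = b^2 (c + d r). So this is the symbol modulo N of the image of z under sqrt
  2 -> r, that is, the quadratic residue symbol of z modulo the conjugate of w.\<close>

definition chi :: "zsqrt2 \<Rightarrow> zsqrt2 \<Rightarrow> int" where
  "chi w z = Jacobi (sqrt_part w * sqrt_part (w * z)) (nrm w)"

lemma sign_mod_cong:
  "m mod 16 = m' mod 16 \<Longrightarrow> msign m = msign m'"
  "m mod 16 = m' mod 16 \<Longrightarrow> tsign m = tsign m'"
  "m mod 4 = m' mod 4 \<Longrightarrow> n mod 4 = n' mod 4 \<Longrightarrow> rsign m n = rsign m' n'"
proof -
  have "m mod 16 mod 4 = m mod 4" "m mod 16 mod 8 = m mod 8" for m :: int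
    by (simp_all add: mod_mod_cancel)
  thus "m mod 16 = m' mod 16 \<Longrightarrow> msign m = msign m'"
    "m mod 16 = m' mod 16 \<Longrightarrow> tsign m = tsign m'"
    unfolding msign_def tsign_def by metis+
qed (simp add: rsign_def)

lemma abs_class_sign: "\<bar>class_sign \<kappa> \<mu>\<bar> \<le> 1"
proof -
  have "\<bar>msign x\<bar> = 1" "\<bar>tsign x\<bar> = 1" "\<bar>rsign x y\<bar> = 1" for x y
    by (simp_all add: msign_def tsign_def rsign_def)
  moreover obtain a b c d neg ev o' where "\<kappa> = (a, b)" "\<mu> = (c, d, neg, ev, o')"
    by (cases \<kappa>; cases \<mu>)
  ultimately show ?thesis
    by (cases neg; cases ev) (simp_all add: class_sign_def Let_def abs_mult)
qed

lemma mod_16_cong: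
  assumes "x mod 16 = x' mod 16" "y mod 16 = y' mod (16::int)"
  shows "(x * y) mod 16 = (x' * y') mod 16" "(x + y) mod 16 = (x' + y') mod 16"
    "(x - y) mod 16 = (x' - y') mod 16"
  using assms by (metis mod_mult_eq, metis mod_add_eq, metis mod_diff_eq)

lemma mod_16_imp_mod_4: "x mod 16 = y mod (16::int) \<Longrightarrow> x mod 4 = y mod 4"
proof -
  have "m mod 16 mod 4 = m mod 4" for m :: int by (simp add: mod_mod_cancel)
  thus "x mod 16 = y mod (16::int) \<Longrightarrow> x mod 4 = y mod 4" by metis
qed

text \<open>\<open>Jacobi_product\<close> leaves (u / N), which mixes the two factors. Modulo N one
  has a b v = b^2 u, so it equals (a / N) times \<open>chi w z\<close>; every other factor depends
  on w alone, on z alone or on the classes.\<close>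

lemma spin_mult:
  assumes w: "totally_positive w" and z: "totally_positive z"
    and o: "odd (rat_part w)" "odd (rat_part z)" and nz: "sqrt_part z \<noteq> 0"
  shows "spin (w * z) = class_sign (class_left w) (class_right z) *
     (Jacobi (2 * sqrt_part w) (rat_part w) * Jacobi (rat_part w) (nrm w)) *
     Jacobi (rat_part z) (odd_part (sqrt_part z)) * chi w z"
proof -
  define a b c d where "a = rat_part w" and "b = sqrt_part w" and "c = rat_part z" and "d = sqrt_part z"
  define u v N d' \<delta> where "u = a * c + 2 * b * d" and "v = a * d + b * c" and "N = a\<^sup>2 - 2 * b\<^sup>2"
    and "d' = odd_part d" and "\<delta> = even_part d"
  have d0: "d \<noteq> 0" using nz by (simp add: d_def)
  have u: "u > 0" "odd u" using totally_positive_mult[OF w z] o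
    by (auto simp: totally_positive_def u_def a_def b_def c_def d_def)
  have N: "N > 0" "nrm w = N" "odd N" using w o
    by (auto simp: totally_positive_nrm nrm_def N_def a_def b_def)
  have a: "a > 0" "odd a" "odd c" using w o by (auto simp: totally_positive_def a_def c_def)
  have d': "odd d'" "d' > 0" "d = \<delta> * d'" using odd_part_props[OF d0] by (auto simp: d'_def \<delta>_def)
  have J: "Jacobi v u = Jacobi (2 * b) a * Jacobi c d' * Jacobi u N * (Jacobi \<delta> u * Jacobi \<delta> a) *
           (rsign a u * rsign d' u * rsign a d' * rsign N u)"
    unfolding u_def v_def N_def
    by (rule Jacobi_product) (use a d' u N even_part_coprime[OF d0] in \<open>auto simp: u_def N_def \<delta>_def\<close>)
  have sgn: "class_sign (class_left w) (class_right z) =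
    (Jacobi \<delta> u * Jacobi \<delta> a) * (rsign a u * rsign d' u * rsign a d' * rsign N u)"
  proof -
    define u' N' where "u' = (a mod 16) * (c mod 16) + 2 * (b mod 16) * (d mod 16)"
      and "N' = (a mod 16)\<^sup>2 - 2 * (b mod 16)\<^sup>2"
    have c1: "u' mod 16 = u mod 16" "N' mod 16 = N mod 16"
      unfolding u'_def u_def N'_def N_def power2_eq_square by (intro mod_16_cong; simp)+
    have c3: "(a mod 16) mod 16 = a mod 16" by simp
    have c2: "u' mod 4 = u mod 4" "N' mod 4 = N mod 4" "(a mod 16) mod 4 = a mod 4"
      "(d' mod 4) mod 4 = d' mod 4"
      using c1 c3 by (auto intro: mod_16_imp_mod_4)
    have "class_sign (class_left w) (class_right z) =
       ((if d < 0 then msign u' else 1) * (if even (multiplicity 2 d) then 1 else tsign u') *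
      ((if d < 0 then msign (a mod 16) else 1) * (if even (multiplicity 2 d) then 1 else tsign (a mod 16)))) *
     (rsign (a mod 16) u' * rsign (d' mod 4) u' * rsign (a mod 16) (d' mod 4) * rsign N' u')"
      by (simp add: class_sign_def class_left_def class_right_def Let_def u'_def N'_def a_def b_def
          c_def d_def d'_def)
    also have "\<dots> = ((if d < 0 then msign u else 1) * (if even (multiplicity 2 d) then 1 else tsign u) *
      ((if d < 0 then msign a else 1) * (if even (multiplicity 2 d) then 1 else tsign a))) *
     (rsign a u * rsign d' u * rsign a d' * rsign N u)"
      using sign_mod_cong(1,2)[OF c1(1)] sign_mod_cong(1,2)[OF c3]
        sign_mod_cong(3)[OF c2(3) c2(1)] sign_mod_cong(3)[OF c2(4) c2(1)]
        sign_mod_cong(3)[OF c2(3) c2(4)] sign_mod_cong(3)[OF c2(2) c2(1)] by simp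
    also have "\<dots> = (Jacobi \<delta> u * Jacobi \<delta> a) * (rsign a u * rsign d' u * rsign a d' * rsign N u)"
      using Jacobi_even_part[OF d0] u a by (simp add: \<delta>_def)
    finally show ?thesis .
  qed
  \<comment> \<open>If a and b have a common factor, both sides contain the vanishing symbol (2 b /
    a), so b may be assumed invertible modulo N.\<close>
  have F: "Jacobi (2 * b) a * Jacobi u N = Jacobi (2 * b) a * Jacobi a N * chi w z"
  proof (cases "coprime a b")
    case False
    hence "\<not> coprime (2 * b) a" using coprime_commute by auto
    hence "Jacobi (2 * b) a = 0" using a Jacobi_eq_0_iff[of a "2 * b"] by simp
    thus ?thesis by simp
  next
    case True
    have "coprime b N"
    proof -
      have "coprime b (a\<^sup>2)" using True by (simp add: coprime_commute)
      moreover have "gcd b (a\<^sup>2) = gcd b N"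
        using gcd_add_mult[of b "- 2 * b" "a\<^sup>2"] by (simp add: N_def power2_eq_square mult.assoc)
      ultimately show ?thesis by (simp add: coprime_iff_gcd_eq_1)
    qed
    have "a * (b * v) - b\<^sup>2 * u = b * d * N"
      by (simp add: u_def v_def N_def power2_eq_square algebra_simps)
    hence "[a * (b * v) = b\<^sup>2 * u] (mod N)" by (simp add: cong_iff_dvd_diff)
    hence "Jacobi (a * (b * v)) N = Jacobi (b\<^sup>2 * u) N" by (rule Jacobi_cong)
    hence "Jacobi a N * Jacobi (b * v) N = Jacobi u N"
      using N Jacobi_power2_left[OF N(3) \<open>coprime b N\<close>] by (simp add: Jacobi_mult_left)
    moreover have "chi w z = Jacobi (b * v) N"
      by (simp add: chi_def N v_def a_def b_def c_def d_def)
    ultimately show ?thesis by simp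
  qed
  have "spin (w * z) = Jacobi v u"
    using u by (simp add: spin_def u_def v_def a_def b_def c_def d_def)
  also have "\<dots> = (Jacobi (2 * b) a * Jacobi u N) * Jacobi c d' *
      ((Jacobi \<delta> u * Jacobi \<delta> a) * (rsign a u * rsign d' u * rsign a d' * rsign N u))"
    unfolding J by (simp add: mult_ac)
  also have "\<dots> = class_sign (class_left w) (class_right z) *
     (Jacobi (2 * b) a * Jacobi a N) * Jacobi c d' * chi w z"
    unfolding F sgn[symmetric] by (simp add: mult_ac)
  finally show ?thesis by (simp add: a_def b_def c_def d'_def d_def N(2))
qed

text \<open>Modulo the norm of w, the argument of the symbol is b^2 times a ring homomorphism in z,
  and b^2 has symbol 1 when b is coprime to the norm.\<close>

lemma chi_mult:
  assumes "odd (rat_part w)" and cop: "coprime (sqrt_part w) (nrm w)"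
  shows "chi w (y * z) = chi w y * chi w z" and "chi w 1 = 1"
proof -
  define a b N where "a = rat_part w" and "b = sqrt_part w" and "N = nrm w"
  have oN: "odd N" using assms by (simp add: N_def nrm_def)
  have "(b * sqrt_part (w * y)) * (b * sqrt_part (w * z)) - b\<^sup>2 * (sqrt_part w * sqrt_part (w * (y * z)))
      = b\<^sup>2 * sqrt_part y * sqrt_part z * N"
    by (simp add: a_def b_def N_def nrm_def power2_eq_square algebra_simps)
  hence "[(b * sqrt_part (w * y)) * (b * sqrt_part (w * z)) = b\<^sup>2 * (sqrt_part w * sqrt_part (w * (y * z)))] (mod N)"
    by (simp add: cong_iff_dvd_diff)
  hence "Jacobi ((b * sqrt_part (w * y)) * (b * sqrt_part (w * z))) N
     = Jacobi (b\<^sup>2 * (sqrt_part w * sqrt_part (w * (y * z)))) N" by (rule Jacobi_cong)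
  hence e: "chi w y * chi w z = Jacobi (b\<^sup>2) N * chi w (y * z)"
    unfolding chi_def using oN by (simp add: Jacobi_mult_left b_def N_def)
  have J1: "Jacobi (b\<^sup>2) N = 1" using cop Jacobi_power2_left[OF oN] by (simp add: b_def N_def)
  show "chi w (y * z) = chi w y * chi w z" using e J1 by simp
  show "chi w 1 = 1" using J1 by (simp add: chi_def b_def N_def power2_eq_square)
qed

lemma abs_chi_le: "\<bar>chi w z\<bar> \<le> 1"
  by (simp add: chi_def abs_Jacobi_le)

section \<open>Characters modulo 16 and invariance under units\<close>

context
  fixes \<phi> :: "int \<Rightarrow> complex" assumes dc: "dirichlet_char 16 \<phi>"
begin

lemma dirichlet_char_mult: "\<phi> (a * b) = \<phi> a * \<phi> b"
  using dc by (simp add: dirichlet_char_def)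

lemma dirichlet_char_periodic: "\<phi> (a + 16 * k) = \<phi> a"
proof -
  have 1: "\<phi> (a + 16 * int n) = \<phi> a" for a n
  proof (induction n)
    case (Suc n)
    have "\<phi> (a + 16 * int (Suc n)) = \<phi> ((a + 16 * int n) + 16)" by (simp add: algebra_simps)
    also have "\<dots> = \<phi> a" using dc Suc by (simp add: dirichlet_char_def)
    finally show ?case .
  qed auto
  show ?thesis
  proof (cases "k \<ge> 0")
    case True thus ?thesis using 1[of a "nat k"] by simp
  next
    case False thus ?thesis using 1[of "a + 16 * k" "nat (- k)"] by simp
  qed
qed

lemma dirichlet_char_cong: "a mod 16 = b mod 16 \<Longrightarrow> \<phi> a = \<phi> b"
proof -
  have "\<phi> a = \<phi> (a mod 16)" for a
    using dirichlet_char_periodic[of "a mod 16" "a div 16"] by (simp only: mod_mult_div_eq)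
  thus "a mod 16 = b mod 16 \<Longrightarrow> \<phi> a = \<phi> b" by metis
qed

text \<open>The fourth power of an odd number is 1 modulo 16, so the nonzero values are fourth roots
  of unity.\<close>

lemma norm_dirichlet_char_le: "cmod (\<phi> a) \<le> 1"
proof (cases "\<phi> a = 0")
  case False
  have "\<phi> 1 * \<phi> 1 = \<phi> 1" using dirichlet_char_mult[of 1 1] by simp
  moreover have "\<phi> 1 \<noteq> 0" using dc by (simp add: dirichlet_char_def)
  ultimately have one: "\<phi> 1 = 1" by simp
  have "coprime a 16" using False dc by (simp add: dirichlet_char_def)
  hence "odd a" using not_coprimeI[of 2 a 16] by auto
  then obtain k where k: "a = 2 * k + 1" by (auto elim: oddE)
  have "even (k * (k + 1))" by simp
  then obtain j where j: "k * (k + 1) = 2 * j" by (rule evenE)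
  have "a ^ 4 = (4 * (k * (k + 1)) + 1)\<^sup>2" unfolding k by (simp add: power2_eq_square eval_nat_numeral algebra_simps)
  also have "\<dots> = 1 + 16 * (4 * j\<^sup>2 + j)" unfolding j by (simp add: power2_eq_square algebra_simps)
  finally have "\<phi> (a ^ 4) = \<phi> 1" using dirichlet_char_periodic[of 1] by metis
  moreover have "\<phi> (a ^ k) = \<phi> a ^ k" for k
    by (induction k) (simp_all add: one dirichlet_char_mult)
  ultimately have "\<phi> a ^ 4 = 1" using one by metis
  from power_eq_1_iff[OF this] show ?thesis by simp
qed auto

end

lemma spin_eq_0:
  assumes "g > 1" "g dvd rat_part w" "g dvd sqrt_part w" "rat_part w > 0"
  shows "spin w = 0"
proof -
  have "\<not> coprime (sqrt_part w) (rat_part w)" using assms by (intro not_coprimeI[of g]) auto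
  thus ?thesis using assms Jacobi_eq_0_iff by (simp add: spin_def)
qed

text \<open>Multiplication by the eighth power of the fundamental unit, \<open>577 + 408 \<surd>2\<close>, is the
  case of norm one in the reciprocity formula, where the mixed symbol disappears.\<close>

lemma spin_unit_invariant:
  assumes w: "totally_positive w" shows "spin (ZSqrt2 577 408 * w) = spin w"
proof -
  define c d where "c = rat_part w" and "d = sqrt_part w"
  define u v where "u = 577 * c + 2 * 408 * d" and "v = 577 * d + 408 * c"
  have e: "rat_part (ZSqrt2 577 408 * w) = u" "sqrt_part (ZSqrt2 577 408 * w) = v"
    by (simp_all add: u_def v_def c_def d_def)
  have "totally_positive (ZSqrt2 577 408)" by (simp add: totally_positive_def)
  hence u: "u > 0" using totally_positive_mult[OF _ w] e by (metis totally_positive_def)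
  have c: "c > 0" using w by (simp add: c_def totally_positive_def)
  \<comment> \<open>Since 577 = 1 and 816 = 0 modulo 16, the rational part keeps its residue, and
    with it every sign in the reciprocity formula.\<close>
  have um: "u mod 16 = c mod 16"
  proof -
    have "u - c = 16 * (36 * c + 51 * d)" by (simp add: u_def)
    thus ?thesis by (metis mod_eq_dvd_iff dvd_triv_left)
  qed
  have par: "odd u \<longleftrightarrow> odd c" by (simp add: u_def)
  show ?thesis
  proof (cases "odd c")
    case False
    thus ?thesis using par by (simp add: spin_def e c_def[symmetric] del: zsqrt2_sel)
  next
    case o: True
    \<comment> \<open>This evaluates (816 / 577) = 1: one has 816 = 16 * 51, and 577 = 16 modulo 51
      after a reciprocity flip without sign.\<close>
    have "Jacobi (4\<^sup>2 * 51) 577 = Jacobi (4\<^sup>2) 577 * Jacobi 51 577" by (rule Jacobi_mult_left) simp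
    also have "Jacobi (4\<^sup>2) 577 = 1"
      by (rule Jacobi_power2_left) (simp_all add: coprime_iff_gcd_eq_1 gcd_non_0_int)
    also have "Jacobi 51 577 = Jacobi 577 51"
      using Jacobi_reciprocity[of 51 577] by (simp add: rsign_def)
    also have "Jacobi 577 51 = Jacobi (4\<^sup>2) 51" by (rule Jacobi_cong) (simp add: Cong.cong_def)
    also have "Jacobi (4\<^sup>2) 51 = 1"
      by (rule Jacobi_power2_left) (simp_all add: coprime_iff_gcd_eq_1 gcd_non_0_int)
    finally have J816: "Jacobi 816 577 = 1" by simp
    show ?thesis
    \<comment> \<open>For d = 0 there is no odd part to work with. Either the element is 1, or c > 1
      divides both coordinates before and after, and both spins vanish.\<close>
    proof (cases "d = 0")
      case True
      show ?thesis
      proof (cases "c = 1")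
        case True
        have "Jacobi 816 577 = Jacobi 2 577 * Jacobi 408 577"
          using Jacobi_mult_left[of 577 2 408] by simp
        moreover have "Jacobi 2 577 = 1" by (simp add: Jacobi_2 tsign_def)
        ultimately have "Jacobi 408 577 = 1" using J816 by simp
        thus ?thesis using True \<open>d = 0\<close> unfolding spin_def e
          by (simp add: u_def v_def c_def[symmetric] d_def[symmetric])
      next
        case False
        have "spin w = 0" using False c \<open>d = 0\<close> by (intro spin_eq_0[of c]) (auto simp: c_def d_def)
        moreover have "spin (ZSqrt2 577 408 * w) = 0" 
          by (rule spin_eq_0[of c]) (use False c \<open>d = 0\<close> u in \<open>auto simp: e u_def v_def simp del: zsqrt2_sel\<close>)
        ultimately show ?thesis by simp
      qed
    next
      case d0: False
      define d' \<delta> where "d' = odd_part d" and "\<delta> = even_part d"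
      have d': "odd d'" "d' > 0" "d = \<delta> * d'" using odd_part_props[OF d0] by (auto simp: d'_def \<delta>_def)
      have "Jacobi (577 * d + 408 * c) (577 * c + 2 * 408 * d) =
          Jacobi (2 * 408) 577 * Jacobi c d' * Jacobi (577 * c + 2 * 408 * d) (577\<^sup>2 - 2 * 408\<^sup>2) *
          (Jacobi \<delta> (577 * c + 2 * 408 * d) * Jacobi \<delta> 577) *
           (rsign 577 (577 * c + 2 * 408 * d) * rsign d' (577 * c + 2 * 408 * d) * rsign 577 d' *
             rsign (577\<^sup>2 - 2 * 408\<^sup>2) (577 * c + 2 * 408 * d))"
        by (rule Jacobi_product)
           (use d' o u even_part_coprime[OF d0] in \<open>auto simp: u_def \<delta>_def\<close>)
      hence "Jacobi v u = Jacobi c d' * (Jacobi \<delta> u * Jacobi \<delta> 577) * rsign d' u"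
        using J816 by (simp add: u_def v_def rsign_def)
      also have "Jacobi \<delta> 577 = 1" unfolding \<delta>_def
        by (subst Jacobi_even_part[OF d0]) (auto simp: msign_def tsign_def)
      also have "Jacobi \<delta> u = Jacobi \<delta> c"
        using Jacobi_even_part[OF d0] u c o par sign_mod_cong(1,2)[OF um] by (simp add: \<delta>_def)
      also have "rsign d' u = rsign d' c"
        using sign_mod_cong(3)[of d' d' u c] mod_16_imp_mod_4[OF um] by simp
      also have "Jacobi c d' * (Jacobi \<delta> c * 1) * rsign d' c = Jacobi \<delta> c * Jacobi d' c"
        using Jacobi_reciprocity[of d' c] d' c o by simp
      also have "\<dots> = Jacobi d c" using o d'(3) by (simp add: Jacobi_mult_left)
      finally show ?thesis using o par by (simp add: spin_def e c_def[symmetric] d_def[symmetric] del: zsqrt2_sel)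
    qed
  qed
qed

lemma fund_unit_power8: "fund_unit ^ 8 = ZSqrt2 577 408"
proof -
  have "fund_unit ^ 4 = fund_unit ^ 2 * fund_unit ^ 2" by (simp flip: power_add)
  hence 4: "fund_unit ^ 4 = ZSqrt2 17 12" by (simp add: fund_unit_power2 zsqrt2_eq_iff)
  have "fund_unit ^ 8 = fund_unit ^ 4 * fund_unit ^ 4" by (simp flip: power_add)
  thus ?thesis by (simp add: 4 zsqrt2_eq_iff)
qed

lemma nrm_neg_eq: "- (rat_part w)\<^sup>2 + 2 * (sqrt_part w)\<^sup>2 = - nrm w"
  by (simp add: nrm_def)

text \<open>\<epsilon>^8 has norm 1 and fixes rational parts modulo 16, so both characters are blind
  to it.\<close>

lemma twisted_spin_unit_invariant:
  assumes "dirichlet_char 16 \<phi>" "dirichlet_char 16 \<psi>" "totally_positive w"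
  shows "twisted_spin \<phi> \<psi> (fund_unit ^ 8 * w) = twisted_spin \<phi> \<psi> w"
proof -
  have n: "nrm (fund_unit ^ 8 * w) = nrm w" by (simp add: nrm_mult fund_unit_power8 nrm_def[of "ZSqrt2 _ _"])
  have "rat_part (ZSqrt2 577 408 * w) - rat_part w = 16 * (36 * rat_part w + 51 * sqrt_part w)" by simp
  hence "rat_part (fund_unit ^ 8 * w) mod 16 = rat_part w mod 16"
    unfolding fund_unit_power8 by (metis mod_eq_dvd_iff dvd_triv_left)
  hence "\<psi> (rat_part (fund_unit ^ 8 * w)) = \<psi> (rat_part w)" by (rule dirichlet_char_cong[OF assms(2)])
  thus ?thesis unfolding twisted_spin_def nrm_neg_eq n using spin_unit_invariant[OF assms(3)]
    by (simp add: fund_unit_power8 del: zsqrt2_sel)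
qed

definition spin_sum :: "(int \<Rightarrow> complex) \<Rightarrow> (int \<Rightarrow> complex) \<Rightarrow> zsqrt2 \<Rightarrow> complex" where
  "spin_sum \<phi> \<psi> w = (\<Sum>k\<le>3. twisted_spin \<phi> \<psi> (fund_unit ^ (2 * k) * w))"

text \<open>Multiplication by \<epsilon>^2 shifts the index by one, and the new last term equals the
  old first one by invariance under \<epsilon>^8. This is why four terms are summed.\<close>

lemma spin_sum_unit_sq:
  assumes "dirichlet_char 16 \<phi>" "dirichlet_char 16 \<psi>" "totally_positive w"
  shows "spin_sum \<phi> \<psi> (unit_sq * w) = spin_sum \<phi> \<psi> w"
proof -
  have e: "fund_unit ^ (2 * k) * (unit_sq * w) = fund_unit ^ (2 * Suc k) * w" for k
    by (simp add: fund_unit_power2[symmetric] power_add mult_ac power2_eq_square)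
  have "{..3} = {0, 1, 2, 3::nat}" by auto
  thus ?thesis
    unfolding spin_sum_def e using twisted_spin_unit_invariant[OF assms] by (simp add: eval_nat_numeral)
qed

lemma spin_sum_normalize:
  assumes "dirichlet_char 16 \<phi>" "dirichlet_char 16 \<psi>" "totally_positive w"
  shows "spin_sum \<phi> \<psi> (normalize w) = spin_sum \<phi> \<psi> w"
  using assms by (intro totally_positive_invariant) (auto intro: spin_sum_unit_sq)

lemma norm_twisted_spin_le:
  assumes "dirichlet_char 16 \<phi>" "dirichlet_char 16 \<psi>"
  shows "cmod (twisted_spin \<phi> \<psi> w) \<le> 1"
proof -
  have "\<bar>spin w\<bar> \<le> 1" by (simp add: spin_def abs_Jacobi_le)
  hence "cmod (of_int (spin w)) \<le> 1" by (metis norm_of_int of_int_abs of_int_le_1_iff)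
  thus ?thesis unfolding twisted_spin_def norm_mult
    by (intro mult_le_one mult_nonneg_nonneg norm_ge_zero norm_dirichlet_char_le[OF assms(1)]
        norm_dirichlet_char_le[OF assms(2)])
qed

lemma norm_spin_sum_le:
  assumes "dirichlet_char 16 \<phi>" "dirichlet_char 16 \<psi>"
  shows "cmod (spin_sum \<phi> \<psi> w) \<le> 4"
proof -
  have "cmod (spin_sum \<phi> \<psi> w) \<le> (\<Sum>k\<le>3::nat. 1)"
    unfolding spin_sum_def by (intro sum_norm_le norm_twisted_spin_le assms)
  thus ?thesis by simp
qed

section \<open>Ideals as multisets of primes\<close>

text \<open>An ideal is stored as the multiset of the normalized generators of its prime factors.
  Union is the product of ideals, inclusion is divisibility, and \<open>prod_mset\<close> is a
  totally positive generator that is exactly multiplicative.\<close>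

definition prime_msets :: "zsqrt2 multiset set" where
  "prime_msets = {A. \<forall>p\<in>#A. prime p}"

definition mnorm :: "zsqrt2 multiset \<Rightarrow> real" where
  "mnorm A = of_int (nrm (prod_mset A))"

lemma prime_canonical:
  assumes "prime (p::zsqrt2)" shows "canonical p" "totally_positive p" "nrm p \<ge> 2"
proof -
  have "p \<noteq> 0" "normalize p = p" using assms by auto
  thus c: "canonical p" using canonical_normalize by metis
  thus t: "totally_positive p" by (rule canonical_imp_totally_positive)
  have "\<not> p dvd 1" using assms by auto
  hence "nrm p \<noteq> 1" by (auto simp: zsqrt2_is_unit_iff)
  thus "nrm p \<ge> 2" using t by (auto simp: totally_positive_nrm)
qed

lemma prime_msets_simps [simp]:
  "{#} \<in> prime_msets" "A + B \<in> prime_msets \<longleftrightarrow> A \<in> prime_msets \<and> B \<in> prime_msets"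
  "add_mset p A \<in> prime_msets \<longleftrightarrow> prime p \<and> A \<in> prime_msets"
  by (auto simp: prime_msets_def)

lemma prime_msets_subset: "A \<in> prime_msets \<Longrightarrow> B \<subseteq># A \<Longrightarrow> B \<in> prime_msets"
  by (auto simp: prime_msets_def dest: mset_subset_eqD)

lemma prod_mset_totally_positive: "A \<in> prime_msets \<Longrightarrow> totally_positive (prod_mset A)"
  by (induction A) (auto intro: totally_positive_mult prime_canonical)

lemma mnorm_empty [simp]: "mnorm {#} = 1" by (simp add: mnorm_def)

lemma mnorm_union: "mnorm (A + B) = mnorm A * mnorm B"
  by (simp add: mnorm_def nrm_mult)

lemma mnorm_add_mset: "mnorm (add_mset p A) = of_int (nrm p) * mnorm A"
  by (simp add: mnorm_def nrm_mult)

lemma mnorm_ge_1: "A \<in> prime_msets \<Longrightarrow> mnorm A \<ge> 1"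
  using prod_mset_totally_positive[of A] by (auto simp: mnorm_def totally_positive_nrm)

lemma mnorm_pos: "A \<in> prime_msets \<Longrightarrow> mnorm A > 0"
  using mnorm_ge_1[of A] by simp

lemma mnorm_gt_1: "A \<in> prime_msets \<Longrightarrow> A \<noteq> {#} \<Longrightarrow> mnorm A > 1"
proof -
  assume A: "A \<in> prime_msets" "A \<noteq> {#}"
  then obtain p B where B: "A = add_mset p B" by (meson multiset_cases)
  hence "nrm p \<ge> 2" "mnorm B \<ge> 1" using A mnorm_ge_1 prime_canonical(3) by auto
  hence "2 * 1 \<le> of_int (nrm p) * mnorm B" by (intro mult_mono) auto
  thus ?thesis by (simp add: B mnorm_add_mset)
qed

lemma prime_factorization_prod_prime_mset:
  "A \<in> prime_msets \<Longrightarrow> prime_factorization (prod_mset A) = A"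
  by (rule prime_factorization_prod_mset_primes) (auto simp: prime_msets_def)

lemma prime_factorization_in_prime_msets: "prime_factorization (w::zsqrt2) \<in> prime_msets"
  by (auto simp: prime_msets_def)

lemma prime_factorization_normalize_zsqrt2:
  "prime_factorization (normalize (w::zsqrt2)) = prime_factorization w"
proof (cases "w = 0")
  case False
  thus ?thesis by (simp add: prime_factorization_unique)
qed auto

text \<open>\<open>prod_mset A\<close> may leave the fundamental domain. \<open>rep A\<close> is its
  associate inside, whose coordinates are bounded in terms of the norm; the price is that
  \<open>rep\<close> is not multiplicative.\<close>

definition rep :: "zsqrt2 multiset \<Rightarrow> zsqrt2" where
  "rep A = normalize (prod_mset A)"

lemma rep_canonical: "A \<in> prime_msets \<Longrightarrow> canonical (rep A)"
  unfolding rep_def using prod_mset_totally_positive totally_positive_nonzero canonical_normalize by blast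

lemma nrm_rep: "A \<in> prime_msets \<Longrightarrow> of_int (nrm (rep A)) = mnorm A"
proof -
  assume A: "A \<in> prime_msets"
  have "nrm (rep A) > 0" using rep_canonical[OF A] canonical_imp_totally_positive totally_positive_nrm by blast
  moreover have "nrm (prod_mset A) > 0" using prod_mset_totally_positive[OF A] totally_positive_nrm by blast
  ultimately show ?thesis using nrm_normalize[of "prod_mset A"] by (simp add: rep_def mnorm_def)
qed

lemma prime_factorization_rep: "A \<in> prime_msets \<Longrightarrow> prime_factorization (rep A) = A"
  unfolding rep_def by (simp add: prime_factorization_normalize_zsqrt2 prime_factorization_prod_prime_mset)

lemma rep_inj: "inj_on rep prime_msets"
  by (rule inj_on_inverseI[of _ prime_factorization]) (rule prime_factorization_rep)

lemma rep_prime_factorization: "canonical w \<Longrightarrow> rep (prime_factorization w) = w"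
  unfolding rep_def using canonical_nonzero[of w] normalize_canonical[of w]
  by (simp add: prod_mset_prime_factorization_weak)

lemma canonical_box:
  assumes "canonical w" "real_of_int (nrm w) \<le> x"
  shows "0 < rat_part w" "of_int (rat_part w) \<le> 3 * sqrt x" "0 \<le> sqrt_part w" "sqrt_part w < rat_part w"
proof -
  show "0 < rat_part w" "0 \<le> sqrt_part w" "sqrt_part w < rat_part w"
    using assms(1) by (auto simp: canonical_def)
  have "real_of_int ((rat_part w)\<^sup>2) \<le> real_of_int (9 * nrm w)"
    using canonical_bound[OF assms(1)] by (simp only: of_int_le_iff)
  hence "(real_of_int (rat_part w))\<^sup>2 \<le> 9 * x" using assms(2) by simp
  hence "real_of_int (rat_part w) \<le> sqrt (9 * x)" by (rule real_le_rsqrt)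
  thus "of_int (rat_part w) \<le> 3 * sqrt x" by (simp add: real_sqrt_mult)
qed

text \<open>In the fundamental domain both coordinates are at most 3 sqrt x, so counting lattice
  points of a square suffices.\<close>

lemma finite_card_canonical:
  assumes "x \<ge> 1"
  shows "finite {w. canonical w \<and> real_of_int (nrm w) \<le> x}"
    "real (card {w. canonical w \<and> real_of_int (nrm w) \<le> x}) \<le> 9 * x"
proof -
  let ?S = "{w. canonical w \<and> real_of_int (nrm w) \<le> x}"
  define m where "m = \<lfloor>3 * sqrt x\<rfloor>"
  have sub: "?S \<subseteq> (\<lambda>(a, b). ZSqrt2 a b) ` ({1..m} \<times> {0..<m})"
  proof
    fix w assume w: "w \<in> ?S"
    hence "0 < rat_part w" "rat_part w \<le> m" "0 \<le> sqrt_part w" "sqrt_part w < rat_part w"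
      using canonical_box[of w x] by (auto simp: m_def le_floor_iff)
    thus "w \<in> (\<lambda>(a, b). ZSqrt2 a b) ` ({1..m} \<times> {0..<m})"
      by (intro image_eqI[of _ _ "(rat_part w, sqrt_part w)"]) auto
  qed
  show fin: "finite ?S" by (rule finite_subset[OF sub]) auto
  have "card ?S \<le> card ((\<lambda>(a, b). ZSqrt2 a b) ` ({1..m} \<times> {0..<m}))" by (rule card_mono[OF _ sub]) auto
  also have "\<dots> \<le> card ({1..m} \<times> {0..<m})" by (rule card_image_le) auto
  also have "\<dots> = nat m * nat m" by (simp add: card_cartesian_product)
  finally have "real (card ?S) \<le> real (nat m) * real (nat m)" by (metis of_nat_le_iff of_nat_mult)
  also have "\<dots> \<le> (3 * sqrt x) * (3 * sqrt x)"
  proof (rule mult_mono)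
    have "real (nat m) = of_int m" using assms by (simp add: m_def)
    thus "real (nat m) \<le> 3 * sqrt x" "real (nat m) \<le> 3 * sqrt x" by (simp_all add: m_def)
  qed (use assms in auto)
  also have "\<dots> = 9 * x" using assms by simp
  finally show "real (card ?S) \<le> 9 * x" .
qed

definition msets_upto :: "real \<Rightarrow> zsqrt2 multiset set" where
  "msets_upto x = {A \<in> prime_msets. mnorm A \<le> x}"

lemma msets_upto_rep: "rep ` msets_upto x = {w. canonical w \<and> real_of_int (nrm w) \<le> x}"
proof (intro equalityI subsetI)
  fix w assume "w \<in> rep ` msets_upto x"
  thus "w \<in> {w. canonical w \<and> real_of_int (nrm w) \<le> x}"
    using rep_canonical nrm_rep by (auto simp: msets_upto_def)
next
  fix w assume "w \<in> {w. canonical w \<and> real_of_int (nrm w) \<le> x}"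
  hence w: "canonical w" "real_of_int (nrm w) \<le> x" by auto
  have "prime_factorization w \<in> msets_upto x"
    using w nrm_rep[OF prime_factorization_in_prime_msets, of w]
    by (simp add: msets_upto_def prime_factorization_in_prime_msets rep_prime_factorization)
  thus "w \<in> rep ` msets_upto x" using rep_prime_factorization[OF w(1)] by (metis image_eqI)
qed

lemma inj_on_rep_msets_upto: "inj_on rep (msets_upto x)"
  by (rule inj_on_subset[OF rep_inj]) (auto simp: msets_upto_def)

lemma finite_msets_upto [simp]: "finite (msets_upto x)"
proof (cases "x \<ge> 1")
  case True
  thus ?thesis using finite_card_canonical(1) finite_imageD[OF _ inj_on_rep_msets_upto] msets_upto_rep by metis
next
  case False
  have "msets_upto x = {}" using False mnorm_ge_1 unfolding msets_upto_def by fastforce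
  thus ?thesis by simp
qed

lemma card_msets_upto: "x \<ge> 1 \<Longrightarrow> real (card (msets_upto x)) \<le> 9 * x"
  using finite_card_canonical(2)[of x] card_image[OF inj_on_rep_msets_upto[of x]] msets_upto_rep by metis

text \<open>The von Mangoldt function: a prime power is a multiset with a single distinct element.
  The sum over the singleton names that element without a choice operator.\<close>

definition lam :: "zsqrt2 multiset \<Rightarrow> real" where
  "lam A = (if card (set_mset A) = 1 then \<Sum>p\<in>set_mset A. ln (of_int (nrm p)) else 0)"

section \<open>Translation of ideals, their index and prime ideals into multisets\<close>

abbreviation zr :: "zsqrt2 ring" where "zr \<equiv> ring_of_type_algebra"

lemma zr_simps [simp]:
  "carrier zr = UNIV" "monoid.mult zr = (*)" "monoid.one zr = 1" "ring.zero zr = 0" "ring.add zr = (+)"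
  by (simp_all add: ring_of_type_algebra_def)

lemma ring_zr: "ring zr" and cring_zr: "cring zr"
  by (auto intro: ring_from_type_algebra cring_from_type_algebra)

lemma PIdl_eq: "PIdl\<^bsub>zr\<^esub> w = {v. w dvd v}"
  by (auto simp: cgenideal_def dvd_def mult.commute)

lemma ideal_PIdl: "ideal (PIdl\<^bsub>zr\<^esub> w) zr"
  by (intro cring.cgenideal_ideal cring_zr) auto

lemma ideal_props:
  assumes "ideal I zr"
  shows "0 \<in> I" "x \<in> I \<Longrightarrow> y \<in> I \<Longrightarrow> x + y \<in> I" "x \<in> I \<Longrightarrow> y * x \<in> I" "x \<in> I \<Longrightarrow> y \<in> I \<Longrightarrow> x - y \<in> I"
proof -
  interpret ideal I zr by (rule assms)
  show "0 \<in> I" using additive_subgroup.zero_closed[OF is_additive_subgroup] by simp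
  show a: "x \<in> I \<Longrightarrow> y \<in> I \<Longrightarrow> x + y \<in> I" for x y
    using additive_subgroup.a_closed[OF is_additive_subgroup, of x y] by simp
  show m: "x \<in> I \<Longrightarrow> y * x \<in> I" for x y using I_l_closed[of x y] by simp
  show "x \<in> I \<Longrightarrow> y \<in> I \<Longrightarrow> x - y \<in> I" using a[of x "(-1) * y"] m[of y "-1"] by simp
qed

text \<open>Division with remainder: a nonzero element of least Euclidean size generates.\<close>

lemma ideal_principal:
  assumes I: "ideal I zr" shows "\<exists>w. I = PIdl\<^bsub>zr\<^esub> w"
proof (cases "I = {0}")
  case True
  thus ?thesis by (intro exI[of _ 0]) (auto simp: PIdl_eq)
next
  case False
  then obtain v where v: "v \<in> I" "v \<noteq> 0" using ideal_props(1)[OF I] by blast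
  define w where "w = arg_min euclidean_size (\<lambda>w. w \<in> I \<and> w \<noteq> 0)"
  have w: "w \<in> I \<and> w \<noteq> 0" unfolding w_def by (rule arg_min_natI[of _ v]) (use v in auto)
  have min: "euclidean_size w \<le> euclidean_size u" if "u \<in> I" "u \<noteq> 0" for u
    unfolding w_def by (rule arg_min_nat_le) (use that in auto)
  have "w dvd u" if u: "u \<in> I" for u
  proof (rule ccontr)
    assume "\<not> w dvd u"
    hence "u mod w \<noteq> 0" by (simp add: mod_eq_0_iff_dvd)
    moreover have "u mod w = u - (u div w) * w" by (metis minus_div_mult_eq_mod)
    hence "u mod w \<in> I" using ideal_props(3,4)[OF I] u w by metis
    ultimately have "euclidean_size w \<le> euclidean_size (u mod w)" using min by blast
    thus False using mod_size_less[of w u] w by simp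
  qed
  moreover have "u \<in> I" if "w dvd u" for u
    using that ideal_props(3)[OF I, of w] w by (auto simp: dvd_def mult.commute)
  ultimately show ?thesis by (intro exI[of _ w]) (auto simp: PIdl_eq)
qed

lemma PIdl_eq_iff: "PIdl\<^bsub>zr\<^esub> w = PIdl\<^bsub>zr\<^esub> z \<longleftrightarrow> normalize w = normalize z"
proof
  assume "PIdl\<^bsub>zr\<^esub> w = PIdl\<^bsub>zr\<^esub> z"
  hence "w dvd v \<longleftrightarrow> z dvd v" for v unfolding PIdl_eq by blast
  from this[of w] this[of z] show "normalize w = normalize z" by (simp add: associated_iff_dvd)
next
  assume "normalize w = normalize z"
  hence "w dvd v \<longleftrightarrow> z dvd v" for v by (metis normalize_dvd_iff)
  thus "PIdl\<^bsub>zr\<^esub> w = PIdl\<^bsub>zr\<^esub> z" unfolding PIdl_eq by blast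
qed

lemma carrier_Quot_PIdl:
  "carrier (zr Quot (PIdl\<^bsub>zr\<^esub> w)) = range (\<lambda>x. {v. w dvd v - x})"
proof -
  have "PIdl\<^bsub>zr\<^esub> w +>\<^bsub>zr\<^esub> x = {v. w dvd v - x}" for x
  proof (intro equalityI subsetI)
    fix v assume "v \<in> {v. w dvd v - x}"
    hence "\<exists>h. w dvd h \<and> v = h + x" by (intro exI[of _ "v - x"]) simp
    thus "v \<in> PIdl\<^bsub>zr\<^esub> w +>\<^bsub>zr\<^esub> x" by (auto simp: a_r_coset_def' PIdl_eq)
  qed (auto simp: a_r_coset_def' PIdl_eq)
  thus ?thesis by (auto simp: FactRing_def A_RCOSETS_def')
qed

text \<open>The lattice of multiples of w has a basis in Hermite form: (m, 0) and a vector with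
  second coordinate g = gcd(a, b), where m g = |nrm w|. Hence the m g lattice points of a rectangle
  represent every coset once.\<close>

lemma ideal_norm_PIdl:
  assumes "w \<noteq> 0" shows "int (ideal_norm (PIdl\<^bsub>zr\<^esub> w)) = \<bar>nrm w\<bar>"
proof -
  define a b g where "a = rat_part w" and "b = sqrt_part w" and "g = gcd a b"
  have w_eq: "w = ZSqrt2 a b" by (simp add: a_def b_def)
  have g: "g > 0" using assms by (auto simp: g_def w_eq zsqrt2_eq_iff)
  then obtain a' b' where ab: "a = a' * g" "b = b' * g" "coprime a' b'"
    unfolding g_def by (metis gcd_coprime_exists less_irrefl)
  define k where "k = a * a' - 2 * b * b'"
  have k: "nrm w = k * g" by (simp add: nrm_def w_eq k_def ab power2_eq_square algebra_simps)
  define m where "m = \<bar>k\<bar>"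
  have m: "m > 0" using assms nrm_eq_0_iff[of w] k by (auto simp: m_def)
  have F1: "g dvd sqrt_part x" if "w dvd x" for x
  proof -
    obtain y where "x = w * y" using \<open>w dvd x\<close> by (auto simp: dvd_def)
    hence "sqrt_part x = (a' * sqrt_part y + b' * rat_part y) * g"
      by (simp add: w_eq ab algebra_simps)
    thus ?thesis by (metis dvd_triv_right)
  qed
  \<comment> \<open>For a multiple w (s + t sqrt 2) without sqrt 2 part, a' t + b' s = 0 forces (s,
    t) to be an integer multiple of (a', -b'), which yields a multiple of \<open>k\<close>.\<close>
  have F2: "m dvd rat_part x" if wx: "w dvd x" and s0: "sqrt_part x = 0" for x
  proof -
    obtain y where y: "x = w * y" using wx by (auto simp: dvd_def)
    define s t where "s = rat_part y" and "t = sqrt_part y"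
    have "g * (a' * t + b' * s) = 0" using s0 unfolding y w_eq by (simp add: ab s_def t_def algebra_simps)
    hence z: "a' * t = - (b' * s)" using g by simp
    hence "a' dvd b' * s" by (metis dvd_minus_iff dvd_triv_left)
    hence "a' dvd s" using ab(3) coprime_dvd_mult_right_iff by blast
    then obtain r where r: "s = a' * r" by (auto simp: dvd_def)
    have "\<exists>r. s = a' * r \<and> t = - (b' * r)"
    proof (cases "a' = 0")
      case True
      hence b1: "\<bar>b'\<bar> = 1" using ab(3) by simp
      hence "b' \<noteq> 0" "b' * b' = 1" by (auto simp: abs_if split: if_splits)
      thus ?thesis using z True by (intro exI[of _ "- (b' * t)"]) (simp add: mult.assoc[symmetric])
    next
      case False
      have "a' * t = a' * (- (b' * r))" using z r by (simp add: algebra_simps)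
      hence "t = - (b' * r)" using False mult_left_cancel by blast
      thus ?thesis using r by blast
    qed
    then obtain r where r: "s = a' * r" "t = - (b' * r)" by blast
    have "rat_part x = a * s + 2 * b * t" unfolding y w_eq by (simp add: s_def t_def)
    hence "rat_part x = k * r" unfolding r k_def by (simp add: algebra_simps)
    hence "k dvd rat_part x" by (metis dvd_triv_left)
    thus ?thesis by (simp add: m_def)
  qed
  obtain p q where pq: "p * a + q * b = g" using bezout_int[of a b] unfolding g_def by blast
  \<comment> \<open>Bezout supplies a multiple of \<open>w\<close> whose second coordinate is
    exactly \<open>g\<close>.\<close>
  define e where "e = w * ZSqrt2 q p"
  have e: "w dvd e" "sqrt_part e = g" using pq by (simp_all add: e_def w_eq algebra_simps)
  have F4: "w dvd ZSqrt2 m 0"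
  proof -
    have "ZSqrt2 k 0 = w * ZSqrt2 a' (- b')" by (simp add: zsqrt2_eq_iff w_eq k_def ab algebra_simps)
    moreover have "ZSqrt2 m 0 = ZSqrt2 k 0 * ZSqrt2 (sgn k) 0"
      by (simp add: zsqrt2_eq_iff m_def abs_sgn)
    ultimately show ?thesis by simp
  qed
  define f where "f = (\<lambda>(i::int, j::int). {v. w dvd v - ZSqrt2 i j})"
  have inj: "inj_on f ({0..<m} \<times> {0..<g})"
  proof (rule inj_onI, clarify)
    fix i j i' j'
    assume A: "i \<in> {0..<m}" "j \<in> {0..<g}" "i' \<in> {0..<m}" "j' \<in> {0..<g}" "f (i, j) = f (i', j')"
    have "ZSqrt2 i j \<in> f (i, j)" by (simp add: f_def)
    hence "ZSqrt2 i j \<in> f (i', j')" unfolding A(5) .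
    hence d: "w dvd ZSqrt2 i j - ZSqrt2 i' j'" by (simp add: f_def)
    have "g dvd j - j'" using F1[OF d] by simp
    hence jj: "j = j'" using A by (metis atLeastLessThan_iff mod_eq_dvd_iff mod_pos_pos_trivial)
    have "m dvd i - i'" using F2[OF d] jj by simp
    hence "i = i'" using A by (metis atLeastLessThan_iff mod_eq_dvd_iff mod_pos_pos_trivial)
    thus "i = i' \<and> j = j'" using jj by simp
  qed
  have img: "f ` ({0..<m} \<times> {0..<g}) = range (\<lambda>x. {v. w dvd v - x})"
  proof (intro equalityI subsetI)
    fix C assume "C \<in> range (\<lambda>x. {v. w dvd v - x})"
    then obtain x where C: "C = {v. w dvd v - x}" by blast
    \<comment> \<open>The second coordinate is reduced by multiples of \<open>e\<close>, then the
      first by multiples of the rational integer \<open>m\<close>.\<close>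
    define y where "y = x - ZSqrt2 (sqrt_part x div g) 0 * e"
    define z where "z = y - ZSqrt2 (rat_part y div m) 0 * ZSqrt2 m 0"
    have "sqrt_part y = sqrt_part x mod g" unfolding y_def using e(2)
      by (simp add: minus_div_mult_eq_mod)
    hence sy: "sqrt_part z \<in> {0..<g}" using g by (simp add: z_def)
    have "rat_part z = rat_part y mod m" by (simp add: z_def minus_div_mult_eq_mod)
    hence ry: "rat_part z \<in> {0..<m}" using m by simp
    have "w dvd x - y" "w dvd y - z" using e(1) F4 by (simp_all add: y_def z_def)
    hence xz: "w dvd x - z" using dvd_add[of w "x - y" "y - z"] by simp
    have "w dvd v - x \<longleftrightarrow> w dvd v - z" for v
      using dvd_add[of w "v - x" "x - z"] dvd_diff[of w "v - z" "x - z"] xz by auto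
    hence "C = f (rat_part z, sqrt_part z)" by (simp add: C f_def)
    thus "C \<in> f ` ({0..<m} \<times> {0..<g})" using sy ry by blast
  qed (auto simp: f_def)
  have "ideal_norm (PIdl\<^bsub>zr\<^esub> w) = card ({0..<m} \<times> {0..<g})"
    unfolding ideal_norm_def carrier_Quot_PIdl img[symmetric] by (rule card_image[OF inj])
  also have "int \<dots> = m * g" using m g by (simp add: card_cartesian_product)
  also have "\<dots> = \<bar>nrm w\<bar>" using g by (simp add: k m_def abs_mult)
  finally show ?thesis .
qed

lemma ideal_prod_PIdl: "ideal_prod zr (PIdl\<^bsub>zr\<^esub> a) (PIdl\<^bsub>zr\<^esub> b) = PIdl\<^bsub>zr\<^esub> (a * b)"
proof (intro equalityI subsetI)
  fix x assume "x \<in> ideal_prod zr (PIdl\<^bsub>zr\<^esub> a) (PIdl\<^bsub>zr\<^esub> b)"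
  thus "x \<in> PIdl\<^bsub>zr\<^esub> (a * b)"
    by (induction rule: ideal_prod.induct) (auto simp: PIdl_eq intro: mult_dvd_mono)
next
  fix x assume "x \<in> PIdl\<^bsub>zr\<^esub> (a * b)"
  then obtain k where "x = (k * a) * b" by (auto simp: PIdl_eq dvd_def mult_ac)
  moreover have "(k * a) \<otimes>\<^bsub>zr\<^esub> b \<in> ideal_prod zr (PIdl\<^bsub>zr\<^esub> a) (PIdl\<^bsub>zr\<^esub> b)"
    by (intro ideal_prod.prod) (auto simp: PIdl_eq)
  ultimately show "x \<in> ideal_prod zr (PIdl\<^bsub>zr\<^esub> a) (PIdl\<^bsub>zr\<^esub> b)" by simp
qed

lemma ideals_set_power_PIdl: "PIdl\<^bsub>zr\<^esub> p [^]\<^bsub>ideals_set zr\<^esub> (k::nat) = PIdl\<^bsub>zr\<^esub> (p ^ k)"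
proof (induction k)
  case 0
  have "one (ideals_set zr) = UNIV" by (simp add: ideals_set_def)
  thus ?case by (simp add: nat_pow_def PIdl_eq)
next
  case (Suc k)
  have "monoid.mult (ideals_set zr) = ideal_prod zr" by (simp add: ideals_set_def)
  thus ?case using Suc ideal_prod_PIdl[of "p ^ k" p] by (simp add: nat_pow_def mult.commute)
qed

lemma primeideal_PIdl_iff:
  assumes "w \<noteq> 0" shows "primeideal (PIdl\<^bsub>zr\<^esub> w) zr \<longleftrightarrow> prime_elem w"
proof
  assume P: "primeideal (PIdl\<^bsub>zr\<^esub> w) zr"
  have "\<not> w dvd 1" using primeideal.I_notcarr[OF P] by (auto simp: PIdl_eq)
  moreover have "w dvd a * b \<Longrightarrow> w dvd a \<or> w dvd b" for a b
    using primeideal.I_prime[OF P, of a b] by (auto simp: PIdl_eq)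
  ultimately show "prime_elem w" using assms by (auto simp: prime_elem_def)
next
  assume P: "prime_elem w"
  show "primeideal (PIdl\<^bsub>zr\<^esub> w) zr"
  proof (rule primeidealI[OF ideal_PIdl cring_zr])
    have "1 \<notin> PIdl\<^bsub>zr\<^esub> w" using P by (auto simp: PIdl_eq prime_elem_def)
    thus "carrier zr \<noteq> PIdl\<^bsub>zr\<^esub> w" by auto
  qed (use P in \<open>auto simp: PIdl_eq prime_elem_dvd_mult_iff\<close>)
qed

text \<open>Unique factorization: a generator of a power of P is, up to units, the same power of the
  normalized generator of P.\<close>

lemma is_prime_base_iff:
  assumes A: "A \<in> prime_msets"
  shows "is_prime_base P (PIdl\<^bsub>zr\<^esub> (prod_mset A)) \<longleftrightarrow>
    (\<exists>p k. prime p \<and> P = PIdl\<^bsub>zr\<^esub> p \<and> k \<ge> 1 \<and> A = replicate_mset k p)"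
proof
  assume "is_prime_base P (PIdl\<^bsub>zr\<^esub> (prod_mset A))"
  then obtain k :: nat where P: "primeideal P zr" "k \<ge> 1"
      "PIdl\<^bsub>zr\<^esub> (prod_mset A) = P [^]\<^bsub>ideals_set zr\<^esub> k"
    by (auto simp: is_prime_base_def)
  obtain w where w: "P = PIdl\<^bsub>zr\<^esub> w" using ideal_principal primeideal.axioms(1)[OF P(1)] by blast
  have e: "normalize (prod_mset A) = normalize (w ^ k)"
    using P(3) unfolding w ideals_set_power_PIdl PIdl_eq_iff .
  have nz: "prod_mset A \<noteq> 0" using prod_mset_totally_positive[OF A] totally_positive_nonzero by blast
  have w0: "w \<noteq> 0" using e nz P(2) by (auto simp: power_0_left)
  have pe: "prime_elem w" using P(1) primeideal_PIdl_iff[OF w0] w by simp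
  define p where "p = normalize w"
  have p: "prime p" using pe by (simp add: p_def prime_def)
  have "A = prime_factorization (prod_mset A)" using prime_factorization_prod_prime_mset[OF A] by simp
  also have "\<dots> = prime_factorization (w ^ k)"
    using e prime_factorization_normalize_zsqrt2 by metis
  also have "\<dots> = prime_factorization (p ^ k)"
  proof -
    have "normalize (w ^ k) = normalize (p ^ k)"
      unfolding p_def by (metis associated_iff_dvd dvd_normalize_iff normalize_dvd_iff dvd_refl dvd_power_same)
    thus ?thesis using prime_factorization_normalize_zsqrt2 by metis
  qed
  also have "\<dots> = replicate_mset k p" using p by (simp add: prime_factorization_prime_power)
  finally have "A = replicate_mset k p" .
  moreover have "P = PIdl\<^bsub>zr\<^esub> p" unfolding w PIdl_eq_iff by (simp add: p_def)
  ultimately show "\<exists>p k. prime p \<and> P = PIdl\<^bsub>zr\<^esub> p \<and> k \<ge> 1 \<and> A = replicate_mset k p"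
    using p P(2) by blast
next
  assume "\<exists>p k. prime p \<and> P = PIdl\<^bsub>zr\<^esub> p \<and> k \<ge> 1 \<and> A = replicate_mset k p"
  then obtain p k where p: "prime p" "P = PIdl\<^bsub>zr\<^esub> p" "k \<ge> 1" "A = replicate_mset k p" by blast
  have "primeideal P zr" using primeideal_PIdl_iff[of p] p by auto
  thus "is_prime_base P (PIdl\<^bsub>zr\<^esub> (prod_mset A))"
    using p ideals_set_power_PIdl[of p k] unfolding is_prime_base_def by auto
qed

lemma ideal_mangoldt_PIdl:
  assumes A: "A \<in> prime_msets"
  shows "ideal_mangoldt (PIdl\<^bsub>zr\<^esub> (prod_mset A)) = lam A"
proof (cases "card (set_mset A) = 1")
  case True
  then obtain p where p: "set_mset A = {p}" by (auto simp: card_1_singleton_iff)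
  hence Ar: "A = replicate_mset (count A p) p"
    by (intro multiset_eqI) (auto simp: not_in_iff[symmetric])
  have pr: "prime p" using A p by (auto simp: prime_msets_def)
  have c: "count A p \<ge> 1" using p by (metis count_greater_eq_one_iff insertI1)
  have base: "is_prime_base P (PIdl\<^bsub>zr\<^esub> (prod_mset A)) \<longleftrightarrow> P = PIdl\<^bsub>zr\<^esub> p" for P
  proof
    assume "is_prime_base P (PIdl\<^bsub>zr\<^esub> (prod_mset A))"
    then obtain q k where q: "P = PIdl\<^bsub>zr\<^esub> q" "k \<ge> 1" "A = replicate_mset k q"
      unfolding is_prime_base_iff[OF A] by blast
    hence "set_mset A = {q}" by simp
    thus "P = PIdl\<^bsub>zr\<^esub> p" using p q by simp
  qed (use is_prime_base_iff[OF A] Ar pr c in blast)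
  have "real (ideal_norm (PIdl\<^bsub>zr\<^esub> p)) = of_int (nrm p)"
    using ideal_norm_PIdl[of p] prime_canonical(3)[OF pr] pr
    by (metis abs_of_nonneg not_prime_0 of_int_of_nat_eq order_trans zero_le_numeral)
  thus ?thesis using True unfolding ideal_mangoldt_def base by (simp add: lam_def p)
next
  case False
  have "\<not> is_prime_base P (PIdl\<^bsub>zr\<^esub> (prod_mset A))" for P
    unfolding is_prime_base_iff[OF A] using False by auto
  thus ?thesis using False by (simp add: ideal_mangoldt_def lam_def)
qed

text \<open>The generator picked by the choice operator has the same normal form as
  \<open>w\<close>, and \<open>spin_sum\<close> depends on the normal form only.\<close>

lemma ideal_coeff_PIdl:
  assumes "dirichlet_char 16 \<phi>" "dirichlet_char 16 \<psi>" "totally_positive w"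
  shows "ideal_coeff \<phi> \<psi> (PIdl\<^bsub>zr\<^esub> w) = spin_sum \<phi> \<psi> w"
proof -
  define v where "v = (SOME v. totally_positive v \<and> PIdl\<^bsub>zr\<^esub> w = PIdl\<^bsub>zr\<^esub> v)"
  have "totally_positive v \<and> PIdl\<^bsub>zr\<^esub> w = PIdl\<^bsub>zr\<^esub> v"
    unfolding v_def by (rule someI[of _ w]) (use assms in auto)
  hence "spin_sum \<phi> \<psi> v = spin_sum \<phi> \<psi> w"
    using spin_sum_normalize[OF assms(1,2)] assms(3) unfolding PIdl_eq_iff by metis
  thus ?thesis unfolding ideal_coeff_def v_def[symmetric] by (simp add: spin_sum_def)
qed

text \<open>The interface between the statement about ideals and the analytic part, which sees
  multisets of primes only.\<close>

lemma sum_ideals_eq: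
  assumes "dirichlet_char 16 \<phi>" "dirichlet_char 16 \<psi>"
  shows "(\<Sum>I\<in>ideals_upto x. ideal_coeff \<phi> \<psi> I * of_real (ideal_mangoldt I)) =
    (\<Sum>A\<in>msets_upto x. spin_sum \<phi> \<psi> (prod_mset A) * of_real (lam A))"
proof -
  have norm: "real (ideal_norm (PIdl\<^bsub>zr\<^esub> (prod_mset A))) = mnorm A" if "A \<in> prime_msets" for A
    using ideal_norm_PIdl[of "prod_mset A"] prod_mset_totally_positive[OF that]
    by (metis abs_of_pos mnorm_def of_int_of_nat_eq totally_positive_nonzero totally_positive_nrm)
  have bij: "bij_betw (\<lambda>A. PIdl\<^bsub>zr\<^esub> (prod_mset A)) (msets_upto x) (ideals_upto x)"
    unfolding bij_betw_def
  proof
    show "inj_on (\<lambda>A. PIdl\<^bsub>zr\<^esub> (prod_mset A)) (msets_upto x)"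
    proof (rule inj_onI)
      fix A B assume "A \<in> msets_upto x" "B \<in> msets_upto x"
        "PIdl\<^bsub>zr\<^esub> (prod_mset A) = PIdl\<^bsub>zr\<^esub> (prod_mset B)"
      thus "A = B" using inj_on_rep_msets_upto[of x] unfolding PIdl_eq_iff
        by (simp add: inj_on_def rep_def)
    qed
    show "(\<lambda>A. PIdl\<^bsub>zr\<^esub> (prod_mset A)) ` msets_upto x = ideals_upto x"
    proof (intro equalityI subsetI)
      fix I assume "I \<in> (\<lambda>A. PIdl\<^bsub>zr\<^esub> (prod_mset A)) ` msets_upto x"
      then obtain A where A: "A \<in> prime_msets" "mnorm A \<le> x" "I = PIdl\<^bsub>zr\<^esub> (prod_mset A)"
        by (auto simp: msets_upto_def)
      have "prod_mset A \<in> I" "prod_mset A \<noteq> 0"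
        using A prod_mset_totally_positive[OF A(1)] totally_positive_nonzero by (auto simp: PIdl_eq)
      thus "I \<in> ideals_upto x" using A norm[OF A(1)] ideal_PIdl by (auto simp: ideals_upto_def)
    next
      fix I assume I: "I \<in> ideals_upto x"
      then obtain w where w: "I = PIdl\<^bsub>zr\<^esub> w" using ideal_principal by (auto simp: ideals_upto_def)
      have w0: "w \<noteq> 0" using I by (auto simp: ideals_upto_def w PIdl_eq)
      define A where "A = prime_factorization w"
      have A: "A \<in> prime_msets" by (simp add: A_def prime_factorization_in_prime_msets)
      have "I = PIdl\<^bsub>zr\<^esub> (prod_mset A)" unfolding w PIdl_eq_iff A_def
        using prod_mset_prime_factorization_weak[OF w0] by simp
      moreover from this have "A \<in> msets_upto x" using norm[OF A] I A by (simp add: msets_upto_def ideals_upto_def)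
      ultimately show "I \<in> (\<lambda>A. PIdl\<^bsub>zr\<^esub> (prod_mset A)) ` msets_upto x" by blast
    qed
  qed
  have "(\<Sum>A\<in>msets_upto x. spin_sum \<phi> \<psi> (prod_mset A) * of_real (lam A)) =
     (\<Sum>A\<in>msets_upto x. ideal_coeff \<phi> \<psi> (PIdl\<^bsub>zr\<^esub> (prod_mset A)) *
        of_real (ideal_mangoldt (PIdl\<^bsub>zr\<^esub> (prod_mset A))))"
    by (intro sum.cong refl)
       (auto simp: msets_upto_def ideal_mangoldt_PIdl ideal_coeff_PIdl[OF assms] prod_mset_totally_positive)
  also have "\<dots> = (\<Sum>I\<in>ideals_upto x. ideal_coeff \<phi> \<psi> I * of_real (ideal_mangoldt I))"
    by (rule sum.reindex_bij_betw[OF bij])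
  finally show ?thesis ..
qed

section \<open>Divisor bounds and Vaughan's identity\<close>

text \<open>The divisor bound, kept abstract so that it serves the primes of the quadratic ring and
  the rational primes alike. A prime of size at least Y = 2^(1/\<eta>) satisfies e + 1 <= 2^e <=
  N^(\<eta> e); each of the finitely many smaller primes costs a constant factor.\<close>

lemma prod_count_le_powr:
  fixes N :: "'a \<Rightarrow> real" and \<eta> :: real
  assumes N2: "\<And>p. p \<in> P \<Longrightarrow> N p \<ge> 2" and fin: "\<And>x. finite {p \<in> P. N p < x}" and \<eta>: "\<eta> > 0"
  shows "\<exists>K\<ge>1. \<forall>A. set_mset A \<subseteq> P \<longrightarrow>
    real (\<Prod>p\<in>set_mset A. count A p + 1) \<le> K * (\<Prod>p\<in>#A. N p) powr \<eta>"
proof -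
  define Y where "Y = 2 powr (1 / \<eta>)"
  define F where "F = {p \<in> P. N p < Y}"
  \<comment> \<open>Chosen so that e + 1 <= c (1 + e \<eta> ln 2) <= c 2^(\<eta> e) for every
    exponent e.\<close>
  define c where "c = max 1 (1 / (\<eta> * ln 2))"
  have finF: "finite F" unfolding F_def by (rule fin)
  have c1: "c \<ge> 1" by (simp add: c_def)
  have e: "real (e + 1) \<le> (if p \<in> F then c else 1) * (N p powr \<eta>) ^ e" if p: "p \<in> P" for p e
  proof (cases "p \<in> F")
    case True
    have "1 \<le> c" "1 \<le> c * (\<eta> * ln 2)"
      using \<eta> by (auto simp: c_def field_simps max_def)
    hence "real e * 1 + 1 \<le> real e * (c * (\<eta> * ln 2)) + c"
      by (intro add_mono mult_left_mono) auto
    also have "\<dots> = c * (1 + real e * \<eta> * ln 2)" by (simp add: algebra_simps)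
    also have "\<dots> \<le> c * exp (real e * \<eta> * ln 2)"
      using c1 by (intro mult_left_mono) (auto simp: exp_ge_add_one_self)
    also have "exp (real e * \<eta> * ln 2) = (2 powr \<eta>) ^ e"
      by (simp add: powr_def exp_of_nat_mult[symmetric] mult_ac)
    also have "c * \<dots> \<le> c * (N p powr \<eta>) ^ e"
      using c1 N2[OF p] \<eta> by (intro mult_left_mono power_mono powr_mono2) auto
    finally show ?thesis using True by simp
  next
    case False
    hence "Y \<le> N p" using p by (auto simp: F_def)
    hence "Y powr \<eta> \<le> N p powr \<eta>" using \<eta> by (intro powr_mono2) (auto simp: Y_def)
    hence two: "2 \<le> N p powr \<eta>" using \<eta> by (simp add: Y_def powr_powr)
    have "e + 1 \<le> 2 ^ e" by (induction e) auto
    hence "real (e + 1) \<le> 2 ^ e" by (metis of_nat_le_iff of_nat_numeral of_nat_power)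
    also have "\<dots> \<le> (N p powr \<eta>) ^ e" using two by (intro power_mono) auto
    finally show ?thesis using False by simp
  qed
  show ?thesis
  proof (intro exI[of _ "c ^ card F"] conjI allI impI)
    show "1 \<le> c ^ card F" using c1 by simp
    fix A :: "'a multiset" assume A: "set_mset A \<subseteq> P"
    have "real (\<Prod>p\<in>set_mset A. count A p + 1) = (\<Prod>p\<in>set_mset A. real (count A p + 1))" by simp
    also have "\<dots> \<le> (\<Prod>p\<in>set_mset A. (if p \<in> F then c else 1) * (N p powr \<eta>) ^ count A p)"
    proof (rule prod_mono)
      fix p assume "p \<in> set_mset A"
      hence "p \<in> P" using A by blast
      from e[OF this, of "count A p"] show "0 \<le> real (count A p + 1) \<and>
        real (count A p + 1) \<le> (if p \<in> F then c else 1) * (N p powr \<eta>) ^ count A p" by simp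
    qed
    also have "\<dots> = (\<Prod>p\<in>set_mset A. if p \<in> F then c else 1) * (\<Prod>p\<in>set_mset A. (N p powr \<eta>) ^ count A p)"
      by (rule prod.distrib)
    also have "(\<Prod>p\<in>set_mset A. if p \<in> F then c else 1) = c ^ card (set_mset A \<inter> F)"
      by (simp add: prod.If_cases)
    also have "(\<Prod>p\<in>set_mset A. (N p powr \<eta>) ^ count A p) = (\<Prod>p\<in>#A. N p powr \<eta>)"
      by (simp add: image_prod_mset_multiplicity)
    also have "\<dots> = (\<Prod>p\<in>#A. N p) powr \<eta>"
    proof -
      have "(\<Prod>p\<in>#A. N p) \<ge> 0 \<and> (\<Prod>p\<in>#A. N p powr \<eta>) = (\<Prod>p\<in>#A. N p) powr \<eta>" using A
      proof (induction A)
        case (add x A)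
        have "N x \<ge> 0" using N2[of x] add.prems by force
        thus ?case using add by (auto simp: powr_mult)
      qed auto
      thus ?thesis by blast
    qed
    also have "c ^ card (set_mset A \<inter> F) * (\<Prod>p\<in>#A. N p) powr \<eta> \<le> c ^ card F * (\<Prod>p\<in>#A. N p) powr \<eta>"
      using c1 finF by (intro mult_right_mono power_increasing card_mono) auto
    finally show "real (\<Prod>p\<in>set_mset A. count A p + 1) \<le> c ^ card F * (\<Prod>p\<in>#A. N p) powr \<eta>" .
  qed
qed

lemma submultisets:
  shows finite_submultisets: "finite {B. B \<subseteq># A}"
    and card_submultisets_le: "card {B. B \<subseteq># A} \<le> (\<Prod>p\<in>set_mset A. count A p + 1)"
proof -
  define f where "f = (\<lambda>B. restrict (count B) (set_mset A))"
  have inj: "inj_on f {B. B \<subseteq># A}"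
  proof (rule inj_onI)
    fix B C assume B: "B \<in> {B. B \<subseteq># A}" and C: "C \<in> {B. B \<subseteq># A}" and e: "f B = f C"
    show "B = C"
    proof (rule multiset_eqI)
      fix p
      show "count B p = count C p"
      proof (cases "p \<in># A")
        case True
        thus ?thesis using fun_cong[OF e, of p] by (simp add: f_def)
      next
        case False
        hence "count A p = 0" by (simp add: not_in_iff)
        moreover have "count B p \<le> count A p" "count C p \<le> count A p"
          using B C by (auto simp: mset_subset_eq_count)
        ultimately show ?thesis by simp
      qed
    qed
  qed
  have sub: "f ` {B. B \<subseteq># A} \<subseteq> PiE (set_mset A) (\<lambda>p. {..count A p})"
    by (auto simp: f_def mset_subset_eq_count)
  have fin: "finite (PiE (set_mset A) (\<lambda>p. {..count A p}))" by (intro finite_PiE) auto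
  show "finite {B. B \<subseteq># A}" using finite_imageD[OF finite_subset[OF sub fin] inj] .
  have "card {B. B \<subseteq># A} = card (f ` {B. B \<subseteq># A})" by (rule card_image[OF inj, symmetric])
  also have "\<dots> \<le> card (PiE (set_mset A) (\<lambda>p. {..count A p}))" by (rule card_mono[OF fin sub])
  also have "\<dots> = (\<Prod>p\<in>set_mset A. count A p + 1)" by (simp add: card_PiE)
  finally show "card {B. B \<subseteq># A} \<le> (\<Prod>p\<in>set_mset A. count A p + 1)" .
qed

lemma mnorm_eq_prod: "mnorm A = (\<Prod>p\<in>#A. of_int (nrm p))"
  by (induction A) (auto simp: mnorm_add_mset)

lemma zsqrt2_divisor_bound:
  fixes \<eta> :: real assumes "\<eta> > 0"
  shows "\<exists>K\<ge>1. \<forall>A\<in>prime_msets. real (card {B. B \<subseteq># A}) \<le> K * mnorm A powr \<eta>"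
proof -
  have fin: "finite {p \<in> {p. prime p}. real_of_int (nrm p) < x}" for x
  proof (cases "x \<ge> 1")
    case True
    show ?thesis
      by (rule finite_subset[OF _ finite_card_canonical(1)[OF True]]) (auto dest: prime_canonical)
  next
    case False
    have "{p \<in> {p. prime p}. real_of_int (nrm p) < x} = {}"
      using False prime_canonical(3) by force
    thus ?thesis by (metis finite.emptyI)
  qed
  obtain K where K: "K \<ge> 1" "\<And>A. set_mset A \<subseteq> {p::zsqrt2. prime p} \<Longrightarrow>
      real (\<Prod>p\<in>set_mset A. count A p + 1) \<le> K * (\<Prod>p\<in>#A. real_of_int (nrm p)) powr \<eta>"
    using prod_count_le_powr[OF _ fin assms] prime_canonical(3) by force
  show ?thesis
  proof (intro exI[of _ K] conjI ballI K(1))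
    fix A assume "A \<in> prime_msets"
    hence "set_mset A \<subseteq> {p. prime p}" by (auto simp: prime_msets_def)
    from K(2)[OF this] show "real (card {B. B \<subseteq># A}) \<le> K * mnorm A powr \<eta>"
      using card_submultisets_le[of A] unfolding mnorm_eq_prod by linarith
  qed
qed

lemma canonical_divisor_bound:
  fixes \<eta> :: real assumes "\<eta> > 0"
  shows "\<exists>K\<ge>1. \<forall>w. w \<noteq> 0 \<longrightarrow> finite {d. canonical d \<and> d dvd w} \<and>
    real (card {d. canonical d \<and> d dvd w}) \<le> K * real_of_int \<bar>nrm w\<bar> powr \<eta>"
proof -
  obtain K where K: "K \<ge> 1" "\<And>A. A \<in> prime_msets \<Longrightarrow> real (card {B. B \<subseteq># A}) \<le> K * mnorm A powr \<eta>"
    using zsqrt2_divisor_bound[OF assms] by blast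
  show ?thesis
  proof (intro exI[of _ K] conjI allI impI K(1))
    fix w :: zsqrt2 assume w: "w \<noteq> 0"
    define A where "A = prime_factorization w"
    have A: "A \<in> prime_msets" by (simp add: A_def prime_factorization_in_prime_msets)
    have sub: "prime_factorization ` {d. canonical d \<and> d dvd w} \<subseteq> {B. B \<subseteq># A}"
      using w by (auto simp: A_def prime_factorization_subset_iff_dvd canonical_nonzero)
    have inj: "inj_on prime_factorization {d. canonical d \<and> d dvd w}"
      by (rule inj_on_inverseI[of _ rep]) (auto simp: rep_prime_factorization)
    show "finite {d. canonical d \<and> d dvd w}"
      using finite_imageD[OF finite_subset[OF sub finite_submultisets] inj] .
    have "card {d. canonical d \<and> d dvd w} \<le> card {B. B \<subseteq># A}"
      using card_mono[OF finite_submultisets sub] card_image[OF inj] by simp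
    also have "real \<dots> \<le> K * mnorm A powr \<eta>" by (rule K(2)[OF A])
    also have "mnorm A = real_of_int \<bar>nrm w\<bar>"
    proof -
      have "normalize (prod_mset A) = normalize w"
        unfolding A_def by (rule prod_mset_prime_factorization_weak[OF w])
      hence "\<bar>nrm (prod_mset A)\<bar> = \<bar>nrm w\<bar>" by (metis nrm_normalize)
      moreover have "nrm (prod_mset A) > 0" using prod_mset_totally_positive[OF A] totally_positive_nrm by blast
      ultimately show ?thesis by (simp add: mnorm_def)
    qed
    finally show "real (card {d. canonical d \<and> d dvd w}) \<le> K * real_of_int \<bar>nrm w\<bar> powr \<eta>"
      by simp
  qed
qed

text \<open>If the norms multiply to k^2, then v and w both divide the rational integer k^2, and k
  <= M. The number of pairs is thus at most M values of k times the square of a divisor count,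
  instead of the order M^2 of all pairs.\<close>

lemma square_pairs_bound:
  fixes \<eta> :: real assumes "\<eta> > 0"
  shows "\<exists>K\<ge>1. \<forall>M\<ge>1. real (card {(v, w). canonical v \<and> canonical w \<and> real_of_int (nrm v) \<le> M \<and>
     real_of_int (nrm w) \<le> M \<and> (\<exists>k. nrm v * nrm w = k\<^sup>2)}) \<le> K * M powr (1 + \<eta>)"
proof -
  \<comment> \<open>The exponent is \<eta> / 8 because k^2 has norm k^4 <= M^4 and its divisor count
    is squared.\<close>
  obtain K where K: "K \<ge> 1" "\<And>w. w \<noteq> 0 \<Longrightarrow> finite {d. canonical d \<and> d dvd w}"
      "\<And>w. w \<noteq> 0 \<Longrightarrow> real (card {d. canonical d \<and> d dvd w}) \<le> K * real_of_int \<bar>nrm w\<bar> powr (\<eta> / 8)"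
    using canonical_divisor_bound[of "\<eta> / 8"] assms by auto
  show ?thesis
  proof (intro exI[of _ "K\<^sup>2"] conjI allI impI)
    show "1 \<le> K\<^sup>2" using K(1) by simp
    fix M :: real assume M: "M \<ge> 1"
    define D where "D = (\<lambda>k::int. {d. canonical d \<and> d dvd ZSqrt2 (k\<^sup>2) 0})"
    have nz: "k \<ge> 1 \<Longrightarrow> ZSqrt2 (k\<^sup>2) 0 \<noteq> 0" for k by (auto simp: zsqrt2_eq_iff)
    let ?S = "{(v, w). canonical v \<and> canonical w \<and> real_of_int (nrm v) \<le> M \<and>
     real_of_int (nrm w) \<le> M \<and> (\<exists>k. nrm v * nrm w = k\<^sup>2)}"
    have sub: "?S \<subseteq> (\<Union>k\<in>{1..\<lfloor>M\<rfloor>}. D k \<times> D k)"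
    proof safe
      fix v w k
      assume A: "canonical v" "canonical w" "real_of_int (nrm v) \<le> M" "real_of_int (nrm w) \<le> M" "nrm v * nrm w = k\<^sup>2"
      have pos: "nrm v > 0" "nrm w > 0" using A canonical_imp_totally_positive totally_positive_nrm by auto
      have dv: "v dvd ZSqrt2 (nrm v * nrm w) 0"
      proof -
        have "ZSqrt2 (nrm v * nrm w) 0 = v * (conj2 v * ZSqrt2 (nrm w) 0)"
          by (simp add: mult.assoc[symmetric] mult_conj2) (simp add: zsqrt2_eq_iff)
        thus ?thesis by simp
      qed
      have dw: "w dvd ZSqrt2 (nrm v * nrm w) 0"
      proof -
        have "ZSqrt2 (nrm v * nrm w) 0 = w * (conj2 w * ZSqrt2 (nrm v) 0)"
          by (simp add: mult.assoc[symmetric] mult_conj2) (simp add: zsqrt2_eq_iff)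
        thus ?thesis by simp
      qed
      have "real_of_int (nrm v) * real_of_int (nrm w) \<le> M * M"
        using A pos M by (intro mult_mono) auto
      hence "real_of_int (\<bar>k\<bar>\<^sup>2) \<le> M\<^sup>2" using A(5) by (metis of_int_mult power2_abs power2_eq_square)
      hence "(real_of_int \<bar>k\<bar>)\<^sup>2 \<le> M\<^sup>2" by simp
      hence "real_of_int \<bar>k\<bar> \<le> M" by (rule power2_le_imp_le) (use M in auto)
      hence kM: "\<bar>k\<bar> \<le> \<lfloor>M\<rfloor>" by (simp add: le_floor_iff)
      have "k \<noteq> 0" using pos A(5) by (metis mult_pos_pos less_irrefl zero_power2)
      hence "\<bar>k\<bar> \<ge> 1" by simp
      hence "\<bar>k\<bar> \<in> {1..\<lfloor>M\<rfloor>}" using kM by simp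
      moreover have "(v, w) \<in> D \<bar>k\<bar> \<times> D \<bar>k\<bar>" using A dv dw by (simp add: D_def)
      ultimately show "(v, w) \<in> (\<Union>k\<in>{1..\<lfloor>M\<rfloor>}. D k \<times> D k)" by blast
    qed
    have fin: "finite (D k)" if "k \<in> {1..\<lfloor>M\<rfloor>}" for k using K(2)[OF nz] that by (simp add: D_def)
    have "card ?S \<le> card (\<Union>k\<in>{1..\<lfloor>M\<rfloor>}. D k \<times> D k)" by (rule card_mono[OF _ sub]) (use fin in auto)
    also have "\<dots> \<le> (\<Sum>k\<in>{1..\<lfloor>M\<rfloor>}. card (D k \<times> D k))" by (rule card_UN_le) auto
    finally have "real (card ?S) \<le> (\<Sum>k\<in>{1..\<lfloor>M\<rfloor>}. real (card (D k)) * real (card (D k)))"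
      by (simp add: card_cartesian_product del: of_nat_sum flip: of_nat_mult of_nat_sum)
    also have "\<dots> \<le> (\<Sum>k\<in>{1..\<lfloor>M\<rfloor>}. (K * M powr (\<eta> / 2)) * (K * M powr (\<eta> / 2)))"
    proof (rule sum_mono)
      fix k assume k: "k \<in> {1..\<lfloor>M\<rfloor>}"
      hence kM: "1 \<le> real_of_int k" "real_of_int k \<le> M" by (simp_all add: le_floor_iff)
      have "real (card (D k)) \<le> K * real_of_int \<bar>nrm (ZSqrt2 (k\<^sup>2) 0)\<bar> powr (\<eta> / 8)"
        unfolding D_def using k by (intro K(3) nz) auto
      also have "real_of_int \<bar>nrm (ZSqrt2 (k\<^sup>2) 0)\<bar> = real_of_int k ^ 4" by (simp add: nrm_def)
      also have "K * (real_of_int k ^ 4) powr (\<eta> / 8) \<le> K * (M ^ 4) powr (\<eta> / 8)"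
        using K(1) kM assms by (intro mult_left_mono powr_mono2 power_mono) auto
      also have "(M ^ 4) powr (\<eta> / 8) = M powr (\<eta> / 2)"
      proof -
        have "(M ^ 4) powr (\<eta> / 8) = (M powr 4) powr (\<eta> / 8)" using M by simp
        also have "\<dots> = M powr (4 * (\<eta> / 8))" by (rule powr_powr)
        also have "4 * (\<eta> / 8) = \<eta> / 2" by simp
        finally show ?thesis .
      qed
      finally have "real (card (D k)) \<le> K * M powr (\<eta> / 2)" .
      thus "real (card (D k)) * real (card (D k)) \<le> (K * M powr (\<eta> / 2)) * (K * M powr (\<eta> / 2))"
        by (intro mult_mono) auto
    qed
    also have "\<dots> = real (nat \<lfloor>M\<rfloor>) * (K\<^sup>2 * (M powr (\<eta> / 2) * M powr (\<eta> / 2)))"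
      by (simp add: power2_eq_square)
    also have "M powr (\<eta> / 2) * M powr (\<eta> / 2) = M powr \<eta>" by (simp add: powr_add[symmetric])
    also have "real (nat \<lfloor>M\<rfloor>) * (K\<^sup>2 * M powr \<eta>) \<le> M * (K\<^sup>2 * M powr \<eta>)"
      using M by (intro mult_right_mono) auto
    also have "\<dots> = K\<^sup>2 * M powr (1 + \<eta>)" using M by (simp add: powr_add)
    finally show "real (card ?S) \<le> K\<^sup>2 * M powr (1 + \<eta>)" .
  qed
qed

section \<open>Moebius function, von Mangoldt function and Vaughan's identity\<close>

definition mu :: "zsqrt2 multiset \<Rightarrow> real" where
  "mu A = (if \<forall>p. count A p \<le> 1 then (-1) ^ size A else 0)"

lemma abs_mu_le: "\<bar>mu A\<bar> \<le> 1"
  by (simp add: mu_def)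

text \<open>Subsets with and without a fixed element cancel in pairs.\<close>

lemma sum_Pow_alternating:
  assumes "finite S" "S \<noteq> {}" shows "(\<Sum>T\<in>Pow S. (-1::real) ^ card T) = 0"
proof -
  obtain x S' where S: "S = insert x S'" "x \<notin> S'" using assms(2) by (metis Set.set_insert all_not_in_conv)
  have fin: "finite S'" using assms S by simp
  have inj: "inj_on (insert x) (Pow S')"
  proof (rule inj_onI)
    fix T U assume "T \<in> Pow S'" "U \<in> Pow S'" "insert x T = insert x U"
    thus "T = U" using S(2) by (metis Diff_insert_absorb PowD subsetD)
  qed
  have disj: "Pow S' \<inter> insert x ` Pow S' = {}" using S(2) by auto
  have "(\<Sum>T\<in>Pow S. (-1::real) ^ card T) = (\<Sum>T\<in>Pow S'. (-1) ^ card T) + (\<Sum>T\<in>insert x ` Pow S'. (-1) ^ card T)"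
    unfolding S(1) Pow_insert by (rule sum.union_disjoint) (use fin disj in auto)
  also have "(\<Sum>T\<in>insert x ` Pow S'. (-1::real) ^ card T) = (\<Sum>T\<in>Pow S'. (-1) ^ card (insert x T))"
    by (simp add: sum.reindex[OF inj])
  also have "\<dots> = (\<Sum>T\<in>Pow S'. - ((-1) ^ card T))"
  proof (intro sum.cong refl)
    fix T assume "T \<in> Pow S'"
    hence "finite T" "x \<notin> T" using fin S(2) finite_subset by auto
    thus "(-1::real) ^ card (insert x T) = - ((-1) ^ card T)" by simp
  qed
  finally show ?thesis by (simp add: sum_negf)
qed

text \<open>Only submultisets without repetition count; they correspond to the subsets of the
  support.\<close>

lemma sum_mu: "(\<Sum>B | B \<subseteq># A. mu B) = (if A = {#} then 1 else 0)"
proof -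
  have bij: "bij_betw mset_set (Pow (set_mset A)) {B. B \<subseteq># A \<and> (\<forall>p. count B p \<le> 1)}"
  proof (rule bij_betwI[where g = set_mset])
    show "mset_set \<in> Pow (set_mset A) \<rightarrow> {B. B \<subseteq># A \<and> (\<forall>p. count B p \<le> 1)}"
    proof safe
      fix T assume T: "T \<subseteq> set_mset A"
      hence fin: "finite T" by (rule finite_subset) simp
      show "mset_set T \<subseteq># A" using T fin
        by (auto simp: subseteq_mset_def count_mset_set' Suc_le_eq)
      fix p show "count (mset_set T) p \<le> 1" by (simp add: count_mset_set')
    qed
    show "set_mset \<in> {B. B \<subseteq># A \<and> (\<forall>p. count B p \<le> 1)} \<rightarrow> Pow (set_mset A)"
      by (auto dest: mset_subset_eqD)
    fix T assume "T \<in> Pow (set_mset A)"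
    hence "finite T" using finite_subset by auto
    thus "set_mset (mset_set T) = T" by simp
  next
    fix B assume B: "B \<in> {B. B \<subseteq># A \<and> (\<forall>p. count B p \<le> 1)}"
    show "mset_set (set_mset B) = B"
    proof (rule multiset_eqI)
      fix p
      have "count B p \<le> 1" using B by auto
      thus "count (mset_set (set_mset B)) p = count B p"
      proof (cases "p \<in># B")
        case True
        hence "count B p > 0" by simp
        hence "count B p = 1" using \<open>count B p \<le> 1\<close> by linarith
        thus ?thesis using True by simp
      qed (simp add: not_in_iff)
    qed
  qed
  have "(\<Sum>B | B \<subseteq># A. mu B) = (\<Sum>B | B \<subseteq># A \<and> (\<forall>p. count B p \<le> 1). (-1) ^ size B)"
    unfolding mu_def by (subst sum.inter_filter[symmetric]) (auto simp: finite_submultisets)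
  also have "\<dots> = (\<Sum>T\<in>Pow (set_mset A). (-1) ^ size (mset_set T))"
    by (rule sum.reindex_bij_betw[OF bij, symmetric])
  also have "\<dots> = (\<Sum>T\<in>Pow (set_mset A). (-1) ^ card T)" by simp
  also have "\<dots> = (if A = {#} then 1 else 0)"
    using sum_Pow_alternating[of "set_mset A"] by auto
  finally show ?thesis .
qed

lemma sum_mset_image_multiplicity:
  "(\<Sum>p\<in>#A. f p) = (\<Sum>p\<in>set_mset A. real (count A p) * f p)"
proof (induction A)
  case (add x A)
  have "(\<Sum>p\<in>set_mset (add_mset x A). real (count (add_mset x A) p) * f p) =
      (\<Sum>p\<in>insert x (set_mset A). real (count A p) * f p + (if p = x then f p else 0))"
    by (intro sum.cong) (auto simp: algebra_simps)
  also have "\<dots> = (\<Sum>p\<in>insert x (set_mset A). real (count A p) * f p) + f x"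
    by (simp only: sum.distrib) (simp add: sum.delta)
  also have "(\<Sum>p\<in>insert x (set_mset A). real (count A p) * f p) = (\<Sum>p\<in>set_mset A. real (count A p) * f p)"
    by (rule sum.mono_neutral_right) (auto simp: not_in_iff)
  finally show ?case using add by simp
qed auto

lemma ln_mnorm:
  assumes "A \<in> prime_msets" shows "ln (mnorm A) = (\<Sum>p\<in>#A. ln (of_int (nrm p)))"
  using assms
proof (induction A)
  case (add p A)
  hence "nrm p > 0" using prime_canonical(3)[of p] by auto
  thus ?case using add mnorm_pos[of A] by (simp add: mnorm_add_mset ln_mult)
qed auto

text \<open>A prime of multiplicity e in \<open>A\<close> contributes through its powers with
  exponents 1 to e, hence e times the logarithm of its norm.\<close>

lemma sum_lam:
  assumes A: "A \<in> prime_msets" shows "(\<Sum>B | B \<subseteq># A. lam B) = ln (mnorm A)"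
proof -
  define T where "T = Sigma (set_mset A) (\<lambda>p. {1..count A p})"
  have bij: "bij_betw (\<lambda>(p, k). replicate_mset k p) T {B. B \<subseteq># A \<and> card (set_mset B) = 1}"
    unfolding bij_betw_def
  proof
    show "inj_on (\<lambda>(p, k). replicate_mset k p) T"
    proof (rule inj_onI, clarify)
      fix p k q l assume "(p, k) \<in> T" "(q, l) \<in> T" and e: "replicate_mset k p = replicate_mset l q"
      hence "k \<ge> 1" "l \<ge> 1" by (auto simp: T_def)
      moreover have "k = l" using e by (metis size_replicate_mset)
      moreover have "set_mset (replicate_mset k p) = set_mset (replicate_mset l q)" using e by simp
      ultimately show "p = q \<and> k = l" by (auto split: if_splits)
    qed
    show "(\<lambda>(p, k). replicate_mset k p) ` T = {B. B \<subseteq># A \<and> card (set_mset B) = 1}"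
    proof (intro equalityI subsetI)
      fix B assume B: "B \<in> {B. B \<subseteq># A \<and> card (set_mset B) = 1}"
      then obtain p where p: "set_mset B = {p}" by (auto simp: card_1_singleton_iff)
      have "B = replicate_mset (count B p) p"
        using p by (intro multiset_eqI) (auto simp: not_in_iff[symmetric])
      moreover have "count B p \<le> count A p" "count B p \<ge> 1" "p \<in># A"
        using B p by (auto simp: mset_subset_eq_count count_greater_eq_one_iff dest: mset_subset_eqD)
      ultimately show "B \<in> (\<lambda>(p, k). replicate_mset k p) ` T"
        by (intro image_eqI[of _ _ "(p, count B p)"]) (auto simp: T_def)
    qed (auto simp: T_def count_le_replicate_mset_subset_eq[symmetric])
  qed
  have "(\<Sum>B | B \<subseteq># A. lam B) = (\<Sum>B | B \<subseteq># A \<and> card (set_mset B) = 1. lam B)"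
    by (rule sum.mono_neutral_right) (auto simp: finite_submultisets lam_def)
  also have "\<dots> = (\<Sum>(p, k)\<in>T. lam (replicate_mset k p))"
    using sum.reindex_bij_betw[OF bij, of lam] by (simp add: case_prod_unfold)
  also have "\<dots> = (\<Sum>(p, k)\<in>T. ln (of_int (nrm p)))"
    by (intro sum.cong refl) (auto simp: T_def lam_def)
  also have "\<dots> = (\<Sum>p\<in>set_mset A. \<Sum>k\<in>{1..count A p}. ln (of_int (nrm p)))"
    unfolding T_def by (rule sum.Sigma[symmetric]) auto
  also have "\<dots> = (\<Sum>p\<in>#A. ln (of_int (nrm p)))"
    by (simp add: sum_mset_image_multiplicity)
  finally show ?thesis using ln_mnorm[OF A] by simp
qed

lemma lam_nonneg: "A \<in> prime_msets \<Longrightarrow> lam A \<ge> 0"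
  using prime_canonical(3) by (force simp: lam_def prime_msets_def intro!: sum_nonneg)

lemma lam_le:
  assumes "A \<in> prime_msets" shows "lam A \<le> ln (mnorm A)"
proof -
  have "lam A \<le> (\<Sum>B | B \<subseteq># A. lam B)"
    using assms finite_submultisets[of A] by (intro member_le_sum) (auto intro: lam_nonneg prime_msets_subset)
  thus ?thesis using sum_lam[OF assms] by simp
qed

text \<open>The convolution with 1 of the part of \<open>lam\<close> beyond \<open>y\<close>. It
  vanishes up to norm \<open>y\<close> and lies between 0 and the logarithm of the norm, as a type
  II coefficient should.\<close>

definition lam_tail :: "real \<Rightarrow> zsqrt2 multiset \<Rightarrow> real" where
  "lam_tail y E = (\<Sum>C | C \<subseteq># E. if mnorm C \<le> y then 0 else lam C)"

lemma lam_tail_bounds: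
  assumes "E \<in> prime_msets" shows "0 \<le> lam_tail y E" "lam_tail y E \<le> ln (mnorm E)"
proof -
  show "0 \<le> lam_tail y E" unfolding lam_tail_def
    using assms by (intro sum_nonneg) (auto intro: lam_nonneg prime_msets_subset)
  have "lam_tail y E \<le> (\<Sum>C | C \<subseteq># E. lam C)" unfolding lam_tail_def
    using assms by (intro sum_mono) (auto intro: lam_nonneg prime_msets_subset)
  thus "lam_tail y E \<le> ln (mnorm E)" using sum_lam[OF assms] by simp
qed

lemma mnorm_mono:
  assumes "E \<in> prime_msets" "C \<subseteq># E" shows "mnorm C \<le> mnorm E"
proof -
  have "mnorm E = mnorm C * mnorm (E - C)" using assms(2) by (metis mnorm_union subset_mset.add_diff_inverse)
  moreover have "mnorm (E - C) \<ge> 1" using assms by (intro mnorm_ge_1) (auto intro: prime_msets_subset)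
  moreover have "mnorm C > 0" using assms by (intro mnorm_pos) (auto intro: prime_msets_subset)
  ultimately show ?thesis by simp
qed

lemma lam_tail_eq_0:
  assumes "E \<in> prime_msets" "mnorm E \<le> y" shows "lam_tail y E = 0"
  unfolding lam_tail_def
  by (rule sum.neutral) (use mnorm_mono[OF assms(1)] assms(2) in force)

lemma sum_submultisets_rearrange:
  fixes h :: "zsqrt2 multiset \<Rightarrow> zsqrt2 multiset \<Rightarrow> complex"
  shows "(\<Sum>A\<in>msets_upto x. \<Sum>B | B \<subseteq># A. h B (A - B)) =
    (\<Sum>B\<in>msets_upto x. \<Sum>C\<in>msets_upto (x / mnorm B). h B C)"
proof -
  have "(\<Sum>A\<in>msets_upto x. \<Sum>B | B \<subseteq># A. h B (A - B)) =
     (\<Sum>(A, B)\<in>Sigma (msets_upto x) (\<lambda>A. {B. B \<subseteq># A}). h B (A - B))"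
    by (rule sum.Sigma) (auto simp: finite_submultisets)
  also have "\<dots> = (\<Sum>(B, C)\<in>Sigma (msets_upto x) (\<lambda>B. msets_upto (x / mnorm B)). h B C)"
  proof (rule sum.reindex_bij_witness[where i = "\<lambda>(B, C). (B + C, B)" and j = "\<lambda>(A, B). (B, A - B)"])
    fix p assume "p \<in> Sigma (msets_upto x) (\<lambda>A. {B. B \<subseteq># A})"
    then obtain A B where p: "p = (A, B)" "A \<in> prime_msets" "mnorm A \<le> x" "B \<subseteq># A"
      by (auto simp: msets_upto_def)
    have "mnorm A = mnorm B * mnorm (A - B)" using p(4) by (metis mnorm_union subset_mset.add_diff_inverse)
    moreover have "B \<in> prime_msets" "A - B \<in> prime_msets" using p by (auto intro: prime_msets_subset)
    moreover have "mnorm B \<le> x" using mnorm_mono[OF p(2,4)] p(3) by linarith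
    ultimately show "(case p of (A, B) \<Rightarrow> (B, A - B)) \<in> Sigma (msets_upto x) (\<lambda>B. msets_upto (x / mnorm B))"
      using p mnorm_pos[of B] by (auto simp: msets_upto_def field_simps)
  next
    fix q assume "q \<in> Sigma (msets_upto x) (\<lambda>B. msets_upto (x / mnorm B))"
    then obtain B C where q: "q = (B, C)" "B \<in> prime_msets" "mnorm B \<le> x" "C \<in> prime_msets" "mnorm C \<le> x / mnorm B"
      by (auto simp: msets_upto_def)
    have "mnorm B * mnorm C \<le> x" using q mnorm_pos[of B] by (simp add: field_simps)
    thus "(case q of (B, C) \<Rightarrow> (B + C, B)) \<in> Sigma (msets_upto x) (\<lambda>A. {B. B \<subseteq># A})"
      using q by (auto simp: msets_upto_def mnorm_union)
  qed (auto simp: msets_upto_def)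
  also have "\<dots> = (\<Sum>B\<in>msets_upto x. \<Sum>C\<in>msets_upto (x / mnorm B). h B C)"
    by (rule sum.Sigma[symmetric]) auto
  finally show ?thesis .
qed

text \<open>The logarithm is the convolution of 1 with \<open>L\<close> plus
  \<open>lam_tail\<close>. So the two sums with \<open>M1\<close> and a logarithm or
  \<open>L\<close> combine to \<open>M1\<close> convolved with \<open>lam_tail\<close>, and the sum
  with \<open>M2\<close> completes this to \<open>mu\<close> convolved with \<open>lam_tail\<close>.
  As \<open>mu\<close> inverts convolution with 1, what remains is the part of \<open>lam\<close>
  beyond \<open>y\<close>.\<close>

lemma vaughan_pointwise:
  fixes y :: real
  assumes A: "A \<in> prime_msets"
  defines "L \<equiv> \<lambda>C. if mnorm C \<le> y then lam C else 0"
    and "M1 \<equiv> \<lambda>B. if mnorm B \<le> y then mu B else 0" and "M2 \<equiv> \<lambda>B. if mnorm B \<le> y then 0 else mu B"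
  shows "lam A = L A + (\<Sum>B | B \<subseteq># A. M1 B * ln (mnorm (A - B)))
     - (\<Sum>B | B \<subseteq># A. M1 B * (\<Sum>C | C \<subseteq># A - B. L C)) + (\<Sum>B | B \<subseteq># A. M2 B * lam_tail y (A - B))"
proof -
  define L2 where "L2 = (\<lambda>C. if mnorm C \<le> y then 0 else lam C)"
  have ln: "ln (mnorm (A - B)) = (\<Sum>C | C \<subseteq># A - B. L C) + lam_tail y (A - B)" if "B \<subseteq># A" for B
  proof -
    have "A - B \<in> prime_msets" using A by (auto intro: prime_msets_subset)
    hence "ln (mnorm (A - B)) = (\<Sum>C | C \<subseteq># A - B. lam C)" using sum_lam by simp
    also have "\<dots> = (\<Sum>C | C \<subseteq># A - B. L C + L2 C)" by (intro sum.cong) (auto simp: L_def L2_def)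
    finally show ?thesis by (simp add: sum.distrib lam_tail_def L2_def)
  qed
  have "(\<Sum>B | B \<subseteq># A. M1 B * ln (mnorm (A - B))) - (\<Sum>B | B \<subseteq># A. M1 B * (\<Sum>C | C \<subseteq># A - B. L C))
     + (\<Sum>B | B \<subseteq># A. M2 B * lam_tail y (A - B)) = (\<Sum>B | B \<subseteq># A. mu B * lam_tail y (A - B))"
    unfolding sum_subtractf[symmetric] sum.distrib[symmetric]
    by (intro sum.cong refl) (auto simp: ln M1_def M2_def algebra_simps)
  also have "\<dots> = (\<Sum>B | B \<subseteq># A. \<Sum>C | C \<in> {C. C \<subseteq># A} \<and> B + C \<subseteq># A. mu B * L2 C)"
  proof (intro sum.cong refl)
    fix B assume B: "B \<in> {B. B \<subseteq># A}"
    have "C \<subseteq># A - B \<longleftrightarrow> C \<in> {C. C \<subseteq># A} \<and> B + C \<subseteq># A" for C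
    proof -
      have "C \<subseteq># A - B \<longleftrightarrow> B + C \<subseteq># A" 
        using B by (metis add.commute mem_Collect_eq subset_mset.le_diff_conv2)
      moreover have "B + C \<subseteq># A \<Longrightarrow> C \<subseteq># A" 
        by (metis mset_subset_eq_add_right subset_mset.order_trans)
      ultimately show ?thesis by blast
    qed
    thus "mu B * lam_tail y (A - B) = (\<Sum>C | C \<in> {C. C \<subseteq># A} \<and> B + C \<subseteq># A. mu B * L2 C)"
      by (simp add: lam_tail_def L2_def sum_distrib_left)
  qed
  also have "\<dots> = (\<Sum>C | C \<subseteq># A. \<Sum>B | B \<in> {B. B \<subseteq># A} \<and> B + C \<subseteq># A. mu B * L2 C)"
    by (rule sum.swap_restrict) (auto simp: finite_submultisets)
  also have "\<dots> = (\<Sum>C | C \<subseteq># A. L2 C * (if A - C = {#} then 1 else 0))"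
  proof (intro sum.cong refl)
    fix C assume C: "C \<in> {B. B \<subseteq># A}"
    have "B \<subseteq># A - C \<longleftrightarrow> B \<in> {B. B \<subseteq># A} \<and> B + C \<subseteq># A" for B
    proof -
      have "B \<subseteq># A - C \<longleftrightarrow> B + C \<subseteq># A" 
        using C by (metis mem_Collect_eq subset_mset.le_diff_conv2)
      moreover have "B + C \<subseteq># A \<Longrightarrow> B \<subseteq># A" 
        by (metis mset_subset_eq_add_left subset_mset.order_trans)
      ultimately show ?thesis by blast
    qed
    hence "(\<Sum>B | B \<in> {B. B \<subseteq># A} \<and> B + C \<subseteq># A. mu B * L2 C) = (\<Sum>B | B \<subseteq># A - C. mu B) * L2 C"
      by (simp add: sum_distrib_right)
    thus "(\<Sum>B | B \<in> {B. B \<subseteq># A} \<and> B + C \<subseteq># A. mu B * L2 C) = L2 C * (if A - C = {#} then 1 else 0)"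
      using sum_mu[of "A - C"] by simp
  qed
  also have "\<dots> = (\<Sum>C | C \<subseteq># A. if C = A then L2 C else 0)"
  proof (intro sum.cong refl)
    fix C assume C: "C \<in> {B. B \<subseteq># A}"
    have "A - C = {#} \<longleftrightarrow> C = A" using C 
      by (metis Diff_eq_empty_iff_mset mem_Collect_eq subset_mset.antisym subset_mset.order_refl)
    thus "L2 C * (if A - C = {#} then 1 else 0) = (if C = A then L2 C else 0)" by simp
  qed
  also have "\<dots> = L2 A" using finite_submultisets[of A] by (simp add: sum.delta)
  finally have "(\<Sum>B | B \<subseteq># A. M1 B * ln (mnorm (A - B))) - (\<Sum>B | B \<subseteq># A. M1 B * (\<Sum>C | C \<subseteq># A - B. L C))
     + (\<Sum>B | B \<subseteq># A. M2 B * lam_tail y (A - B)) = L2 A" .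
  moreover have "lam A = L A + L2 A" by (simp add: L_def L2_def)
  ultimately show ?thesis by linarith
qed

lemma sum_convolution:
  fixes c d :: "zsqrt2 multiset \<Rightarrow> real" and G :: "zsqrt2 multiset \<Rightarrow> complex"
  shows "(\<Sum>A\<in>msets_upto x. of_real (\<Sum>B | B \<subseteq># A. c B * d (A - B)) * G A) =
     (\<Sum>B\<in>msets_upto x. of_real (c B) * (\<Sum>C\<in>msets_upto (x / mnorm B). of_real (d C) * G (B + C)))"
proof -
  have "(\<Sum>A\<in>msets_upto x. of_real (\<Sum>B | B \<subseteq># A. c B * d (A - B)) * G A) =
    (\<Sum>A\<in>msets_upto x. \<Sum>B | B \<subseteq># A. of_real (c B) * (of_real (d (A - B)) * G (B + (A - B))))"
  proof (intro sum.cong refl)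
    fix A assume "A \<in> msets_upto x"
    have "of_real (\<Sum>B | B \<subseteq># A. c B * d (A - B)) * G A = (\<Sum>B | B \<subseteq># A. of_real (c B * d (A - B)) * G A)"
      by (simp only: of_real_sum sum_distrib_right)
    also have "\<dots> = (\<Sum>B | B \<subseteq># A. of_real (c B) * (of_real (d (A - B)) * G (B + (A - B))))"
      by (intro sum.cong refl) simp
    finally show "of_real (\<Sum>B | B \<subseteq># A. c B * d (A - B)) * G A =
      (\<Sum>B | B \<subseteq># A. of_real (c B) * (of_real (d (A - B)) * G (B + (A - B))))" .
  qed
  also have "\<dots> = (\<Sum>B\<in>msets_upto x. \<Sum>C\<in>msets_upto (x / mnorm B). of_real (c B) * (of_real (d C) * G (B + C)))"
    by (rule sum_submultisets_rearrange)
  finally show ?thesis by (simp only: sum_distrib_left)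
qed

lemma sum_convolution_one:
  fixes c :: "zsqrt2 multiset \<Rightarrow> real" and G :: "zsqrt2 multiset \<Rightarrow> complex"
  shows "(\<Sum>A\<in>msets_upto x. of_real (\<Sum>B | B \<subseteq># A. c B) * G A) =
     (\<Sum>B\<in>msets_upto x. of_real (c B) * (\<Sum>C\<in>msets_upto (x / mnorm B). G (B + C)))"
  using sum_convolution[of c "\<lambda>_. 1" G x] by (simp only: mult_1_right mult_1_left of_real_1)

text \<open>The first sum is short. In the second and third the innermost variable runs freely up to
  a bound, with at most a logarithmic weight (type I). In the last one the coefficients vanish
  unless both variables exceed \<open>y\<close> (type II).\<close>

theorem vaughan_identity:
  fixes F :: "zsqrt2 multiset \<Rightarrow> complex" and y x :: real
  defines "L \<equiv> \<lambda>C. if mnorm C \<le> y then lam C else 0"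
    and "M1 \<equiv> \<lambda>B. if mnorm B \<le> y then mu B else 0" and "M2 \<equiv> \<lambda>B. if mnorm B \<le> y then 0 else mu B"
  shows "(\<Sum>A\<in>msets_upto x. of_real (lam A) * F A) =
     (\<Sum>A\<in>msets_upto x. of_real (L A) * F A)
   + (\<Sum>B\<in>msets_upto x. of_real (M1 B) * (\<Sum>C\<in>msets_upto (x / mnorm B). of_real (ln (mnorm C)) * F (B + C)))
   - (\<Sum>B\<in>msets_upto x. of_real (M1 B) * (\<Sum>C\<in>msets_upto (x / mnorm B). of_real (L C) *
        (\<Sum>D\<in>msets_upto (x / mnorm B / mnorm C). F (B + C + D))))
   + (\<Sum>B\<in>msets_upto x. of_real (M2 B) * (\<Sum>E\<in>msets_upto (x / mnorm B). of_real (lam_tail y E) * F (B + E)))"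
proof -
  have "(\<Sum>A\<in>msets_upto x. of_real (lam A) * F A) =
     (\<Sum>A\<in>msets_upto x. of_real (L A) * F A + of_real (\<Sum>B | B \<subseteq># A. M1 B * ln (mnorm (A - B))) * F A
     - of_real (\<Sum>B | B \<subseteq># A. M1 B * (\<Sum>C | C \<subseteq># A - B. L C)) * F A
     + of_real (\<Sum>B | B \<subseteq># A. M2 B * lam_tail y (A - B)) * F A)"
  proof (intro sum.cong refl)
    fix A assume "A \<in> msets_upto x"
    hence A: "A \<in> prime_msets" by (simp add: msets_upto_def)
    have p: "lam A = L A + (\<Sum>B | B \<subseteq># A. M1 B * ln (mnorm (A - B)))
     - (\<Sum>B | B \<subseteq># A. M1 B * (\<Sum>C | C \<subseteq># A - B. L C)) + (\<Sum>B | B \<subseteq># A. M2 B * lam_tail y (A - B))"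
      unfolding L_def M1_def M2_def by (rule vaughan_pointwise[OF A])
    show "of_real (lam A) * F A = of_real (L A) * F A + of_real (\<Sum>B | B \<subseteq># A. M1 B * ln (mnorm (A - B))) * F A
     - of_real (\<Sum>B | B \<subseteq># A. M1 B * (\<Sum>C | C \<subseteq># A - B. L C)) * F A
     + of_real (\<Sum>B | B \<subseteq># A. M2 B * lam_tail y (A - B)) * F A"
      by (subst p) (simp only: of_real_add of_real_diff distrib_right left_diff_distrib)
  qed
  also have "\<dots> = (\<Sum>A\<in>msets_upto x. of_real (L A) * F A)
    + (\<Sum>A\<in>msets_upto x. of_real (\<Sum>B | B \<subseteq># A. M1 B * ln (mnorm (A - B))) * F A)
    - (\<Sum>A\<in>msets_upto x. of_real (\<Sum>B | B \<subseteq># A. M1 B * (\<Sum>C | C \<subseteq># A - B. L C)) * F A)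
    + (\<Sum>A\<in>msets_upto x. of_real (\<Sum>B | B \<subseteq># A. M2 B * lam_tail y (A - B)) * F A)"
    by (simp only: sum.distrib sum_subtractf)
  also have "(\<Sum>A\<in>msets_upto x. of_real (\<Sum>B | B \<subseteq># A. M1 B * ln (mnorm (A - B))) * F A) =
    (\<Sum>B\<in>msets_upto x. of_real (M1 B) * (\<Sum>C\<in>msets_upto (x / mnorm B). of_real (ln (mnorm C)) * F (B + C)))"
    by (rule sum_convolution)
  also have "(\<Sum>A\<in>msets_upto x. of_real (\<Sum>B | B \<subseteq># A. M2 B * lam_tail y (A - B)) * F A) =
    (\<Sum>B\<in>msets_upto x. of_real (M2 B) * (\<Sum>E\<in>msets_upto (x / mnorm B). of_real (lam_tail y E) * F (B + E)))"
    by (rule sum_convolution)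
  also have "(\<Sum>A\<in>msets_upto x. of_real (\<Sum>B | B \<subseteq># A. M1 B * (\<Sum>C | C \<subseteq># A - B. L C)) * F A) =
    (\<Sum>B\<in>msets_upto x. of_real (M1 B) * (\<Sum>E\<in>msets_upto (x / mnorm B). of_real (\<Sum>C | C \<subseteq># E. L C) * F (B + E)))"
    by (rule sum_convolution)
  also have "\<dots> = (\<Sum>B\<in>msets_upto x. of_real (M1 B) * (\<Sum>C\<in>msets_upto (x / mnorm B). of_real (L C) *
        (\<Sum>D\<in>msets_upto (x / mnorm B / mnorm C). F (B + (C + D)))))"
    by (simp only: sum_convolution_one)
  finally show ?thesis by (simp only: add.assoc)
qed

section \<open>Polya--Vinogradov\<close>

text \<open>The additive character exp(2 pi i t).\<close>

definition e2 :: "real \<Rightarrow> complex" where "e2 t = cis (2 * pi * t)"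

lemma e2_add: "e2 (x + y) = e2 x * e2 y"
  by (simp add: e2_def cis_mult distrib_left)

lemma norm_e2 [simp]: "cmod (e2 x) = 1" by (simp add: e2_def)

lemma e2_int [simp]: "e2 (of_int n) = 1" by (simp add: e2_def)

lemma e2_add_int: "e2 (x + of_int n) = e2 x" by (simp add: e2_add)

lemma e2_0 [simp]: "e2 0 = 1" by (simp add: e2_def)

lemma e2_eqI: "x - y = of_int n \<Longrightarrow> e2 x = e2 y"
  using e2_add_int[of y n] by (simp add: algebra_simps)

lemma e2_frac_cong:
  assumes "[a = b] (mod s)" "s \<noteq> 0" shows "e2 (of_int a / of_int s) = e2 (of_int b / of_int s)"
proof -
  obtain k where "a - b = s * k" using assms(1) by (auto simp: cong_iff_dvd_diff dvd_def)
  hence "real_of_int a - real_of_int b = real_of_int s * real_of_int k" by (metis of_int_diff of_int_mult)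
  thus ?thesis using assms(2) by (intro e2_eqI[of _ _ k]) (simp add: diff_divide_distrib[symmetric])
qed

lemma sum_int_telescope:
  fixes f :: "int \<Rightarrow> 'a::ab_group_add" assumes "a \<le> b"
  shows "(\<Sum>x\<in>{a..<b}. f (x + 1) - f x) = f b - f a"
  using assms
proof (induction b rule: int_ge_induct)
  case (step i)
  have "{a..<i + 1} = insert i {a..<i}" using step by auto
  thus ?case using step by simp
qed simp

text \<open>A weak form of sin(pi x) >= 2 x that suffices here: up to the angle pi/3 the sine has
  derivative at least 1/2, and from there to pi/2 it is at least 1/2.\<close>

lemma sin_pi_ge:
  assumes "0 \<le> \<alpha>" "\<alpha> \<le> 1 / 2" shows "sin (pi * \<alpha>) \<ge> \<alpha>"
proof (cases "pi * \<alpha> \<le> pi / 3")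
  case True
  have "sin 0 - 0 / 2 \<le> sin (pi * \<alpha>) - (pi * \<alpha>) / 2"
  proof (rule DERIV_nonneg_imp_nondecreasing[where f = "\<lambda>x. sin x - x / 2"])
    show "0 \<le> pi * \<alpha>" using assms by simp
    fix x assume x: "0 \<le> x" "x \<le> pi * \<alpha>"
    have "x \<le> pi / 3" using x True by linarith
    hence "cos (pi / 3) \<le> cos x" using x by (intro cos_monotone_0_pi_le) auto
    hence "0 \<le> cos x - 1 / 2" by (simp add: cos_60)
    moreover have "((\<lambda>x. sin x - x / 2) has_real_derivative cos x - 1 / 2) (at x)"
      by (auto intro!: derivative_eq_intros)
    ultimately show "\<exists>y. ((\<lambda>x. sin x - x / 2) has_real_derivative y) (at x) \<and> 0 \<le> y" by blast
  qed
  hence "pi * \<alpha> / 2 \<le> sin (pi * \<alpha>)" by simp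
  moreover have "2 * \<alpha> \<le> pi * \<alpha>" using assms pi_ge_two by (intro mult_right_mono) auto
  ultimately show ?thesis by linarith
next
  case False
  have "pi * \<alpha> \<le> pi / 2" using assms(2) mult_left_mono[of \<alpha> "1 / 2" pi] by simp
  hence "sin (pi / 3) \<le> sin (pi * \<alpha>)"
    using False pi_gt_zero by (intro sin_monotone_2pi_le) linarith+
  moreover have "1 / 2 \<le> sin (pi / 3)" using real_le_rsqrt[of 1 3] by (simp add: sin_60)
  ultimately show ?thesis using assms by linarith
qed

lemma sin_pi_ge_min:
  assumes "0 \<le> \<alpha>" "\<alpha> \<le> 1" shows "sin (pi * \<alpha>) \<ge> min \<alpha> (1 - \<alpha>)"
proof (cases "\<alpha> \<le> 1 / 2")
  case True thus ?thesis using sin_pi_ge[of \<alpha>] assms by simp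
next
  case False
  have "sin (pi * (1 - \<alpha>)) = sin (pi * \<alpha>)" by (simp add: right_diff_distrib sin_diff)
  thus ?thesis using sin_pi_ge[of "1 - \<alpha>"] assms False by simp
qed

lemma norm_e2_minus_1: "cmod (e2 \<alpha> - 1) = 2 * \<bar>sin (pi * \<alpha>)\<bar>"
proof -
  have "(cmod (e2 \<alpha> - 1))\<^sup>2 = (cos (2 * (pi * \<alpha>)) - 1)\<^sup>2 + (sin (2 * (pi * \<alpha>)))\<^sup>2"
    by (simp add: e2_def cmod_power2 mult.assoc)
  also have "\<dots> = 2 - 2 * cos (2 * (pi * \<alpha>))"
    using sin_cos_squared_add[of "2 * (pi * \<alpha>)"] by (simp add: power2_eq_square algebra_simps)
  also have "\<dots> = (2 * \<bar>sin (pi * \<alpha>)\<bar>)\<^sup>2"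
    unfolding cos_double_sin[of "pi * \<alpha>"] power_mult_distrib power2_abs by simp
  finally show ?thesis by (rule power2_eq_imp_eq) auto
qed

text \<open>Geometric series: multiplication by e2 \<alpha> - 1, of modulus 2 sin(pi \<alpha>),
  telescopes to a difference of two unimodular numbers.\<close>

lemma norm_exp_sum_le:
  assumes "0 < \<alpha>" "\<alpha> < 1"
  shows "cmod (\<Sum>x\<in>{a..<b::int}. e2 (\<alpha> * of_int x)) \<le> 1 / min \<alpha> (1 - \<alpha>)"
proof (cases "a \<le> b")
  case True
  have m: "min \<alpha> (1 - \<alpha>) > 0" using assms by simp
  have s: "sin (pi * \<alpha>) \<ge> min \<alpha> (1 - \<alpha>)" using sin_pi_ge_min[of \<alpha>] assms by simp
  have "(e2 \<alpha> - 1) * (\<Sum>x\<in>{a..<b}. e2 (\<alpha> * of_int x)) =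
      (\<Sum>x\<in>{a..<b}. e2 (\<alpha> * of_int (x + 1)) - e2 (\<alpha> * of_int x))"
    by (simp add: sum_distrib_left distrib_left e2_add left_diff_distrib mult.commute)
  also have "\<dots> = e2 (\<alpha> * of_int b) - e2 (\<alpha> * of_int a)" by (rule sum_int_telescope[OF True])
  finally have "cmod (e2 \<alpha> - 1) * cmod (\<Sum>x\<in>{a..<b}. e2 (\<alpha> * of_int x)) \<le> 2"
    using norm_triangle_ineq4[of "e2 (\<alpha> * of_int b)" "e2 (\<alpha> * of_int a)"] by (simp add: norm_mult[symmetric])
  hence "sin (pi * \<alpha>) * cmod (\<Sum>x\<in>{a..<b}. e2 (\<alpha> * of_int x)) \<le> 1"
    using s m by (simp add: norm_e2_minus_1)
  moreover have "min \<alpha> (1 - \<alpha>) * cmod (\<Sum>x\<in>{a..<b}. e2 (\<alpha> * of_int x))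
      \<le> sin (pi * \<alpha>) * cmod (\<Sum>x\<in>{a..<b}. e2 (\<alpha> * of_int x))"
    using s by (intro mult_right_mono) auto
  ultimately show ?thesis using m by (simp add: field_simps)
qed (use assms in auto)

text \<open>Majorant of a geometric sum whose frequency lies in the j-th of s equal arcs of the
  circle. The arcs 0 and s - 1 touch the integers and receive the trivial bound N; on the others the
  distance to both ends is visible.\<close>

definition dker :: "int \<Rightarrow> real \<Rightarrow> int \<Rightarrow> real" where
  "dker s N j = (if j = 0 \<or> j = s - 1 then N else of_int s / of_int j + of_int s / of_int (s - 1 - j))"

lemma norm_exp_sum_le_dker:
  assumes j: "0 \<le> j" "j < s" and \<delta>: "0 \<le> \<delta>" "\<delta> < 1 / of_int s" and N: "of_int (b - a) \<le> N" "0 \<le> N"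
  shows "cmod (\<Sum>x\<in>{a..<b::int}. e2 ((of_int j / of_int s + \<delta>) * of_int x)) \<le> dker s N j"
proof (cases "j = 0 \<or> j = s - 1")
  case True
  have "cmod (\<Sum>x\<in>{a..<b}. e2 ((of_int j / of_int s + \<delta>) * of_int x)) \<le> (\<Sum>x\<in>{a..<b}. 1)"
    by (intro sum_norm_le) simp
  also have "\<dots> \<le> N" using N by (cases "a \<le> b") auto
  finally show ?thesis using True by (simp add: dker_def)
next
  case False
  hence j1: "1 \<le> j" "j \<le> s - 2" using j by auto
  define \<alpha> where "\<alpha> = of_int j / of_int s + \<delta>"
  have s: "real_of_int s > 0" using j by simp
  have lo: "of_int j / of_int s \<le> \<alpha>" using \<delta> by (simp add: \<alpha>_def)
  have hi: "\<alpha> < of_int (j + 1) / of_int s" using \<delta> by (simp add: \<alpha>_def add_divide_distrib)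
  have p1: "real_of_int j / of_int s > 0" using j1 s by simp
  have p2: "real_of_int (s - 1 - j) / of_int s > 0" using j1 s by simp
  have e: "1 - real_of_int (j + 1) / of_int s = of_int (s - 1 - j) / of_int s" using s by (simp add: field_simps)
  have a1: "0 < \<alpha>" "\<alpha> < 1" "of_int (s - 1 - j) / of_int s \<le> 1 - \<alpha>"
    using lo hi p1 p2 e by linarith+
  have "cmod (\<Sum>x\<in>{a..<b}. e2 (\<alpha> * of_int x)) \<le> 1 / min \<alpha> (1 - \<alpha>)" using a1 by (intro norm_exp_sum_le)
  also have "\<dots> \<le> 1 / \<alpha> + 1 / (1 - \<alpha>)" using a1 by (auto simp: min_def)
  also have "\<dots> \<le> 1 / (of_int j / of_int s) + 1 / (of_int (s - 1 - j) / of_int s)"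
    using a1 lo p1 p2 by (intro add_mono frac_le) auto
  also have "\<dots> = dker s N j" using False by (simp add: dker_def)
  finally show ?thesis by (simp add: \<alpha>_def)
qed

lemma sum_inverse_le:
  assumes "n \<ge> (1::int)" shows "(\<Sum>j\<in>{1..n}. 1 / real_of_int j) \<le> 1 + ln (of_int n)"
  using assms
proof (induction n rule: int_ge_induct)
  case (step i)
  have "{1..i + 1} = insert (i + 1) {1..i}" using step by auto
  hence "(\<Sum>j\<in>{1..i + 1}. 1 / real_of_int j) = 1 / real_of_int (i + 1) + (\<Sum>j\<in>{1..i}. 1 / real_of_int j)" by simp
  moreover have "1 / real_of_int (i + 1) \<le> ln (of_int (i + 1)) - ln (of_int i)"
  proof -
    have "ln (real_of_int i / of_int (i + 1)) \<le> real_of_int i / of_int (i + 1) - 1"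
      using step by (intro ln_le_minus_one) auto
    also have "\<dots> = - (1 / of_int (i + 1))" using step by (simp add: field_simps)
    finally show ?thesis using step by (simp add: ln_div)
  qed
  ultimately show ?case using step.IH by linarith
qed auto

text \<open>Two harmonic sums, mirror images under j -> s - 1 - j. The logarithm of
  Polya--Vinogradov arises here.\<close>

lemma sum_dker_le:
  assumes "s \<ge> 1" "N \<ge> 0"
  shows "(\<Sum>j\<in>{0..<s}. dker s N j) \<le> 2 * N + 2 * of_int s * (1 + ln (of_int s))"
proof -
  have L: "ln (real_of_int s) \<ge> 0" using assms by simp
  have 1: "(\<Sum>j\<in>{1..s - 2}. of_int s / real_of_int j) \<le> of_int s * (1 + ln (of_int s))"
  proof (cases "s - 2 \<ge> 1")
    case True
    have "(\<Sum>j\<in>{1..s - 2}. 1 / real_of_int j) \<le> 1 + ln (of_int (s - 2))" by (rule sum_inverse_le[OF True])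
    also have "\<dots> \<le> 1 + ln (of_int s)" using True by simp
    finally have "of_int s * (\<Sum>j\<in>{1..s - 2}. 1 / real_of_int j) \<le> of_int s * (1 + ln (of_int s))"
      using assms by (intro mult_left_mono) auto
    thus ?thesis by (simp add: sum_distrib_left)
  qed (use assms L in auto)
  have 2: "(\<Sum>j\<in>{1..s - 2}. of_int s / real_of_int (s - 1 - j)) = (\<Sum>j\<in>{1..s - 2}. of_int s / real_of_int j)"
    by (rule sum.reindex_bij_witness[where i = "\<lambda>j. s - 1 - j" and j = "\<lambda>j. s - 1 - j"]) auto
  have 3: "(\<Sum>j\<in>{1..s - 2}. dker s N j) = (\<Sum>j\<in>{1..s - 2}. of_int s / real_of_int j + of_int s / real_of_int (s - 1 - j))"
    by (intro sum.cong) (auto simp: dker_def)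
  have "(\<Sum>j\<in>{0..<s}. dker s N j) \<le> (\<Sum>j\<in>{0, s - 1}. dker s N j) + (\<Sum>j\<in>{1..s - 2}. dker s N j)"
  proof -
    have "{0..<s} = {0, s - 1} \<union> {1..s - 2}" using assms by auto
    hence "(\<Sum>j\<in>{0..<s}. dker s N j) = (\<Sum>j\<in>{0, s - 1}. dker s N j) + (\<Sum>j\<in>{1..s - 2}. dker s N j)"
      by (simp only:) (rule sum.union_disjoint; auto)
    thus ?thesis by simp
  qed
  also have "(\<Sum>j\<in>{0, s - 1}. dker s N j) \<le> 2 * N" using assms by (cases "s = 1") (auto simp: dker_def)
  finally show ?thesis using 1 2 3 by (simp add: sum.distrib)
qed

section \<open>Complete sums: orthogonality and Gauss sums\<close>

lemma sum_mod_shift: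
  fixes f :: "int \<Rightarrow> 'a :: comm_monoid_add"
  assumes "s \<ge> 1" and per: "\<And>a b. [a = b] (mod s) \<Longrightarrow> f a = f b"
    and bij: "inj_on (\<lambda>h. g h mod s) {0..<s}"
  shows "(\<Sum>h\<in>{0..<s}. f (g h)) = (\<Sum>h\<in>{0..<s}. f h)"
proof -
  have sub: "(\<lambda>h. g h mod s) ` {0..<s} \<subseteq> {0..<s}" using assms(1) by auto
  have img: "(\<lambda>h. g h mod s) ` {0..<s} = {0..<s}"
    by (rule card_subset_eq[OF _ sub]) (simp_all add: card_image[OF bij])
  have "(\<Sum>h\<in>{0..<s}. f (g h)) = (\<Sum>h\<in>{0..<s}. f (g h mod s))"
    by (intro sum.cong refl per) (simp add: Cong.cong_def)
  also have "\<dots> = (\<Sum>h\<in>(\<lambda>h. g h mod s) ` {0..<s}. f h)"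
    by (simp add: sum.reindex[OF bij])
  finally show ?thesis by (simp only: img)
qed

lemma sum_mod_mult:
  fixes f :: "int \<Rightarrow> 'a :: comm_monoid_add"
  assumes "s \<ge> 1" and "\<And>a b. [a = b] (mod s) \<Longrightarrow> f a = f b" and "coprime g s"
  shows "(\<Sum>h\<in>{0..<s}. f (g * h)) = (\<Sum>h\<in>{0..<s}. f h)"
proof (rule sum_mod_shift[OF assms(1,2)])
  show "inj_on (\<lambda>h. g * h mod s) {0..<s}"
  proof (rule inj_onI)
    fix x y assume xy: "x \<in> {0..<s}" "y \<in> {0..<s}" "g * x mod s = g * y mod s"
    hence "[g * x = g * y] (mod s)" by (simp add: Cong.cong_def)
    hence "[x = y] (mod s)" using assms(3) by (simp add: cong_mult_lcancel)
    thus "x = y" using xy by (simp add: Cong.cong_def)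
  qed
qed

lemma sum_mod_add:
  fixes f :: "int \<Rightarrow> 'a :: comm_monoid_add"
  assumes "s \<ge> 1" and "\<And>a b. [a = b] (mod s) \<Longrightarrow> f a = f b"
  shows "(\<Sum>h\<in>{0..<s}. f (h + k)) = (\<Sum>h\<in>{0..<s}. f h)"
proof (rule sum_mod_shift[OF assms])
  show "inj_on (\<lambda>h. (h + k) mod s) {0..<s}"
  proof (rule inj_onI)
    fix x y assume xy: "x \<in> {0..<s}" "y \<in> {0..<s}" "(x + k) mod s = (y + k) mod s"
    hence "[x + k = y + k] (mod s)" by (simp add: Cong.cong_def)
    hence "[x = y] (mod s)" by (simp add: cong_add_rcancel)
    thus "x = y" using xy by (simp add: Cong.cong_def)
  qed
qed

text \<open>Shifting h permutes the residues and multiplies the sum by e2 (k / s), which differs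
  from 1 unless s divides k.\<close>

lemma sum_e2_orthogonal:
  assumes s: "s \<ge> 1"
  shows "(\<Sum>h\<in>{0..<s::int}. e2 (of_int (h * k) / of_int s)) = (if s dvd k then of_int s else 0)"
proof (cases "s dvd k")
  case True
  have "e2 (of_int (h * k) / of_int s) = 1" for h
  proof -
    have "[h * k = 0] (mod s)" using True by (simp add: cong_0_iff)
    from e2_frac_cong[OF this] show ?thesis using s by simp
  qed
  thus ?thesis using True s by simp
next
  case False
  let ?S = "\<Sum>h\<in>{0..<s}. e2 (of_int (h * k) / of_int s)"
  have "(\<Sum>h\<in>{0..<s}. e2 (of_int ((h + 1) * k) / of_int s)) = ?S"
  proof (rule sum_mod_add[OF s])
    fix a b assume "[a = b] (mod s)"
    hence "[a * k = b * k] (mod s)" by (rule cong_scalar_right)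
    thus "e2 (of_int (a * k) / of_int s) = e2 (of_int (b * k) / of_int s)" using s by (intro e2_frac_cong) auto
  qed
  moreover have "e2 (of_int ((h + 1) * k) / of_int s) = e2 (of_int k / of_int s) * e2 (of_int (h * k) / of_int s)" for h
    by (simp add: e2_add[symmetric] add_divide_distrib[symmetric] algebra_simps)
  ultimately have z: "e2 (of_int k / of_int s) * ?S = ?S" by (simp only: sum_distrib_left)
  have "e2 (of_int k / of_int s) \<noteq> 1"
  proof
    assume one: "e2 (of_int k / of_int s) = 1"
    define \<alpha> where "\<alpha> = real_of_int (k mod s) / of_int s"
    have "e2 \<alpha> = e2 (of_int k / of_int s)" unfolding \<alpha>_def using s
      by (intro e2_frac_cong) (auto simp: Cong.cong_def)
    hence "sin (pi * \<alpha>) = 0" using one norm_e2_minus_1[of \<alpha>] by simp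
    moreover have "k mod s \<noteq> 0" using False by (simp add: mod_eq_0_iff_dvd)
    hence "0 < k mod s" "k mod s < s" using s pos_mod_bound[of s k] pos_mod_sign[of s k] by linarith+
    hence "0 < \<alpha>" "\<alpha> < 1" using s by (auto simp: \<alpha>_def)
    ultimately show False using sin_pi_ge_min[of \<alpha>] by (auto simp: min_def split: if_splits)
  qed
  moreover have "(e2 (of_int k / of_int s) - 1) * ?S = 0"
    unfolding left_diff_distrib mult_1_left z by (rule diff_self)
  ultimately have "?S = 0" unfolding mult_eq_0_iff right_minus_eq by blast
  thus ?thesis unfolding if_not_P[OF False] .
qed

text \<open>For x coprime to s, substitute x h for h. Otherwise a prime p divides both; as s is
  squarefree, some g = 1 modulo s / p has (g / s) = -1, and g x = x modulo s shows that the left sum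
  is its own negative.\<close>

lemma Jacobi_gauss_twist:
  assumes s: "s \<ge> 1" "odd s" "squarefree s"
  shows "(\<Sum>h\<in>{0..<s}. of_int (Jacobi h s) * e2 (of_int (h * x) / of_int s)) =
     of_int (Jacobi x s) * (\<Sum>h\<in>{0..<s}. of_int (Jacobi h s) * e2 (of_int h / of_int s))"
proof -
  define f where "f = (\<lambda>x h. of_int (Jacobi h s) * e2 (of_int (h * x) / of_int s))"
  have per: "f x a = f x b" if "[a = b] (mod s)" for a b x
  proof -
    have "[a * x = b * x] (mod s)" using that by (rule cong_scalar_right)
    thus ?thesis unfolding f_def using Jacobi_cong[OF that] e2_frac_cong s by (metis not_one_le_zero)
  qed
  show ?thesis
  proof (cases "coprime x s")
    case True
    have J: "Jacobi x s * Jacobi x s = 1" using Jacobi_square[OF True] s by simp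
    have "of_int (Jacobi x s) * (\<Sum>h\<in>{0..<s}. f 1 h) = of_int (Jacobi x s) * (\<Sum>h\<in>{0..<s}. f 1 (x * h))"
      using sum_mod_mult[where f = "f 1", OF s(1) per True] by simp
    also have "\<dots> = (\<Sum>h\<in>{0..<s}. of_int (Jacobi x s * Jacobi x s) * f x h)"
      using s by (simp add: f_def Jacobi_mult_left sum_distrib_left mult_ac)
    finally show ?thesis by (simp add: J f_def)
  next
    case False
    hence J0: "Jacobi x s = 0" using Jacobi_eq_0_iff[of s x] s by simp
    have "\<not> is_unit (gcd x s)" using False by (simp add: coprime_iff_gcd_eq_1)
    moreover have "gcd x s \<noteq> 0" using s by auto
    ultimately obtain p where p: "prime p" "p dvd x" "p dvd s" using prime_divisor_exists by (metis gcd_greatest_iff)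
    obtain m where m: "s = p * m" using p(3) by (auto simp: dvd_def)
    have pm: "coprime p m" 
    proof (rule ccontr)
      assume "\<not> coprime p m"
      hence "p dvd m" using p(1) prime_imp_coprime by blast
      hence "p\<^sup>2 dvd s" using m by (auto simp: power2_eq_square)
      hence "is_unit p" using s(3) unfolding squarefree_def by blast
      thus False using p(1) by auto
    qed
    have om: "odd p" "odd m" "m \<noteq> 0" using s m by auto
    obtain g where g: "[g = 1] (mod m)" "coprime g s" "Jacobi g s = -1"
      using exists_Jacobi_minus_1[of p m 1] p om pm m by auto
    have "[g * x = x] (mod s)"
    proof -
      have "m dvd g - 1" using g(1) by (simp add: cong_iff_dvd_diff)
      hence "m * p dvd (g - 1) * x" using p(2) by (rule mult_dvd_mono)
      moreover have "g * x - x = (g - 1) * x" by (simp add: left_diff_distrib)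
      ultimately show ?thesis unfolding cong_iff_dvd_diff m by (metis mult.commute)
    qed
    have "f x (g * h) = - f x h" for h
    proof -
      have "[g * h * x = h * x] (mod s)"
        using cong_scalar_left[OF \<open>[g * x = x] (mod s)\<close>, of h] by (simp add: mult_ac)
      hence "e2 (of_int (g * h * x) / of_int s) = e2 (of_int (h * x) / of_int s)" using s by (intro e2_frac_cong) auto
      thus ?thesis using s g(3) by (simp add: f_def Jacobi_mult_left)
    qed
    hence "(\<Sum>h\<in>{0..<s}. f x h) = - (\<Sum>h\<in>{0..<s}. f x h)"
      using sum_mod_mult[where f = "f x", OF s(1) per g(2)] by (simp add: sum_negf)
    hence "(\<Sum>h\<in>{0..<s}. f x h) = 0" by (simp add: eq_neg_iff_add_eq_0)
    thus ?thesis using J0 by (simp add: f_def)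
  qed
qed

text \<open>The twist formula holds for every residue, so |G|^2 becomes a full double sum in which
  orthogonality keeps only y = 1.\<close>

lemma norm_Jacobi_gauss:
  assumes s: "s \<ge> 1" "odd s" "squarefree s"
  shows "cmod (\<Sum>h\<in>{0..<s}. of_int (Jacobi h s) * e2 (of_int h / of_int s)) = sqrt (of_int s)"
proof -
  define G where "G = (\<Sum>h\<in>{0..<s}. of_int (Jacobi h s) * e2 (of_int h / of_int s))"
  have cn: "cnj (e2 t) = e2 (- t)" for t by (simp add: e2_def cis_cnj)
  have "G * cnj G = (\<Sum>h\<in>{0..<s}. (of_int (Jacobi h s) * G) * e2 (- (of_int h / of_int s)))"
    by (subst (2) G_def) (simp add: cn sum_distrib_left mult_ac)
  also have "\<dots> = (\<Sum>h\<in>{0..<s}. (\<Sum>y\<in>{0..<s}. of_int (Jacobi y s) * e2 (of_int (y * h) / of_int s)) * e2 (- (of_int h / of_int s)))"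
    unfolding G_def by (simp only: Jacobi_gauss_twist[OF s])
  also have "\<dots> = (\<Sum>h\<in>{0..<s}. \<Sum>y\<in>{0..<s}. of_int (Jacobi y s) * e2 (of_int (h * (y - 1)) / of_int s))"
  proof (intro sum.cong refl)
    fix h
    have "e2 (of_int (y * h) / of_int s) * e2 (- (of_int h / of_int s)) = e2 (of_int (h * (y - 1)) / of_int s)" for y
      unfolding e2_add[symmetric] by (rule arg_cong[of _ _ e2]) (simp add: algebra_simps diff_divide_distrib)
    thus "(\<Sum>y\<in>{0..<s}. of_int (Jacobi y s) * e2 (of_int (y * h) / of_int s)) * e2 (- (of_int h / of_int s)) =
        (\<Sum>y\<in>{0..<s}. of_int (Jacobi y s) * e2 (of_int (h * (y - 1)) / of_int s))"
      unfolding sum_distrib_right by (intro sum.cong refl) (metis mult.assoc)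
  qed
  also have "\<dots> = (\<Sum>y\<in>{0..<s}. of_int (Jacobi y s) * (\<Sum>h\<in>{0..<s}. e2 (of_int (h * (y - 1)) / of_int s)))"
    by (subst sum.swap) (simp add: sum_distrib_left)
  \<comment> \<open>The form \<open>1 mod s\<close> includes s = 1, where the only residue is
    0.\<close>
  also have "\<dots> = (\<Sum>y\<in>{0..<s}. if y = 1 mod s then of_int s else 0)"
  proof (intro sum.cong refl)
    fix y assume y: "y \<in> {0..<s}"
    have "s dvd y - 1 \<longleftrightarrow> y = 1 mod s" using y by (metis atLeastLessThan_iff mod_eq_dvd_iff mod_pos_pos_trivial)
    moreover have "y = 1 mod s \<Longrightarrow> Jacobi y s = 1"
      using Jacobi_cong[of "1 mod s" 1 s] s by (simp add: Cong.cong_def)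
    ultimately show "of_int (Jacobi y s) * (\<Sum>h\<in>{0..<s}. e2 (of_int (h * (y - 1)) / of_int s)) =
        (if y = 1 mod s then of_int s else 0)"
      by (subst sum_e2_orthogonal[OF s(1)]) simp
  qed
  also have "\<dots> = of_int s" using s(1) by (simp add: sum.delta)
  finally have "complex_of_real ((cmod G)\<^sup>2) = of_int s" by (metis complex_norm_square)
  hence "(cmod G)\<^sup>2 = of_int s" by (metis of_real_eq_iff of_real_of_int_eq)
  thus ?thesis unfolding G_def[symmetric] by (metis norm_ge_zero real_sqrt_abs abs_of_nonneg)
qed

text \<open>The additive twist absorbs congruence conditions on the summation variable, so that
  progressions cost nothing.\<close>

lemma polya_vinogradov_twisted:
  assumes s: "s \<ge> 1" "odd s" "squarefree s" and N: "of_int (b - a) \<le> N" "0 \<le> N"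
  shows "cmod (\<Sum>x\<in>{a..<b}. of_int (Jacobi x s) * e2 (\<theta> * of_int x))
    \<le> (2 * N + 2 * of_int s * (1 + ln (of_int s))) / sqrt (of_int s)"
proof -
  define G where "G = (\<Sum>h\<in>{0..<s}. of_int (Jacobi h s) * e2 (of_int h / of_int s))"
  \<comment> \<open>The twist is split as k / s plus an offset in [0, 1/s). The integer
    \<open>k\<close> merely permutes the frequencies modulo s, and the offset stays within one arc
    of \<open>dker\<close>.\<close>
  define k where "k = \<lfloor>\<theta> * of_int s\<rfloor>"
  define \<delta> where "\<delta> = \<theta> - of_int k / of_int s"
  have sp: "real_of_int s > 0" using s by simp
  have \<delta>: "0 \<le> \<delta>" "\<delta> < 1 / of_int s"
  proof -
    have "of_int k \<le> \<theta> * of_int s" "\<theta> * of_int s < of_int k + 1" by (simp_all add: k_def)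
    thus "0 \<le> \<delta>" "\<delta> < 1 / of_int s" using sp by (simp_all add: \<delta>_def field_simps)
  qed
  define T where "T = (\<lambda>h. cmod (\<Sum>x\<in>{a..<b}. e2 ((of_int h / of_int s + \<delta>) * of_int x)))"
  have perT: "T h = T h'" if "[h = h'] (mod s)" for h h'
  proof -
    have "e2 ((of_int h / of_int s + \<delta>) * of_int x) = e2 ((of_int h' / of_int s + \<delta>) * of_int x)" for x
    proof -
      have "[h * x = h' * x] (mod s)" using that by (rule cong_scalar_right)
      hence "e2 (of_int (h * x) / of_int s) = e2 (of_int (h' * x) / of_int s)" using s by (intro e2_frac_cong) auto
      thus ?thesis by (simp add: distrib_right e2_add)
    qed
    thus ?thesis by (simp add: T_def)
  qed
  \<comment> \<open>Multiplication by the Gauss sum replaces (x / s) by additive characters; its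
    modulus sqrt s is divided out at the end.\<close>
  have "G * (\<Sum>x\<in>{a..<b}. of_int (Jacobi x s) * e2 (\<theta> * of_int x)) =
      (\<Sum>x\<in>{a..<b}. (of_int (Jacobi x s) * G) * e2 (\<theta> * of_int x))" by (simp add: sum_distrib_left mult_ac)
  also have "\<dots> = (\<Sum>x\<in>{a..<b}. \<Sum>h\<in>{0..<s}. of_int (Jacobi h s) * e2 (of_int (h * x) / of_int s) * e2 (\<theta> * of_int x))"
    unfolding G_def Jacobi_gauss_twist[OF s, symmetric] by (simp add: sum_distrib_right)
  also have "\<dots> = (\<Sum>h\<in>{0..<s}. of_int (Jacobi h s) *
      (\<Sum>x\<in>{a..<b}. e2 ((of_int (h + k) / of_int s + \<delta>) * of_int x)))"
    by (subst sum.swap) (simp add: sum_distrib_left mult.assoc e2_add[symmetric] \<delta>_def algebra_simps add_divide_distrib)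
  finally have eq: "G * (\<Sum>x\<in>{a..<b}. of_int (Jacobi x s) * e2 (\<theta> * of_int x)) = (\<Sum>h\<in>{0..<s}. of_int (Jacobi h s) *
      (\<Sum>x\<in>{a..<b}. e2 ((of_int (h + k) / of_int s + \<delta>) * of_int x)))" .
  have "cmod G * cmod (\<Sum>x\<in>{a..<b}. of_int (Jacobi x s) * e2 (\<theta> * of_int x)) = cmod (\<Sum>h\<in>{0..<s}. of_int (Jacobi h s) *
      (\<Sum>x\<in>{a..<b}. e2 ((of_int (h + k) / of_int s + \<delta>) * of_int x)))"
    unfolding norm_mult[symmetric] eq ..
  also have "\<dots> \<le> (\<Sum>h\<in>{0..<s}. T (h + k))"
  proof (rule sum_norm_le)
    fix h
    have "cmod (of_int (Jacobi h s)) \<le> 1" using abs_Jacobi_le[of h s]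
      by (metis norm_of_int of_int_abs of_int_le_1_iff)
    thus "cmod (of_int (Jacobi h s) * (\<Sum>x\<in>{a..<b}. e2 ((of_int (h + k) / of_int s + \<delta>) * of_int x))) \<le> T (h + k)"
      unfolding norm_mult T_def by (intro mult_left_le_one_le) auto
  qed
  also have "\<dots> = (\<Sum>h\<in>{0..<s}. T h)" by (rule sum_mod_add[OF s(1) perT])
  also have "\<dots> \<le> (\<Sum>h\<in>{0..<s}. dker s N h)"
    unfolding T_def using N \<delta> by (intro sum_mono norm_exp_sum_le_dker) auto
  also have "\<dots> \<le> 2 * N + 2 * of_int s * (1 + ln (of_int s))" using s N by (intro sum_dker_le)
  finally show ?thesis unfolding G_def norm_Jacobi_gauss[OF s] using sp by (simp add: field_simps)
qed

section \<open>Progressions and moduli with square factors\<close>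

text \<open>Uniformity over all additive twists is what makes such a bound stable under restriction
  to progressions.\<close>

definition twist_bounded :: "(int \<Rightarrow> complex) \<Rightarrow> int set \<Rightarrow> real \<Rightarrow> bool" where
  "twist_bounded F I B \<longleftrightarrow> (\<forall>\<theta>. cmod (\<Sum>x\<in>I. F x * e2 (\<theta> * of_int x)) \<le> B)"

text \<open>The indicator of a residue class is, up to phases, an average of D additive characters.
  Each is absorbed into the twist, and an average of quantities bounded by B is bounded by
  B.\<close>

lemma twist_bounded_progression:
  assumes "twist_bounded F I B" "D \<ge> 1"
  shows "twist_bounded (\<lambda>x. if D dvd x - r then F x else 0) I B"
  unfolding twist_bounded_def
proof
  fix \<theta>
  have D: "real_of_int D > 0" using assms by simp
  have "(\<Sum>x\<in>I. (if D dvd x - r then F x else 0) * e2 (\<theta> * of_int x)) =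
     (\<Sum>x\<in>I. (1 / of_int D) * (\<Sum>h\<in>{0..<D}. e2 (of_int (h * (x - r)) / of_int D)) * (F x * e2 (\<theta> * of_int x)))"
    by (intro sum.cong refl) (subst sum_e2_orthogonal[OF assms(2)], use assms(2) in simp)
  also have "\<dots> = (\<Sum>x\<in>I. \<Sum>h\<in>{0..<D}. (1 / of_int D) * e2 (of_int (- h * r) / of_int D) *
     (F x * e2 ((\<theta> + of_int h / of_int D) * of_int x)))"
  proof (intro sum.cong refl)
    fix x
    have E: "e2 (of_int (h * (x - r)) / of_int D) * e2 (\<theta> * of_int x) =
        e2 (of_int (- h * r) / of_int D) * e2 ((\<theta> + of_int h / of_int D) * of_int x)" for h
      unfolding e2_add[symmetric] by (rule arg_cong[of _ _ e2]) (simp add: algebra_simps diff_divide_distrib)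
    show "(1 / of_int D) * (\<Sum>h\<in>{0..<D}. e2 (of_int (h * (x - r)) / of_int D)) * (F x * e2 (\<theta> * of_int x)) =
      (\<Sum>h\<in>{0..<D}. (1 / of_int D) * e2 (of_int (- h * r) / of_int D) * (F x * e2 ((\<theta> + of_int h / of_int D) * of_int x)))"
      unfolding sum_distrib_left sum_distrib_right
    proof (intro sum.cong refl)
      fix h
      have "1 / of_int D * e2 (of_int (h * (x - r)) / of_int D) * (F x * e2 (\<theta> * of_int x)) =
        (1 / of_int D * F x) * (e2 (of_int (h * (x - r)) / of_int D) * e2 (\<theta> * of_int x))"
        by (simp only: mult_ac)
      also have "\<dots> = 1 / of_int D * e2 (of_int (- h * r) / of_int D) * (F x * e2 ((\<theta> + of_int h / of_int D) * of_int x))"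
        unfolding E by (simp only: mult_ac)
      finally show "1 / of_int D * e2 (of_int (h * (x - r)) / of_int D) * (F x * e2 (\<theta> * of_int x)) =
        1 / of_int D * e2 (of_int (- h * r) / of_int D) * (F x * e2 ((\<theta> + of_int h / of_int D) * of_int x))" .
    qed
  qed
  also have "\<dots> = (\<Sum>h\<in>{0..<D}. (1 / of_int D) * e2 (of_int (- h * r) / of_int D) *
     (\<Sum>x\<in>I. F x * e2 ((\<theta> + of_int h / of_int D) * of_int x)))"
    by (subst sum.swap) (simp add: sum_distrib_left)
  also have "cmod \<dots> \<le> (\<Sum>h\<in>{0..<D}. (1 / of_int D) * B)"
  proof (rule sum_norm_le)
    fix h
    have "cmod (\<Sum>x\<in>I. F x * e2 ((\<theta> + of_int h / of_int D) * of_int x)) \<le> B"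
      using assms(1) unfolding twist_bounded_def by blast
    thus "cmod ((1 / of_int D) * e2 (of_int (- h * r) / of_int D) *
        (\<Sum>x\<in>I. F x * e2 ((\<theta> + of_int h / of_int D) * of_int x))) \<le> (1 / of_int D) * B"
      using D by (simp add: norm_mult norm_divide divide_right_mono)
  qed
  also have "\<dots> = B" using D by simp
  finally show "cmod (\<Sum>x\<in>I. (if D dvd x - r then F x else 0) * e2 (\<theta> * of_int x)) \<le> B" .
qed

text \<open>Deleting the multiples of one further element subtracts a progression and so doubles the
  bound.\<close>

lemma twist_bounded_coprime:
  assumes "finite P" "twist_bounded F I B" "\<And>p. p \<in> P \<Longrightarrow> p \<ge> 1"
  shows "twist_bounded (\<lambda>x. if \<forall>p\<in>P. \<not> p dvd x then F x else 0) I (2 ^ card P * B)"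
  using assms(1,3)
proof (induction P rule: finite_induct)
  case empty
  thus ?case using assms(2) by simp
next
  case (insert p P)
  define F' where "F' = (\<lambda>x. if \<forall>p\<in>P. \<not> p dvd x then F x else 0)"
  have IH: "twist_bounded F' I (2 ^ card P * B)" using insert unfolding F'_def by simp
  have IH2: "twist_bounded (\<lambda>x. if p dvd x - 0 then F' x else 0) I (2 ^ card P * B)"
    using insert.prems by (intro twist_bounded_progression[OF IH]) auto
  show ?case unfolding twist_bounded_def
  proof
    fix \<theta>
    have "(\<Sum>x\<in>I. (if \<forall>p\<in>insert p P. \<not> p dvd x then F x else 0) * e2 (\<theta> * of_int x)) =
      (\<Sum>x\<in>I. F' x * e2 (\<theta> * of_int x)) - (\<Sum>x\<in>I. (if p dvd x - 0 then F' x else 0) * e2 (\<theta> * of_int x))"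
      unfolding sum_subtractf[symmetric] by (intro sum.cong refl) (auto simp: F'_def)
    also have "cmod \<dots> \<le> 2 ^ card P * B + 2 ^ card P * B"
      using IH IH2 unfolding twist_bounded_def by (intro norm_triangle_le_diff add_mono) blast+
    also have "2 ^ card P * B + 2 ^ card P * B = 2 ^ card (insert p P) * B" using insert.hyps by simp
    finally show "cmod (\<Sum>x\<in>I. (if \<forall>p\<in>insert p P. \<not> p dvd x then F x else 0) * e2 (\<theta> * of_int x))
      \<le> 2 ^ card (insert p P) * B" .
  qed
qed

text \<open>A square factor of the modulus only deletes the arguments that share a prime with it.
  This reduces general odd moduli to squarefree ones.\<close>

lemma Jacobi_square_factor:
  assumes "s \<noteq> 0" "t \<noteq> 0"
  shows "Jacobi x (s * t\<^sup>2) = (if \<forall>p\<in>prime_factors t. \<not> p dvd x then Jacobi x s else 0)"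
proof -
  have e: "Jacobi x (s * t\<^sup>2) = Jacobi x s * (Jacobi x t * Jacobi x t)"
    using assms by (simp add: Jacobi_mult_right power2_eq_square)
  have "coprime x t \<longleftrightarrow> (\<forall>p\<in>prime_factors t. \<not> p dvd x)"
  proof
    assume c: "coprime x t"
    show "\<forall>p\<in>prime_factors t. \<not> p dvd x"
    proof
      fix p assume "p \<in> prime_factors t"
      hence "p dvd t" "prime p" by auto
      thus "\<not> p dvd x" using c by (meson coprime_common_divisor not_prime_unit)
    qed
  next
    assume a: "\<forall>p\<in>prime_factors t. \<not> p dvd x"
    show "coprime x t"
    proof (rule ccontr)
      assume "\<not> coprime x t"
      hence "\<not> is_unit (gcd x t)" by (simp add: coprime_iff_gcd_eq_1)
      moreover have "gcd x t \<noteq> 0" using assms by auto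
      ultimately obtain p where "prime p" "p dvd x" "p dvd t" using prime_divisor_exists by (metis gcd_greatest_iff)
      thus False using a assms by (auto simp: in_prime_factors_iff)
    qed
  qed
  thus ?thesis using e Jacobi_square[of x t] Jacobi_eq_0_iff[of t x] assms by auto
qed

lemma polya_vinogradov_progression:
  assumes "s \<ge> 1" "odd s" "squarefree s" "t \<noteq> 0" "of_int (b - a) \<le> N" "0 \<le> N" "D \<ge> 1"
  shows "cmod (\<Sum>x | x \<in> {a..<b} \<and> D dvd x - r. of_int (Jacobi x (s * t\<^sup>2)))
    \<le> 2 ^ card (prime_factors t) * ((2 * N + 2 * of_int s * (1 + ln (of_int s))) / sqrt (of_int s))"
proof -
  let ?B = "(2 * N + 2 * of_int s * (1 + ln (of_int s))) / sqrt (of_int s)"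
  have "twist_bounded (\<lambda>x. of_int (Jacobi x s)) {a..<b} ?B"
    unfolding twist_bounded_def using polya_vinogradov_twisted assms by blast
  hence "twist_bounded (\<lambda>x. if \<forall>p\<in>prime_factors t. \<not> p dvd x then of_int (Jacobi x s) else 0) {a..<b}
     (2 ^ card (prime_factors t) * ?B)"
    by (intro twist_bounded_coprime) (auto simp: in_prime_factors_iff intro: prime_ge_1_int)
  moreover have "(\<lambda>x. if \<forall>p\<in>prime_factors t. \<not> p dvd x then complex_of_int (Jacobi x s) else 0) =
      (\<lambda>x. of_int (Jacobi x (s * t\<^sup>2)))"
  proof
    fix x
    have "s \<noteq> 0" using assms(1) by auto
    thus "(if \<forall>p\<in>prime_factors t. \<not> p dvd x then complex_of_int (Jacobi x s) else 0) =
      of_int (Jacobi x (s * t\<^sup>2))" using Jacobi_square_factor[of s t x] assms(4) by simp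
  qed
  ultimately have "twist_bounded (\<lambda>x. of_int (Jacobi x (s * t\<^sup>2))) {a..<b} (2 ^ card (prime_factors t) * ?B)"
    by (simp only:)
  hence "twist_bounded (\<lambda>x. if D dvd x - r then of_int (Jacobi x (s * t\<^sup>2)) else 0) {a..<b}
     (2 ^ card (prime_factors t) * ?B)"
    by (rule twist_bounded_progression[OF _ assms(7)])
  hence "cmod (\<Sum>x\<in>{a..<b}. (if D dvd x - r then of_int (Jacobi x (s * t\<^sup>2)) else 0) * e2 (0 * of_int x))
     \<le> 2 ^ card (prime_factors t) * ?B" unfolding twist_bounded_def by blast
  moreover have "(\<Sum>x\<in>{a..<b}. (if D dvd x - r then of_int (Jacobi x (s * t\<^sup>2)) else 0) * e2 (0 * of_int x))
    = (\<Sum>x | x \<in> {a..<b} \<and> D dvd x - r. complex_of_int (Jacobi x (s * t\<^sup>2)))"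
    by (simp add: sum.inter_filter[symmetric])
  ultimately show ?thesis by simp
qed

section \<open>Type I sums\<close>

text \<open>Serves to recognize the v with m dividing u + v sqrt 2 and with v fixed modulo 16 as a
  single progression, whose modulus need not be computed.\<close>

lemma int_subgroup_principal:
  fixes H :: "int set"
  assumes diff: "\<And>x y. x \<in> H \<Longrightarrow> y \<in> H \<Longrightarrow> x - y \<in> H" and P: "P \<in> H" "P \<ge> 1"
  shows "\<exists>q\<ge>1. \<forall>h. h \<in> H \<longleftrightarrow> q dvd h"
proof -
  define n where "n = (LEAST n::nat. int n \<in> H \<and> n \<ge> 1)"
  have "int (nat P) \<in> H \<and> nat P \<ge> 1" using P by simp
  hence n: "int n \<in> H" "n \<ge> 1" unfolding n_def by (metis (mono_tags, lifting) LeastI)+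
  have min: "n \<le> k" if "int k \<in> H" "k \<ge> 1" for k unfolding n_def using that by (intro Least_le) auto
  have 0: "0 \<in> H" using diff[OF P(1) P(1)] by simp
  have neg: "- x \<in> H" if "x \<in> H" for x using diff[OF 0 that] by simp
  have add: "x + y \<in> H" if "x \<in> H" "y \<in> H" for x y using diff[OF that(1) neg[OF that(2)]] by simp
  have mult: "int n * int k \<in> H" for k
    by (induction k) (auto simp: 0 distrib_left intro: add n)
  have multi: "int n * k \<in> H" for k
    using mult[of "nat k"] neg[OF mult[of "nat (- k)"]] by (cases "k \<ge> 0") auto
  have "h \<in> H \<longleftrightarrow> int n dvd h" for h
  proof
    assume h: "h \<in> H"
    have "h mod int n = h - int n * (h div int n)" by (simp add: minus_mult_div_eq_mod)
    hence r: "h mod int n \<in> H" using diff[OF h multi] by simp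
    show "int n dvd h"
    proof (rule ccontr)
      assume "\<not> int n dvd h"
      hence "h mod int n \<noteq> 0" by (simp add: mod_eq_0_iff_dvd)
      moreover have "0 \<le> h mod int n" "h mod int n < int n" using n(2) by auto
      ultimately have p: "h mod int n > 0" "h mod int n < int n" by linarith+
      have "n \<le> nat (h mod int n)" using r p by (intro min) auto
      thus False using p by linarith
    qed
  next
    assume "int n dvd h"
    thus "h \<in> H" using multi by (auto simp: dvd_def)
  qed
  thus ?thesis using n by (intro exI[of _ "int n"]) auto
qed

lemma convex_int_set:
  fixes A :: "int set"
  assumes sub: "A \<subseteq> {0..<n}" and conv: "\<And>x y z. x \<in> A \<Longrightarrow> z \<in> A \<Longrightarrow> x \<le> y \<Longrightarrow> y \<le> z \<Longrightarrow> y \<in> A"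
    and n: "n \<ge> 0"
  shows "\<exists>a b. A = {a..<b} \<and> b - a \<le> n"
proof (cases "A = {}")
  case True
  thus ?thesis using n by (intro exI[of _ 0]) auto
next
  case False
  have fin: "finite A" using sub finite_subset by blast
  have "A = {Min A..<Max A + 1}"
  proof (intro equalityI subsetI)
    fix y assume "y \<in> {Min A..<Max A + 1}"
    thus "y \<in> A" using conv[OF Min_in[OF fin False] Max_in[OF fin False], of y] by simp
  qed (use fin in \<open>auto simp: Max_ge le_imp_less_Suc\<close>)
  moreover have "Min A \<in> {0..<n}" "Max A \<in> {0..<n}" using sub fin False Min_in Max_in by blast+
  ultimately show ?thesis by (intro exI[of _ "Min A"] exI[of _ "Max A + 1"]) auto
qed

text \<open>The left side is at most the number of divisors, so the divisor bound over the rational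
  primes applies.\<close>

lemma two_power_prime_factors_bound:
  fixes \<eta> :: real assumes "\<eta> > 0"
  shows "\<exists>K\<ge>1. \<forall>t::int. t \<ge> 1 \<longrightarrow> 2 ^ card (prime_factors t) \<le> K * of_int t powr \<eta>"
proof -
  have fin: "finite {p \<in> {p::int. prime p}. real_of_int p < x}" for x
  proof (rule finite_subset)
    show "{p \<in> {p::int. prime p}. real_of_int p < x} \<subseteq> {0..\<lceil>x\<rceil>}"
      using prime_ge_0_int by (auto simp: le_ceiling_iff)
  qed auto
  obtain K where K: "K \<ge> 1" "\<And>A. set_mset A \<subseteq> {p::int. prime p} \<Longrightarrow>
      real (\<Prod>p\<in>set_mset A. count A p + 1) \<le> K * (\<Prod>p\<in>#A. real_of_int p) powr \<eta>"
    using prod_count_le_powr[OF _ fin assms] prime_ge_2_int by force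
  show ?thesis
  proof (intro exI[of _ K] conjI allI impI K(1))
    fix t :: int assume t: "t \<ge> 1"
    define A where "A = prime_factorization t"
    have "(\<Prod>p\<in>#A. real_of_int p) = of_int (prod_mset A)"
      by (induction A) auto
    also have "prod_mset A = t" using t unfolding A_def by (simp add: prod_mset_prime_factorization_int)
    finally have p: "(\<Prod>p\<in>#A. real_of_int p) = of_int t" .
    have "(2::nat) ^ card (set_mset A) = (\<Prod>p\<in>set_mset A. 2)" by simp
    also have "\<dots> \<le> (\<Prod>p\<in>set_mset A. count A p + 1)"
      by (intro prod_mono) (auto simp: Suc_le_eq)
    finally have "real (2 ^ card (set_mset A)) \<le> real (\<Prod>p\<in>set_mset A. count A p + 1)"
      by (simp only: of_nat_le_iff)
    also have "\<dots> \<le> K * (\<Prod>p\<in>#A. real_of_int p) powr \<eta>" by (rule K(2)) (auto simp: A_def)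
    finally show "2 ^ card (prime_factors t) \<le> K * of_int t powr \<eta>" unfolding p by (simp add: A_def)
  qed
qed

text \<open>For fixed u, divisibility by m cuts out a progression in v, and splitting v modulo 16
  makes both characters constant. What remains is (v / u) along progressions; its bound does not see
  the modulus of the progression and hence is uniform in m.\<close>

lemma row_sum_bound:
  assumes dc: "dirichlet_char 16 \<phi>" "dirichlet_char 16 \<psi>" and m: "m \<noteq> 0"
    and u: "u = s * t\<^sup>2" "s \<ge> 1" "odd u" "squarefree s" "t \<noteq> 0" and N: "of_int (b - a) \<le> N" "0 \<le> N"
  shows "cmod (\<Sum>v | v \<in> {a..<b} \<and> m dvd ZSqrt2 u v. twisted_spin \<phi> \<psi> (ZSqrt2 u v))
    \<le> 16 * (2 ^ card (prime_factors t) * ((2 * N + 2 * of_int s * (1 + ln (of_int s))) / sqrt (of_int s)))"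
    (is "_ \<le> 16 * ?B")
proof -
  have so: "odd s" using u by auto
  define V where "V = {v. v \<in> {a..<b} \<and> m dvd ZSqrt2 u v}"
  have finV: "finite V" by (rule finite_subset[of _ "{a..<b}"]) (auto simp: V_def)
  have B0: "?B \<ge> 0" using u(2) N by simp
  define H where "H = {h. m dvd ZSqrt2 0 h \<and> 16 dvd h}"
  have "\<exists>q\<ge>1. \<forall>h. h \<in> H \<longleftrightarrow> q dvd h"
  proof (rule int_subgroup_principal)
    fix x y assume "x \<in> H" "y \<in> H"
    moreover have "ZSqrt2 0 (x - y) = ZSqrt2 0 x - ZSqrt2 0 y" by (simp add: zsqrt2_eq_iff)
    ultimately show "x - y \<in> H" by (auto simp: H_def)
  next
    \<comment> \<open>The subgroup of admissible differences is nonzero, since it contains 16 |nrm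
      m|.\<close>
    have "ZSqrt2 0 (16 * \<bar>nrm m\<bar>) = m * (conj2 m * ZSqrt2 0 (16 * sgn (nrm m)))"
      by (simp add: mult.assoc[symmetric] mult_conj2) (simp add: zsqrt2_eq_iff abs_sgn)
    hence "m dvd ZSqrt2 0 (16 * \<bar>nrm m\<bar>)" by (metis dvd_triv_left)
    thus "16 * \<bar>nrm m\<bar> \<in> H" by (simp add: H_def)
    show "16 * \<bar>nrm m\<bar> \<ge> 1" using m nrm_eq_0_iff[of m] by linarith
  qed
  then obtain q where q: "q \<ge> 1" "\<And>h. h \<in> H \<longleftrightarrow> q dvd h" by blast
  have part: "cmod (\<Sum>v | v \<in> V \<and> v mod 16 = c. twisted_spin \<phi> \<psi> (ZSqrt2 u v)) \<le> ?B" for c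
  proof (cases "{v. v \<in> V \<and> v mod 16 = c} = {}")
    case True
    show ?thesis unfolding True using B0 by simp
  next
    case False
    then obtain r where r: "r \<in> V" "r mod 16 = c" by blast
    have eq: "{v. v \<in> V \<and> v mod 16 = c} = {v. v \<in> {a..<b} \<and> q dvd v - r}"
    proof -
      have "m dvd ZSqrt2 u v \<and> v mod 16 = c \<longleftrightarrow> q dvd v - r" for v
      proof -
        have "ZSqrt2 u v = ZSqrt2 u r + ZSqrt2 0 (v - r)" by (simp add: zsqrt2_eq_iff)
        hence "m dvd ZSqrt2 u v \<longleftrightarrow> m dvd ZSqrt2 0 (v - r)"
          using r(1) by (simp add: V_def dvd_add_right_iff)
        moreover have "v mod 16 = c \<longleftrightarrow> 16 dvd v - r" unfolding r(2)[symmetric] by (rule mod_eq_dvd_iff)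
        ultimately show ?thesis unfolding q(2)[symmetric] H_def by simp
      qed
      thus ?thesis by (auto simp: V_def)
    qed
    have tw: "twisted_spin \<phi> \<psi> (ZSqrt2 u v) = (\<phi> (- u\<^sup>2 + 2 * r\<^sup>2) * \<psi> u) * of_int (Jacobi v (s * t\<^sup>2))"
      if "v mod 16 = c" for v
    proof -
      have "(- u\<^sup>2 + 2 * v\<^sup>2) mod 16 = (- u\<^sup>2 + 2 * r\<^sup>2) mod 16"
        unfolding power2_eq_square by (intro mod_16_cong) (use that r(2) in simp_all)
      hence "\<phi> (- u\<^sup>2 + 2 * v\<^sup>2) = \<phi> (- u\<^sup>2 + 2 * r\<^sup>2)" by (rule dirichlet_char_cong[OF dc(1)])
      thus ?thesis using u(1,3) by (simp add: twisted_spin_def spin_def)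
    qed
    have "(\<Sum>v | v \<in> V \<and> v mod 16 = c. twisted_spin \<phi> \<psi> (ZSqrt2 u v)) =
      (\<phi> (- u\<^sup>2 + 2 * r\<^sup>2) * \<psi> u) * (\<Sum>v | v \<in> V \<and> v mod 16 = c. of_int (Jacobi v (s * t\<^sup>2)))"
      unfolding sum_distrib_left by (intro sum.cong refl) (use tw in blast)
    also have "cmod \<dots> \<le> 1 * ?B"
      unfolding norm_mult eq
    proof (rule mult_mono)
      show "cmod (\<phi> (- u\<^sup>2 + 2 * r\<^sup>2)) * cmod (\<psi> u) \<le> 1"
        by (intro mult_le_one norm_dirichlet_char_le[OF dc(1)] norm_dirichlet_char_le[OF dc(2)] norm_ge_zero)
      show "cmod (\<Sum>v | v \<in> {a..<b} \<and> q dvd v - r. of_int (Jacobi v (s * t\<^sup>2))) \<le> ?B"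
        using u so N q by (intro polya_vinogradov_progression) auto
    qed auto
    finally show ?thesis by simp
  qed
  have "(\<Sum>v\<in>V. twisted_spin \<phi> \<psi> (ZSqrt2 u v)) =
     (\<Sum>c\<in>{0..<16}. \<Sum>v | v \<in> V \<and> v mod 16 = c. twisted_spin \<phi> \<psi> (ZSqrt2 u v))"
    by (rule sum.group[symmetric]) (use finV in auto)
  also have "cmod \<dots> \<le> (\<Sum>c\<in>{0..<16::int}. ?B)" by (intro sum_norm_le part)
  finally show ?thesis by (simp add: V_def)
qed

lemma sum_inverse_sqrt_le:
  assumes "n \<ge> 0" shows "(\<Sum>s\<in>{1..n::int}. 1 / sqrt (of_int s)) \<le> 2 * sqrt (of_int n)"
  using assms
proof (induction n rule: int_ge_induct)
  case (step i)
  define x y where "x = sqrt (real_of_int i)" and "y = sqrt (real_of_int (i + 1))"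
  have y: "y > 0" "x \<ge> 0" "y\<^sup>2 - x\<^sup>2 = 1" using step.hyps by (auto simp: x_def y_def)
  have "0 \<le> (y - x)\<^sup>2" by simp
  hence "1 \<le> (2 * y - 2 * x) * y" using y(3) by (simp add: power2_eq_square algebra_simps)
  hence "1 / y \<le> 2 * y - 2 * x" using y(1) by (simp add: field_simps)
  moreover have "{1..i + 1} = insert (i + 1) {1..i}" using step by auto
  hence "(\<Sum>s\<in>{1..i + 1}. 1 / sqrt (of_int s)) = 1 / y + (\<Sum>s\<in>{1..i}. 1 / sqrt (of_int s))"
    by (simp add: y_def)
  ultimately show ?case using step.IH unfolding x_def y_def by linarith
qed simp

lemma squarefree_part_int:
  assumes "u \<ge> (1::int)"
  shows "u = squarefree_part u * (square_part u)\<^sup>2" "squarefree_part u \<ge> 1" "squarefree (squarefree_part u)"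
    "square_part u \<ge> 1" "squarefree_part u \<le> u" "square_part u \<le> u"
proof -
  show d: "u = squarefree_part u * (square_part u)\<^sup>2" by (rule squarefree_decompose)
  have n0: "square_part u \<noteq> 0" using assms by auto
  have "normalize (square_part u) = square_part u" using assms by (simp add: square_part_def)
  hence "square_part u \<ge> 0" by (metis abs_ge_zero normalize_int_def)
  thus t: "square_part u \<ge> 1" using n0 by linarith
  have t2: "(square_part u)\<^sup>2 \<ge> 1" "square_part u \<le> (square_part u)\<^sup>2"
    using t one_le_power[of "square_part u" 2] self_le_power[of "square_part u" 2] by simp_all
  have "squarefree_part u > 0" using d assms t2 by (metis zero_less_mult_pos2 less_le_trans zero_less_one)
  thus s: "squarefree_part u \<ge> 1" by simp
  show "squarefree (squarefree_part u)" by simp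
  have "squarefree_part u * 1 \<le> squarefree_part u * (square_part u)\<^sup>2" using s t2 by (intro mult_left_mono) auto
  thus "squarefree_part u \<le> u" using d by simp
  have "1 * (square_part u)\<^sup>2 \<le> squarefree_part u * (square_part u)\<^sup>2" using s by (intro mult_right_mono) auto
  thus "square_part u \<le> u" using d t2 by simp
qed

text \<open>The row bound is weak when u has a small squarefree part, but such u are rare: writing u
  = s t^2, the sum over s <= U / t^2 is at most 2 sqrt U / t, and the sum over t costs a
  logarithm.\<close>

lemma sum_inverse_sqrt_squarefree_part_le:
  assumes "U \<ge> (1::int)"
  shows "(\<Sum>u\<in>{1..U}. 1 / sqrt (of_int (squarefree_part u))) \<le> 2 * sqrt (of_int U) * (1 + ln (of_int U))"
proof -
  define S where "S = Sigma {1..U} (\<lambda>t. {1..U div t\<^sup>2})"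
  have "(\<Sum>u\<in>{1..U}. 1 / sqrt (of_int (squarefree_part u))) =
      (\<Sum>(t, s)\<in>(\<lambda>u. (square_part u, squarefree_part u)) ` {1..U}. 1 / sqrt (of_int s))"
  proof (subst sum.reindex)
    show "inj_on (\<lambda>u. (square_part u, squarefree_part u)) {1..U}"
      by (rule inj_onI) (metis prod.inject squarefree_decompose)
  qed auto
  also have "\<dots> \<le> (\<Sum>(t, s)\<in>S. 1 / sqrt (of_int s))"
  proof (rule sum_mono2)
    show "finite S" by (simp add: S_def)
    show "(\<lambda>u. (square_part u, squarefree_part u)) ` {1..U} \<subseteq> S"
    proof safe
      fix u assume u: "u \<in> {1..U}"
      hence u1: "u \<ge> 1" by simp
      note q = squarefree_part_int[OF u1]
      have "squarefree_part u = u div (square_part u)\<^sup>2" using q(1,4) by (metis nonzero_mult_div_cancel_right not_one_le_zero power_eq_0_iff)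
      also have "\<dots> \<le> U div (square_part u)\<^sup>2" using u by (intro zdiv_mono1) (use q(4) in auto)
      finally show "(square_part u, squarefree_part u) \<in> S" using q u by (auto simp: S_def)
    qed
  qed (auto simp: S_def)
  also have "\<dots> = (\<Sum>t\<in>{1..U}. \<Sum>s\<in>{1..U div t\<^sup>2}. 1 / sqrt (of_int s))"
    unfolding S_def by (rule sum.Sigma[symmetric]) auto
  also have "\<dots> \<le> (\<Sum>t\<in>{1..U}. 2 * sqrt (of_int U) * (1 / of_int t))"
  proof (rule sum_mono)
    fix t assume t: "t \<in> {1..U}"
    have "(\<Sum>s\<in>{1..U div t\<^sup>2}. 1 / sqrt (of_int s)) \<le> 2 * sqrt (of_int (U div t\<^sup>2))"
      using assms by (intro sum_inverse_sqrt_le) (simp add: div_int_pos_iff)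
    also have "sqrt (of_int (U div t\<^sup>2)) \<le> sqrt (of_int U / (of_int t)\<^sup>2)"
      using real_of_int_div4[of U "t\<^sup>2"] by simp
    also have "\<dots> = sqrt (of_int U) * (1 / of_int t)" using t by (simp add: real_sqrt_divide)
    finally show "(\<Sum>s\<in>{1..U div t\<^sup>2}. 1 / sqrt (of_int s)) \<le> 2 * sqrt (of_int U) * (1 / of_int t)" by simp
  qed
  also have "\<dots> = 2 * sqrt (of_int U) * (\<Sum>t\<in>{1..U}. 1 / of_int t)" by (simp add: sum_distrib_left)
  also have "\<dots> \<le> 2 * sqrt (of_int U) * (1 + ln (of_int U))"
    using assms sum_inverse_le[OF assms] by (intro mult_left_mono) auto
  finally show ?thesis .
qed

lemma unit_sq_power_props:
  shows "unit_sq ^ k * unit_sq_inv ^ k = 1" "nrm (unit_sq ^ k) = 1" "fund_unit ^ (2 * k) = unit_sq ^ k"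
  by (simp_all add: power_mult_distrib[symmetric] unit_sq_mult_inv nrm_power power_mult fund_unit_power2)
     (simp add: nrm_def)

text \<open>The region 0 <= v < u is mapped into itself by 3 + 2 sqrt 2, and the new rational part 3
  u + 4 v is at most 7 u.\<close>

lemma unit_sq_power_box:
  assumes "0 < rat_part w" "0 \<le> sqrt_part w" "sqrt_part w < rat_part w"
  shows "0 < rat_part (unit_sq ^ k * w) \<and> 0 \<le> sqrt_part (unit_sq ^ k * w) \<and>
    sqrt_part (unit_sq ^ k * w) < rat_part (unit_sq ^ k * w) \<and> rat_part (unit_sq ^ k * w) \<le> 7 ^ k * rat_part w"
proof (induction k)
  case 0 thus ?case using assms by simp
next
  case (Suc k)
  define z where "z = unit_sq ^ k * w"
  have z: "0 < rat_part z" "0 \<le> sqrt_part z" "sqrt_part z < rat_part z" "rat_part z \<le> 7 ^ k * rat_part w"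
    using Suc unfolding z_def by blast+
  have "unit_sq ^ Suc k * w = unit_sq * z" by (simp only: z_def mult.assoc power_Suc)
  moreover have "rat_part (unit_sq * z) = 3 * rat_part z + 4 * sqrt_part z"
    "sqrt_part (unit_sq * z) = 3 * sqrt_part z + 2 * rat_part z" by simp_all
  moreover have "(7::int) ^ Suc k * rat_part w = 7 * (7 ^ k * rat_part w)" by simp
  ultimately show ?case using z by (simp only:) linarith
qed

text \<open>The domain and its translates by \<epsilon>^(2k) are cut into rows of constant rational
  part u. A row is an interval of length at most u, and u is at most a constant times sqrt Z. With R
  of that order, the row bounds add up to R^(3/2) = Z^(3/4) up to small powers, uniformly in
  m.\<close>

lemma type_I_elements:
  fixes \<eta> :: real assumes \<eta>: "\<eta> > 0"
  shows "\<exists>C>0. \<forall>\<phi> \<psi> (m::zsqrt2) Z. dirichlet_char 16 \<phi> \<longrightarrow> dirichlet_char 16 \<psi> \<longrightarrow> m \<noteq> 0 \<longrightarrow> Z \<ge> 1 \<longrightarrow>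
    cmod (\<Sum>w | canonical w \<and> real_of_int (nrm w) \<le> Z \<and> m dvd w. spin_sum \<phi> \<psi> w) \<le> C * Z powr (3 / 4 + \<eta>)"
proof -
  \<comment> \<open>Three factors R^\<delta> arise, with R of order sqrt Z, so their product is of
    order Z^\<eta>.\<close>
  define \<delta> where "\<delta> = 2 * \<eta> / 3"
  have \<delta>: "\<delta> > 0" using \<eta> by (simp add: \<delta>_def)
  obtain K where K: "K \<ge> 1" "\<And>t::int. t \<ge> 1 \<Longrightarrow> 2 ^ card (prime_factors t) \<le> K * of_int t powr \<delta>"
    using two_power_prime_factors_bound[OF \<delta>] by blast
  define C0 where "C0 = 16 * K * ((4 + 2 / \<delta>) * (2 * (1 + 1 / \<delta>)))"
  have C0: "C0 > 0" using K \<delta> by (auto simp: C0_def intro!: mult_pos_pos add_pos_pos)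
  define C where "C = 4 * (C0 * 1029 powr (3 / 2 + 3 * \<delta>))"
  show ?thesis
  proof (intro exI[of _ C] conjI allI impI)
    show "C > 0" using C0 by (simp add: C_def)
    fix \<phi> \<psi> and m :: zsqrt2 and Z :: real
    assume dc: "dirichlet_char 16 \<phi>" "dirichlet_char 16 \<psi>" and m: "m \<noteq> 0" and Z: "Z \<ge> 1"
    define W where "W = {w. canonical w \<and> real_of_int (nrm w) \<le> Z \<and> m dvd w}"
    have finW: "finite W" unfolding W_def
      by (rule finite_subset[OF _ finite_card_canonical(1)[OF Z]]) auto
    \<comment> \<open>1029 = 3 * 7^3: rational parts up to 3 sqrt Z in the domain, times 7 for each
      of at most three multiplications by \<epsilon>^2.\<close>
    define U where "U = \<lfloor>1029 * sqrt Z\<rfloor>"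
    have sX: "sqrt Z \<ge> 1" using Z by simp
    have "1 \<le> 1029 * sqrt Z" using sX by linarith
    hence U1: "U \<ge> 1" unfolding U_def by (subst le_floor_iff) simp
    have UX: "real_of_int U \<le> 1029 * sqrt Z" by (simp add: U_def)
    define R where "R = real_of_int U"
    have R1: "R \<ge> 1" using U1 by (simp add: R_def)
    have fixed: "cmod (\<Sum>w\<in>W. twisted_spin \<phi> \<psi> (fund_unit ^ (2 * k) * w)) \<le> C0 * R powr (3 / 2 + 3 * \<delta>)"
      if k: "k \<le> 3" for k
    proof -
      define e ei where "e = unit_sq ^ k" and "ei = unit_sq_inv ^ k"
      have e: "e * ei = 1" "nrm e = 1" "fund_unit ^ (2 * k) = e" by (simp_all add: e_def ei_def unit_sq_power_props)
      define A where "A = (\<lambda>u. {v. canonical (ei * ZSqrt2 u v) \<and> real_of_int (nrm (ZSqrt2 u v)) \<le> Z})"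
      define V where "V = (\<lambda>u. {v. v \<in> A u \<and> m dvd ZSqrt2 u v})"
      have unit: "e dvd 1" "ei dvd 1" using e(1) by (metis dvd_triv_left, metis dvd_triv_right)
      have nei: "nrm ei = 1" using e(1,2) by (metis mult_1 nrm_mult nrm_simps(2))
      have box: "0 < u \<and> 0 \<le> v \<and> v < u \<and> u \<le> U" if v: "v \<in> A u" for u v
      proof -
        define w where "w = ei * ZSqrt2 u v"
        have w: "canonical w" "real_of_int (nrm w) \<le> Z"
          using v by (auto simp: A_def w_def nrm_mult nei)
        have ew: "e * w = ZSqrt2 u v" unfolding w_def mult.assoc[symmetric] e(1) by simp
        note cb = canonical_box[OF w]
        have B: "0 < u" "0 \<le> v" "v < u" "u \<le> 7 ^ k * rat_part w"
          using unit_sq_power_box[OF cb(1,3,4), of k] unfolding e_def[symmetric] ew by auto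
        have "7 ^ k * rat_part w \<le> 7 ^ 3 * rat_part w" using k cb by (intro mult_right_mono power_increasing) auto
        hence "u \<le> 343 * rat_part w" using B(4) by simp
        hence "real_of_int u \<le> 343 * real_of_int (rat_part w)" by linarith
        also have "\<dots> \<le> 1029 * sqrt Z" using cb(2) by simp
        finally have "u \<le> U" by (simp add: U_def le_floor_iff)
        thus ?thesis using B by simp
      qed
      \<comment> \<open>The translated domain is given by strict inequalities that are affine in v,
        and for v >= 0 the norm decreases in v. Both conditions therefore persist between two
        admissible values.\<close>
      have int: "\<exists>a b. A u = {a..<b} \<and> b - a \<le> u" if "u \<ge> 1" for u
      proof (rule convex_int_set)
        show "A u \<subseteq> {0..<u}" using box by auto
        fix x y z assume xz: "x \<in> A u" "z \<in> A u" "x \<le> y" "y \<le> z"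
        have lin: "\<alpha> * y + \<beta> > 0" if "\<alpha> * x + \<beta> > 0" "\<alpha> * z + \<beta> > 0" for \<alpha> \<beta> :: int
        proof (cases "\<alpha> \<ge> 0")
          case True
          have "\<alpha> * x \<le> \<alpha> * y" using True xz by (intro mult_left_mono) auto
          thus ?thesis using that by linarith
        next
          case False
          have "\<alpha> * z \<le> \<alpha> * y" using False xz by (intro mult_left_mono_neg) auto
          thus ?thesis using that by linarith
        qed
        define p q where "p = rat_part ei" and "q = sqrt_part ei"
        have can: "canonical (ei * ZSqrt2 u v) \<longleftrightarrow> (2 * q) * v + p * u > 0 \<and> p * v + (q * u + 1) > 0 \<and>
            (4 * q - 3 * p) * v + (2 * p * u - 3 * q * u) > 0" for v
          by (auto simp: canonical_def p_def q_def algebra_simps)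
        have "canonical (ei * ZSqrt2 u y)"
          using xz(1,2) lin unfolding A_def can by blast
        moreover have "nrm (ZSqrt2 u y) \<le> nrm (ZSqrt2 u x)"
          using box[OF xz(1)] xz by (simp add: nrm_def power_mono)
        hence "real_of_int (nrm (ZSqrt2 u y)) \<le> Z" using xz(1) by (simp add: A_def)
        ultimately show "y \<in> A u" by (simp add: A_def)
      qed (use that in auto)
      have finV: "finite (V u)" for u
        by (rule finite_subset[of _ "{0..<u}"]) (use box in \<open>auto simp: V_def\<close>)
      have img: "(\<lambda>w. e * w) ` W = (\<lambda>(u, v). ZSqrt2 u v) ` Sigma {1..U} V"
      proof (intro equalityI subsetI)
        fix z assume "z \<in> (\<lambda>w. e * w) ` W"
        then obtain w where w: "w \<in> W" "z = e * w" by blast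
        have ez: "ei * z = w" unfolding w(2) mult.assoc[symmetric] using e(1) by (simp add: mult.commute)
        have "m dvd z" using w by (auto simp: W_def)
        moreover have "real_of_int (nrm z) \<le> Z" using w by (simp add: W_def nrm_mult e(2))
        ultimately have "sqrt_part z \<in> V (rat_part z)" using w(1) ez by (auto simp: V_def A_def W_def)
        moreover from this have "rat_part z \<in> {1..U}" using box by (force simp: V_def)
        ultimately show "z \<in> (\<lambda>(u, v). ZSqrt2 u v) ` Sigma {1..U} V"
          by (intro image_eqI[of _ _ "(rat_part z, sqrt_part z)"]) auto
      next
        fix z assume "z \<in> (\<lambda>(u, v). ZSqrt2 u v) ` Sigma {1..U} V"
        then obtain u v where z: "z = ZSqrt2 u v" "v \<in> V u" by auto
        have "ei * z \<in> W" using z nei unit by (auto simp: W_def V_def A_def nrm_mult)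
        moreover have "z = e * (ei * z)" unfolding mult.assoc[symmetric] e(1) by simp
        ultimately show "z \<in> (\<lambda>w. e * w) ` W" by blast
      qed
      have e0: "e \<noteq> 0" using e(2) by auto
      have "(\<Sum>w\<in>W. twisted_spin \<phi> \<psi> (fund_unit ^ (2 * k) * w)) = (\<Sum>z\<in>(\<lambda>w. e * w) ` W. twisted_spin \<phi> \<psi> z)"
        unfolding e(3) by (subst sum.reindex) (use e0 in \<open>auto simp: inj_on_def\<close>)
      also have "\<dots> = (\<Sum>(u, v)\<in>Sigma {1..U} V. twisted_spin \<phi> \<psi> (ZSqrt2 u v))"
        unfolding img by (subst sum.reindex) (auto simp: inj_on_def case_prod_unfold)
      also have "\<dots> = (\<Sum>u\<in>{1..U}. \<Sum>v\<in>V u. twisted_spin \<phi> \<psi> (ZSqrt2 u v))"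
        by (rule sum.Sigma[symmetric]) (use finV in auto)
      also have "cmod \<dots> \<le> (\<Sum>u\<in>{1..U}. 16 * (K * R powr \<delta> * (R * (4 + 2 * ln R))) * (1 / sqrt (of_int (squarefree_part u))))"
      proof (rule sum_norm_le)
        fix u assume u: "u \<in> {1..U}"
        hence u1: "u \<ge> 1" by simp
        note q = squarefree_part_int[OF u1]
        define s t where "s = squarefree_part u" and "t = square_part u"
        have st: "u = s * t\<^sup>2" "s \<ge> 1" "squarefree s" "t \<ge> 1" "s \<le> u" "t \<le> u" using q by (simp_all add: s_def t_def)
        have uR: "real_of_int u \<le> R" "real_of_int s \<le> R" "real_of_int t \<le> R"
          using u st(5,6) by (auto simp: R_def)
        have lnR: "ln R \<ge> 0" using R1 by simp
        show "cmod (\<Sum>v\<in>V u. twisted_spin \<phi> \<psi> (ZSqrt2 u v)) \<le>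
          16 * (K * R powr \<delta> * (R * (4 + 2 * ln R))) * (1 / sqrt (of_int (squarefree_part u)))"
        proof (cases "odd u")
          case False
          have "twisted_spin \<phi> \<psi> (ZSqrt2 u v) = 0" for v using False by (simp add: twisted_spin_def spin_def)
          thus ?thesis using K(1) R1 lnR st(2) by (simp add: s_def[symmetric])
        next
          case True
          obtain a b where ab: "A u = {a..<b}" "b - a \<le> u" using int[OF u1] by blast
          have "cmod (\<Sum>v | v \<in> {a..<b} \<and> m dvd ZSqrt2 u v. twisted_spin \<phi> \<psi> (ZSqrt2 u v))
            \<le> 16 * (2 ^ card (prime_factors t) * ((2 * R + 2 * of_int s * (1 + ln (of_int s))) / sqrt (of_int s)))"
            by (rule row_sum_bound[OF dc m st(1,2) True st(3)]) (use ab(2) uR R1 st(4) in linarith)+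
          also have "\<dots> \<le> 16 * ((K * R powr \<delta>) * ((2 * R + 2 * R * (1 + ln R)) / sqrt (of_int s)))"
          proof (intro mult_left_mono mult_mono divide_right_mono add_mono order_refl)
            have "2 ^ card (prime_factors t) \<le> K * of_int t powr \<delta>" by (rule K(2)[OF st(4)])
            also have "\<dots> \<le> K * R powr \<delta>" using K(1) uR st(4) \<delta> by (intro mult_left_mono powr_mono2) auto
            finally show "2 ^ card (prime_factors t) \<le> K * R powr \<delta>" .
            show "ln (real_of_int s) \<le> ln R" using uR st(2) by simp
          qed (use uR R1 st(2) K(1) lnR in auto)
          also have "\<dots> = 16 * (K * R powr \<delta> * (R * (4 + 2 * ln R))) * (1 / sqrt (of_int s))"
            by (simp add: algebra_simps add_divide_distrib)
          finally show ?thesis by (simp add: V_def ab(1) s_def)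
        qed
      qed
      also have "\<dots> = 16 * (K * R powr \<delta> * (R * (4 + 2 * ln R))) * (\<Sum>u\<in>{1..U}. 1 / sqrt (of_int (squarefree_part u)))"
        by (simp only: sum_distrib_left)
      also have "\<dots> \<le> 16 * (K * R powr \<delta> * (R * (4 + 2 * ln R))) * (2 * sqrt R * (1 + ln R))"
        unfolding R_def using sum_inverse_sqrt_squarefree_part_le[OF U1] K(1) U1
        by (intro mult_left_mono) auto
      also have "\<dots> \<le> 16 * (K * R powr \<delta> * (R * ((4 + 2 / \<delta>) * R powr \<delta>))) * (2 * sqrt R * ((1 + 1 / \<delta>) * R powr \<delta>))"
      proof -
        have l: "ln R \<le> R powr \<delta> / \<delta>" by (rule ln_powr_bound[OF R1 \<delta>])
        have p: "1 \<le> R powr \<delta>" using R1 \<delta> by (simp add: ge_one_powr_ge_zero)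
        have l4: "4 + 2 * ln R \<le> (4 + 2 / \<delta>) * R powr \<delta>" and l1: "1 + ln R \<le> (1 + 1 / \<delta>) * R powr \<delta>"
          using l p by (simp_all add: algebra_simps)
        have lnR: "ln R \<ge> 0" using R1 by simp
        show ?thesis
          by (intro mult_mono l4 l1 order_refl mult_nonneg_nonneg) (use K(1) R1 lnR \<delta> in auto)
      qed
      also have "\<dots> = C0 * (R * sqrt R * (R powr \<delta> * R powr \<delta> * R powr \<delta>))"
        by (simp add: C0_def algebra_simps)
      also have "R * sqrt R * (R powr \<delta> * R powr \<delta> * R powr \<delta>) = R powr (3 / 2 + 3 * \<delta>)"
      proof -
        have "R * sqrt R = R powr 1 * R powr (1 / 2)" using R1 by (simp add: powr_half_sqrt)
        also have "\<dots> = R powr (1 + 1 / 2)" by (rule powr_add[symmetric])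
        finally have "R * sqrt R = R powr (3 / 2)" by simp
        hence "R * sqrt R * (R powr \<delta> * R powr \<delta> * R powr \<delta>) = R powr (3 / 2 + (\<delta> + \<delta> + \<delta>))"
          by (simp only: powr_add mult.assoc)
        moreover have "3 / 2 + (\<delta> + \<delta> + \<delta>) = 3 / 2 + 3 * \<delta>" by simp
        ultimately show ?thesis by (simp only:)
      qed
      finally show ?thesis .
    qed
    have "(\<Sum>w\<in>W. spin_sum \<phi> \<psi> w) = (\<Sum>k\<le>3. \<Sum>w\<in>W. twisted_spin \<phi> \<psi> (fund_unit ^ (2 * k) * w))"
      unfolding spin_sum_def by (rule sum.swap)
    also have "cmod \<dots> \<le> (\<Sum>k\<le>3::nat. C0 * R powr (3 / 2 + 3 * \<delta>))"
      by (intro sum_norm_le fixed) auto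
    also have "\<dots> = 4 * (C0 * R powr (3 / 2 + 3 * \<delta>))" by simp
    also have "\<dots> \<le> 4 * (C0 * (1029 * sqrt Z) powr (3 / 2 + 3 * \<delta>))"
      using C0 UX R1 \<delta> by (intro mult_left_mono powr_mono2) (auto simp: R_def)
    also have "(1029 * sqrt Z) powr (3 / 2 + 3 * \<delta>) = 1029 powr (3 / 2 + 3 * \<delta>) * Z powr (3 / 4 + \<eta>)"
    proof -
      have "sqrt Z powr (3 / 2 + 3 * \<delta>) = Z powr (1 / 2 * (3 / 2 + 3 * \<delta>))"
        using Z by (simp add: powr_half_sqrt[symmetric] powr_powr)
      also have "1 / 2 * (3 / 2 + 3 * \<delta>) = 3 / 4 + \<eta>" unfolding \<delta>_def by simp
      finally have e: "sqrt Z powr (3 / 2 + 3 * \<delta>) = Z powr (3 / 4 + \<eta>)" .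
      have "0 \<le> sqrt Z" using Z by simp
      hence "(1029 * sqrt Z) powr p = 1029 powr p * sqrt Z powr p" for p by (intro powr_mult)
      thus ?thesis unfolding e[symmetric] .
    qed
    finally show "cmod (\<Sum>w | canonical w \<and> real_of_int (nrm w) \<le> Z \<and> m dvd w. spin_sum \<phi> \<psi> w) \<le> C * Z powr (3 / 4 + \<eta>)"
      by (simp add: C_def W_def mult_ac)
  qed
qed

text \<open>Adding B identifies the multisets of norm at most T with the canonical elements that are
  divisible by the generator of B and have norm at most T times that of B.\<close>

lemma type_I_bound:
  fixes \<eta> :: real assumes \<eta>: "\<eta> > 0"
  shows "\<exists>C>0. \<forall>\<phi> \<psi> B T. dirichlet_char 16 \<phi> \<longrightarrow> dirichlet_char 16 \<psi> \<longrightarrow> B \<in> prime_msets \<longrightarrow>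
    cmod (\<Sum>D\<in>msets_upto T. spin_sum \<phi> \<psi> (prod_mset (B + D))) \<le> C * (T * mnorm B) powr (3 / 4 + \<eta>)"
proof -
  obtain C where C: "C > 0" "\<forall>\<phi> \<psi> (m::zsqrt2) Z. dirichlet_char 16 \<phi> \<longrightarrow> dirichlet_char 16 \<psi> \<longrightarrow> m \<noteq> 0 \<longrightarrow> Z \<ge> 1 \<longrightarrow>
    cmod (\<Sum>w | canonical w \<and> real_of_int (nrm w) \<le> Z \<and> m dvd w. spin_sum \<phi> \<psi> w) \<le> C * Z powr (3 / 4 + \<eta>)"
    using type_I_elements[OF \<eta>] by (elim exE conjE) (rule that)
  show ?thesis
  proof (intro exI[of _ C] conjI allI impI C(1))
    fix \<phi> \<psi> B and T :: real
    assume dc: "dirichlet_char 16 \<phi>" "dirichlet_char 16 \<psi>" and B: "B \<in> prime_msets"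
    show "cmod (\<Sum>D\<in>msets_upto T. spin_sum \<phi> \<psi> (prod_mset (B + D))) \<le> C * (T * mnorm B) powr (3 / 4 + \<eta>)"
    proof (cases "T \<ge> 1")
      case False
      hence "msets_upto T = {}" using mnorm_ge_1 unfolding msets_upto_def by fastforce
      thus ?thesis using C(1) by simp
    next
      case True
      define m where "m = prod_mset B"
      have m: "m \<noteq> 0" unfolding m_def using prod_mset_totally_positive[OF B] by (rule totally_positive_nonzero)
      have mB: "mnorm B \<ge> 1" by (rule mnorm_ge_1[OF B])
      have Z: "T * mnorm B \<ge> 1" using True mB by (metis mult_mono mult_1 zero_le_one order_trans)
      have img: "(\<lambda>D. rep (B + D)) ` msets_upto T = {w. canonical w \<and> real_of_int (nrm w) \<le> T * mnorm B \<and> m dvd w}"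
      proof (intro equalityI subsetI)
        fix w assume "w \<in> (\<lambda>D. rep (B + D)) ` msets_upto T"
        then obtain D where D: "D \<in> prime_msets" "mnorm D \<le> T" "w = rep (B + D)" by (auto simp: msets_upto_def)
        have BD: "B + D \<in> prime_msets" using B D by simp
        have "real_of_int (nrm w) = mnorm B * mnorm D" using nrm_rep[OF BD] D by (simp add: mnorm_union)
        also have "\<dots> \<le> mnorm B * T" using D mB by (intro mult_left_mono) auto
        finally have "real_of_int (nrm w) \<le> T * mnorm B" by (simp add: mult.commute)
        moreover have "m dvd w" unfolding D rep_def by (simp add: m_def)
        ultimately show "w \<in> {w. canonical w \<and> real_of_int (nrm w) \<le> T * mnorm B \<and> m dvd w}"
          using rep_canonical[OF BD] D by simp
      next
        fix w assume "w \<in> {w. canonical w \<and> real_of_int (nrm w) \<le> T * mnorm B \<and> m dvd w}"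
        hence w: "canonical w" "real_of_int (nrm w) \<le> T * mnorm B" "m dvd w" by auto
        define A where "A = prime_factorization w"
        have A: "A \<in> prime_msets" by (simp add: A_def prime_factorization_in_prime_msets)
        have "prime_factorization m \<subseteq># A" unfolding A_def
          using w(3) m canonical_nonzero[OF w(1)] by (simp add: prime_factorization_subset_iff_dvd)
        hence BA: "B \<subseteq># A" by (simp add: m_def prime_factorization_prod_prime_mset[OF B])
        have Aeq: "A = B + (A - B)" using BA by simp
        have "mnorm B * mnorm (A - B) = real_of_int (nrm w)"
          using nrm_rep[OF A] Aeq rep_prime_factorization[OF w(1)] by (metis A_def mnorm_union)
        hence "mnorm B * mnorm (A - B) \<le> mnorm B * T" using w(2) by (simp add: mult.commute)
        hence "mnorm (A - B) \<le> T" using mB by simp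
        hence "A - B \<in> msets_upto T" using A by (auto simp: msets_upto_def intro: prime_msets_subset)
        moreover have "w = rep (B + (A - B))" using Aeq rep_prime_factorization[OF w(1)] by (simp add: A_def)
        ultimately show "w \<in> (\<lambda>D. rep (B + D)) ` msets_upto T" by blast
      qed
      have inj: "inj_on (\<lambda>D. rep (B + D)) (msets_upto T)"
      proof (rule inj_onI)
        fix D E assume "D \<in> msets_upto T" "E \<in> msets_upto T" "rep (B + D) = rep (B + E)"
        hence "B + D = B + E" using inj_onD[OF rep_inj, of "B + D" "B + E"] B by (auto simp: msets_upto_def)
        thus "D = E" by simp
      qed
      have "(\<Sum>D\<in>msets_upto T. spin_sum \<phi> \<psi> (prod_mset (B + D))) = (\<Sum>D\<in>msets_upto T. spin_sum \<phi> \<psi> (rep (B + D)))"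
        unfolding rep_def using B
        by (intro sum.cong refl spin_sum_normalize[OF dc, symmetric] prod_mset_totally_positive)
           (auto simp: msets_upto_def)
      also have "\<dots> = (\<Sum>w\<in>(\<lambda>D. rep (B + D)) ` msets_upto T. spin_sum \<phi> \<psi> w)"
        by (simp add: sum.reindex[OF inj])
      finally show ?thesis unfolding img using C(2)[rule_format, OF dc m Z] by simp
    qed
  qed
qed

section \<open>Second moments of the quadratic symbols\<close>

lemma chi_cong:
  assumes "[c = c'] (mod q)" "[d = d'] (mod q)" "nrm w dvd q"
  shows "chi w (ZSqrt2 c d) = chi w (ZSqrt2 c' d')"
proof -
  have "[c = c'] (mod nrm w)" "[d = d'] (mod nrm w)" using assms cong_dvd_modulus by blast+
  hence "[sqrt_part w * (rat_part w * d + sqrt_part w * c) = sqrt_part w * (rat_part w * d' + sqrt_part w * c')] (mod nrm w)"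
    by (intro cong_scalar_left cong_add)
  thus ?thesis unfolding chi_def by (intro Jacobi_cong) simp
qed

text \<open>Homogeneity under rational integers; the cancellation in \<open>chi_complete_sum\<close>
  comes from it.\<close>

lemma chi_scale:
  assumes "odd (nrm w)"
  shows "chi w (ZSqrt2 (g * c) (g * d)) = Jacobi g (nrm w) * chi w (ZSqrt2 c d)"
proof -
  have "sqrt_part w * sqrt_part (w * ZSqrt2 (g * c) (g * d)) = g * (sqrt_part w * sqrt_part (w * ZSqrt2 c d))"
    by (simp add: algebra_simps)
  thus ?thesis unfolding chi_def by (simp only: Jacobi_mult_left[OF assms])
qed

text \<open>As q is not a square, some g has (g / q) = -1. Scaling both coordinates by g permutes
  the residues modulo q and reverses the sign of the summand, so the sum is its own
  negative.\<close>

lemma chi_complete_sum: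
  assumes "odd (nrm v)" "odd (nrm w)" "nrm v > 0" "nrm w > 0" and nsq: "\<nexists>k. nrm v * nrm w = k\<^sup>2"
  defines "q \<equiv> nrm v * nrm w"
  shows "(\<Sum>c\<in>{0..<q}. \<Sum>d\<in>{0..<q}. chi v (ZSqrt2 c d) * chi w (ZSqrt2 c d)) = 0"
proof -
  define f where "f = (\<lambda>c d. chi v (ZSqrt2 c d) * chi w (ZSqrt2 c d))"
  have q: "q \<ge> 1" "odd q" "q > 0" using assms by (auto simp: q_def zero_less_mult_iff int_one_le_iff_zero_less)
  obtain g where g: "coprime g q" "Jacobi g q = -1"
    using nonsquare_exists_Jacobi_minus_1[of q] q nsq by (auto simp: q_def)
  have per: "f c d = f c' d'" if "[c = c'] (mod q)" "[d = d'] (mod q)" for c d c' d'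
    unfolding f_def using chi_cong[OF that, of v] chi_cong[OF that, of w] by (simp add: q_def)
  have sc: "f (g * c) (g * d) = - f c d" for c d
  proof -
    have "f (g * c) (g * d) = (Jacobi g (nrm v) * Jacobi g (nrm w)) * f c d"
      unfolding f_def chi_scale[OF assms(1)] chi_scale[OF assms(2)] by (simp only: mult_ac)
    also have "Jacobi g (nrm v) * Jacobi g (nrm w) = Jacobi g q"
      using assms by (simp add: q_def Jacobi_mult_right)
    finally show ?thesis using g by simp
  qed
  have "(\<Sum>c\<in>{0..<q}. \<Sum>d\<in>{0..<q}. f c d) = (\<Sum>c\<in>{0..<q}. \<Sum>d\<in>{0..<q}. f (g * c) d)"
    by (rule sum_mod_mult[OF q(1) _ g(1), symmetric]) (intro sum.cong refl per, auto)
  also have "\<dots> = (\<Sum>c\<in>{0..<q}. \<Sum>d\<in>{0..<q}. f (g * c) (g * d))"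
    by (intro sum.cong refl sum_mod_mult[OF q(1) _ g(1), symmetric] per) auto
  also have "\<dots> = - (\<Sum>c\<in>{0..<q}. \<Sum>d\<in>{0..<q}. f c d)"
    by (simp only: sc sum_negf)
  finally show ?thesis unfolding f_def by simp
qed

lemma sum_periodic_multiple:
  fixes g :: "int \<Rightarrow> int"
  assumes per: "\<And>a b. [a = b] (mod q) \<Longrightarrow> g a = g b" and q: "q \<ge> 1"
  shows "(\<Sum>c\<in>{0..<int r * q}. g c) = int r * (\<Sum>c\<in>{0..<q}. g c)"
proof (induction r)
  case (Suc r)
  define R where "R = int r * q"
  have R: "0 \<le> R" "int (Suc r) * q = R + q" using q by (simp_all add: R_def algebra_simps)
  have "{0..<R + q} = {0..<R} \<union> {R..<R + q}" using R(1) q by auto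
  hence "{0..<int (Suc r) * q} = {0..<int r * q} \<union> {int r * q..<int (Suc r) * q}"
    by (simp only: R(2) R_def[symmetric])
  hence "(\<Sum>c\<in>{0..<int (Suc r) * q}. g c) = (\<Sum>c\<in>{0..<int r * q}. g c) + (\<Sum>c\<in>{int r * q..<int (Suc r) * q}. g c)"
    by (simp only:) (rule sum.union_disjoint, auto)
  also have "(\<Sum>c\<in>{int r * q..<int (Suc r) * q}. g c) = (\<Sum>c\<in>{0..<q}. g c)"
    by (rule sum.reindex_bij_witness[where i = "\<lambda>c. c + int r * q" and j = "\<lambda>c. c - int r * q"])
       (auto simp: algebra_simps intro!: per simp: cong_iff_dvd_diff)
  finally show ?case using Suc by (simp add: algebra_simps)
qed simp

text \<open>A square whose side is the largest multiple of q not exceeding Y contributes zero. Two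
  strips of width at most q and length at most Y remain.\<close>

lemma box_sum_bound:
  fixes f :: "int \<Rightarrow> int \<Rightarrow> int"
  assumes per: "\<And>c d c' d'. [c = c'] (mod q) \<Longrightarrow> [d = d'] (mod q) \<Longrightarrow> f c d = f c' d'"
    and bd: "\<And>c d. \<bar>f c d\<bar> \<le> 1" and q: "q \<ge> 1" and Y: "Y \<ge> 0"
    and zero: "(\<Sum>c\<in>{0..<q}. \<Sum>d\<in>{0..<q}. f c d) = 0"
  shows "\<bar>\<Sum>c\<in>{0..<Y}. \<Sum>d\<in>{0..<Y}. f c d\<bar> \<le> 2 * q * Y"
proof -
  define r where "r = nat (Y div q)"
  define Y0 where "Y0 = int r * q"
  have "Y div q \<ge> 0" using Y q by (simp add: div_int_pos_iff)
  hence Y0: "Y0 = Y - Y mod q" by (simp add: Y0_def r_def minus_mod_eq_div_mult)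
  hence Yb: "0 \<le> Y0" "Y0 \<le> Y" "Y - Y0 \<le> q"
    using q pos_mod_bound[of q Y] pos_mod_sign[of q Y] zmod_le_nonneg_dividend[OF Y, of q] by linarith+
  have full: "(\<Sum>c\<in>{0..<Y0}. \<Sum>d\<in>{0..<Y0}. f c d) = 0"
  proof -
    have "(\<Sum>d\<in>{0..<Y0}. f c d) = int r * (\<Sum>d\<in>{0..<q}. f c d)" for c
      unfolding Y0_def by (intro sum_periodic_multiple per q) auto
    hence "(\<Sum>c\<in>{0..<Y0}. \<Sum>d\<in>{0..<Y0}. f c d) = int r * (\<Sum>c\<in>{0..<Y0}. \<Sum>d\<in>{0..<q}. f c d)"
      by (simp add: sum_distrib_left)
    also have "(\<Sum>c\<in>{0..<Y0}. \<Sum>d\<in>{0..<q}. f c d) = int r * (\<Sum>c\<in>{0..<q}. \<Sum>d\<in>{0..<q}. f c d)"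
      unfolding Y0_def by (intro sum_periodic_multiple q sum.cong refl per) auto
    finally show ?thesis using zero by simp
  qed
  have split: "(\<Sum>c\<in>{0..<Y}. h c) = (\<Sum>c\<in>{0..<Y0}. h c) + (\<Sum>c\<in>{Y0..<Y}. h c)" for h :: "int \<Rightarrow> int"
    using Yb by (subst sum.union_disjoint[symmetric]) (auto intro!: sum.cong)
  have bnd: "\<bar>\<Sum>d\<in>S. f c d\<bar> \<le> int (card S)" for S c
    by (rule order_trans[OF sum_abs]) (use sum_bounded_above[of S "\<lambda>d. \<bar>f c d\<bar>" 1] bd in simp)
  have row: "\<bar>\<Sum>d\<in>{0..<Y}. f c d\<bar> \<le> Y" for c using bnd[where S = "{0..<Y}" and c = c] Y by simp
  have tail: "\<bar>\<Sum>d\<in>{Y0..<Y}. f c d\<bar> \<le> q" for c using bnd[where S = "{Y0..<Y}" and c = c] Yb by simp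
  have "\<bar>\<Sum>c\<in>{Y0..<Y}. \<Sum>d\<in>{0..<Y}. f c d\<bar> \<le> (\<Sum>c\<in>{Y0..<Y}. Y)"
    by (rule order_trans[OF sum_abs sum_mono]) (rule row)
  also have "\<dots> = (Y - Y0) * Y" using Yb by simp
  also have "\<dots> \<le> q * Y" using Yb Y by (intro mult_right_mono) auto
  finally have 1: "\<bar>\<Sum>c\<in>{Y0..<Y}. \<Sum>d\<in>{0..<Y}. f c d\<bar> \<le> q * Y" .
  have "\<bar>\<Sum>c\<in>{0..<Y0}. \<Sum>d\<in>{Y0..<Y}. f c d\<bar> \<le> (\<Sum>c\<in>{0..<Y0}. q)"
    by (rule order_trans[OF sum_abs sum_mono]) (rule tail)
  also have "\<dots> = q * Y0" using Yb by simp
  also have "\<dots> \<le> q * Y" using Yb q by (intro mult_left_mono) auto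
  finally have 2: "\<bar>\<Sum>c\<in>{0..<Y0}. \<Sum>d\<in>{Y0..<Y}. f c d\<bar> \<le> q * Y" .
  have "(\<Sum>c\<in>{0..<Y}. \<Sum>d\<in>{0..<Y}. f c d) = (\<Sum>c\<in>{0..<Y0}. \<Sum>d\<in>{Y0..<Y}. f c d) + (\<Sum>c\<in>{Y0..<Y}. \<Sum>d\<in>{0..<Y}. f c d)"
    using full by (subst split) (simp add: split[of "f _"] sum.distrib)
  thus ?thesis using 1 2 by linarith
qed

lemma unimodular_factor: "\<exists>e::complex. cmod e \<le> 1 \<and> of_real (cmod s) = e * s"
proof (cases "s = 0")
  case False
  thus ?thesis
    by (intro exI[of _ "cnj s / of_real (cmod s)"])
       (simp add: norm_divide mult.commute[of "cnj s"] complex_norm_square[symmetric] power2_eq_square)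
qed (auto intro: exI[of _ 0])

lemma sum_symmetric_difference:
  fixes a b c :: "'a \<Rightarrow> real"
  shows "(\<Sum>i\<in>I. \<Sum>j\<in>I. c i + c j - a i * b j - a j * b i) =
    2 * (real (card I) * (\<Sum>i\<in>I. c i)) - 2 * ((\<Sum>i\<in>I. a i) * (\<Sum>i\<in>I. b i))"
  by (simp add: sum.distrib sum_subtractf sum_distrib_left[symmetric] sum_distrib_right[symmetric])

text \<open>Hoelder's inequality for integer exponents, by induction on the exponent with
  Chebyshev's sum inequality: a nonnegative function and its powers are similarly ordered.\<close>

lemma power_mean:
  fixes f :: "'a \<Rightarrow> real"
  assumes "finite I" "\<And>i. i \<in> I \<Longrightarrow> f i \<ge> 0"
  shows "(\<Sum>i\<in>I. f i) ^ Suc k \<le> real (card I) ^ k * (\<Sum>i\<in>I. f i ^ Suc k)"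
proof (induction k)
  case (Suc k)
  define S where "S = (\<lambda>j. \<Sum>i\<in>I. f i ^ j)"
  have cheb: "S 1 * S (Suc k) \<le> real (card I) * S (Suc (Suc k))"
  proof -
    have "0 \<le> (\<Sum>i\<in>I. \<Sum>j\<in>I. (f i - f j) * (f i ^ Suc k - f j ^ Suc k))"
    proof (intro sum_nonneg)
      fix i j assume "i \<in> I" "j \<in> I"
      hence "f i \<ge> 0" "f j \<ge> 0" using assms by auto
      thus "0 \<le> (f i - f j) * (f i ^ Suc k - f j ^ Suc k)"
        using power_mono[of "f i" "f j" "Suc k"] power_mono[of "f j" "f i" "Suc k"]
        by (cases "f i \<le> f j") (auto intro: mult_nonpos_nonpos mult_nonneg_nonneg)
    qed
    also have "\<dots> = (\<Sum>i\<in>I. \<Sum>j\<in>I. f i ^ Suc (Suc k) + f j ^ Suc (Suc k) - f i * f j ^ Suc k - f j * f i ^ Suc k)"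
      by (intro sum.cong refl) (simp add: algebra_simps)
    also have "\<dots> = 2 * (real (card I) * (\<Sum>i\<in>I. f i ^ Suc (Suc k))) - 2 * ((\<Sum>i\<in>I. f i) * (\<Sum>i\<in>I. f i ^ Suc k))"
      by (rule sum_symmetric_difference)
    finally have "0 \<le> 2 * (real (card I) * S (Suc (Suc k))) - 2 * (S 1 * S (Suc k))" by (simp add: S_def)
    thus ?thesis by simp
  qed
  have "(\<Sum>i\<in>I. f i) ^ Suc (Suc k) = S 1 * (\<Sum>i\<in>I. f i) ^ Suc k" by (simp add: S_def)
  also have "\<dots> \<le> S 1 * (real (card I) ^ k * S (Suc k))"
    using Suc assms by (intro mult_left_mono) (auto simp: S_def intro: sum_nonneg)
  also have "\<dots> = real (card I) ^ k * (S 1 * S (Suc k))" by simp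
  also have "\<dots> \<le> real (card I) ^ k * (real (card I) * S (Suc (Suc k)))"
    using cheb by (intro mult_left_mono) auto
  finally show ?case by (simp add: S_def mult_ac)
qed simp

text \<open>The real embedding is multiplicative and dominates both coordinates when these are
  nonnegative, so products stay in an explicit box. A single factor has embedding at most 3 sqrt N +
  2 * 3 sqrt N.\<close>

lemma canonical_prod_box:
  assumes "finite I" "\<And>i. i \<in> I \<Longrightarrow> canonical (g i)" "\<And>i. i \<in> I \<Longrightarrow> real_of_int (nrm (g i)) \<le> N"
  shows "0 \<le> rat_part (prod g I) \<and> 0 \<le> sqrt_part (prod g I) \<and>
    real_of_zsqrt2 (prod g I) \<le> (9 * sqrt N) ^ card I \<and> nrm (prod g I) > 0 \<and>
    real_of_int (nrm (prod g I)) \<le> N ^ card I"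
  using assms
proof (induction I rule: finite_induct)
  case empty
  show ?case by (simp add: real_of_zsqrt2_hom)
next
  case (insert x F)
  have x: "canonical (g x)" "real_of_int (nrm (g x)) \<le> N" using insert by auto
  have IH: "0 \<le> rat_part (prod g F)" "0 \<le> sqrt_part (prod g F)"
    "real_of_zsqrt2 (prod g F) \<le> (9 * sqrt N) ^ card F" "nrm (prod g F) > 0" "real_of_int (nrm (prod g F)) \<le> N ^ card F"
    using insert by auto
  note cb = canonical_box[OF x]
  have tp: "nrm (g x) > 0" using canonical_imp_totally_positive[OF x(1)] totally_positive_nrm by blast
  have N0: "N > 0" using tp x(2) by linarith
  have "sqrt 2 \<le> 2" using real_le_lsqrt[of 2 2] by simp
  have "real_of_zsqrt2 (g x) \<le> of_int (rat_part (g x)) + of_int (rat_part (g x)) * 2"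
    unfolding real_of_zsqrt2_def using cb \<open>sqrt 2 \<le> 2\<close> by (intro add_mono mult_mono) auto
  also have "\<dots> \<le> 9 * sqrt N" using cb(2) by simp
  finally have r: "real_of_zsqrt2 (g x) \<le> 9 * sqrt N" .
  have r0: "real_of_zsqrt2 (prod g F) \<ge> 0" using IH by (simp add: real_of_zsqrt2_def)
  have "real_of_zsqrt2 (g x * prod g F) \<le> (9 * sqrt N) * (9 * sqrt N) ^ card F"
    unfolding real_of_zsqrt2_hom using r IH r0 N0 by (intro mult_mono) auto
  moreover have "real_of_int (nrm (g x * prod g F)) \<le> N * N ^ card F"
    unfolding nrm_mult of_int_mult using x IH N0 by (intro mult_mono) auto
  moreover have "0 \<le> rat_part (g x * prod g F)" "0 \<le> sqrt_part (g x * prod g F)"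
    using cb IH by simp_all
  moreover have "nrm (g x * prod g F) > 0" using tp IH by (simp add: nrm_mult)
  ultimately show ?case using insert.hyps by simp
qed

lemma chi_prod:
  assumes "odd (rat_part w)" "coprime (sqrt_part w) (nrm w)" "finite I"
  shows "chi w (prod g I) = (\<Prod>i\<in>I. chi w (g i))"
  using assms(3) by (induction I rule: finite_induct) (simp_all add: chi_mult[OF assms(1,2)])

text \<open>The intended \<open>t\<close> multiplies by a power of \<epsilon>^2, which leaves the
  fundamental domain but keeps the norm. The last two conditions are those under which
  \<open>chi (t w)\<close> is multiplicative.\<close>

definition unitary_twist :: "zsqrt2 set \<Rightarrow> (zsqrt2 \<Rightarrow> zsqrt2) \<Rightarrow> bool" where
  "unitary_twist W t \<longleftrightarrow> (\<forall>w\<in>W. nrm (t w) = nrm w \<and> odd (rat_part (t w)) \<and>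
     coprime (sqrt_part (t w)) (nrm (t w)))"

text \<open>Expanding the square leads to box sums over z for pairs of symbols. Pairs whose norms
  multiply to a square get the trivial bound Y^2, and there are only about M of them; every other
  pair cancels down to 2 M^2 Y. Since Y >= M^3, the second contribution does not exceed the order of
  the first.\<close>

lemma chi_second_moment:
  fixes \<eta> :: real assumes \<eta>: "\<eta> > 0"
  shows "\<exists>C\<ge>1. \<forall>M W t \<epsilon> Y. M \<ge> 1 \<longrightarrow> W \<subseteq> {w. canonical w \<and> real_of_int (nrm w) \<le> M} \<longrightarrow>
    unitary_twist W t \<longrightarrow> (\<forall>w. cmod (\<epsilon> w) \<le> 1) \<longrightarrow> of_int Y \<ge> M ^ 3 \<longrightarrow>
    (\<Sum>(c, d)\<in>{0..<Y} \<times> {0..<Y}. (cmod (\<Sum>w\<in>W. \<epsilon> w * of_int (chi (t w) (ZSqrt2 c d))))\<^sup>2)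
      \<le> C * M powr (1 + \<eta>) * (of_int Y)\<^sup>2"
proof -
  obtain K where K: "K \<ge> 1" "\<And>M. M \<ge> 1 \<Longrightarrow> real (card {(v, w). canonical v \<and> canonical w \<and> real_of_int (nrm v) \<le> M \<and>
     real_of_int (nrm w) \<le> M \<and> (\<exists>k. nrm v * nrm w = k\<^sup>2)}) \<le> K * M powr (1 + \<eta>)"
    using square_pairs_bound[OF \<eta>] by blast
  show ?thesis
  proof (intro exI[of _ "K + 162"] conjI allI impI)
    show "1 \<le> K + 162" using K(1) by simp
    fix M :: real and W t and \<epsilon> :: "zsqrt2 \<Rightarrow> complex" and Y :: int
    assume M: "M \<ge> 1" and W: "W \<subseteq> {w. canonical w \<and> real_of_int (nrm w) \<le> M}" and t: "unitary_twist W t"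
      and \<epsilon>: "\<forall>w. cmod (\<epsilon> w) \<le> 1" and Y: "of_int Y \<ge> M ^ 3"
    note fc = finite_card_canonical[OF M]
    have finW: "finite W" using W fc(1) by (rule finite_subset)
    have cW: "real (card W) \<le> 9 * M" using card_mono[OF fc(1) W] fc(2) by linarith
    have "M ^ 3 \<ge> 1" using M by (rule one_le_power)
    hence Y1: "real_of_int Y \<ge> 1" using Y by linarith
    hence Y0: "Y \<ge> 0" by simp
    define S where "S = (\<lambda>v w. \<Sum>c\<in>{0..<Y}. \<Sum>d\<in>{0..<Y}. chi (t v) (ZSqrt2 c d) * chi (t w) (ZSqrt2 c d))"
    define Bad where "Bad = {(v, w). v \<in> W \<and> w \<in> W \<and> (\<exists>k. nrm v * nrm w = k\<^sup>2)}"
    have triv: "\<bar>real_of_int (S v w)\<bar> \<le> (of_int Y)\<^sup>2" for v w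
    proof -
      have "\<bar>chi (t v) (ZSqrt2 c d) * chi (t w) (ZSqrt2 c d)\<bar> \<le> 1" for c d
        using abs_chi_le[of "t v" "ZSqrt2 c d"] abs_chi_le[of "t w" "ZSqrt2 c d"]
        unfolding abs_mult by (intro mult_le_one) auto
      hence "\<bar>S v w\<bar> \<le> (\<Sum>c\<in>{0..<Y}. \<Sum>d\<in>{0..<Y}. 1)"
        unfolding S_def by (intro order_trans[OF sum_abs sum_mono] order_trans[OF sum_abs sum_mono])
      also have "\<dots> = Y\<^sup>2" using Y0 by (simp add: power2_eq_square)
      finally have "real_of_int \<bar>S v w\<bar> \<le> real_of_int (Y\<^sup>2)" by (simp only: of_int_le_iff)
      thus ?thesis by simp
    qed
    have good: "\<bar>real_of_int (S v w)\<bar> \<le> 2 * M\<^sup>2 * of_int Y" if vw: "v \<in> W" "w \<in> W" "\<nexists>k. nrm v * nrm w = k\<^sup>2" for v w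
    proof -
      have tv: "nrm (t v) = nrm v" "odd (nrm (t v))" "nrm v > 0" "real_of_int (nrm v) \<le> M"
        using vw(1) t W canonical_imp_totally_positive totally_positive_nrm
        by (auto simp: unitary_twist_def nrm_def[of "t v"])
      have tw: "nrm (t w) = nrm w" "odd (nrm (t w))" "nrm w > 0" "real_of_int (nrm w) \<le> M"
        using vw(2) t W canonical_imp_totally_positive totally_positive_nrm
        by (auto simp: unitary_twist_def nrm_def[of "t w"])
      define q where "q = nrm (t v) * nrm (t w)"
      have q: "q \<ge> 1" using tv tw by (simp add: q_def int_one_le_iff_zero_less)
      have "\<bar>S v w\<bar> \<le> 2 * q * Y" unfolding S_def
      proof (rule box_sum_bound)
        fix c d c' d' assume cd: "[c = c'] (mod q)" "[d = d'] (mod q)"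
        show "chi (t v) (ZSqrt2 c d) * chi (t w) (ZSqrt2 c d) = chi (t v) (ZSqrt2 c' d') * chi (t w) (ZSqrt2 c' d')"
          using chi_cong[OF cd, of "t v"] chi_cong[OF cd, of "t w"] by (simp add: q_def)
      next
        fix c d
        show "\<bar>chi (t v) (ZSqrt2 c d) * chi (t w) (ZSqrt2 c d)\<bar> \<le> 1"
          using abs_chi_le[of "t v" "ZSqrt2 c d"] abs_chi_le[of "t w" "ZSqrt2 c d"]
          unfolding abs_mult by (intro mult_le_one) auto
      next
        show "(\<Sum>c\<in>{0..<q}. \<Sum>d\<in>{0..<q}. chi (t v) (ZSqrt2 c d) * chi (t w) (ZSqrt2 c d)) = 0"
          unfolding q_def using tv tw vw(3) by (intro chi_complete_sum) auto
      qed (use q Y0 in auto)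
      hence "real_of_int \<bar>S v w\<bar> \<le> real_of_int (2 * q * Y)" by (simp only: of_int_le_iff)
      also have "\<dots> \<le> 2 * (M * M) * of_int Y"
        using tv tw M Y0 by (auto simp: q_def intro!: mult_mono)
      finally show ?thesis by (simp add: power2_eq_square)
    qed
    have "complex_of_real (\<Sum>(c, d)\<in>{0..<Y} \<times> {0..<Y}. (cmod (\<Sum>w\<in>W. \<epsilon> w * of_int (chi (t w) (ZSqrt2 c d))))\<^sup>2)
      = (\<Sum>(c, d)\<in>{0..<Y} \<times> {0..<Y}. \<Sum>v\<in>W. \<Sum>w\<in>W. (\<epsilon> v * cnj (\<epsilon> w)) *
          of_int (chi (t v) (ZSqrt2 c d) * chi (t w) (ZSqrt2 c d)))"
      unfolding of_real_sum
    proof (intro sum.cong refl, clarify)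
      fix c d
      have "complex_of_real ((cmod (\<Sum>w\<in>W. \<epsilon> w * of_int (chi (t w) (ZSqrt2 c d))))\<^sup>2) =
        (\<Sum>v\<in>W. \<epsilon> v * of_int (chi (t v) (ZSqrt2 c d))) * (\<Sum>w\<in>W. cnj (\<epsilon> w) * of_int (chi (t w) (ZSqrt2 c d)))"
        unfolding complex_norm_square by simp
      also have "\<dots> = (\<Sum>v\<in>W. \<Sum>w\<in>W. (\<epsilon> v * of_int (chi (t v) (ZSqrt2 c d))) * (cnj (\<epsilon> w) * of_int (chi (t w) (ZSqrt2 c d))))"
        by (rule sum_product)
      also have "\<dots> = (\<Sum>v\<in>W. \<Sum>w\<in>W. (\<epsilon> v * cnj (\<epsilon> w)) *
          of_int (chi (t v) (ZSqrt2 c d) * chi (t w) (ZSqrt2 c d)))"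
        by (intro sum.cong refl) (simp only: of_int_mult mult_ac)
      finally show "complex_of_real ((cmod (\<Sum>w\<in>W. \<epsilon> w * of_int (chi (t w) (ZSqrt2 c d))))\<^sup>2) =
          (\<Sum>v\<in>W. \<Sum>w\<in>W. (\<epsilon> v * cnj (\<epsilon> w)) * of_int (chi (t v) (ZSqrt2 c d) * chi (t w) (ZSqrt2 c d)))" .
    qed
    also have "\<dots> = (\<Sum>v\<in>W. \<Sum>w\<in>W. (\<epsilon> v * cnj (\<epsilon> w)) * of_int (S v w))"
    proof -
      have "(\<Sum>(c, d)\<in>{0..<Y} \<times> {0..<Y}. \<Sum>v\<in>W. \<Sum>w\<in>W. (\<epsilon> v * cnj (\<epsilon> w)) *
          of_int (chi (t v) (ZSqrt2 c d) * chi (t w) (ZSqrt2 c d))) =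
        (\<Sum>v\<in>W. \<Sum>w\<in>W. \<Sum>(c, d)\<in>{0..<Y} \<times> {0..<Y}. (\<epsilon> v * cnj (\<epsilon> w)) *
          of_int (chi (t v) (ZSqrt2 c d) * chi (t w) (ZSqrt2 c d)))"
        unfolding case_prod_unfold by (subst sum.swap, rule sum.cong[OF refl], rule sum.swap)
      also have "\<dots> = (\<Sum>v\<in>W. \<Sum>w\<in>W. (\<epsilon> v * cnj (\<epsilon> w)) * of_int (S v w))"
        by (intro sum.cong refl)
           (simp add: S_def sum.cartesian_product sum_distrib_left case_prod_unfold del: of_int_mult)
      finally show ?thesis .
    qed
    finally have eq: "complex_of_real (\<Sum>(c, d)\<in>{0..<Y} \<times> {0..<Y}. (cmod (\<Sum>w\<in>W. \<epsilon> w * of_int (chi (t w) (ZSqrt2 c d))))\<^sup>2)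
       = (\<Sum>v\<in>W. \<Sum>w\<in>W. (\<epsilon> v * cnj (\<epsilon> w)) * of_int (S v w))" .
    have "(\<Sum>(c, d)\<in>{0..<Y} \<times> {0..<Y}. (cmod (\<Sum>w\<in>W. \<epsilon> w * of_int (chi (t w) (ZSqrt2 c d))))\<^sup>2)
       \<le> cmod (complex_of_real (\<Sum>(c, d)\<in>{0..<Y} \<times> {0..<Y}. (cmod (\<Sum>w\<in>W. \<epsilon> w * of_int (chi (t w) (ZSqrt2 c d))))\<^sup>2))"
      unfolding norm_of_real by (rule abs_ge_self)
    also have "\<dots> \<le> (\<Sum>v\<in>W. \<Sum>w\<in>W. \<bar>real_of_int (S v w)\<bar>)"
      unfolding eq
    proof (intro sum_norm_le)
      fix v w
      have "cmod (\<epsilon> v) * cmod (\<epsilon> w) \<le> 1" using \<epsilon> by (intro mult_le_one) auto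
      thus "cmod (\<epsilon> v * cnj (\<epsilon> w) * of_int (S v w)) \<le> \<bar>real_of_int (S v w)\<bar>"
        by (simp add: norm_mult mult_left_le_one_le)
    qed
    also have "\<dots> = (\<Sum>(v, w)\<in>W \<times> W. \<bar>real_of_int (S v w)\<bar>)" by (simp add: sum.cartesian_product)
    also have "\<dots> \<le> (\<Sum>(v, w)\<in>W \<times> W. (if (v, w) \<in> Bad then (of_int Y)\<^sup>2 else 0) + 2 * M\<^sup>2 * of_int Y)"
    proof (intro sum_mono, clarify)
      fix v w assume vw: "v \<in> W" "w \<in> W"
      have p: "0 \<le> 2 * M\<^sup>2 * real_of_int Y" using Y0 by simp
      show "\<bar>real_of_int (S v w)\<bar> \<le> (if (v, w) \<in> Bad then (of_int Y)\<^sup>2 else 0) + 2 * M\<^sup>2 * of_int Y"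
      proof (cases "(v, w) \<in> Bad")
        case True
        show ?thesis unfolding if_P[OF True] using triv[of v w] p by linarith
      next
        case False
        hence "\<nexists>k. nrm v * nrm w = k\<^sup>2" using vw unfolding Bad_def by blast
        thus ?thesis using good[OF vw] False by simp
      qed
    qed
    also have "\<dots> = (\<Sum>p\<in>W \<times> W. if p \<in> Bad then (of_int Y)\<^sup>2 else 0) + real (card W) * real (card W) * (2 * M\<^sup>2 * of_int Y)"
      by (simp add: case_prod_unfold sum.distrib card_cartesian_product)
    also have "(\<Sum>p\<in>W \<times> W. if p \<in> Bad then (real_of_int Y)\<^sup>2 else 0) = real (card Bad) * (of_int Y)\<^sup>2"
    proof -
      have "Bad \<subseteq> W \<times> W" by (auto simp: Bad_def)
      hence "{p \<in> W \<times> W. p \<in> Bad} = Bad" by auto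
      thus ?thesis using finW by (simp add: sum.inter_filter[symmetric])
    qed
    also have "real (card Bad) * (of_int Y)\<^sup>2 + real (card W) * real (card W) * (2 * M\<^sup>2 * of_int Y)
        \<le> (K * M powr (1 + \<eta>)) * (of_int Y)\<^sup>2 + (9 * M) * (9 * M) * (2 * M\<^sup>2 * of_int Y)"
    proof (intro add_mono mult_right_mono mult_mono cW)
      have "finite {(v, w). canonical v \<and> canonical w \<and> real_of_int (nrm v) \<le> M \<and>
         real_of_int (nrm w) \<le> M \<and> (\<exists>k. nrm v * nrm w = k\<^sup>2)}"
        by (rule finite_subset[OF _ finite_cartesian_product[OF fc(1) fc(1)]]) auto
      moreover have "Bad \<subseteq> {(v, w). canonical v \<and> canonical w \<and> real_of_int (nrm v) \<le> M \<and>
         real_of_int (nrm w) \<le> M \<and> (\<exists>k. nrm v * nrm w = k\<^sup>2)}" using W by (auto simp: Bad_def)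
      ultimately have "card Bad \<le> card {(v, w). canonical v \<and> canonical w \<and> real_of_int (nrm v) \<le> M \<and>
         real_of_int (nrm w) \<le> M \<and> (\<exists>k. nrm v * nrm w = k\<^sup>2)}" by (rule card_mono)
      thus "real (card Bad) \<le> K * M powr (1 + \<eta>)" using K(2)[OF M] by linarith
    qed (use M Y0 in auto)
    \<comment> \<open>At most (9 M)^2 pairs with 2 M^2 Y each; M^3 <= Y trades three powers of M for
      one more Y.\<close>
    also have "(9 * M) * (9 * M) * (2 * M\<^sup>2 * of_int Y) = 162 * (M * M ^ 3 * of_int Y)"
      by (simp add: power2_eq_square power3_eq_cube)
    also have "162 * (M * M ^ 3 * of_int Y) \<le> 162 * (M powr (1 + \<eta>) * of_int Y * of_int Y)"
    proof (intro mult_left_mono mult_right_mono mult_mono Y)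
      have "M powr 1 \<le> M powr (1 + \<eta>)" using M \<eta> by (intro powr_mono) auto
      thus "M \<le> M powr (1 + \<eta>)" using M by simp
    qed (use M Y0 in auto)
    finally show "(\<Sum>(c, d)\<in>{0..<Y} \<times> {0..<Y}. (cmod (\<Sum>w\<in>W. \<epsilon> w * of_int (chi (t w) (ZSqrt2 c d))))\<^sup>2)
      \<le> (K + 162) * M powr (1 + \<eta>) * (of_int Y)\<^sup>2"
      by (simp add: algebra_simps power2_eq_square)
  qed
qed

section \<open>Type II sums\<close>

text \<open>Raising the inner sum to the sixth power replaces the variable \<open>z\<close> by products of six
  such elements, which are long enough for the second moment to show cancellation.\<close>

lemma chi_bilinear:
  fixes \<eta> :: real assumes \<eta>: "\<eta> > 0"
  shows "\<exists>C>0. \<forall>M N W Z t \<alpha> \<beta>. 1 \<le> M \<longrightarrow> M \<le> N \<longrightarrow> W \<subseteq> {w. canonical w \<and> real_of_int (nrm w) \<le> M} \<longrightarrow>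
    Z \<subseteq> {z. canonical z \<and> real_of_int (nrm z) \<le> N} \<longrightarrow> unitary_twist W t \<longrightarrow>
    (\<forall>w. cmod (\<alpha> w) \<le> 1) \<longrightarrow> (\<forall>z. cmod (\<beta> z) \<le> 1) \<longrightarrow>
    cmod (\<Sum>w\<in>W. \<Sum>z\<in>Z. \<alpha> w * \<beta> z * of_int (chi (t w) z)) \<le> C * M powr (11 / 12) * N powr (1 + \<eta>)"
proof -
  \<comment> \<open>In the sixth power the losses are N^(36 \<delta>) from multiplicities and
    M^(\<delta> / 2) from the second moment; 73 \<delta> / 2 = 6 \<eta>.\<close>
  define \<delta> where "\<delta> = 12 * \<eta> / 73"
  have \<delta>: "\<delta> > 0" using \<eta> by (simp add: \<delta>_def)
  obtain C1 where C1: "C1 \<ge> 1" "\<forall>M W t \<epsilon> Y. M \<ge> 1 \<longrightarrow> W \<subseteq> {w. canonical w \<and> real_of_int (nrm w) \<le> M} \<longrightarrow>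
    unitary_twist W t \<longrightarrow> (\<forall>w. cmod (\<epsilon> w) \<le> 1) \<longrightarrow> of_int Y \<ge> M ^ 3 \<longrightarrow>
    (\<Sum>(c, d)\<in>{0..<Y} \<times> {0..<Y}. (cmod (\<Sum>w\<in>W. \<epsilon> w * of_int (chi (t w) (ZSqrt2 c d))))\<^sup>2)
      \<le> C1 * M powr (1 + \<delta>) * (of_int Y)\<^sup>2"
    using chi_second_moment[OF \<delta>] by (elim exE conjE) (rule that)
  obtain K where K: "K \<ge> 1" "\<forall>w. w \<noteq> 0 \<longrightarrow> finite {d. canonical d \<and> d dvd w} \<and>
    real (card {d. canonical d \<and> d dvd w}) \<le> K * real_of_int \<bar>nrm w\<bar> powr \<delta>"
    using canonical_divisor_bound[OF \<delta>] by (elim exE conjE) (rule that)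
  define cY where "cY = (2 * 9 ^ 6 :: real)"
  define C2 where "C2 = 9 ^ 5 * (K ^ 6 * (C1 * cY\<^sup>2))"
  define C where "C = max 1 C2"
  have C: "C \<ge> 1" "C2 \<le> C" by (simp_all add: C_def)
  show ?thesis
  proof (intro exI[of _ C] conjI allI impI)
    show "C > 0" using C by simp
    fix M N :: real and W Z t and \<alpha> \<beta> :: "zsqrt2 \<Rightarrow> complex"
    assume M: "1 \<le> M" and MN: "M \<le> N" and W: "W \<subseteq> {w. canonical w \<and> real_of_int (nrm w) \<le> M}"
      and Z: "Z \<subseteq> {z. canonical z \<and> real_of_int (nrm z) \<le> N}" and t: "unitary_twist W t"
      and \<alpha>: "\<forall>w. cmod (\<alpha> w) \<le> 1" and \<beta>: "\<forall>z. cmod (\<beta> z) \<le> 1"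
    have N: "N \<ge> 1" using M MN by simp
    note fcM = finite_card_canonical[OF M] and fcN = finite_card_canonical[OF N]
    have finW: "finite W" and finZ: "finite Z" using finite_subset[OF W fcM(1)] finite_subset[OF Z fcN(1)] by auto
    have cW: "real (card W) \<le> 9 * M" using card_mono[OF fcM(1) W] fcM(2) by linarith
    define S where "S = (\<lambda>w. \<Sum>z\<in>Z. \<beta> z * of_int (chi (t w) z))"
    \<comment> \<open>The sixth power expands over six-tuples, and by multiplicativity of
      \<open>chi\<close> a tuple enters the symbol through its product only.\<close>
    define G where "G = PiE {..<6::nat} (\<lambda>_. Z)"
    define b where "b = (\<lambda>g::nat \<Rightarrow> zsqrt2. \<Prod>i<6. \<beta> (g i))"
    have finG: "finite G" unfolding G_def by (intro finite_PiE finZ) auto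
    have b1: "cmod (b g) \<le> 1" for g
      unfolding b_def prod_norm[symmetric] using \<beta> by (intro prod_le_1) auto
    have S6: "S w ^ 6 = (\<Sum>g\<in>G. b g * of_int (chi (t w) (prod g {..<6})))" if w: "w \<in> W" for w
    proof -
      have c: "odd (rat_part (t w))" "coprime (sqrt_part (t w)) (nrm (t w))"
        using t w by (auto simp: unitary_twist_def)
      have "S w ^ 6 = (\<Prod>i\<in>{..<6::nat}. \<Sum>z\<in>Z. \<beta> z * of_int (chi (t w) z))" by (simp add: S_def)
      also have "\<dots> = (\<Sum>g\<in>G. \<Prod>i\<in>{..<6}. \<beta> (g i) * of_int (chi (t w) (g i)))"
        unfolding G_def by (rule prod_sum_PiE) (use finZ in auto)
      also have "\<dots> = (\<Sum>g\<in>G. b g * of_int (chi (t w) (prod g {..<6})))"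
        unfolding b_def by (intro sum.cong refl) (simp add: prod.distrib chi_prod[OF c])
      finally show ?thesis .
    qed
    \<comment> \<open>Unimodular factors make the sum of |S w|^6 linear in the symbols, so that the
      sum over w can be moved inside.\<close>
    have "\<forall>w. \<exists>e. cmod e \<le> 1 \<and> of_real (cmod (S w ^ 6)) = e * S w ^ 6"
      by (intro allI unimodular_factor)
    then obtain e where e: "\<forall>w. cmod (e w) \<le> 1 \<and> of_real (cmod (S w ^ 6)) = e w * S w ^ 6"
      by (rule choice[THEN exE])
    define T where "T = (\<lambda>\<zeta>. \<Sum>w\<in>W. e w * of_int (chi (t w) \<zeta>))"
    have "complex_of_real (\<Sum>w\<in>W. cmod (S w) ^ 6) = (\<Sum>w\<in>W. e w * S w ^ 6)"
      unfolding of_real_sum by (intro sum.cong refl) (metis e norm_power)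
    also have "\<dots> = (\<Sum>w\<in>W. \<Sum>g\<in>G. b g * (e w * of_int (chi (t w) (prod g {..<6}))))"
      by (intro sum.cong refl) (simp add: S6 sum_distrib_left mult_ac)
    also have "\<dots> = (\<Sum>g\<in>G. b g * T (prod g {..<6}))"
      unfolding T_def by (subst sum.swap) (simp add: sum_distrib_left)
    finally have six: "complex_of_real (\<Sum>w\<in>W. cmod (S w) ^ 6) = (\<Sum>g\<in>G. b g * T (prod g {..<6}))" .
    \<comment> \<open>The side of a box containing all products of six elements. It is of order N^3,
      hence at least M^3 as the second moment requires.\<close>
    define Y where "Y = \<lfloor>(9 * sqrt N) ^ 6\<rfloor> + 1"
    have s6: "(9 * sqrt N) ^ 6 = 9 ^ 6 * N ^ 3"
    proof -
      have "sqrt N ^ 6 = (sqrt N ^ 2) ^ 3" by (simp add: power_mult[symmetric])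
      thus ?thesis using N by (simp add: power_mult_distrib)
    qed
    have N3: "N ^ 3 \<ge> 1" using N by (rule one_le_power)
    have Yub: "real_of_int Y \<le> cY * N ^ 3"
    proof -
      have "real_of_int Y \<le> 9 ^ 6 * N ^ 3 + 1" unfolding Y_def s6 by simp
      thus ?thesis using N3 by (simp add: cY_def)
    qed
    have Ylb: "real_of_int Y \<ge> N ^ 3"
    proof -
      have "9 ^ 6 * N ^ 3 \<le> real_of_int Y" unfolding Y_def s6 by linarith
      thus ?thesis using N3 by simp
    qed
    have Y0: "real_of_int Y \<ge> 1" "Y \<ge> 0" using Ylb N3 by linarith+
    define Box where "Box = {0..<Y} \<times> {0..<Y}"
    define pr where "pr = (\<lambda>g::nat \<Rightarrow> zsqrt2. (rat_part (prod g {..<6}), sqrt_part (prod g {..<6})))"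
    have prodG: "0 \<le> rat_part (prod g {..<6}) \<and> 0 \<le> sqrt_part (prod g {..<6}) \<and>
      real_of_zsqrt2 (prod g {..<6}) \<le> (9 * sqrt N) ^ 6 \<and> nrm (prod g {..<6}) > 0 \<and>
      real_of_int (nrm (prod g {..<6})) \<le> N ^ 6" if "g \<in> G" for g
    proof -
      have "canonical (g i)" "real_of_int (nrm (g i)) \<le> N" if "i < 6" for i
        using \<open>g \<in> G\<close> that Z by (auto simp: G_def)
      thus ?thesis using canonical_prod_box[of "{..<6}" g N] by auto
    qed
    have prBox: "pr ` G \<subseteq> Box"
    proof
      fix p assume "p \<in> pr ` G"
      then obtain g where g: "g \<in> G" "p = pr g" by blast
      define z where "z = prod g {..<6}"
      have z: "0 \<le> rat_part z" "0 \<le> sqrt_part z" "real_of_zsqrt2 z \<le> (9 * sqrt N) ^ 6"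
        using prodG[OF g(1)] by (auto simp: z_def)
      have "1 \<le> sqrt 2" by simp
      hence "of_int (sqrt_part z) * 1 \<le> of_int (sqrt_part z) * sqrt 2" using z by (intro mult_left_mono) auto
      hence "of_int (rat_part z) \<le> (9 * sqrt N) ^ 6" "of_int (sqrt_part z) \<le> (9 * sqrt N) ^ 6"
        using z unfolding real_of_zsqrt2_def by linarith+
      hence "rat_part z < Y" "sqrt_part z < Y" unfolding Y_def by linarith+
      thus "p \<in> Box" using z g by (simp add: pr_def Box_def z_def)
    qed
    \<comment> \<open>Each factor of a product is one of its canonical divisors; this bounds the
      number of tuples with a given product, whose norm is at most N^6.\<close>
    define Rm where "Rm = (K * (N ^ 6) powr \<delta>) ^ 6"
    have Rm0: "Rm \<ge> 0" using K by (simp add: Rm_def)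
    have fiber: "real (card {g \<in> G. pr g = p}) \<le> Rm" for p
    proof (cases "{g \<in> G. pr g = p} = {}")
      case True
      show ?thesis unfolding True using Rm0 by simp
    next
      case False
      then obtain g0 where g0: "g0 \<in> G" "pr g0 = p" by blast
      define \<zeta> where "\<zeta> = prod g0 {..<6}"
      have \<zeta>: "nrm \<zeta> > 0" "real_of_int (nrm \<zeta>) \<le> N ^ 6" using prodG[OF g0(1)] by (auto simp: \<zeta>_def)
      hence \<zeta>0: "\<zeta> \<noteq> 0" by auto
      define D where "D = {d. canonical d \<and> d dvd \<zeta>}"
      have finD: "finite D" and cD: "real (card D) \<le> K * real_of_int \<bar>nrm \<zeta>\<bar> powr \<delta>"
        using K(2) \<zeta>0 by (auto simp: D_def)
      have "{g \<in> G. pr g = p} \<subseteq> PiE {..<6} (\<lambda>_. D)"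
      proof
        fix g assume g: "g \<in> {g \<in> G. pr g = p}"
        hence "prod g {..<6} = \<zeta>" using g0 by (auto simp: pr_def \<zeta>_def zsqrt2_eq_iff)
        moreover have "g i dvd prod g {..<6}" if "i < 6" for i using that by (intro dvd_prodI) auto
        ultimately show "g \<in> PiE {..<6} (\<lambda>_. D)" using g Z by (auto simp: G_def D_def PiE_iff)
      qed
      hence "card {g \<in> G. pr g = p} \<le> card (PiE {..<6::nat} (\<lambda>_. D))"
        by (intro card_mono finite_PiE finD) auto
      also have "\<dots> = card D ^ 6" by (simp add: card_PiE)
      finally have "real (card {g \<in> G. pr g = p}) \<le> real (card D) ^ 6" by (metis of_nat_le_iff of_nat_power)
      also have "\<dots> \<le> Rm" unfolding Rm_def
      proof (intro power_mono)
        have "K * real_of_int \<bar>nrm \<zeta>\<bar> powr \<delta> \<le> K * (N ^ 6) powr \<delta>"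
          using K \<zeta> \<delta> by (intro mult_left_mono powr_mono2) auto
        thus "real (card D) \<le> K * (N ^ 6) powr \<delta>" using cD by linarith
      qed auto
      finally show ?thesis .
    qed
    have "(\<Sum>w\<in>W. cmod (S w) ^ 6) \<le> cmod (complex_of_real (\<Sum>w\<in>W. cmod (S w) ^ 6))"
      unfolding norm_of_real by (rule abs_ge_self)
    also have "\<dots> \<le> (\<Sum>g\<in>G. cmod (T (prod g {..<6})))"
      unfolding six by (intro sum_norm_le) (simp add: norm_mult b1 mult_left_le_one_le)
    also have "\<dots> = (\<Sum>p\<in>Box. \<Sum>g | g \<in> G \<and> pr g = p. cmod (T (prod g {..<6})))"
      by (rule sum.group[symmetric, OF finG _ prBox]) (simp add: Box_def)
    also have "\<dots> = (\<Sum>p\<in>Box. real (card {g \<in> G. pr g = p}) * cmod (T (ZSqrt2 (fst p) (snd p))))"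
    proof (intro sum.cong refl)
      fix p
      have "(\<Sum>g | g \<in> G \<and> pr g = p. cmod (T (prod g {..<6}))) = (\<Sum>g | g \<in> G \<and> pr g = p. cmod (T (ZSqrt2 (fst p) (snd p))))"
        by (intro sum.cong refl) (auto simp: pr_def)
      thus "(\<Sum>g | g \<in> G \<and> pr g = p. cmod (T (prod g {..<6}))) =
          real (card {g \<in> G. pr g = p}) * cmod (T (ZSqrt2 (fst p) (snd p)))" by simp
    qed
    also have "\<dots> \<le> (\<Sum>p\<in>Box. Rm * cmod (T (ZSqrt2 (fst p) (snd p))))"
      by (intro sum_mono mult_right_mono fiber) auto
    also have "\<dots> = Rm * (\<Sum>p\<in>Box. cmod (T (ZSqrt2 (fst p) (snd p))))" by (rule sum_distrib_left[symmetric])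
    \<comment> \<open>Cauchy--Schwarz over the box brings in the second moment, and with it M^(1/2)
      in place of the trivial M.\<close>
    also have "\<dots> \<le> Rm * (C1 * M powr ((1 + \<delta>) / 2) * (of_int Y)\<^sup>2)"
    proof (intro mult_left_mono Rm0)
      show "(\<Sum>p\<in>Box. cmod (T (ZSqrt2 (fst p) (snd p)))) \<le> C1 * M powr ((1 + \<delta>) / 2) * (of_int Y)\<^sup>2"
      proof (rule power2_le_imp_le)
        have Y3: "of_int Y \<ge> M ^ 3" using Ylb power_mono[OF MN, of 3] M by linarith
        have "(\<Sum>p\<in>Box. cmod (T (ZSqrt2 (fst p) (snd p))))\<^sup>2 = (\<Sum>p\<in>Box. cmod (T (ZSqrt2 (fst p) (snd p))) * 1)\<^sup>2" by simp
        also have "\<dots> \<le> (\<Sum>p\<in>Box. (cmod (T (ZSqrt2 (fst p) (snd p))))\<^sup>2) * (\<Sum>p\<in>Box. 1\<^sup>2)"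
          by (rule Cauchy_Schwarz_ineq_sum)
        also have "(\<Sum>p\<in>Box. 1\<^sup>2) = (real_of_int Y)\<^sup>2"
          using Y0 by (simp add: Box_def card_cartesian_product power2_eq_square)
        also have "(\<Sum>p\<in>Box. (cmod (T (ZSqrt2 (fst p) (snd p))))\<^sup>2) * (of_int Y)\<^sup>2
            \<le> (C1 * M powr (1 + \<delta>) * (of_int Y)\<^sup>2) * (of_int Y)\<^sup>2"
        proof (rule mult_right_mono)
          have "(\<Sum>(c, d)\<in>{0..<Y} \<times> {0..<Y}. (cmod (\<Sum>w\<in>W. e w * of_int (chi (t w) (ZSqrt2 c d))))\<^sup>2)
              \<le> C1 * M powr (1 + \<delta>) * (of_int Y)\<^sup>2"
            using C1(2)[rule_format, of M W t e Y] M W t e Y3 by blast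
          thus "(\<Sum>p\<in>Box. (cmod (T (ZSqrt2 (fst p) (snd p))))\<^sup>2) \<le> C1 * M powr (1 + \<delta>) * (of_int Y)\<^sup>2"
            by (simp add: Box_def T_def case_prod_unfold)
        qed auto
        also have "\<dots> \<le> (C1\<^sup>2 * M powr (1 + \<delta>) * (of_int Y)\<^sup>2) * (of_int Y)\<^sup>2"
          using C1(1) by (intro mult_right_mono) (auto simp: power2_eq_square)
        also have "M powr (1 + \<delta>) = (M powr ((1 + \<delta>) / 2))\<^sup>2"
        proof -
          have "1 + \<delta> = (1 + \<delta>) / 2 + (1 + \<delta>) / 2" by (simp only: field_sum_of_halves)
          hence "M powr (1 + \<delta>) = M powr ((1 + \<delta>) / 2 + (1 + \<delta>) / 2)" by (rule arg_cong)
          thus ?thesis by (simp only: powr_add power2_eq_square)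
        qed
        finally show "(\<Sum>p\<in>Box. cmod (T (ZSqrt2 (fst p) (snd p))))\<^sup>2 \<le> (C1 * M powr ((1 + \<delta>) / 2) * (of_int Y)\<^sup>2)\<^sup>2"
          by (simp only: power_mult_distrib power2_eq_square mult_ac)
      qed (use C1 in auto)
    qed
    also have "\<dots> \<le> Rm * (C1 * M powr ((1 + \<delta>) / 2) * (cY * N ^ 3)\<^sup>2)"
      using Yub Y0 C1 Rm0 by (intro mult_left_mono power_mono) auto
    finally have mom: "(\<Sum>w\<in>W. cmod (S w) ^ 6) \<le> Rm * (C1 * M powr ((1 + \<delta>) / 2) * (cY * N ^ 3)\<^sup>2)" .
    have "cmod (\<Sum>w\<in>W. \<Sum>z\<in>Z. \<alpha> w * \<beta> z * of_int (chi (t w) z)) = cmod (\<Sum>w\<in>W. \<alpha> w * S w)"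
      by (simp add: S_def sum_distrib_left mult.assoc)
    also have "\<dots> \<le> (\<Sum>w\<in>W. cmod (S w))"
      by (intro sum_norm_le) (use \<alpha> in \<open>simp add: norm_mult mult_left_le_one_le\<close>)
    finally have le: "cmod (\<Sum>w\<in>W. \<Sum>z\<in>Z. \<alpha> w * \<beta> z * of_int (chi (t w) z)) \<le> (\<Sum>w\<in>W. cmod (S w))" .
    \<comment> \<open>Hoelder over w: the fifth power of |W| <= 9 M, together with M^(1/2) from the
      moment, gives M^(11/2), whose sixth root is M^(11/12).\<close>
    have "(\<Sum>w\<in>W. cmod (S w)) ^ 6 \<le> real (card W) ^ 5 * (\<Sum>w\<in>W. cmod (S w) ^ 6)"
      using power_mean[OF finW, of "\<lambda>w. cmod (S w)" 5] by simp
    also have "\<dots> \<le> (9 * M) ^ 5 * (Rm * (C1 * M powr ((1 + \<delta>) / 2) * (cY * N ^ 3)\<^sup>2))"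
      using cW mom M by (intro mult_mono power_mono) (auto intro: sum_nonneg)
    also have "Rm = K ^ 6 * N powr (36 * \<delta>)"
    proof -
      have "(N ^ 6) powr \<delta> = (N powr 6) powr \<delta>" using N by simp
      also have "\<dots> = N powr (6 * \<delta>)" by (rule powr_powr)
      finally have a: "(N ^ 6) powr \<delta> = N powr (6 * \<delta>)" .
      have "(N powr (6 * \<delta>)) ^ 6 = (N powr (6 * \<delta>)) powr 6" using N by simp
      also have "\<dots> = N powr (6 * \<delta> * 6)" by (rule powr_powr)
      also have "6 * \<delta> * 6 = 36 * \<delta>" by simp
      finally have "(N powr (6 * \<delta>)) ^ 6 = N powr (36 * \<delta>)" .
      thus ?thesis by (simp only: Rm_def a power_mult_distrib)
    qed
    also have "(9 * M) ^ 5 * (K ^ 6 * N powr (36 * \<delta>) * (C1 * M powr ((1 + \<delta>) / 2) * (cY * N ^ 3)\<^sup>2))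
      = C2 * ((M ^ 5 * M powr ((1 + \<delta>) / 2)) * (N powr (36 * \<delta>) * (N ^ 3)\<^sup>2))"
      unfolding C2_def power_mult_distrib by (simp only: mult_ac)
    also have "\<dots> \<le> C2 * ((M powr (11 / 2) * N powr (\<delta> / 2)) * (N powr (36 * \<delta>) * N powr 6))"
    proof (rule mult_left_mono[OF mult_mono])
      have "M ^ 5 * M powr ((1 + \<delta>) / 2) = M powr 5 * M powr ((1 + \<delta>) / 2)" using M by simp
      also have "\<dots> = M powr (5 + (1 + \<delta>) / 2)" by (rule powr_add[symmetric])
      also have "5 + (1 + \<delta>) / 2 = 11 / 2 + \<delta> / 2" by (simp add: field_simps)
      also have "M powr (11 / 2 + \<delta> / 2) = M powr (11 / 2) * M powr (\<delta> / 2)" by (rule powr_add)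
      also have "\<dots> \<le> M powr (11 / 2) * N powr (\<delta> / 2)"
        using M MN \<delta> by (intro mult_left_mono powr_mono2) auto
      finally show "M ^ 5 * M powr ((1 + \<delta>) / 2) \<le> M powr (11 / 2) * N powr (\<delta> / 2)" .
      have "(N ^ 3)\<^sup>2 = N powr 6" using N by (simp add: power_mult[symmetric])
      thus "N powr (36 * \<delta>) * (N ^ 3)\<^sup>2 \<le> N powr (36 * \<delta>) * N powr 6" by simp
    qed (use K C1 M N in \<open>auto simp: C2_def cY_def\<close>)
    also have "\<dots> = C2 * (M powr (11 / 2) * N powr (6 + 6 * \<eta>))"
    proof -
      have "\<delta> / 2 + (36 * \<delta> + 6) = 6 + 6 * \<eta>" unfolding \<delta>_def by simp
      hence "N powr (\<delta> / 2) * (N powr (36 * \<delta>) * N powr 6) = N powr (6 + 6 * \<eta>)"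
        by (simp only: powr_add[symmetric])
      thus ?thesis by (simp only: mult.assoc)
    qed
    also have "\<dots> \<le> C ^ 6 * (M powr (11 / 2) * N powr (6 + 6 * \<eta>))"
    proof (rule mult_right_mono)
      have "C \<le> C ^ 6" using C by (intro self_le_power) auto
      thus "C2 \<le> C ^ 6" using C by linarith
    qed auto
    also have "\<dots> = (C * M powr (11 / 12) * N powr (1 + \<eta>)) ^ 6"
    proof -
      have p6: "(x powr a) ^ 6 = x powr (a * 6)" for x a :: real
      proof (cases "x = 0")
        case False
        hence "(x powr a) ^ 6 = (x powr a) powr 6" by simp
        also have "\<dots> = x powr (a * 6)" by (rule powr_powr)
        finally show ?thesis .
      qed simp
      have "M powr (11 / 12 * 6) = M powr (11 / 2)" by simp
      moreover have "(1 + \<eta>) * 6 = 6 + 6 * \<eta>" by simp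
      ultimately show ?thesis by (simp only: power_mult_distrib p6 mult.assoc)
    qed
    finally have "(\<Sum>w\<in>W. cmod (S w)) ^ 6 \<le> (C * M powr (11 / 12) * N powr (1 + \<eta>)) ^ 6" .
    hence "(\<Sum>w\<in>W. cmod (S w)) \<le> C * M powr (11 / 12) * N powr (1 + \<eta>)"
      by (rule power_le_imp_le_base[of _ 5, simplified]) (use C in auto)
    thus "cmod (\<Sum>w\<in>W. \<Sum>z\<in>Z. \<alpha> w * \<beta> z * of_int (chi (t w) z)) \<le> C * M powr (11 / 12) * N powr (1 + \<eta>)"
      using le by linarith
  qed
qed

section \<open>Twisted spins as bilinear forms in the quadratic symbol\<close>

text \<open>The share of the left factor in the twisted spin of a product. The share of the right
  factor and that of the classes follow, and \<open>chi\<close> is all that is left.\<close>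

definition weight_left :: "(int \<Rightarrow> complex) \<Rightarrow> zsqrt2 \<Rightarrow> complex" where
  "weight_left \<phi> w = of_int (Jacobi (2 * sqrt_part w) (rat_part w) * Jacobi (rat_part w) (nrm w)) * \<phi> (nrm w)"

definition weight_right :: "(int \<Rightarrow> complex) \<Rightarrow> zsqrt2 \<Rightarrow> complex" where
  "weight_right \<phi> z = of_int (Jacobi (rat_part z) (odd_part (sqrt_part z))) * \<phi> (nrm z)"

text \<open>The value \<open>\<phi> (- 1)\<close> appears because -u^2 + 2 v^2 is minus the norm;
  the argument of \<open>\<psi>\<close> is the rational part of the product modulo 16.\<close>

definition class_weight :: "(int \<Rightarrow> complex) \<Rightarrow> (int \<Rightarrow> complex) \<Rightarrow> int \<times> int \<Rightarrow>
    int \<times> int \<times> bool \<times> bool \<times> int \<Rightarrow> complex" where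
  "class_weight \<phi> \<psi> \<kappa> \<mu> = of_int (class_sign \<kappa> \<mu>) * \<phi> (- 1) *
     \<psi> (fst \<kappa> * fst \<mu> + 2 * snd \<kappa> * fst (snd \<mu>))"

lemma cmod_of_int_le_1: "\<bar>k\<bar> \<le> 1 \<Longrightarrow> cmod (of_int k) \<le> 1"
  by (metis norm_of_int of_int_abs of_int_le_1_iff)

lemma norm_weights_le:
  assumes "dirichlet_char 16 \<phi>" "dirichlet_char 16 \<psi>"
  shows "cmod (weight_left \<phi> w) \<le> 1" "cmod (weight_right \<phi> w) \<le> 1" "cmod (class_weight \<phi> \<psi> \<kappa> \<mu>) \<le> 1"
proof -
  note d = norm_dirichlet_char_le[OF assms(1)] norm_dirichlet_char_le[OF assms(2)]
  have "\<bar>Jacobi a b * Jacobi c e\<bar> \<le> 1" for a b c e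
    unfolding abs_mult by (intro mult_le_one abs_Jacobi_le) auto
  thus "cmod (weight_left \<phi> w) \<le> 1" unfolding weight_left_def norm_mult[of _ "\<phi> _"]
    by (intro mult_le_one cmod_of_int_le_1 d) auto
  show "cmod (weight_right \<phi> w) \<le> 1" unfolding weight_right_def norm_mult
    by (intro mult_le_one cmod_of_int_le_1 abs_Jacobi_le d) auto
  show "cmod (class_weight \<phi> \<psi> \<kappa> \<mu>) \<le> 1" unfolding class_weight_def norm_mult
    by (intro mult_le_one cmod_of_int_le_1 abs_class_sign d mult_nonneg_nonneg) auto
qed

lemma twisted_spin_mult:
  assumes dc: "dirichlet_char 16 \<phi>" "dirichlet_char 16 \<psi>"
    and "totally_positive w" "totally_positive z"
    and "odd (rat_part w)" "odd (rat_part z)" "sqrt_part z \<noteq> 0"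
  shows "twisted_spin \<phi> \<psi> (w * z) = class_weight \<phi> \<psi> (class_left w) (class_right z) *
     weight_left \<phi> w * weight_right \<phi> z * of_int (chi w z)"
proof -
  have "- nrm (w * z) = (-1) * (nrm w * nrm z)" by (simp add: nrm_mult)
  hence phi: "\<phi> (- nrm (w * z)) = \<phi> (-1) * (\<phi> (nrm w) * \<phi> (nrm z))"
    by (simp only: dirichlet_char_mult[OF dc(1)])
  have psi: "\<psi> (rat_part (w * z)) = \<psi> (fst (class_left w) * fst (class_right z) +
      2 * snd (class_left w) * fst (snd (class_right z)))"
    unfolding class_left_def class_right_def fst_conv snd_conv
  proof (rule dirichlet_char_cong[OF dc(2)])
    show "rat_part (w * z) mod 16 = (rat_part w mod 16 * (rat_part z mod 16) +
      2 * (sqrt_part w mod 16) * (sqrt_part z mod 16)) mod 16"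
      unfolding zsqrt2_sel by (intro mod_16_cong; simp)
  qed
  show ?thesis
    unfolding twisted_spin_def nrm_neg_eq phi psi spin_mult[OF assms(3-7)]
      class_weight_def weight_left_def weight_right_def by simp
qed

lemma coprime_sqrt_part_nrm:
  assumes "coprime (rat_part w) (sqrt_part w)" shows "coprime (sqrt_part w) (nrm w)"
proof -
  have "coprime (sqrt_part w) ((rat_part w)\<^sup>2)" using assms by (simp add: coprime_commute)
  moreover have "gcd (sqrt_part w) ((rat_part w)\<^sup>2) = gcd (sqrt_part w) (nrm w)"
    using gcd_add_mult[of "sqrt_part w" "- 2 * sqrt_part w" "(rat_part w)\<^sup>2"]
    by (simp add: nrm_def power2_eq_square mult.assoc)
  ultimately show ?thesis by (simp add: coprime_iff_gcd_eq_1)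
qed

text \<open>Pairs outside the reach of the factorization contribute nothing. An even rational part
  makes that of the product even, a common factor of the coordinates of w kills (2 b / a), and a z
  without sqrt 2 part is a rational integer above 1 that divides both coordinates of the
  product.\<close>

lemma twisted_spin_mult_eq_0:
  assumes w: "totally_positive w" and z: "canonical z" "nrm z > 1"
    and bad: "\<not> (odd (rat_part w) \<and> coprime (sqrt_part w) (nrm w) \<and> odd (rat_part z) \<and> sqrt_part z \<noteq> 0)"
  shows "twisted_spin \<phi> \<psi> (w * z) = 0"
proof -
  have tz: "totally_positive z" by (rule canonical_imp_totally_positive[OF z(1)])
  have tp: "rat_part (w * z) > 0" using totally_positive_mult[OF w tz] by (simp only: totally_positive_def)
  have "spin (w * z) = 0"
  proof (cases "odd (rat_part w) \<and> odd (rat_part z)")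
    case False
    hence "even (rat_part (w * z))" by auto
    thus ?thesis by (simp add: spin_def)
  next
    case odd: True
    show ?thesis
    proof (cases "sqrt_part z = 0")
      case True
      have "(rat_part z)\<^sup>2 > 1" using z(2) True by (simp add: nrm_def)
      hence "rat_part z > 1" using z(1) power_le_one[of "rat_part z" 2]
        by (auto simp: canonical_def not_le[symmetric])
      thus ?thesis using True tp by (intro spin_eq_0[of "rat_part z"]) auto
    next
      case False
      hence "\<not> coprime (rat_part w) (sqrt_part w)" using bad odd coprime_sqrt_part_nrm by blast
      hence "\<not> coprime (2 * sqrt_part w) (rat_part w)" using coprime_commute by auto
      moreover have "rat_part w \<noteq> 0" using odd by auto
      ultimately have "Jacobi (2 * sqrt_part w) (rat_part w) = 0" using Jacobi_eq_0_iff by blast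
      thus ?thesis using spin_mult[OF w tz] odd False by simp
    qed
  qed
  thus ?thesis by (simp add: twisted_spin_def)
qed

section \<open>Separating variables under a norm condition\<close>

lemma sum_swap3:
  "(\<Sum>a\<in>A. \<Sum>b\<in>B. \<Sum>c\<in>C. f a b c) = (\<Sum>c\<in>C. \<Sum>a\<in>A. \<Sum>b\<in>B. f a b c)"
proof -
  have "(\<Sum>a\<in>A. \<Sum>b\<in>B. \<Sum>c\<in>C. f a b c) = (\<Sum>a\<in>A. \<Sum>c\<in>C. \<Sum>b\<in>B. f a b c)"
    by (intro sum.cong refl sum.swap)
  also have "\<dots> = (\<Sum>c\<in>C. \<Sum>a\<in>A. \<Sum>b\<in>B. f a b c)" by (rule sum.swap)
  finally show ?thesis .
qed

lemma totally_positive_unit_sq_power: "totally_positive w \<Longrightarrow> totally_positive (unit_sq ^ k * w)"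
proof (induction k)
  case (Suc k)
  have "unit_sq ^ Suc k * w = unit_sq * (unit_sq ^ k * w)" by (simp only: power_Suc mult.assoc)
  moreover have "totally_positive (unit_sq * (unit_sq ^ k * w))"
    by (rule totally_positive_mult[OF totally_positive_simps(2)]) (use Suc in blast)
  ultimately show ?case by (simp only:)
qed simp

text \<open>Pairs are grouped by class. On a class the class weight is constant, and the other two
  weights are absorbed into the coefficients of \<open>chi_bilinear\<close>, with multiplication by
  \<epsilon>^(2k) as the twist.\<close>

lemma bilinear_twisted_ordered:
  fixes \<eta> :: real assumes \<eta>: "\<eta> > 0"
  shows "\<exists>C>0. \<forall>\<phi> \<psi> k M N W Z \<alpha> \<beta>. dirichlet_char 16 \<phi> \<longrightarrow> dirichlet_char 16 \<psi> \<longrightarrow> 1 \<le> M \<longrightarrow> M \<le> N \<longrightarrow>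
    W \<subseteq> {w. canonical w \<and> real_of_int (nrm w) \<le> M} \<longrightarrow>
    Z \<subseteq> {z. canonical z \<and> nrm z > 1 \<and> real_of_int (nrm z) \<le> N} \<longrightarrow>
    (\<forall>w. cmod (\<alpha> w) \<le> 1) \<longrightarrow> (\<forall>z. cmod (\<beta> z) \<le> 1) \<longrightarrow>
    cmod (\<Sum>w\<in>W. \<Sum>z\<in>Z. \<alpha> w * \<beta> z * twisted_spin \<phi> \<psi> (fund_unit ^ (2 * k) * (w * z)))
      \<le> C * M powr (11 / 12) * N powr (1 + \<eta>)"
proof -
  obtain C0 where C0: "C0 > 0" "\<forall>M N W Z t \<alpha> \<beta>. 1 \<le> M \<longrightarrow> M \<le> N \<longrightarrow> W \<subseteq> {w. canonical w \<and> real_of_int (nrm w) \<le> M} \<longrightarrow>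
    Z \<subseteq> {z. canonical z \<and> real_of_int (nrm z) \<le> N} \<longrightarrow> unitary_twist W t \<longrightarrow>
    (\<forall>w. cmod (\<alpha> w) \<le> 1) \<longrightarrow> (\<forall>z. cmod (\<beta> z) \<le> 1) \<longrightarrow>
    cmod (\<Sum>w\<in>W. \<Sum>z\<in>Z. \<alpha> w * \<beta> z * of_int (chi (t w) z)) \<le> C0 * M powr (11 / 12) * N powr (1 + \<eta>)"
    using chi_bilinear[OF \<eta>] by (elim exE conjE) (rule that)
  \<comment> \<open>All classes that can occur; their number only affects the constant.\<close>
  define KL :: "((int \<times> int) \<times> (int \<times> int \<times> bool \<times> bool \<times> int)) set" where
    "KL = ({0..<16} \<times> {0..<16}) \<times> ({0..<16} \<times> {0..<16} \<times> UNIV \<times> UNIV \<times> {0..<4})"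
  have finKL: "finite KL" by (simp add: KL_def)
  define C where "C = (real (card KL) + 1) * C0"
  show ?thesis
  proof (intro exI[of _ C] conjI allI impI)
    show "C > 0" using C0(1) by (simp add: C_def)
    fix \<phi> \<psi> :: "int \<Rightarrow> complex" and k and M N :: real and W Z and \<alpha> \<beta> :: "zsqrt2 \<Rightarrow> complex"
    assume dc: "dirichlet_char 16 \<phi>" "dirichlet_char 16 \<psi>" and M: "1 \<le> M" and MN: "M \<le> N"
      and W: "W \<subseteq> {w. canonical w \<and> real_of_int (nrm w) \<le> M}"
      and Z: "Z \<subseteq> {z. canonical z \<and> nrm z > 1 \<and> real_of_int (nrm z) \<le> N}"
      and \<alpha>: "\<forall>w. cmod (\<alpha> w) \<le> 1" and \<beta>: "\<forall>z. cmod (\<beta> z) \<le> 1"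
    have N: "N \<ge> 1" using M MN by simp
    have Z': "Z \<subseteq> {z. canonical z \<and> real_of_int (nrm z) \<le> N}" using Z by auto
    have finW: "finite W" and finZ: "finite Z"
      using finite_subset[OF W finite_card_canonical(1)[OF M]] finite_subset[OF Z' finite_card_canonical(1)[OF N]] by auto
    define B where "B = C0 * M powr (11 / 12) * N powr (1 + \<eta>)"
    have B0: "B \<ge> 0" using C0(1) by (simp add: B_def)
    define t where "t = (\<lambda>w. unit_sq ^ k * w)"
    have tw: "fund_unit ^ (2 * k) * (w * z) = t w * z" for w z
      by (simp only: t_def unit_sq_power_props(3) mult.assoc)
    have nt: "nrm (t w) = nrm w" for w by (simp add: t_def nrm_mult unit_sq_power_props(2))
    have tpt: "totally_positive (t w)" if "w \<in> W" for w unfolding t_def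
      using that W by (intro totally_positive_unit_sq_power canonical_imp_totally_positive) auto
    define W1 where "W1 = {w \<in> W. odd (rat_part (t w)) \<and> coprime (sqrt_part (t w)) (nrm (t w))}"
    define Z1 where "Z1 = {z \<in> Z. odd (rat_part z) \<and> sqrt_part z \<noteq> 0}"
    define H where "H = (\<lambda>(w, z). \<alpha> w * \<beta> z * twisted_spin \<phi> \<psi> (t w * z))"
    define cls where "cls = (\<lambda>(w, z). (class_left (t w), class_right z))"
    have "(\<Sum>w\<in>W. \<Sum>z\<in>Z. \<alpha> w * \<beta> z * twisted_spin \<phi> \<psi> (fund_unit ^ (2 * k) * (w * z))) = (\<Sum>p\<in>W \<times> Z. H p)"
      unfolding tw by (simp add: sum.cartesian_product H_def)
    also have "\<dots> = (\<Sum>p\<in>W1 \<times> Z1. H p)"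
    proof (rule sum.mono_neutral_right)
      show "\<forall>p\<in>W \<times> Z - W1 \<times> Z1. H p = 0"
      proof
        fix p assume p: "p \<in> W \<times> Z - W1 \<times> Z1"
        obtain w z where wz: "p = (w, z)" by (cases p)
        have "twisted_spin \<phi> \<psi> (t w * z) = 0"
          using p wz tpt Z by (intro twisted_spin_mult_eq_0) (auto simp: W1_def Z1_def)
        thus "H p = 0" by (simp add: H_def wz)
      qed
    qed (use finW finZ in \<open>auto simp: W1_def Z1_def\<close>)
    also have "\<dots> = (\<Sum>c\<in>KL. \<Sum>p | p \<in> W1 \<times> Z1 \<and> cls p = c. H p)"
    proof (rule sum.group[symmetric, OF _ finKL])
      show "finite (W1 \<times> Z1)" using finW finZ by (simp add: W1_def Z1_def)
      show "cls ` (W1 \<times> Z1) \<subseteq> KL" by (auto simp: cls_def class_left_def class_right_def KL_def)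
    qed
    also have "cmod \<dots> \<le> (\<Sum>c\<in>KL. B)"
    proof (rule sum_norm_le)
      fix c :: "(int \<times> int) \<times> (int \<times> int \<times> bool \<times> bool \<times> int)"
      obtain \<kappa> \<mu> where c: "c = (\<kappa>, \<mu>)" by (cases c)
      define Wk where "Wk = {w \<in> W1. class_left (t w) = \<kappa>}"
      define Zm where "Zm = {z \<in> Z1. class_right z = \<mu>}"
      have "{p. p \<in> W1 \<times> Z1 \<and> cls p = c} = Wk \<times> Zm" by (auto simp: cls_def c Wk_def Zm_def)
      hence "(\<Sum>p | p \<in> W1 \<times> Z1 \<and> cls p = c. H p) = (\<Sum>w\<in>Wk. \<Sum>z\<in>Zm. H (w, z))"
        by (simp add: sum.cartesian_product)
      also have "\<dots> = class_weight \<phi> \<psi> \<kappa> \<mu> * (\<Sum>w\<in>Wk. \<Sum>z\<in>Zm. (\<alpha> w * weight_left \<phi> (t w)) * (\<beta> z * weight_right \<phi> z) * of_int (chi (t w) z))"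
        unfolding sum_distrib_left
      proof (intro sum.cong refl)
        fix w z assume w: "w \<in> Wk" and z: "z \<in> Zm"
        have "twisted_spin \<phi> \<psi> (t w * z) = class_weight \<phi> \<psi> (class_left (t w)) (class_right z) *
          weight_left \<phi> (t w) * weight_right \<phi> z * of_int (chi (t w) z)"
          by (rule twisted_spin_mult[OF dc tpt canonical_imp_totally_positive])
             (use w z Z in \<open>auto simp: Wk_def Zm_def W1_def Z1_def\<close>)
        moreover have "class_left (t w) = \<kappa>" "class_right z = \<mu>" using w z by (simp_all add: Wk_def Zm_def)
        ultimately show "H (w, z) = class_weight \<phi> \<psi> \<kappa> \<mu> *
            ((\<alpha> w * weight_left \<phi> (t w)) * (\<beta> z * weight_right \<phi> z) * of_int (chi (t w) z))"
          by (simp add: H_def)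
      qed
      also have "cmod \<dots> \<le> 1 * B"
        unfolding norm_mult
      proof (rule mult_mono)
        show "cmod (class_weight \<phi> \<psi> \<kappa> \<mu>) \<le> 1" by (rule norm_weights_le(3)[OF dc])
        have "cmod (\<Sum>w\<in>Wk. \<Sum>z\<in>Zm. (\<lambda>w. \<alpha> w * weight_left \<phi> (t w)) w * (\<lambda>z. \<beta> z * weight_right \<phi> z) z * of_int (chi (t w) z)) \<le> B"
          unfolding B_def
        proof (rule C0(2)[rule_format, OF M MN])
          show "Wk \<subseteq> {w. canonical w \<and> real_of_int (nrm w) \<le> M}" using W by (auto simp: Wk_def W1_def)
          show "Zm \<subseteq> {z. canonical z \<and> real_of_int (nrm z) \<le> N}" using Z by (auto simp: Zm_def Z1_def)
          show "unitary_twist Wk t" by (auto simp: unitary_twist_def Wk_def W1_def nt)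
          show "cmod (\<alpha> w * weight_left \<phi> (t w)) \<le> 1" for w
            unfolding norm_mult using \<alpha> norm_weights_le(1)[OF dc] by (intro mult_le_one) auto
          show "cmod (\<beta> z * weight_right \<phi> z) \<le> 1" for z
            unfolding norm_mult using \<beta> norm_weights_le(2)[OF dc] by (intro mult_le_one) auto
        qed
        thus "cmod (\<Sum>w\<in>Wk. \<Sum>z\<in>Zm. \<alpha> w * weight_left \<phi> (t w) * (\<beta> z * weight_right \<phi> z) * of_int (chi (t w) z)) \<le> B" .
      qed auto
      finally show "cmod (\<Sum>p | p \<in> W1 \<times> Z1 \<and> cls p = c. H p) \<le> B" by simp
    qed
    also have "\<dots> = real (card KL) * B" by simp
    also have "\<dots> \<le> (real (card KL) + 1) * B" using B0 by (intro mult_right_mono) auto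
    finally show "cmod (\<Sum>w\<in>W. \<Sum>z\<in>Z. \<alpha> w * \<beta> z * twisted_spin \<phi> \<psi> (fund_unit ^ (2 * k) * (w * z)))
      \<le> C * M powr (11 / 12) * N powr (1 + \<eta>)" by (simp add: B_def C_def mult.assoc)
  qed
qed

text \<open>The right side is symmetric in M and N, so the roles of the variables can be exchanged
  afterwards.\<close>

lemma balanced_exponent_le:
  fixes \<eta> :: real
  assumes "1 \<le> M" "M \<le> N" "\<eta> > 0"
  shows "M powr (11 / 12) * N powr (1 + \<eta>) \<le> (M * N) powr (1 + \<eta>) * (min M N) powr (- 1 / 12)"
proof -
  have "M powr (11 / 12) = M powr (1 + - 1 / 12)" by simp
  also have "\<dots> = M powr 1 * M powr (- 1 / 12)" by (rule powr_add)
  also have "\<dots> \<le> M powr (1 + \<eta>) * M powr (- 1 / 12)"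
    using assms by (intro mult_right_mono powr_mono) auto
  finally have "M powr (11 / 12) * N powr (1 + \<eta>) \<le> (M powr (1 + \<eta>) * M powr (- 1 / 12)) * N powr (1 + \<eta>)"
    by (intro mult_right_mono) auto
  also have "\<dots> = (M * N) powr (1 + \<eta>) * (min M N) powr (- 1 / 12)"
    using assms by (simp add: powr_mult min_absorb1)
  finally show ?thesis .
qed

text \<open>Multiplication commutes, so the longer variable can always be the one that is raised to
  the sixth power.\<close>

lemma bilinear_spin_sum:
  fixes \<eta> :: real assumes \<eta>: "\<eta> > 0"
  shows "\<exists>C>0. \<forall>\<phi> \<psi> M N W Z \<alpha> \<beta>. dirichlet_char 16 \<phi> \<longrightarrow> dirichlet_char 16 \<psi> \<longrightarrow> 1 \<le> M \<longrightarrow> 1 \<le> N \<longrightarrow>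
    W \<subseteq> {w. canonical w \<and> nrm w > 1 \<and> real_of_int (nrm w) \<le> M} \<longrightarrow>
    Z \<subseteq> {z. canonical z \<and> nrm z > 1 \<and> real_of_int (nrm z) \<le> N} \<longrightarrow>
    (\<forall>w. cmod (\<alpha> w) \<le> 1) \<longrightarrow> (\<forall>z. cmod (\<beta> z) \<le> 1) \<longrightarrow>
    cmod (\<Sum>w\<in>W. \<Sum>z\<in>Z. \<alpha> w * \<beta> z * spin_sum \<phi> \<psi> (w * z))
      \<le> C * ((M * N) powr (1 + \<eta>) * (min M N) powr (- 1 / 12))"
proof -
  obtain C where C: "C > 0" "\<forall>\<phi> \<psi> k M N W Z \<alpha> \<beta>. dirichlet_char 16 \<phi> \<longrightarrow> dirichlet_char 16 \<psi> \<longrightarrow> 1 \<le> M \<longrightarrow> M \<le> N \<longrightarrow>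
    W \<subseteq> {w. canonical w \<and> real_of_int (nrm w) \<le> M} \<longrightarrow>
    Z \<subseteq> {z. canonical z \<and> nrm z > 1 \<and> real_of_int (nrm z) \<le> N} \<longrightarrow>
    (\<forall>w. cmod (\<alpha> w) \<le> 1) \<longrightarrow> (\<forall>z. cmod (\<beta> z) \<le> 1) \<longrightarrow>
    cmod (\<Sum>w\<in>W. \<Sum>z\<in>Z. \<alpha> w * \<beta> z * twisted_spin \<phi> \<psi> (fund_unit ^ (2 * k) * (w * z)))
      \<le> C * M powr (11 / 12) * N powr (1 + \<eta>)"
    using bilinear_twisted_ordered[OF \<eta>] by (elim exE conjE) (rule that)
  have ordered: "cmod (\<Sum>w\<in>W. \<Sum>z\<in>Z. \<alpha> w * \<beta> z * spin_sum \<phi> \<psi> (w * z))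
      \<le> 4 * C * ((M * N) powr (1 + \<eta>) * (min M N) powr (- 1 / 12))"
    if dc: "dirichlet_char 16 \<phi>" "dirichlet_char 16 \<psi>" and M: "1 \<le> M" and MN: "M \<le> N"
      and W: "W \<subseteq> {w. canonical w \<and> nrm w > 1 \<and> real_of_int (nrm w) \<le> M}"
      and Z: "Z \<subseteq> {z. canonical z \<and> nrm z > 1 \<and> real_of_int (nrm z) \<le> N}"
      and \<alpha>: "\<forall>w. cmod (\<alpha> w) \<le> 1" and \<beta>: "\<forall>z. cmod (\<beta> z) \<le> 1"
    for \<phi> \<psi> \<alpha> \<beta> W Z and M N :: real
  proof -
    have W': "W \<subseteq> {w. canonical w \<and> real_of_int (nrm w) \<le> M}" using W by auto
    have "(\<Sum>w\<in>W. \<Sum>z\<in>Z. \<alpha> w * \<beta> z * spin_sum \<phi> \<psi> (w * z)) =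
       (\<Sum>w\<in>W. \<Sum>z\<in>Z. \<Sum>k\<le>3. \<alpha> w * \<beta> z * twisted_spin \<phi> \<psi> (fund_unit ^ (2 * k) * (w * z)))"
      by (simp add: spin_sum_def sum_distrib_left)
    also have "\<dots> = (\<Sum>k\<le>3. \<Sum>w\<in>W. \<Sum>z\<in>Z. \<alpha> w * \<beta> z * twisted_spin \<phi> \<psi> (fund_unit ^ (2 * k) * (w * z)))"
      by (rule sum_swap3)
    also have "cmod \<dots> \<le> (\<Sum>k\<le>3::nat. C * M powr (11 / 12) * N powr (1 + \<eta>))"
      by (intro sum_norm_le) (use C(2)[rule_format, OF dc M MN W' Z] \<alpha> \<beta> in blast)
    also have "\<dots> = 4 * C * (M powr (11 / 12) * N powr (1 + \<eta>))" by simp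
    also have "\<dots> \<le> 4 * C * ((M * N) powr (1 + \<eta>) * (min M N) powr (- 1 / 12))"
      using C(1) M MN \<eta> by (intro mult_left_mono balanced_exponent_le) auto
    finally show ?thesis .
  qed
  show ?thesis
  proof (intro exI[of _ "4 * C"] conjI allI impI)
    show "4 * C > 0" using C(1) by simp
    fix \<phi> \<psi> :: "int \<Rightarrow> complex" and M N :: real and W Z and \<alpha> \<beta> :: "zsqrt2 \<Rightarrow> complex"
    assume A: "dirichlet_char 16 \<phi>" "dirichlet_char 16 \<psi>" "1 \<le> M" "1 \<le> N"
      "W \<subseteq> {w. canonical w \<and> nrm w > 1 \<and> real_of_int (nrm w) \<le> M}"
      "Z \<subseteq> {z. canonical z \<and> nrm z > 1 \<and> real_of_int (nrm z) \<le> N}"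
      "\<forall>w. cmod (\<alpha> w) \<le> 1" "\<forall>z. cmod (\<beta> z) \<le> 1"
    show "cmod (\<Sum>w\<in>W. \<Sum>z\<in>Z. \<alpha> w * \<beta> z * spin_sum \<phi> \<psi> (w * z))
      \<le> 4 * C * ((M * N) powr (1 + \<eta>) * (min M N) powr (- 1 / 12))"
    proof (cases "M \<le> N")
      case True
      show ?thesis by (rule ordered[OF A(1,2,3) True A(5-8)])
    next
      case False
      have "(\<Sum>w\<in>W. \<Sum>z\<in>Z. \<alpha> w * \<beta> z * spin_sum \<phi> \<psi> (w * z)) = (\<Sum>z\<in>Z. \<Sum>w\<in>W. \<beta> z * \<alpha> w * spin_sum \<phi> \<psi> (z * w))"
        by (subst sum.swap) (simp only: mult.commute)
      thus ?thesis using ordered[OF A(1,2,4) _ A(6,5,8,7)] False by (simp add: mult.commute min.commute)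
    qed
  qed
qed

text \<open>Both arguments are totally positive generators of the same ideal.\<close>

lemma spin_sum_rep:
  assumes dc: "dirichlet_char 16 \<phi>" "dirichlet_char 16 \<psi>" and A: "A \<in> prime_msets" and B: "B \<in> prime_msets"
  shows "spin_sum \<phi> \<psi> (prod_mset (A + B)) = spin_sum \<phi> \<psi> (rep A * rep B)"
proof -
  have "rep A dvd prod_mset A" "prod_mset A dvd rep A" "rep B dvd prod_mset B" "prod_mset B dvd rep B"
    by (simp_all add: rep_def)
  hence "normalize (prod_mset (A + B)) = normalize (rep A * rep B)"
    unfolding associated_iff_dvd by (simp add: mult_dvd_mono)
  moreover have "totally_positive (prod_mset (A + B))" using A B by (intro prod_mset_totally_positive) simp
  moreover have "totally_positive (rep A * rep B)"
    using A B by (intro totally_positive_mult canonical_imp_totally_positive rep_canonical)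
  ultimately show ?thesis using spin_sum_normalize[OF dc] by metis
qed

lemma sum_msets_rep:
  fixes f :: "zsqrt2 multiset \<Rightarrow> complex"
  assumes "f {#} = 0"
  shows "(\<Sum>A\<in>msets_upto M. f A) = (\<Sum>w\<in>rep ` (msets_upto M - {{#}}). f (prime_factorization w))"
proof -
  have "(\<Sum>A\<in>msets_upto M. f A) = (\<Sum>A\<in>msets_upto M - {{#}}. f A)"
    using assms by (intro sum.mono_neutral_right) auto
  also have "\<dots> = (\<Sum>A\<in>msets_upto M - {{#}}. f (prime_factorization (rep A)))"
    by (intro sum.cong refl) (auto simp: msets_upto_def prime_factorization_rep)
  also have "\<dots> = (\<Sum>w\<in>rep ` (msets_upto M - {{#}}). f (prime_factorization w))"
    by (subst sum.reindex) (auto intro: inj_on_subset[OF inj_on_rep_msets_upto])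
  finally show ?thesis .
qed

text \<open>The bilinear bound for multisets. Coefficients that vanish at the empty multiset
  restrict the sums to norms above 1, where excluded pairs are known to contribute zero.\<close>

lemma type_II_bound:
  fixes \<eta> :: real assumes \<eta>: "\<eta> > 0"
  shows "\<exists>C>0. \<forall>\<phi> \<psi> M N \<alpha> \<beta>. dirichlet_char 16 \<phi> \<longrightarrow> dirichlet_char 16 \<psi> \<longrightarrow> 1 \<le> M \<longrightarrow> 1 \<le> N \<longrightarrow>
    (\<forall>A. cmod (\<alpha> A) \<le> 1) \<longrightarrow> (\<forall>B. cmod (\<beta> B) \<le> 1) \<longrightarrow> \<alpha> {#} = 0 \<longrightarrow> \<beta> {#} = 0 \<longrightarrow>
    cmod (\<Sum>A\<in>msets_upto M. \<Sum>B\<in>msets_upto N. \<alpha> A * \<beta> B * spin_sum \<phi> \<psi> (prod_mset (A + B)))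
      \<le> C * ((M * N) powr (1 + \<eta>) * (min M N) powr (- 1 / 12))"
proof -
  obtain C where C: "C > 0" "\<forall>\<phi> \<psi> M N W Z \<alpha> \<beta>. dirichlet_char 16 \<phi> \<longrightarrow> dirichlet_char 16 \<psi> \<longrightarrow> 1 \<le> M \<longrightarrow> 1 \<le> N \<longrightarrow>
    W \<subseteq> {w. canonical w \<and> nrm w > 1 \<and> real_of_int (nrm w) \<le> M} \<longrightarrow>
    Z \<subseteq> {z. canonical z \<and> nrm z > 1 \<and> real_of_int (nrm z) \<le> N} \<longrightarrow>
    (\<forall>w. cmod (\<alpha> w) \<le> 1) \<longrightarrow> (\<forall>z. cmod (\<beta> z) \<le> 1) \<longrightarrow>
    cmod (\<Sum>w\<in>W. \<Sum>z\<in>Z. \<alpha> w * \<beta> z * spin_sum \<phi> \<psi> (w * z))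
      \<le> C * ((M * N) powr (1 + \<eta>) * (min M N) powr (- 1 / 12))"
    using bilinear_spin_sum[OF \<eta>] by (elim exE conjE) (rule that)
  show ?thesis
  proof (intro exI[of _ C] conjI allI impI C(1))
    fix \<phi> \<psi> :: "int \<Rightarrow> complex" and M N :: real and \<alpha> \<beta> :: "zsqrt2 multiset \<Rightarrow> complex"
    assume dc: "dirichlet_char 16 \<phi>" "dirichlet_char 16 \<psi>" and MN: "1 \<le> M" "1 \<le> N"
      and \<alpha>: "\<forall>A. cmod (\<alpha> A) \<le> 1" and \<beta>: "\<forall>B. cmod (\<beta> B) \<le> 1" and z: "\<alpha> {#} = 0" "\<beta> {#} = 0"
    define R where "R = (\<lambda>M. rep ` (msets_upto M - {{#}}))"
    have R: "R M \<subseteq> {w. canonical w \<and> nrm w > 1 \<and> real_of_int (nrm w) \<le> M}" for M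
    proof
      fix w assume "w \<in> R M"
      then obtain A where A: "A \<in> prime_msets" "mnorm A \<le> M" "A \<noteq> {#}" "w = rep A"
        by (auto simp: R_def msets_upto_def)
      have "real_of_int (nrm w) = mnorm A" using nrm_rep[OF A(1)] A(4) by simp
      thus "w \<in> {w. canonical w \<and> nrm w > 1 \<and> real_of_int (nrm w) \<le> M}"
        using A mnorm_gt_1[OF A(1,3)] rep_canonical[OF A(1)] by auto
    qed
    have "(\<Sum>A\<in>msets_upto M. \<Sum>B\<in>msets_upto N. \<alpha> A * \<beta> B * spin_sum \<phi> \<psi> (prod_mset (A + B))) =
      (\<Sum>A\<in>msets_upto M. \<Sum>B\<in>msets_upto N. \<alpha> A * \<beta> B * spin_sum \<phi> \<psi> (rep A * rep B))"
    proof (intro sum.cong refl)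
      fix A B assume "A \<in> msets_upto M" "B \<in> msets_upto N"
      hence "A \<in> prime_msets" "B \<in> prime_msets" by (simp_all add: msets_upto_def)
      thus "\<alpha> A * \<beta> B * spin_sum \<phi> \<psi> (prod_mset (A + B)) = \<alpha> A * \<beta> B * spin_sum \<phi> \<psi> (rep A * rep B)"
        by (simp only: spin_sum_rep[OF dc])
    qed
    also have "\<dots> = (\<Sum>w\<in>R M. \<Sum>B\<in>msets_upto N. \<alpha> (prime_factorization w) * \<beta> B * spin_sum \<phi> \<psi> (rep (prime_factorization w) * rep B))"
      unfolding R_def by (rule sum_msets_rep) (simp add: z)
    also have "\<dots> = (\<Sum>w\<in>R M. \<Sum>B\<in>msets_upto N. \<alpha> (prime_factorization w) * \<beta> B * spin_sum \<phi> \<psi> (w * rep B))"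
      using R by (intro sum.cong refl) (auto simp: rep_prime_factorization subset_iff)
    also have "\<dots> = (\<Sum>w\<in>R M. \<Sum>v\<in>R N. \<alpha> (prime_factorization w) * \<beta> (prime_factorization v) *
        spin_sum \<phi> \<psi> (w * rep (prime_factorization v)))"
      unfolding R_def by (intro sum.cong refl sum_msets_rep) (simp add: z)
    also have "\<dots> = (\<Sum>w\<in>R M. \<Sum>v\<in>R N. \<alpha> (prime_factorization w) * \<beta> (prime_factorization v) * spin_sum \<phi> \<psi> (w * v))"
      using R by (intro sum.cong refl) (auto simp: rep_prime_factorization subset_iff)
    finally show "cmod (\<Sum>A\<in>msets_upto M. \<Sum>B\<in>msets_upto N. \<alpha> A * \<beta> B * spin_sum \<phi> \<psi> (prod_mset (A + B)))
      \<le> C * ((M * N) powr (1 + \<eta>) * (min M N) powr (- 1 / 12))"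
      using C(2)[rule_format, OF dc MN R R, of "\<lambda>w. \<alpha> (prime_factorization w)" "\<lambda>v. \<beta> (prime_factorization v)"] \<alpha> \<beta>
      by simp
  qed
qed

text \<open>The coupling \<open>N(B) \<le> T(A)\<close> is removed by expanding the indicator function into additive
  characters modulo an integer exceeding both sides, at the cost of a logarithm.\<close>

lemma indicator_le_expansion:
  assumes "0 \<le> n" "n < Q" "0 \<le> T" "T < Q"
  shows "(if n \<le> T then 1 else 0) = (1 / of_int Q) *
    (\<Sum>h\<in>{0..<Q}. e2 (of_int (h * n) / of_int Q) * (\<Sum>j\<in>{0..<T + 1}. e2 (- (of_int (h * j) / of_int Q))))"
proof -
  have Q: "Q \<ge> 1" using assms by simp
  have "(\<Sum>h\<in>{0..<Q}. e2 (of_int (h * n) / of_int Q) * (\<Sum>j\<in>{0..<T + 1}. e2 (- (of_int (h * j) / of_int Q)))) =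
    (\<Sum>h\<in>{0..<Q}. \<Sum>j\<in>{0..<T + 1}. e2 (of_int (h * (n - j)) / of_int Q))"
    unfolding sum_distrib_left
  proof (intro sum.cong refl)
    fix h j
    show "e2 (of_int (h * n) / of_int Q) * e2 (- (of_int (h * j) / of_int Q)) = e2 (of_int (h * (n - j)) / of_int Q)"
      unfolding e2_add[symmetric] by (rule arg_cong[of _ _ e2]) (simp add: algebra_simps diff_divide_distrib)
  qed
  also have "\<dots> = (\<Sum>j\<in>{0..<T + 1}. \<Sum>h\<in>{0..<Q}. e2 (of_int (h * (n - j)) / of_int Q))" by (rule sum.swap)
  also have "\<dots> = (\<Sum>j\<in>{0..<T + 1}. if j = n then of_int Q else 0)"
  proof (intro sum.cong refl)
    fix j assume j: "j \<in> {0..<T + 1}"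
    have "Q dvd n - j \<longleftrightarrow> j = n"
      using j assms by (metis add1_zle_eq atLeastLessThan_iff dual_order.strict_trans1 mod_eq_dvd_iff mod_pos_pos_trivial zle_add1_eq_le)
    thus "(\<Sum>h\<in>{0..<Q}. e2 (of_int (h * (n - j)) / of_int Q)) = (if j = n then of_int Q else 0)"
      by (subst sum_e2_orthogonal[OF Q]) simp
  qed
  also have "\<dots> = (if n \<le> T then of_int Q else 0)" using assms by (simp add: sum.delta)
  finally show ?thesis using Q by simp
qed

text \<open>The majorant \<open>dker\<close> with offset zero; complex conjugation accounts for the
  sign of the frequency.\<close>

lemma norm_sum_e2_le_dker:
  assumes "0 \<le> h" "h < Q" "0 \<le> T" "T < Q"
  shows "cmod (\<Sum>j\<in>{0..<T + 1}. e2 (- (of_int (h * j) / of_int Q))) \<le> dker Q (of_int Q) h"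
proof -
  have "(\<Sum>j\<in>{0..<T + 1}. e2 (- (of_int (h * j) / of_int Q))) =
    cnj (\<Sum>j\<in>{0..<T + 1}. e2 ((of_int h / of_int Q + 0) * of_int j))"
    by (simp add: e2_def cis_cnj)
  hence "cmod (\<Sum>j\<in>{0..<T + 1}. e2 (- (of_int (h * j) / of_int Q))) =
    cmod (\<Sum>j\<in>{0..<T + 1}. e2 ((of_int h / of_int Q + 0) * of_int j))" by (simp only: complex_mod_cnj)
  also have "\<dots> \<le> dker Q (of_int Q) h" using assms by (intro norm_exp_sum_le_dker) auto
  finally show ?thesis .
qed

text \<open>The threshold may depend on A in any way: after expansion, the sum over j <= T A is a
  coefficient of A alone for each frequency. Divided by \<open>dker\<close> it is bounded by 1, and
  the mean of \<open>dker\<close> over the frequencies is the logarithm that is lost.\<close>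

lemma type_II_decoupled:
  fixes \<eta> :: real assumes \<eta>: "\<eta> > 0"
  shows "\<exists>C>0. \<forall>\<phi> \<psi> M N \<alpha> \<beta> T. dirichlet_char 16 \<phi> \<longrightarrow> dirichlet_char 16 \<psi> \<longrightarrow> 1 \<le> M \<longrightarrow> 1 \<le> N \<longrightarrow>
    (\<forall>A. cmod (\<alpha> A) \<le> 1) \<longrightarrow> (\<forall>B. cmod (\<beta> B) \<le> 1) \<longrightarrow> \<alpha> {#} = 0 \<longrightarrow> \<beta> {#} = 0 \<longrightarrow>
    (\<forall>A. 0 \<le> T A \<and> T A \<le> \<lfloor>N\<rfloor>) \<longrightarrow>
    cmod (\<Sum>A\<in>msets_upto M. \<Sum>B\<in>msets_upto N. if nrm (prod_mset B) \<le> T A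
        then \<alpha> A * \<beta> B * spin_sum \<phi> \<psi> (prod_mset (A + B)) else 0)
      \<le> C * ((M * N) powr (1 + \<eta>) * (min M N) powr (- 1 / 12)) * (4 + 2 * ln (N + 1))"
proof -
  obtain C where C: "C > 0" "\<forall>\<phi> \<psi> M N \<alpha> \<beta>. dirichlet_char 16 \<phi> \<longrightarrow> dirichlet_char 16 \<psi> \<longrightarrow> 1 \<le> M \<longrightarrow> 1 \<le> N \<longrightarrow>
    (\<forall>A. cmod (\<alpha> A) \<le> 1) \<longrightarrow> (\<forall>B. cmod (\<beta> B) \<le> 1) \<longrightarrow> \<alpha> {#} = 0 \<longrightarrow> \<beta> {#} = 0 \<longrightarrow>
    cmod (\<Sum>A\<in>msets_upto M. \<Sum>B\<in>msets_upto N. \<alpha> A * \<beta> B * spin_sum \<phi> \<psi> (prod_mset (A + B)))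
      \<le> C * ((M * N) powr (1 + \<eta>) * (min M N) powr (- 1 / 12))"
    using type_II_bound[OF \<eta>] by (elim exE conjE) (rule that)
  show ?thesis
  proof (intro exI[of _ C] conjI allI impI C(1))
    fix \<phi> \<psi> :: "int \<Rightarrow> complex" and M N :: real and \<alpha> \<beta> :: "zsqrt2 multiset \<Rightarrow> complex" and T :: "zsqrt2 multiset \<Rightarrow> int"
    assume dc: "dirichlet_char 16 \<phi>" "dirichlet_char 16 \<psi>" and MN: "1 \<le> M" "1 \<le> N"
      and \<alpha>: "\<forall>A. cmod (\<alpha> A) \<le> 1" and \<beta>: "\<forall>B. cmod (\<beta> B) \<le> 1" and z: "\<alpha> {#} = 0" "\<beta> {#} = 0"
      and T: "\<forall>A. 0 \<le> T A \<and> T A \<le> \<lfloor>N\<rfloor>"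
    \<comment> \<open>Larger than every norm in the inner sum and every threshold, so that
      congruence modulo \<open>Q\<close> means equality.\<close>
    define Q where "Q = \<lfloor>N\<rfloor> + 1"
    have Q: "Q \<ge> 2" using MN(2) by (simp add: Q_def le_floor_iff)
    have TQ: "0 \<le> T A" "T A < Q" for A using T by (auto simp: Q_def)
    define B0 where "B0 = C * ((M * N) powr (1 + \<eta>) * (min M N) powr (- 1 / 12))"
    have B0: "B0 \<ge> 0" using C(1) by (simp add: B0_def)
    define D where "D = dker Q (of_int Q)"
    have Dpos: "D h > 0" if "h \<in> {0..<Q}" for h
      using that Q by (auto simp: D_def dker_def intro!: add_pos_nonneg)
    define c where "c = (\<lambda>A h. \<Sum>j\<in>{0..<T A + 1}. e2 (- (of_int (h * j) / of_int Q)))"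
    define s where "s = (\<lambda>A B. spin_sum \<phi> \<psi> (prod_mset (A + B)))"
    define n where "n = (\<lambda>B. nrm (prod_mset B))"
    have "(\<Sum>A\<in>msets_upto M. \<Sum>B\<in>msets_upto N. if n B \<le> T A then \<alpha> A * \<beta> B * s A B else 0) =
      (\<Sum>A\<in>msets_upto M. \<Sum>B\<in>msets_upto N. \<Sum>h\<in>{0..<Q}. (of_real (D h) / of_int Q) *
        ((\<alpha> A * c A h / of_real (D h)) * (\<beta> B * e2 (of_int (h * n B) / of_int Q)) * s A B))"
    proof (intro sum.cong refl)
      fix A B assume "B \<in> msets_upto N"
      hence B: "B \<in> prime_msets" "mnorm B \<le> N" by (auto simp: msets_upto_def)
      have "real_of_int (n B) \<le> N" using B by (simp add: n_def mnorm_def)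
      hence nB: "0 \<le> n B" "n B < Q"
        using prod_mset_totally_positive[OF B(1)] by (auto simp: n_def Q_def totally_positive_nrm le_floor_iff)
      have "(if n B \<le> T A then \<alpha> A * \<beta> B * s A B else 0) = (if n B \<le> T A then 1 else 0) * (\<alpha> A * \<beta> B * s A B)" by simp
      also have "\<dots> = (1 / of_int Q) * (\<Sum>h\<in>{0..<Q}. e2 (of_int (h * n B) / of_int Q) * c A h) * (\<alpha> A * \<beta> B * s A B)"
        unfolding c_def by (simp only: indicator_le_expansion[OF nB TQ])
      also have "\<dots> = (\<Sum>h\<in>{0..<Q}. (1 / of_int Q) * (e2 (of_int (h * n B) / of_int Q) * c A h) * (\<alpha> A * \<beta> B * s A B))"
        by (simp only: sum_distrib_left sum_distrib_right)
      also have "\<dots> = (\<Sum>h\<in>{0..<Q}. (of_real (D h) / of_int Q) *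
        ((\<alpha> A * c A h / of_real (D h)) * (\<beta> B * e2 (of_int (h * n B) / of_int Q)) * s A B))"
        by (intro sum.cong refl) (use Dpos in \<open>force simp: field_simps\<close>)
      finally show "(if n B \<le> T A then \<alpha> A * \<beta> B * s A B else 0) = (\<Sum>h\<in>{0..<Q}. (of_real (D h) / of_int Q) *
        ((\<alpha> A * c A h / of_real (D h)) * (\<beta> B * e2 (of_int (h * n B) / of_int Q)) * s A B))" .
    qed
    also have "\<dots> = (\<Sum>h\<in>{0..<Q}. (of_real (D h) / of_int Q) * (\<Sum>A\<in>msets_upto M. \<Sum>B\<in>msets_upto N.
        (\<alpha> A * c A h / of_real (D h)) * (\<beta> B * e2 (of_int (h * n B) / of_int Q)) * s A B))"
      unfolding sum_distrib_left by (rule sum_swap3)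
    also have "cmod \<dots> \<le> (\<Sum>h\<in>{0..<Q}. (D h / of_int Q) * B0)"
    proof (rule sum_norm_le)
      fix h assume h: "h \<in> {0..<Q}"
      have "cmod (\<Sum>A\<in>msets_upto M. \<Sum>B\<in>msets_upto N.
        (\<lambda>A. \<alpha> A * c A h / of_real (D h)) A * (\<lambda>B. \<beta> B * e2 (of_int (h * n B) / of_int Q)) B * spin_sum \<phi> \<psi> (prod_mset (A + B))) \<le> B0"
        unfolding B0_def
      proof (rule C(2)[rule_format, OF dc MN])
        fix A
        have "cmod (c A h) \<le> D h" unfolding c_def D_def
          using h TQ by (intro norm_sum_e2_le_dker) auto
        hence "cmod (\<alpha> A) * cmod (c A h) \<le> 1 * D h" using \<alpha> by (intro mult_mono) auto
        thus "cmod (\<alpha> A * c A h / of_real (D h)) \<le> 1"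
          using Dpos[OF h] by (simp add: norm_mult norm_divide)
      qed (use \<beta> z in \<open>auto simp: norm_mult\<close>)
      thus "cmod ((of_real (D h) / of_int Q) * (\<Sum>A\<in>msets_upto M. \<Sum>B\<in>msets_upto N.
        (\<alpha> A * c A h / of_real (D h)) * (\<beta> B * e2 (of_int (h * n B) / of_int Q)) * s A B)) \<le> (D h / of_int Q) * B0"
        unfolding norm_mult s_def using Dpos[OF h] Q by (intro mult_mono) (auto simp: norm_divide)
    qed
    also have "\<dots> = (\<Sum>h\<in>{0..<Q}. D h) / of_int Q * B0"
      by (simp add: sum_distrib_right[symmetric] sum_divide_distrib[symmetric])
    also have "\<dots> \<le> (2 * of_int Q + 2 * of_int Q * (1 + ln (of_int Q))) / of_int Q * B0"
      unfolding D_def using Q B0 by (intro mult_right_mono divide_right_mono sum_dker_le) auto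
    also have "\<dots> = (4 + 2 * ln (of_int Q)) * B0" using Q by (simp add: field_simps)
    also have "\<dots> \<le> (4 + 2 * ln (N + 1)) * B0"
    proof (rule mult_right_mono[OF _ B0])
      have "real_of_int Q \<le> N + 1" by (simp add: Q_def)
      hence "ln (real_of_int Q) \<le> ln (N + 1)" using Q by simp
      thus "4 + 2 * ln (of_int Q) \<le> 4 + 2 * ln (N + 1)" by simp
    qed
    finally show "cmod (\<Sum>A\<in>msets_upto M. \<Sum>B\<in>msets_upto N. if nrm (prod_mset B) \<le> T A
        then \<alpha> A * \<beta> B * spin_sum \<phi> \<psi> (prod_mset (A + B)) else 0)
      \<le> C * ((M * N) powr (1 + \<eta>) * (min M N) powr (- 1 / 12)) * (4 + 2 * ln (N + 1))"
      unfolding B0_def n_def s_def by (simp only: mult_ac)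
  qed
qed

section \<open>Choice of parameters\<close>

text \<open>Partial summation: ln n is the sum of ln(j + 1) - ln j over 1 <= j < n. The part with
  norm above j is a difference of two partial sums, whence the factor 2.\<close>

lemma log_weighted_sum_bound:
  fixes G :: "zsqrt2 multiset \<Rightarrow> complex"
  assumes z: "z \<ge> 1" and Bd: "\<And>T. T \<le> z \<Longrightarrow> cmod (\<Sum>C\<in>msets_upto T. G C) \<le> Bd"
  shows "cmod (\<Sum>C\<in>msets_upto z. of_real (ln (mnorm C)) * G C) \<le> 2 * Bd * ln z"
proof -
  define J where "J = \<lfloor>z\<rfloor>"
  have J1: "J \<ge> 1" using z by (simp add: J_def le_floor_iff)
  have Bd0: "Bd \<ge> 0" using Bd[of z] norm_ge_zero[of "\<Sum>C\<in>msets_upto z. G C"] by linarith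
  define n where "n = (\<lambda>C. nrm (prod_mset C))"
  define d where "d = (\<lambda>j. ln (real_of_int (j + 1)) - ln (real_of_int j))"
  have tel: "(\<Sum>j\<in>{1..<J}. d j) = ln (real_of_int J) - ln (real_of_int 1)"
    unfolding d_def by (rule sum_int_telescope[OF J1])
  have d0: "d j \<ge> 0" if "j \<in> {1..<J}" for j using that by (simp add: d_def)
  have "(\<Sum>C\<in>msets_upto z. of_real (ln (mnorm C)) * G C) =
      (\<Sum>C\<in>msets_upto z. \<Sum>j\<in>{1..<J}. of_real (d j) * (if j < n C then G C else 0))"
  proof (intro sum.cong refl)
    fix C assume "C \<in> msets_upto z"
    hence C: "C \<in> prime_msets" "mnorm C \<le> z" by (auto simp: msets_upto_def)
    have nC: "1 \<le> n C" "n C \<le> J" "mnorm C = of_int (n C)"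
      using C prod_mset_totally_positive[OF C(1)]
      by (auto simp: n_def J_def mnorm_def totally_positive_nrm le_floor_iff)
    have "ln (mnorm C) = ln (real_of_int (n C)) - ln (real_of_int 1)" by (simp add: nC)
    also have "\<dots> = (\<Sum>j\<in>{1..<n C}. d j)"
      unfolding d_def by (rule sum_int_telescope[OF nC(1), symmetric])
    also have "\<dots> = (\<Sum>j\<in>{1..<J}. if j < n C then d j else 0)"
      using nC by (subst sum.inter_filter[symmetric]) (auto intro!: sum.cong)
    finally have "of_real (ln (mnorm C)) * G C = (\<Sum>j\<in>{1..<J}. of_real (if j < n C then d j else 0)) * G C" by simp
    also have "\<dots> = (\<Sum>j\<in>{1..<J}. of_real (d j) * (if j < n C then G C else 0))"
      unfolding sum_distrib_right by (intro sum.cong refl) auto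
    finally show "of_real (ln (mnorm C)) * G C = (\<Sum>j\<in>{1..<J}. of_real (d j) * (if j < n C then G C else 0))" .
  qed
  also have "\<dots> = (\<Sum>j\<in>{1..<J}. of_real (d j) * (\<Sum>C\<in>msets_upto z. if j < n C then G C else 0))"
    by (subst sum.swap) (simp only: sum_distrib_left)
  also have "cmod \<dots> \<le> (\<Sum>j\<in>{1..<J}. d j * (2 * Bd))"
  proof (rule sum_norm_le)
    fix j assume j: "j \<in> {1..<J}"
    have jz: "real_of_int j \<le> z" using j by (simp add: J_def less_floor_iff)
    have sub: "msets_upto (of_int j) \<subseteq> msets_upto z" using jz by (auto simp: msets_upto_def)
    have "(\<Sum>C\<in>msets_upto z. if j < n C then G C else 0) = (\<Sum>C\<in>msets_upto z - msets_upto (of_int j). G C)"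
    proof -
      have "{C \<in> msets_upto z. j < n C} = msets_upto z - msets_upto (of_int j)"
        by (auto simp: msets_upto_def n_def mnorm_def)
      thus ?thesis by (subst sum.inter_filter[symmetric]) simp_all
    qed
    also have "\<dots> = (\<Sum>C\<in>msets_upto z. G C) - (\<Sum>C\<in>msets_upto (of_int j). G C)"
      by (rule sum_diff[OF _ sub]) simp
    also have "cmod \<dots> \<le> Bd + Bd" by (intro norm_triangle_le_diff add_mono Bd jz order_refl)
    finally show "cmod (of_real (d j) * (\<Sum>C\<in>msets_upto z. if j < n C then G C else 0)) \<le> d j * (2 * Bd)"
      unfolding norm_mult using d0[OF j] by (simp add: mult_left_mono)
  qed
  also have "\<dots> = (\<Sum>j\<in>{1..<J}. d j) * (2 * Bd)" by (simp only: sum_distrib_right)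
  also have "\<dots> = (ln (real_of_int J) - ln (real_of_int 1)) * (2 * Bd)"
    by (simp only: tel)
  also have "\<dots> \<le> ln z * (2 * Bd)"
    using J1 Bd0 z by (intro mult_right_mono) (auto simp: J_def)
  finally show ?thesis by (simp only: mult_ac)
qed

text \<open>The trivial estimate for a variable cut at \<open>y\<close>, where at most 9 y multisets
  survive.\<close>

lemma truncated_sum_bound:
  fixes w :: "zsqrt2 multiset \<Rightarrow> real" and G :: "zsqrt2 multiset \<Rightarrow> complex"
  assumes y: "y \<ge> 1" and "\<And>B. B \<in> prime_msets \<Longrightarrow> mnorm B > y \<Longrightarrow> w B = 0"
    and "\<And>B. B \<in> prime_msets \<Longrightarrow> mnorm B \<le> y \<Longrightarrow> \<bar>w B\<bar> \<le> V"
    and "\<And>B. B \<in> prime_msets \<Longrightarrow> mnorm B \<le> y \<Longrightarrow> mnorm B \<le> x \<Longrightarrow> cmod (G B) \<le> D"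
    and VD: "0 \<le> V" "0 \<le> D"
  shows "cmod (\<Sum>B\<in>msets_upto x. of_real (w B) * G B) \<le> 9 * y * (V * D)"
proof -
  have "(\<Sum>B\<in>msets_upto x. of_real (w B) * G B) = (\<Sum>B\<in>msets_upto x \<inter> msets_upto y. of_real (w B) * G B)"
  proof (rule sum.mono_neutral_right)
    show "\<forall>B\<in>msets_upto x - msets_upto x \<inter> msets_upto y. of_real (w B) * G B = 0"
    proof
      fix B assume "B \<in> msets_upto x - msets_upto x \<inter> msets_upto y"
      hence "B \<in> prime_msets" "mnorm B > y" by (auto simp: msets_upto_def)
      thus "of_real (w B) * G B = 0" using assms(2) by simp
    qed
  qed auto
  also have "cmod \<dots> \<le> (\<Sum>B\<in>msets_upto x \<inter> msets_upto y. V * D)"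
  proof (rule sum_norm_le)
    fix B assume "B \<in> msets_upto x \<inter> msets_upto y"
    hence B: "B \<in> prime_msets" "mnorm B \<le> y" "mnorm B \<le> x" by (auto simp: msets_upto_def)
    show "cmod (of_real (w B) * G B) \<le> V * D"
      unfolding norm_mult norm_of_real using assms(3)[OF B(1,2)] assms(4)[OF B] VD by (intro mult_mono) auto
  qed
  also have "\<dots> = real (card (msets_upto x \<inter> msets_upto y)) * (V * D)" by simp
  also have "\<dots> \<le> (9 * y) * (V * D)"
  proof (rule mult_right_mono)
    have "card (msets_upto x \<inter> msets_upto y) \<le> card (msets_upto y)" by (intro card_mono) auto
    thus "real (card (msets_upto x \<inter> msets_upto y)) \<le> 9 * y" using card_msets_upto[OF y] by linarith
  qed (use VD in simp)
  finally show ?thesis by simp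
qed

lemma powr_log_bounds:
  assumes "v \<ge> 1"
  shows "2 ^ nat \<lfloor>log 2 v\<rfloor> \<le> v" "v < 2 * 2 ^ nat \<lfloor>log 2 v\<rfloor>"
proof -
  have l: "log 2 v \<ge> 0" using assms by simp
  have e: "(2::real) ^ nat \<lfloor>log 2 v\<rfloor> = 2 powr of_int \<lfloor>log 2 v\<rfloor>"
    using l by (simp add: powr_realpow[symmetric])
  have v: "2 powr (log 2 v) = v" using assms by simp
  have "2 powr of_int \<lfloor>log 2 v\<rfloor> \<le> 2 powr (log 2 v)" by (intro powr_mono) auto
  thus "2 ^ nat \<lfloor>log 2 v\<rfloor> \<le> v" using e v by simp
  have "2 powr (log 2 v) < 2 powr (of_int \<lfloor>log 2 v\<rfloor> + 1)" by (intro powr_less_mono) auto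
  also have "\<dots> = 2 * 2 powr of_int \<lfloor>log 2 v\<rfloor>" by (simp add: powr_add)
  finally show "v < 2 * 2 ^ nat \<lfloor>log 2 v\<rfloor>" using e v by simp
qed

text \<open>The norm of B is localized dyadically between m and 2 m, so its cofactor has norm at
  most x / m. Blocks with 2 m <= y or x / m <= y contribute zero; in the others both lengths exceed
  y while their product is 2 x.\<close>

lemma type_II_vaughan:
  fixes \<eta> :: real assumes \<eta>: "\<eta> > 0"
  shows "\<exists>C>0. \<forall>\<phi> \<psi> x y. dirichlet_char 16 \<phi> \<longrightarrow> dirichlet_char 16 \<psi> \<longrightarrow> x \<ge> 2 \<longrightarrow> 1 \<le> y \<longrightarrow>
    cmod (\<Sum>B\<in>msets_upto x. of_real (if mnorm B \<le> y then 0 else mu B) *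
      (\<Sum>E\<in>msets_upto (x / mnorm B). of_real (lam_tail y E) * spin_sum \<phi> \<psi> (prod_mset (B + E))))
    \<le> (1 + log 2 x) * (ln x * (C * ((2 * x) powr (1 + \<eta>) * y powr (- 1 / 12)) * (4 + 2 * ln (x + 1))))"
proof -
  obtain C where C: "C > 0" "\<forall>\<phi> \<psi> M N \<alpha> \<beta> T. dirichlet_char 16 \<phi> \<longrightarrow> dirichlet_char 16 \<psi> \<longrightarrow> 1 \<le> M \<longrightarrow> 1 \<le> N \<longrightarrow>
    (\<forall>A. cmod (\<alpha> A) \<le> 1) \<longrightarrow> (\<forall>B. cmod (\<beta> B) \<le> 1) \<longrightarrow> \<alpha> {#} = 0 \<longrightarrow> \<beta> {#} = 0 \<longrightarrow>
    (\<forall>A. 0 \<le> T A \<and> T A \<le> \<lfloor>N\<rfloor>) \<longrightarrow>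
    cmod (\<Sum>A\<in>msets_upto M. \<Sum>B\<in>msets_upto N. if nrm (prod_mset B) \<le> T A
        then \<alpha> A * \<beta> B * spin_sum \<phi> \<psi> (prod_mset (A + B)) else 0)
      \<le> C * ((M * N) powr (1 + \<eta>) * (min M N) powr (- 1 / 12)) * (4 + 2 * ln (N + 1))"
    using type_II_decoupled[OF \<eta>] by (elim exE conjE) (rule that)
  show ?thesis
  proof (intro exI[of _ C] conjI allI impI C(1))
    fix \<phi> \<psi> :: "int \<Rightarrow> complex" and x y :: real
    assume dc: "dirichlet_char 16 \<phi>" "dirichlet_char 16 \<psi>" and x: "x \<ge> 2" and y: "1 \<le> y"
    define F where "F = (\<lambda>A. spin_sum \<phi> \<psi> (prod_mset A))"
    define M2 where "M2 = (\<lambda>B. if mnorm B \<le> y then 0 else mu B)"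
    define P where "P = (\<lambda>B. of_real (M2 B) * (\<Sum>E\<in>msets_upto (x / mnorm B). of_real (lam_tail y E) * F (B + E)))"
    define idx where "idx = (\<lambda>B. nat \<lfloor>log 2 (mnorm B)\<rfloor>)"
    define K where "K = nat \<lfloor>log 2 x\<rfloor>"
    define Bd where "Bd = ln x * (C * ((2 * x) powr (1 + \<eta>) * y powr (- 1 / 12)) * (4 + 2 * ln (x + 1)))"
    have lnx: "ln x > 0" using x by simp
    have Bd0: "Bd \<ge> 0" unfolding Bd_def using C(1) x by (intro mult_nonneg_nonneg) auto
    have part: "cmod (\<Sum>B | B \<in> msets_upto x \<and> idx B = i. P B) \<le> Bd" for i
    proof -
      define m where "m = (2::real) ^ i"
      have m1: "m \<ge> 1" by (simp add: m_def)
      have mB: "m \<le> mnorm B" "mnorm B < 2 * m" if "B \<in> prime_msets" "idx B = i" for B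
        using powr_log_bounds[OF mnorm_ge_1[OF that(1)]] that(2) by (simp_all add: m_def idx_def)
      define Ui where "Ui = {B. B \<in> msets_upto x \<and> idx B = i}"
      show ?thesis
      proof (cases "2 * m \<le> y \<or> x / m \<le> y")
        case True
        have "P B = 0" if "B \<in> Ui" for B
        proof -
          have B: "B \<in> prime_msets" "m \<le> mnorm B" "mnorm B < 2 * m" using that mB by (auto simp: Ui_def msets_upto_def)
          show ?thesis
          proof (cases "2 * m \<le> y")
            case True thus ?thesis using B by (simp add: P_def M2_def)
          next
            case False
            have "lam_tail y E = 0" if "E \<in> msets_upto (x / mnorm B)" for E
            proof (rule lam_tail_eq_0)
              show "E \<in> prime_msets" using that by (simp add: msets_upto_def)
              have "mnorm E \<le> x / mnorm B" using that by (simp add: msets_upto_def)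
              also have "\<dots> \<le> x / m" using B m1 x by (intro divide_left_mono) auto
              finally show "mnorm E \<le> y" using \<open>2 * m \<le> y \<or> x / m \<le> y\<close> False by linarith
            qed
            thus ?thesis by (simp add: P_def)
          qed
        qed
        thus ?thesis using Bd0 by (simp add: Ui_def[symmetric])
      next
        case False
        define M N where "M = 2 * m" and "N = x / m"
        have MN: "M > y" "N > y" using False by (auto simp: M_def N_def)
        have MN1: "1 \<le> M" "1 \<le> N" using MN y by auto
        have Nx: "N \<le> x" using m1 x by (simp add: N_def field_simps)
        \<comment> \<open>The left coefficient is cut to the block, and the right one is divided by
          ln x to make it at most 1.\<close>
        define \<alpha> where "\<alpha> = (\<lambda>B. if B \<in> Ui then complex_of_real (M2 B) else 0)"
        define \<beta> where "\<beta> = (\<lambda>E. if E \<in> msets_upto x then complex_of_real (lam_tail y E / ln x) else 0)"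
        \<comment> \<open>The decoupling asks for 0 <= T B <= floor N at every multiset; the value 0
          serves those where x / mnorm B is not controlled.\<close>
        define T where "T = (\<lambda>B. if B \<in> prime_msets \<and> m \<le> mnorm B then \<lfloor>x / mnorm B\<rfloor> else 0)"
        have \<alpha>1: "cmod (\<alpha> B) \<le> 1" for B using abs_mu_le[of B] by (simp add: \<alpha>_def M2_def)
        have \<beta>1: "cmod (\<beta> E) \<le> 1" for E
        proof (cases "E \<in> msets_upto x")
          case True
          hence E: "E \<in> prime_msets" "mnorm E \<le> x" by (auto simp: msets_upto_def)
          have "ln (mnorm E) \<le> ln x" using E mnorm_pos[OF E(1)] by simp
          hence "lam_tail y E \<le> ln x" "0 \<le> lam_tail y E" using lam_tail_bounds[OF E(1), of y] by linarith+
          hence "\<bar>lam_tail y E / ln x\<bar> \<le> 1" using lnx by simp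
          thus ?thesis unfolding \<beta>_def if_P[OF True] norm_of_real .
        qed (simp add: \<beta>_def)
        have z: "\<alpha> {#} = 0" "\<beta> {#} = 0" using y lam_tail_eq_0[of "{#}" y] by (simp_all add: \<alpha>_def \<beta>_def M2_def)
        have T: "0 \<le> T B \<and> T B \<le> \<lfloor>N\<rfloor>" for B
        proof (cases "B \<in> prime_msets \<and> m \<le> mnorm B")
          case True
          have "x / mnorm B \<le> N" unfolding N_def using True m1 x by (intro divide_left_mono) auto
          moreover have "0 \<le> x / mnorm B" using x True m1 by simp
          ultimately show ?thesis unfolding T_def if_P[OF True] by (simp add: floor_mono)
        next
          case False
          thus ?thesis using MN1 by (auto simp: T_def)
        qed
        define H where "H = (\<lambda>B E. if nrm (prod_mset E) \<le> T B then \<alpha> B * \<beta> E * F (B + E) else 0)"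
        have "(\<Sum>B\<in>msets_upto M. \<Sum>E\<in>msets_upto N. H B E) = (\<Sum>B\<in>Ui. \<Sum>E\<in>msets_upto N. H B E)"
        proof (rule sum.mono_neutral_right)
          show "Ui \<subseteq> msets_upto M" using mB by (force simp: Ui_def msets_upto_def M_def)
          show "\<forall>B\<in>msets_upto M - Ui. (\<Sum>E\<in>msets_upto N. H B E) = 0"
        proof
          fix B assume "B \<in> msets_upto M - Ui"
          hence "\<alpha> B = 0" by (simp add: \<alpha>_def)
          hence "H B E = 0" for E by (simp add: H_def)
          thus "(\<Sum>E\<in>msets_upto N. H B E) = 0" by simp
        qed
        qed simp
        also have "\<dots> = (\<Sum>B\<in>Ui. P B / of_real (ln x))"
        proof (intro sum.cong refl)
          fix B assume BU: "B \<in> Ui"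
          hence B: "B \<in> prime_msets" "m \<le> mnorm B" using mB by (auto simp: Ui_def msets_upto_def)
          have TB: "T B = \<lfloor>x / mnorm B\<rfloor>" using B by (simp add: T_def)
          have le: "x / mnorm B \<le> N" unfolding N_def using B m1 x by (intro divide_left_mono) auto
          have "(\<Sum>E\<in>msets_upto N. H B E) = (\<Sum>E\<in>msets_upto (x / mnorm B). \<alpha> B * \<beta> E * F (B + E))"
          proof -
            have "{E \<in> msets_upto N. nrm (prod_mset E) \<le> T B} = msets_upto (x / mnorm B)"
              using le by (auto simp: msets_upto_def TB le_floor_iff mnorm_def)
            thus ?thesis unfolding H_def by (subst sum.inter_filter[symmetric]) simp_all
          qed
          also have "\<dots> = (\<Sum>E\<in>msets_upto (x / mnorm B). of_real (M2 B) * (of_real (lam_tail y E) * F (B + E)) / of_real (ln x))"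
          proof (intro sum.cong refl)
            fix E assume "E \<in> msets_upto (x / mnorm B)"
            hence "E \<in> msets_upto x" using le Nx by (auto simp: msets_upto_def)
            thus "\<alpha> B * \<beta> E * F (B + E) = of_real (M2 B) * (of_real (lam_tail y E) * F (B + E)) / of_real (ln x)"
              using BU by (simp add: \<alpha>_def \<beta>_def)
          qed
          also have "\<dots> = P B / of_real (ln x)"
            by (simp only: P_def sum_distrib_left sum_divide_distrib)
          finally show "(\<Sum>E\<in>msets_upto N. H B E) = P B / of_real (ln x)" .
        qed
        also have "\<dots> = (\<Sum>B\<in>Ui. P B) / of_real (ln x)" by (rule sum_divide_distrib[symmetric])
        finally have "(\<Sum>B\<in>Ui. P B) = of_real (ln x) * (\<Sum>B\<in>msets_upto M. \<Sum>E\<in>msets_upto N. H B E)"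
          using lnx by simp
        hence "cmod (\<Sum>B\<in>Ui. P B) = ln x * cmod (\<Sum>B\<in>msets_upto M. \<Sum>E\<in>msets_upto N. H B E)"
          using lnx by (simp add: norm_mult)
        also have "\<dots> \<le> ln x * (C * ((M * N) powr (1 + \<eta>) * (min M N) powr (- 1 / 12)) * (4 + 2 * ln (N + 1)))"
          unfolding H_def F_def
          using C(2)[rule_format, of \<phi> \<psi> M N \<alpha> \<beta> T, OF dc MN1 \<alpha>1 \<beta>1 z T] lnx by (intro mult_left_mono) auto
        also have "\<dots> \<le> Bd" unfolding Bd_def
        proof (intro mult_left_mono mult_mono)
          show "(M * N) powr (1 + \<eta>) \<le> (2 * x) powr (1 + \<eta>)" using m1 by (simp add: M_def N_def)
          show "min M N powr (- 1 / 12) \<le> y powr (- 1 / 12)" using MN y by (intro powr_mono2') auto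
          have "ln (N + 1) \<le> ln (x + 1)" using Nx MN1 by simp
          thus "4 + 2 * ln (N + 1) \<le> 4 + 2 * ln (x + 1)" by simp
        qed (use C(1) lnx MN1 in auto)
        finally show ?thesis by (simp add: Ui_def)
      qed
    qed
    have idxK: "idx ` msets_upto x \<subseteq> {..K}"
    proof
      fix i assume "i \<in> idx ` msets_upto x"
      then obtain B where B: "B \<in> prime_msets" "mnorm B \<le> x" "i = idx B" by (auto simp: msets_upto_def)
      have "log 2 (mnorm B) \<le> log 2 x" using B mnorm_pos[OF B(1)] by simp
      hence "\<lfloor>log 2 (mnorm B)\<rfloor> \<le> \<lfloor>log 2 x\<rfloor>" by (rule floor_mono)
      thus "i \<in> {..K}" by (simp add: B(3) idx_def K_def nat_mono)
    qed
    have "(\<Sum>B\<in>msets_upto x. P B) = (\<Sum>i\<in>{..K}. \<Sum>B | B \<in> msets_upto x \<and> idx B = i. P B)"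
      by (rule sum.group[symmetric, OF _ _ idxK]) auto
    also have "cmod \<dots> \<le> (\<Sum>i\<in>{..K}. Bd)" by (intro sum_norm_le part)
    also have "\<dots> = (1 + real K) * Bd" by simp
    also have "\<dots> \<le> (1 + log 2 x) * Bd"
    proof (rule mult_right_mono[OF _ Bd0])
      have "0 \<le> log 2 x" using x by simp
      thus "1 + real K \<le> 1 + log 2 x" unfolding K_def by linarith
    qed
    finally show "cmod (\<Sum>B\<in>msets_upto x. of_real (if mnorm B \<le> y then 0 else mu B) *
      (\<Sum>E\<in>msets_upto (x / mnorm B). of_real (lam_tail y E) * spin_sum \<phi> \<psi> (prod_mset (B + E))))
    \<le> (1 + log 2 x) * (ln x * (C * ((2 * x) powr (1 + \<eta>) * y powr (- 1 / 12)) * (4 + 2 * ln (x + 1))))"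
      unfolding P_def M2_def F_def Bd_def .
  qed
qed

text \<open>Up to constants the four parts of Vaughan's identity are at most x^(6/25), x^(3/25 + 3/4
  + 2 \<eta>), x^(6/25 + 3/4 + 2 \<eta>) and x^(99/100 + 4 \<eta>).\<close>

lemma spin_sum_primes_bound:
  "\<exists>C>0. \<forall>\<phi> \<psi> x. dirichlet_char 16 \<phi> \<longrightarrow> dirichlet_char 16 \<psi> \<longrightarrow> x \<ge> 2 \<longrightarrow>
    cmod (\<Sum>A\<in>msets_upto x. of_real (lam A) * spin_sum \<phi> \<psi> (prod_mset A)) \<le> C * x powr (149 / 150)"
proof -
  \<comment> \<open>Logarithms are replaced by 2000 x^\<eta>. The largest exponent, 99/100 + 4/2000,
    is below 149/150.\<close>
  define \<eta> :: real where "\<eta> = 1 / 2000"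
  have \<eta>: "\<eta> > 0" by (simp add: \<eta>_def)
  obtain C1 where C1: "C1 > 0" "\<forall>\<phi> \<psi> B T. dirichlet_char 16 \<phi> \<longrightarrow> dirichlet_char 16 \<psi> \<longrightarrow> B \<in> prime_msets \<longrightarrow>
    cmod (\<Sum>D\<in>msets_upto T. spin_sum \<phi> \<psi> (prod_mset (B + D))) \<le> C1 * (T * mnorm B) powr (3 / 4 + \<eta>)"
    using type_I_bound[OF \<eta>] by (elim exE conjE) (rule that)
  obtain C2 where C2: "C2 > 0" "\<forall>\<phi> \<psi> x y. dirichlet_char 16 \<phi> \<longrightarrow> dirichlet_char 16 \<psi> \<longrightarrow> x \<ge> 2 \<longrightarrow> 1 \<le> y \<longrightarrow>
    cmod (\<Sum>B\<in>msets_upto x. of_real (if mnorm B \<le> y then 0 else mu B) *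
      (\<Sum>E\<in>msets_upto (x / mnorm B). of_real (lam_tail y E) * spin_sum \<phi> \<psi> (prod_mset (B + E))))
    \<le> (1 + log 2 x) * (ln x * (C2 * ((2 * x) powr (1 + \<eta>) * y powr (- 1 / 12)) * (4 + 2 * ln (x + 1))))"
    using type_II_vaughan[OF \<eta>] by (elim exE conjE) (rule that)
  \<comment> \<open>8004 = 4 + 2 * 2 * 2000, because ln(x + 1) <= 2 ln x.\<close>
  define K2 where "K2 = (1 + 2000 / ln 2) * (2000 * (C2 * 2 powr (1 + \<eta>) * 8004))"
  have K2: "K2 > 0" unfolding K2_def using C2(1) by (intro mult_pos_pos add_pos_pos) auto
  \<comment> \<open>36 = 9 * 4, 36000 = 9 * 2 * 2000 and 162000 = 9 * 9 * 2000: a factor 9 for each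
    variable cut at y, the bound 4 for a coefficient, the 2 of partial summation and the 2000 of a
    logarithm.\<close>
  define C where "C = 36 + 36000 * C1 + 162000 * C1 + K2"
  show ?thesis
  proof (intro exI[of _ C] conjI allI impI)
    show "C > 0" using C1(1) K2 by (simp add: C_def)
    fix \<phi> \<psi> :: "int \<Rightarrow> complex" and x :: real
    assume dc: "dirichlet_char 16 \<phi>" "dirichlet_char 16 \<psi>" and x: "x \<ge> 2"
    define F where "F = (\<lambda>A. spin_sum \<phi> \<psi> (prod_mset A))"
    define y where "y = x powr (3 / 25)"
    define p where "p = x powr \<eta>"
    define e where "e = (149 / 150 :: real)"
    have x1: "x \<ge> 1" using x by simp
    have y1: "y \<ge> 1" using x1 by (simp add: y_def ge_one_powr_ge_zero)
    have p1: "p \<ge> 1" using x1 \<eta> by (simp add: p_def ge_one_powr_ge_zero)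
    have lnx: "ln x \<le> 2000 * p" using ln_powr_bound[OF x1 \<eta>] by (simp add: p_def \<eta>_def)
    have lnx0: "ln x \<ge> 0" using x1 by simp
    have mono: "x powr a \<le> x powr e" if "a \<le> e" for a using x1 that by (intro powr_mono) auto
    have yx: "y \<le> x" using powr_mono[of "3 / 25" 1 x] x1 by (simp add: y_def)
    have lny: "ln y \<le> 2000 * p" "0 \<le> ln y"
    proof -
      have "ln y \<le> ln x" using yx y1 by simp
      thus "ln y \<le> 2000 * p" using lnx by linarith
    qed (use y1 in simp)
    define L where "L = (\<lambda>C. if mnorm C \<le> y then lam C else 0)"
    define M1 where "M1 = (\<lambda>B. if mnorm B \<le> y then mu B else 0)"
    have L: "\<bar>L B\<bar> \<le> ln y" if "B \<in> prime_msets" for B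
    proof (cases "mnorm B \<le> y")
      case True
      have "ln (mnorm B) \<le> ln y" using True mnorm_pos[OF that] by simp
      thus ?thesis using lam_le[OF that] lam_nonneg[OF that] True by (simp add: L_def)
    qed (use lny in \<open>simp add: L_def\<close>)
    define D where "D = C1 * x powr (3 / 4 + \<eta>)"
    have D0: "D \<ge> 0" using C1(1) by (simp add: D_def)
    have I: "cmod (\<Sum>D\<in>msets_upto T. F (B + D)) \<le> D" if "B \<in> prime_msets" "T * mnorm B \<le> x" for B T
    proof (cases "T \<ge> 0")
      case True
      have "cmod (\<Sum>D\<in>msets_upto T. F (B + D)) \<le> C1 * (T * mnorm B) powr (3 / 4 + \<eta>)"
        unfolding F_def using C1(2) dc that(1) by blast
      also have "\<dots> \<le> D" unfolding D_def
        using C1(1) that True mnorm_pos[OF that(1)] \<eta> by (intro mult_left_mono powr_mono2) auto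
      finally show ?thesis .
    next
      case False
      hence "msets_upto T = {}" using mnorm_pos unfolding msets_upto_def by fastforce
      thus ?thesis using D0 by simp
    qed
    have T0: "cmod (\<Sum>A\<in>msets_upto x. of_real (L A) * F A) \<le> 36 * x powr e"
    proof -
      have "cmod (\<Sum>A\<in>msets_upto x. of_real (L A) * F A) \<le> 9 * y * (ln y * 4)"
      proof (rule truncated_sum_bound[OF y1])
        show "cmod (F B) \<le> 4" for B unfolding F_def by (rule norm_spin_sum_le[OF dc])
        show "L B = 0" if "mnorm B > y" for B using that by (simp add: L_def)
      qed (simp_all add: L lny)
      \<comment> \<open>The crude ln y <= y is affordable, as y^2 is far below the target.\<close>
      also have "\<dots> \<le> 9 * y * (y * 4)"
        using y1 ln_le_minus_one[of y] by (intro mult_left_mono mult_right_mono) auto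
      also have "\<dots> = 36 * (x powr (3 / 25) * x powr (3 / 25))" by (simp add: y_def)
      also have "\<dots> = 36 * x powr (6 / 25)" by (simp add: powr_add[symmetric])
      also have "\<dots> \<le> 36 * x powr e" using mono[of "6 / 25"] by (simp add: e_def)
      finally show ?thesis .
    qed
    have T1: "cmod (\<Sum>B\<in>msets_upto x. of_real (M1 B) * (\<Sum>C\<in>msets_upto (x / mnorm B). of_real (ln (mnorm C)) * F (B + C)))
      \<le> 36000 * C1 * x powr e"
    proof -
      have "cmod (\<Sum>B\<in>msets_upto x. of_real (M1 B) * (\<Sum>C\<in>msets_upto (x / mnorm B). of_real (ln (mnorm C)) * F (B + C)))
        \<le> 9 * y * (1 * (2 * D * (2000 * p)))"
      proof (rule truncated_sum_bound[OF y1])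
        fix B assume B: "B \<in> prime_msets" "mnorm B \<le> y" "mnorm B \<le> x"
        have mB: "mnorm B \<ge> 1" by (rule mnorm_ge_1[OF B(1)])
        have z: "x / mnorm B \<ge> 1" using B mB by (simp add: field_simps)
        have "cmod (\<Sum>C\<in>msets_upto (x / mnorm B). of_real (ln (mnorm C)) * F (B + C)) \<le> 2 * D * ln (x / mnorm B)"
        proof (rule log_weighted_sum_bound[OF z])
          fix T assume "T \<le> x / mnorm B"
          hence "T * mnorm B \<le> x" using mB by (simp add: field_simps)
          thus "cmod (\<Sum>C\<in>msets_upto T. F (B + C)) \<le> D" by (rule I[OF B(1)])
        qed
        also have "\<dots> \<le> 2 * D * (2000 * p)"
        proof (rule mult_left_mono)
          have "x / mnorm B \<le> x" using mB x by (simp add: field_simps)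
          hence "ln (x / mnorm B) \<le> ln x" using z by (subst ln_le_cancel_iff) auto
          thus "ln (x / mnorm B) \<le> 2000 * p" using lnx by linarith
        qed (use D0 in simp)
        finally show "cmod (\<Sum>C\<in>msets_upto (x / mnorm B). of_real (ln (mnorm C)) * F (B + C)) \<le> 2 * D * (2000 * p)" .
      qed (use D0 p1 abs_mu_le in \<open>auto simp: M1_def\<close>)
      also have "\<dots> = 36000 * C1 * (x powr (3 / 25) * x powr (3 / 4 + \<eta>) * x powr \<eta>)"
        by (simp add: y_def D_def p_def)
      also have "\<dots> = 36000 * C1 * x powr (3 / 25 + (3 / 4 + \<eta>) + \<eta>)" by (simp only: powr_add)
      also have "\<dots> \<le> 36000 * C1 * x powr e"
        using C1(1) by (intro mult_left_mono mono) (auto simp: e_def \<eta>_def)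
      finally show ?thesis .
    qed
    have T2: "cmod (\<Sum>B\<in>msets_upto x. of_real (M1 B) * (\<Sum>C\<in>msets_upto (x / mnorm B). of_real (L C) *
        (\<Sum>D\<in>msets_upto (x / mnorm B / mnorm C). F (B + C + D)))) \<le> 162000 * C1 * x powr e"
    proof -
      have "cmod (\<Sum>B\<in>msets_upto x. of_real (M1 B) * (\<Sum>C\<in>msets_upto (x / mnorm B). of_real (L C) *
        (\<Sum>D\<in>msets_upto (x / mnorm B / mnorm C). F (B + C + D)))) \<le> 9 * y * (1 * (9 * y * (ln y * D)))"
      proof (rule truncated_sum_bound[OF y1])
        fix B assume B: "B \<in> prime_msets" "mnorm B \<le> y" "mnorm B \<le> x"
        show "cmod (\<Sum>C\<in>msets_upto (x / mnorm B). of_real (L C) * (\<Sum>D\<in>msets_upto (x / mnorm B / mnorm C). F (B + C + D)))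
          \<le> 9 * y * (ln y * D)"
        proof (rule truncated_sum_bound[OF y1])
          fix C assume C: "C \<in> prime_msets"
          have "x / mnorm B / mnorm C * mnorm (B + C) \<le> x"
            using mnorm_pos[OF B(1)] mnorm_pos[OF C] by (simp add: mnorm_union)
          thus "cmod (\<Sum>D\<in>msets_upto (x / mnorm B / mnorm C). F (B + C + D)) \<le> D"
            using B(1) C by (intro I) auto
        next
          fix C
          show "L C = 0" if "mnorm C > y" using that by (simp add: L_def)
        qed (simp_all add: L lny D0)
      qed (use D0 lny y1 abs_mu_le in \<open>auto simp: M1_def\<close>)
      also have "\<dots> \<le> 9 * y * (1 * (9 * y * ((2000 * p) * D)))"
        using y1 D0 lny by (intro mult_left_mono mult_right_mono) auto
      also have "\<dots> = 162000 * C1 * (x powr (3 / 25) * x powr (3 / 25) * x powr (3 / 4 + \<eta>) * x powr \<eta>)"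
        by (simp add: y_def D_def p_def)
      also have "\<dots> = 162000 * C1 * x powr (3 / 25 + 3 / 25 + (3 / 4 + \<eta>) + \<eta>)" by (simp only: powr_add)
      also have "\<dots> \<le> 162000 * C1 * x powr e"
        using C1(1) by (intro mult_left_mono mono) (auto simp: e_def \<eta>_def)
      finally show ?thesis .
    qed
    have T3: "cmod (\<Sum>B\<in>msets_upto x. of_real (if mnorm B \<le> y then 0 else mu B) *
      (\<Sum>E\<in>msets_upto (x / mnorm B). of_real (lam_tail y E) * F (B + E))) \<le> K2 * x powr e"
    proof -
      have l2: "ln 2 > (0::real)" by simp
      have a: "1 + log 2 x \<le> (1 + 2000 / ln 2) * p"
      proof -
        have "log 2 x \<le> (2000 * p) / ln 2" unfolding log_def using lnx l2 by (intro divide_right_mono) auto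
        thus ?thesis using p1 by (simp add: algebra_simps)
      qed
      have b: "4 + 2 * ln (x + 1) \<le> 8004 * p"
      proof -
        have "x * 2 \<le> x * x" using x by (intro mult_left_mono) auto
        hence "x + 1 \<le> x\<^sup>2" using x unfolding power2_eq_square by linarith
        hence "ln (x + 1) \<le> ln (x\<^sup>2)" using x by (subst ln_le_cancel_iff) auto
        also have "\<dots> = 2 * ln x" using x by (simp add: ln_realpow)
        finally show ?thesis using lnx p1 by linarith
      qed
      have "cmod (\<Sum>B\<in>msets_upto x. of_real (if mnorm B \<le> y then 0 else mu B) *
        (\<Sum>E\<in>msets_upto (x / mnorm B). of_real (lam_tail y E) * F (B + E)))
        \<le> (1 + log 2 x) * (ln x * (C2 * ((2 * x) powr (1 + \<eta>) * y powr (- 1 / 12)) * (4 + 2 * ln (x + 1))))"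
        unfolding F_def using C2(2) dc x y1 by blast
      also have "\<dots> \<le> ((1 + 2000 / ln 2) * p) * ((2000 * p) * (C2 * ((2 * x) powr (1 + \<eta>) * y powr (- 1 / 12)) * (8004 * p)))"
      proof (rule mult_mono[OF a])
        show "ln x * (C2 * ((2 * x) powr (1 + \<eta>) * y powr (- 1 / 12)) * (4 + 2 * ln (x + 1)))
          \<le> (2000 * p) * (C2 * ((2 * x) powr (1 + \<eta>) * y powr (- 1 / 12)) * (8004 * p))"
          using C2(1) p1 x1 by (intro mult_mono[OF lnx mult_left_mono[OF b]]) auto
      qed (use p1 C2(1) x1 l2 lnx0 in \<open>auto intro!: mult_nonneg_nonneg add_nonneg_nonneg\<close>)
      also have "(2 * x) powr (1 + \<eta>) = 2 powr (1 + \<eta>) * x powr (1 + \<eta>)" using x1 by (simp add: powr_mult)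
      also have "y powr (- 1 / 12) = x powr (- 1 / 100)" by (simp add: y_def powr_powr)
      also have "((1 + 2000 / ln 2) * p) * ((2000 * p) * (C2 * (2 powr (1 + \<eta>) * x powr (1 + \<eta>) * x powr (- 1 / 100)) * (8004 * p)))
        = K2 * (p * p * p * x powr (1 + \<eta>) * x powr (- 1 / 100))"
        unfolding K2_def by (simp only: mult_ac)
      also have "\<dots> = K2 * x powr (\<eta> + \<eta> + \<eta> + (1 + \<eta>) + - 1 / 100)" by (simp only: powr_add p_def)
      also have "\<dots> \<le> K2 * x powr e"
        using K2 by (intro mult_left_mono mono) (auto simp: e_def \<eta>_def)
      finally show ?thesis .
    qed
    have "(\<Sum>A\<in>msets_upto x. of_real (lam A) * F A) =
     (\<Sum>A\<in>msets_upto x. of_real (L A) * F A)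
   + (\<Sum>B\<in>msets_upto x. of_real (M1 B) * (\<Sum>C\<in>msets_upto (x / mnorm B). of_real (ln (mnorm C)) * F (B + C)))
   - (\<Sum>B\<in>msets_upto x. of_real (M1 B) * (\<Sum>C\<in>msets_upto (x / mnorm B). of_real (L C) *
        (\<Sum>D\<in>msets_upto (x / mnorm B / mnorm C). F (B + C + D))))
   + (\<Sum>B\<in>msets_upto x. of_real (if mnorm B \<le> y then 0 else mu B) *
        (\<Sum>E\<in>msets_upto (x / mnorm B). of_real (lam_tail y E) * F (B + E)))"
      unfolding L_def M1_def by (rule vaughan_identity)
    also have "cmod \<dots> \<le> 36 * x powr e + 36000 * C1 * x powr e + 162000 * C1 * x powr e + K2 * x powr e"
      by (intro norm_triangle_le norm_triangle_le_diff add_mono T0 T1 T2 T3)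
    also have "\<dots> = C * x powr (149 / 150)" by (simp add: C_def e_def algebra_simps)
    finally show "cmod (\<Sum>A\<in>msets_upto x. of_real (lam A) * spin_sum \<phi> \<psi> (prod_mset A)) \<le> C * x powr (149 / 150)"
      unfolding F_def .
  qed
qed

theorem theorem3:
  shows "\<forall>\<epsilon>::real. \<epsilon> > 0 \<longrightarrow>
    (\<exists>C::real. C > 0 \<and>
      (\<forall>\<phi> \<psi> :: int \<Rightarrow> complex. dirichlet_char 16 \<phi> \<longrightarrow> dirichlet_char 16 \<psi> \<longrightarrow>
        (\<forall>x::real. x \<ge> 2 \<longrightarrow>
          cmod (\<Sum>I\<in>ideals_upto x. ideal_coeff \<phi> \<psi> I * of_real (ideal_mangoldt I))
            \<le> C * x powr (149 / 150 + \<epsilon>))))"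
proof (intro allI impI)
  fix \<epsilon> :: real assume \<epsilon>: "\<epsilon> > 0"
  obtain C where C: "C > 0" "\<forall>\<phi> \<psi> x. dirichlet_char 16 \<phi> \<longrightarrow> dirichlet_char 16 \<psi> \<longrightarrow> x \<ge> 2 \<longrightarrow>
    cmod (\<Sum>A\<in>msets_upto x. of_real (lam A) * spin_sum \<phi> \<psi> (prod_mset A)) \<le> C * x powr (149 / 150)"
    using spin_sum_primes_bound by (elim exE conjE) (rule that)
  show "\<exists>C::real. C > 0 \<and>
      (\<forall>\<phi> \<psi> :: int \<Rightarrow> complex. dirichlet_char 16 \<phi> \<longrightarrow> dirichlet_char 16 \<psi> \<longrightarrow>
        (\<forall>x::real. x \<ge> 2 \<longrightarrow>
          cmod (\<Sum>I\<in>ideals_upto x. ideal_coeff \<phi> \<psi> I * of_real (ideal_mangoldt I))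
            \<le> C * x powr (149 / 150 + \<epsilon>)))"
  proof (intro exI[of _ C] conjI allI impI C(1))
    fix \<phi> \<psi> :: "int \<Rightarrow> complex" and x :: real
    assume dc: "dirichlet_char 16 \<phi>" "dirichlet_char 16 \<psi>" and x: "x \<ge> 2"
    have "cmod (\<Sum>I\<in>ideals_upto x. ideal_coeff \<phi> \<psi> I * of_real (ideal_mangoldt I)) \<le> C * x powr (149 / 150)"
      unfolding sum_ideals_eq[OF dc] using C(2)[rule_format, OF dc x] by (simp only: mult.commute)
    also have "\<dots> \<le> C * x powr (149 / 150 + \<epsilon>)"
      using C(1) x \<epsilon> by (intro mult_left_mono powr_mono) auto
    finally show "cmod (\<Sum>I\<in>ideals_upto x. ideal_coeff \<phi> \<psi> I * of_real (ideal_mangoldt I))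
      \<le> C * x powr (149 / 150 + \<epsilon>)" .
  qed
qed

end
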